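(* Consider the loss reveal process on the configuration model with type-dependent parameters described in the context. Assume: (1) there is a probability distribution $\mu=(\mu_x)_{x\in\mathcal{X}}$ on $\mathcal{X}$, independent of $n$, such that $\mu_x^{(n)}\to\mu_x$ as $n\to\infty$ for all $x\in\mathcal{X}$; (2) $\lambda^{(n)}:=\sum_{x\in\mathcal{X}}d_x^+\mu_x^{(n)}=\sum_{x\in\mathcal{X}}d_x^-\mu_x^{(n)}\to\lambda:=\sum_{x\in\mathcal{X}}d_x^+\mu_x\in(0,\infty)$ as $n\to\infty$; (3) the loss intensity function satisfies $\mathcal{R}_n(t)=0$ for $t>\tau_n^\star$ and $\mathcal{R}_n(t)=n\mathfrak{R}(t)+o_p(n)$ for $t\le\tau_n^\star$, where $\mathfrak{R}$ is continuous, positive and $\|\mathfrak{R}\|_{L^1}=\int_0^\infty\mathfrak{R}(s)\,ds<\infty$. Let $t^\star_{\mathfrak{R}}:=\inf\{t\ge0:f_W^{\mathfrak{R}}(t)=0\}$ (with $\inf\emptyset=\infty$). Then, as $n\to\infty$: (i) If $\int_0^{t^\star_{\mathfrak{R}}}\mathfrak{R}(s)\,ds=\lambda$, then asymptotically all agents are ruined by the end of the loss propagation process, i.e. $D^{(n)}(\tau_n^\star)=n-o_p(n)$. (ii) If $t^\star_{\mathfrak{R}}<\infty$ is a stable solution of $f_W^{\mathfrak{R}}(t)=0$ and $\int_0^{t^\star_{\mathfrak{R}}}\mathfrak{R}(s)\,ds<\lambda$, then for each $x\in\mathcal{X}$ $$\frac{D_x^{(n)}(\tau_n^\star)}{n\mu_x^{(n)}}\to1-\sum_{\theta=0}^{d_x^+}b(d_x^+,\phi^{\mathfrak{R}}(t^\star_{\mathfrak{R}}),\theta)\,\mathcal{S}^{\mathfrak{R}}_{x,\theta}(t^\star_{\mathfrak{R}})\quad\text{in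 probability,}$$ and $$D^{(n)}(\tau_n^\star)=n\sum_{x\in\mathcal{X}}\mu_x\Bigl(1-\sum_{\theta=0}^{d_x^+}b(d_x^+,\phi^{\mathfrak{R}}(t^\star_{\mathfrak{R}}),\theta)\,\mathcal{S}^{\mathfrak{R}}_{x,\theta}(t^\star_{\mathfrak{R}})\Bigr)+o_p(n).$$ (iii) If $t^\star_{\mathfrak{R}}=\infty$ and $\|\mathfrak{R}\|_{L^1}<\lambda$, then for each $x\in\mathcal{X}$ $$\frac{D_x^{(n)}(\tau_n^\star)}{n\mu_x^{(n)}}\to1-\sum_{\theta=0}^{d_x^+}b\bigl(d_x^+,\|\mathfrak{R}\|_{L^1}/\lambda,\theta\bigr)\,\mathcal{S}^{\mathfrak{R}}_{x,\theta}(\infty)\quad\text{in probability,}$$ and $$D^{(n)}(\tau_n^\star)=n\sum_{x\in\mathcal{X}}\mu_x\Bigl(1-\sum_{\theta=0}^{d_x^+}b\bigl(d_x^+,\|\mathfrak{R}\|_{L^1}/\lambda,\theta\bigr)\,\mathcal{S}^{\mathfrak{R}}_{x,\theta}(\infty)\Bigr)+o_p(n),$$ where $\mathcal{S}^{\mathfrak{R}}_{x,\theta}(\infty)$ denotes the limit of $\mathcal{S}^{\mathfrak{R}}_{x,\theta}(t)$ as $t\to\infty$.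
   Context: **Agents and types.** For each $n$ there are agents $[n]=\{1,\dots,n\}$. Each agent has a type in a countable set $\mathcal{X}$; $\mu_x^{(n)}$ is the fraction of agents of type $x$. An agent of type $x$ has $d_x^+$ incoming and $d_x^-$ outgoing half-edges, initial capital $\gamma_x>0$, total end-user claims $\delta_x$, and a continuous non-decreasing premium accumulation function $\alpha_x(t)$, $t\ge0$. Each agent of type $x$ receives an initial proportional shock in $[0,1]$ with cdf $F_x^{(\epsilon)}$ and density $f_x^{(\epsilon)}$, and its incoming losses are i.i.d. positive random variables with cdf $F_x$ and density $f_x$; all shocks and losses are independent. Set $q_{x,0}:=1-F_x^{(\epsilon)}\bigl(\frac{\gamma_x+\alpha_x(0)-\delta_x}{\gamma_x}\bigr)$ (expected fraction of initially ruined agents of type $x$). **Loss reveal process on the configuration model.** The configuration model is the uniformly random matching of all outgoing half-edges with all incoming half-edges (their total numbers are equal); it is constructed simultaneously with the ruin process. An agent of type $x$ with shock $\epsilon$ which has incurred losses $\ell_1,\dots,\ell_k$ by time $t$ has capital $\gamma_x(1-\epsilon)+\alpha_x(t)-\delta_x-\sum_{i=1}^k\ell_i$; it becomes ruined, and remains so forever, at the first time its capital is $\le0$ (possibly at time $0$). All outgoing half-edges of ruined agents are called ruinous. Losses are revealed one by one: at each reveal a not yet revealed ruinous outgoing half-edge is matched with an incoming half-edge chosen uniformly at random among all remaining incoming half-edges, and the agent owning that incoming half-edge, if of type $x$, incurs a random loss with cdf $F_x$. If a loss is revealed at time $t_1$, the waiting time until the next reveal is exponential with parameter $\mathcal{R}_n(t_1)$,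 where the loss reveal intensity $\mathcal{R}_n(t)$ (which may depend on the state of the process at time $t$) does not change between two successive reveals. $W_n(t)$ is the number of unrevealed ruinous outgoing half-edges at time $t$, and $\tau_n^\star$ is the first time at which $W_n(\tau_n^\star)=0$, when the process stops. $D^{(n)}(t)$ is the number of ruined agents at time $t$ and $D_x^{(n)}(t)$ the number of ruined agents of type $x$ at time $t$. $X_n=o_p(n)$ means $|X_n|/n\to0$ in probability. **Limit functions.** Let $b(d,z,\ell):=\binom{d}{\ell}z^\ell(1-z)^{d-\ell}$. Let $t_{\mathfrak{R}}(\lambda):=\inf\{t\ge0:\int_0^t\mathfrak{R}(s)ds\ge\lambda\}$, with $t_{\mathfrak{R}}(\lambda):=\infty$ if $\|\mathfrak{R}\|_{L^1}\le\lambda$, and $$\phi^{\mathfrak{R}}(t):=\frac1\lambda\int_0^{t\wedge t_{\mathfrak{R}}(\lambda)}\mathfrak{R}(s)\,ds.$$ For a shock $\epsilon_x$ and losses $\boldsymbol{\ell}_x=(\ell_x^{(1)},\dots,\ell_x^{(d_x^+)})$, let for $\theta=0,\dots,d_x^+$ $$\tau_{x,\theta}(\epsilon_x,\boldsymbol{\ell}_x):=\inf\Bigl\{t\ge0:\gamma_x(1-\epsilon_x)+\alpha_x(t)-\delta_x\ge\sum_{i=1}^\theta\ell_x^{(i)}\Bigr\}\qquad(\inf\emptyset=\infty).$$ Let $U^{\mathfrak{R},t}_{(1)}\le\dots\le U^{\mathfrak{R},t}_{(\theta)}$ be the order statistics of $\theta$ i.i.d. random variables with $\mathbb{P}(U\le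 y)=\int_0^y\mathfrak{R}(s)ds\big/\int_0^t\mathfrak{R}(s)ds$, $y\le t$. Let $\mathcal{S}^{\mathfrak{R}}_{x,0}(t):=1-q_{x,0}$ and, for $\theta=1,\dots,d_x^+$, $$\mathcal{S}^{\mathfrak{R}}_{x,\theta}(t):=\mathbb{P}\bigl(\tau_{x,0}(\epsilon_x,\boldsymbol{L}_x)=0,\ U^{\mathfrak{R},t}_{(1)}>\tau_{x,1}(\epsilon_x,\boldsymbol{L}_x),\dots,U^{\mathfrak{R},t}_{(\theta)}>\tau_{x,\theta}(\epsilon_x,\boldsymbol{L}_x)\bigr),$$ where $\boldsymbol{L}_x=(L_x^{(1)},\dots,L_x^{(d_x^+)})$ is i.i.d. with cdf $F_x$, $\epsilon_x$ has cdf $F_x^{(\epsilon)}$, and these are independent of each other and of the $U$'s. Finally $$f_W^{\mathfrak{R}}(t):=\lambda(1-\phi^{\mathfrak{R}}(t))-\sum_{x\in\mathcal{X}}\mu_xd_x^-\sum_{\theta=0}^{d_x^+}b(d_x^+,\phi^{\mathfrak{R}}(t),\theta)\,\mathcal{S}^{\mathfrak{R}}_{x,\theta}(t).$$ A finite $t^\star_{\mathfrak{R}}$ is called a *stable solution* of $f_W^{\mathfrak{R}}(t)=0$ if there exists a small $\varepsilon>0$ such that $f_W^{\mathfrak{R}}$ is negative on $(t^\star_{\mathfrak{R}},t^\star_{\mathfrak{R}}+\varepsilon)$.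
   Formalization: Added because the claim fails otherwise: Σ d_x^- μ_x = λ; in (i), d_x^- > 0 whenever μ_x > 0; the limits for each x only for types with μ_x > 0; and R_n(t) = nR(t) + o_p(n) is read as ∫_0^{τ_n*} |R_n(t) − nR(t)| dt = o_p(n). *)

theory Defs
  imports "HOL-Probability.Probability"
begin

text \<open>
  Types are the elements of a countable type \<open>'x\<close>. For a type \<open>x\<close>: \<open>indeg\<close>/\<open>outdeg\<close> are the numbers
  $d_x^+$/$d_x^-$ of incoming/outgoing half-edges, \<open>cap0\<close> is $\gamma_x$, \<open>claims\<close> is $\delta_x$,
  \<open>prem\<close> is $\alpha_x$, and the last two fields are the densities $f_x^{(\epsilon)}$ and $f_x$.
\<close>

record 'x network =
  indeg :: "'x \<Rightarrow> nat"
  outdeg :: "'x \<Rightarrow> nat"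
  cap0 :: "'x \<Rightarrow> real"
  claims :: "'x \<Rightarrow> real"
  prem :: "'x \<Rightarrow> real \<Rightarrow> real"
  shock_dens :: "'x \<Rightarrow> real \<Rightarrow> real"
  loss_dens :: "'x \<Rightarrow> real \<Rightarrow> real"

definition shock_law :: "'x network \<Rightarrow> 'x \<Rightarrow> real measure" where
  "shock_law P x = density lborel (\<lambda>y. ennreal (shock_dens P x y))"

definition loss_law :: "'x network \<Rightarrow> 'x \<Rightarrow> real measure" where
  "loss_law P x = density lborel (\<lambda>y. ennreal (loss_dens P x y))"

definition network_params :: "'x network \<Rightarrow> bool" where
  "network_params P \<longleftrightarrow> (\<forall>x.
     0 < cap0 P x \<and>
     continuous_on {0..} (prem P x) \<and> mono_on {0..} (prem P x) \<and>
     shock_dens P x \<in> borel_measurable borel \<and> (\<forall>y. 0 \<le> shock_dens P x y) \<and>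
     prob_space (shock_law P x) \<and> (AE y in shock_law P x. 0 \<le> y \<and> y \<le> 1) \<and>
     loss_dens P x \<in> borel_measurable borel \<and> (\<forall>y. 0 \<le> loss_dens P x y) \<and>
     prob_space (loss_law P x) \<and> (AE y in loss_law P x. 0 < y))"

definition q0 :: "'x network \<Rightarrow> 'x \<Rightarrow> real" where
  "q0 P x = 1 - cdf (shock_law P x) ((cap0 P x + prem P x 0 - claims P x) / cap0 P x)"


section \<open>The loss reveal process with \<open>n\<close> agents\<close>

text \<open>
  A half-edge is a pair (agent, index). For $k \ge 1$, \<open>src k\<close> and \<open>tgt k\<close> are the outgoing and incoming
  half-edges matched at the $k$-th reveal, \<open>loss k\<close> is the loss revealed then and \<open>time k\<close> the time of
  this reveal, with value \<open>\<infinity>\<close> if it never takes place; \<open>time 0\<close> is 0. The sigma-algebra \<open>hist k\<close> is the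
  information available right after the \<open>k\<close>-th reveal, and \<open>rate k\<close> is the loss reveal intensity from
  the \<open>k\<close>-th reveal until the next one.
\<close>

record ('x, 'w) reveal_run =
  PM :: "'w measure"
  hist :: "nat \<Rightarrow> 'w measure"
  atype :: "nat \<Rightarrow> 'x"
  shock :: "nat \<Rightarrow> 'w \<Rightarrow> real"
  src :: "nat \<Rightarrow> 'w \<Rightarrow> nat \<times> nat"
  tgt :: "nat \<Rightarrow> 'w \<Rightarrow> nat \<times> nat"
  loss :: "nat \<Rightarrow> 'w \<Rightarrow> real"
  time :: "nat \<Rightarrow> 'w \<Rightarrow> ereal"
  rate :: "nat \<Rightarrow> 'w \<Rightarrow> real"

definition type_frac :: "nat \<Rightarrow> ('x, 'w) reveal_run \<Rightarrow> 'x \<Rightarrow> real" where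
  "type_frac n Z x = real (card {i \<in> {1..n}. atype Z i = x}) / real n"

definition in_half_edges :: "'x network \<Rightarrow> nat \<Rightarrow> ('x, 'w) reveal_run \<Rightarrow> (nat \<times> nat) set" where
  "in_half_edges P n Z = (SIGMA i:{1..n}. {..<indeg P (atype Z i)})"

definition out_half_edges :: "'x network \<Rightarrow> nat \<Rightarrow> ('x, 'w) reveal_run \<Rightarrow> (nat \<times> nat) set" where
  "out_half_edges P n Z = (SIGMA i:{1..n}. {..<outdeg P (atype Z i)})"

definition reveals :: "('x, 'w) reveal_run \<Rightarrow> ereal \<Rightarrow> 'w \<Rightarrow> nat set" where
  "reveals Z t \<omega> = {k. 1 \<le> k \<and> time Z k \<omega> \<le> t \<and> time Z k \<omega> \<noteq> \<infinity>}"

definition capital :: "'x network \<Rightarrow> ('x, 'w) reveal_run \<Rightarrow> nat \<Rightarrow> real \<Rightarrow> 'w \<Rightarrow> real" where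
  "capital P Z i t \<omega> =
     cap0 P (atype Z i) * (1 - shock Z i \<omega>) + prem P (atype Z i) t - claims P (atype Z i)
     - (\<Sum>k | k \<in> reveals Z (ereal t) \<omega> \<and> fst (tgt Z k \<omega>) = i. loss Z k \<omega>)"

text \<open>Times are extended reals below, because the process need not stop in finite time.\<close>

definition ruined :: "'x network \<Rightarrow> ('x, 'w) reveal_run \<Rightarrow> nat \<Rightarrow> ereal \<Rightarrow> 'w \<Rightarrow> bool" where
  "ruined P Z i t \<omega> \<longleftrightarrow> (\<exists>s\<ge>0. ereal s \<le> t \<and> capital P Z i s \<omega> \<le> 0)"

definition unrevealed_ruinous ::
    "'x network \<Rightarrow> nat \<Rightarrow> ('x, 'w) reveal_run \<Rightarrow> ereal \<Rightarrow> 'w \<Rightarrow> (nat \<times> nat) set" where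
  "unrevealed_ruinous P n Z t \<omega> =
     {e \<in> out_half_edges P n Z. ruined P Z (fst e) t \<omega>} - (\<lambda>k. src Z k \<omega>) ` reveals Z t \<omega>"

definition unrevealed_count :: "'x network \<Rightarrow> nat \<Rightarrow> ('x, 'w) reveal_run \<Rightarrow> ereal \<Rightarrow> 'w \<Rightarrow> nat" where
  "unrevealed_count P n Z t \<omega> = card (unrevealed_ruinous P n Z t \<omega>)"

definition stop_time :: "'x network \<Rightarrow> nat \<Rightarrow> ('x, 'w) reveal_run \<Rightarrow> 'w \<Rightarrow> ereal" where
  "stop_time P n Z \<omega> = Inf {ereal t | t. 0 \<le> t \<and> unrevealed_count P n Z (ereal t) \<omega> = 0}"

definition ruin_count :: "'x network \<Rightarrow> nat \<Rightarrow> ('x, 'w) reveal_run \<Rightarrow> ereal \<Rightarrow> 'w \<Rightarrow> nat" where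
  "ruin_count P n Z t \<omega> = card {i \<in> {1..n}. ruined P Z i t \<omega>}"

definition ruin_count_type ::
    "'x network \<Rightarrow> nat \<Rightarrow> ('x, 'w) reveal_run \<Rightarrow> 'x \<Rightarrow> ereal \<Rightarrow> 'w \<Rightarrow> nat" where
  "ruin_count_type P n Z x t \<omega> = card {i \<in> {1..n}. atype Z i = x \<and> ruined P Z i t \<omega>}"

definition free_in :: "'x network \<Rightarrow> nat \<Rightarrow> ('x, 'w) reveal_run \<Rightarrow> nat \<Rightarrow> 'w \<Rightarrow> (nat \<times> nat) set" where
  "free_in P n Z k \<omega> = in_half_edges P n Z - (\<lambda>j. tgt Z j \<omega>) ` {1..k}"

text \<open>The \<open>k\<close>-th reveal has taken place (or $k = 0$) and there is still a half-edge to be revealed.\<close>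

definition active :: "'x network \<Rightarrow> nat \<Rightarrow> ('x, 'w) reveal_run \<Rightarrow> nat \<Rightarrow> 'w set" where
  "active P n Z k = {\<omega> \<in> space (PM Z).
     time Z k \<omega> \<noteq> \<infinity> \<and> unrevealed_count P n Z (time Z k \<omega>) \<omega> > 0}"

text \<open>The intensity vanishes after the stopping time, and is constant between successive reveals.\<close>

definition intensity :: "'x network \<Rightarrow> nat \<Rightarrow> ('x, 'w) reveal_run \<Rightarrow> real \<Rightarrow> 'w \<Rightarrow> real" where
  "intensity P n Z t \<omega> =
     (if ereal t \<le> stop_time P n Z \<omega> then rate Z (card (reveals Z (ereal t) \<omega>)) \<omega> else 0)"

text \<open>
  In the last clause: given \<open>hist k\<close>, and as long as the process is not over, the next incoming
  half-edge is uniform on the remaining ones, the loss has the loss distribution of the agent owning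
  it, and the waiting time is exponential with parameter \<open>rate k\<close>, independent of the other two
  (waiting time \<open>\<infinity>\<close> if \<open>rate k\<close> is 0). The rules choosing \<open>src (Suc k)\<close> and \<open>rate k\<close> are arbitrary
  functions of the past; \<open>hist k\<close> may also carry additional randomization.
\<close>

definition loss_reveal_process :: "'x network \<Rightarrow> nat \<Rightarrow> ('x, 'w) reveal_run \<Rightarrow> bool" where
  "loss_reveal_process P n Z \<longleftrightarrow>
     prob_space (PM Z) \<and>
     (\<forall>k. subalgebra (PM Z) (hist Z k) \<and> subalgebra (hist Z (Suc k)) (hist Z k)) \<and>
     (\<forall>i\<in>{1..n}. shock Z i \<in> borel_measurable (hist Z 0) \<and>
        distributed (PM Z) lborel (shock Z i) (\<lambda>y. ennreal (shock_dens P (atype Z i) y))) \<and>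
     prob_space.indep_vars (PM Z) (\<lambda>_. borel) (shock Z) {1..n} \<and>
     (\<forall>k. rate Z k \<in> borel_measurable (hist Z k) \<and>
          src Z (Suc k) \<in> measurable (hist Z k) (count_space UNIV) \<and>
          tgt Z (Suc k) \<in> measurable (hist Z (Suc k)) (count_space UNIV) \<and>
          loss Z (Suc k) \<in> borel_measurable (hist Z (Suc k)) \<and>
          time Z (Suc k) \<in> borel_measurable (hist Z (Suc k))) \<and>
     (\<forall>\<omega>\<in>space (PM Z). time Z 0 \<omega> = 0 \<and>
        (\<forall>k. 0 \<le> rate Z k \<omega> \<and>
           (if \<omega> \<in> active P n Z k
            then time Z k \<omega> < time Z (Suc k) \<omega> \<and>
                 src Z (Suc k) \<omega> \<in> unrevealed_ruinous P n Z (time Z k \<omega>) \<omega> \<and>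
                 tgt Z (Suc k) \<omega> \<in> free_in P n Z k \<omega>
            else time Z (Suc k) \<omega> = \<infinity>))) \<and>
     (\<forall>k. \<forall>A\<in>sets (hist Z k). \<forall>h\<in>in_half_edges P n Z. \<forall>B\<in>sets borel. \<forall>s\<ge>0.
        measure (PM Z) {\<omega> \<in> A \<inter> active P n Z k.
            tgt Z (Suc k) \<omega> = h \<and> loss Z (Suc k) \<omega> \<in> B \<and> time Z (Suc k) \<omega> > time Z k \<omega> + ereal s}
        = (LINT \<omega>:A \<inter> active P n Z k|PM Z.
             (if h \<in> free_in P n Z k \<omega> then 1 / real (card (free_in P n Z k \<omega>)) else 0)
             * measure (loss_law P (atype Z (fst h))) B
             * exp (- rate Z k \<omega> * s)))"


section \<open>Convergence in probability along the spaces \<open>M n\<close>\<close>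

definition conv_in_prob :: "(nat \<Rightarrow> 'w measure) \<Rightarrow> (nat \<Rightarrow> 'w \<Rightarrow> real) \<Rightarrow> real \<Rightarrow> bool" where
  "conv_in_prob M X c \<longleftrightarrow>
     (\<forall>e>0. (\<lambda>n. measure (M n) {\<omega> \<in> space (M n). \<bar>X n \<omega> - c\<bar> > e}) \<longlonglongrightarrow> 0)"

text \<open>\<open>X\<close> is $o_p(n)$; extended real values are admitted for the sake of integrals.\<close>

definition small_op :: "(nat \<Rightarrow> 'w measure) \<Rightarrow> (nat \<Rightarrow> 'w \<Rightarrow> ereal) \<Rightarrow> bool" where
  "small_op M X \<longleftrightarrow>
     (\<forall>e>0. (\<lambda>n. measure (M n) {\<omega> \<in> space (M n). \<bar>X n \<omega>\<bar> > ereal (e * real n)}) \<longlonglongrightarrow> 0)"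


section \<open>Limit functions\<close>

definition binom_prob :: "nat \<Rightarrow> real \<Rightarrow> nat \<Rightarrow> real" where
  "binom_prob d z l = real (d choose l) * z ^ l * (1 - z) ^ (d - l)"

definition cum_rate :: "(real \<Rightarrow> real) \<Rightarrow> ereal \<Rightarrow> real" where
  "cum_rate R T = (LINT s:{s. 0 \<le> s \<and> ereal s \<le> T}|lborel. R s)"

definition t_full :: "(real \<Rightarrow> real) \<Rightarrow> real \<Rightarrow> ereal" where
  "t_full R lam = (if cum_rate R \<infinity> \<le> lam then \<infinity>
     else Inf {ereal t | t. 0 \<le> t \<and> cum_rate R (ereal t) \<ge> lam})"

definition phi :: "(real \<Rightarrow> real) \<Rightarrow> real \<Rightarrow> real \<Rightarrow> real" where
  "phi R lam t = 1 / lam * cum_rate R (min (ereal t) (t_full R lam))"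

definition tau :: "'x network \<Rightarrow> 'x \<Rightarrow> nat \<Rightarrow> real \<Rightarrow> (nat \<Rightarrow> real) \<Rightarrow> ereal" where
  "tau P x \<theta> e l = Inf {ereal t | t.
     0 \<le> t \<and> cap0 P x * (1 - e) + prem P x t - claims P x \<ge> (\<Sum>i=1..\<theta>. l i)}"

definition reveal_time_law :: "(real \<Rightarrow> real) \<Rightarrow> real \<Rightarrow> real measure" where
  "reveal_time_law R t =
     density lborel (\<lambda>s. ennreal (indicator {0..t} s * R s / cum_rate R (ereal t)))"

definition order_stat :: "nat \<Rightarrow> (nat \<Rightarrow> real) \<Rightarrow> nat \<Rightarrow> real" where
  "order_stat \<theta> u i = sort (map u [1..<Suc \<theta>]) ! (i - 1)"

text \<open>
  For $t = 0$ the law of the reveal times is undefined on paper and the null measure here; the value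
  for $\theta \ge 1$ is irrelevant, as it is always multiplied by \<open>binom_prob d 0 \<theta> = 0\<close>.
\<close>

definition surv :: "'x network \<Rightarrow> (real \<Rightarrow> real) \<Rightarrow> 'x \<Rightarrow> nat \<Rightarrow> real \<Rightarrow> real" where
  "surv P R x \<theta> t =
     (if \<theta> = 0 then 1 - q0 P x
      else let S = shock_law P x \<Otimes>\<^sub>M
                   ((\<Pi>\<^sub>M i\<in>{1..indeg P x}. loss_law P x) \<Otimes>\<^sub>M (\<Pi>\<^sub>M i\<in>{1..\<theta>}. reveal_time_law R t))
           in measure S {(e, l, u) \<in> space S.
                tau P x 0 e l = 0 \<and> (\<forall>i\<in>{1..\<theta>}. ereal (order_stat \<theta> u i) > tau P x i e l)})"

definition surv_lim :: "'x network \<Rightarrow> (real \<Rightarrow> real) \<Rightarrow> 'x \<Rightarrow> nat \<Rightarrow> real" where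
  "surv_lim P R x \<theta> = Lim at_top (\<lambda>t. surv P R x \<theta> t)"

definition fW :: "'x network \<Rightarrow> 'x pmf \<Rightarrow> (real \<Rightarrow> real) \<Rightarrow> real \<Rightarrow> real \<Rightarrow> real" where
  "fW P \<mu> R lam t = lam * (1 - phi R lam t)
     - (\<Sum>\<^sub>\<infinity>x. pmf \<mu> x * real (outdeg P x) *
          (\<Sum>\<theta>\<le>indeg P x. binom_prob (indeg P x) (phi R lam t) \<theta> * surv P R x \<theta> t))"

definition t_star :: "'x network \<Rightarrow> 'x pmf \<Rightarrow> (real \<Rightarrow> real) \<Rightarrow> real \<Rightarrow> ereal" where
  "t_star P \<mu> R lam = Inf {ereal t | t. 0 \<le> t \<and> fW P \<mu> R lam t = 0}"

definition stable_solution :: "(real \<Rightarrow> real) \<Rightarrow> real \<Rightarrow> bool" where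
  "stable_solution f t \<longleftrightarrow> f t = 0 \<and> (\<exists>\<epsilon>>0. \<forall>s\<in>{t<..<t + \<epsilon>}. f s < 0)"

end

theory Submission
  imports Defs
begin

text \<open>
  The process is best followed by the number of reveals instead of the time. Premiums only accumulate, so
  an agent can be ruined only at time 0 or by a loss; the state after \<open>k\<close> reveals therefore decides who is
  ruined, and the process can go on as long as the ruined agents own more than \<open>k\<close> outgoing half-edges
  (\<open>active_iff\<close>, \<open>ruined_stop_time\<close>). Sample points of the processes are denoted by \<open>z\<close>. Three facts together
  give a law of large numbers for this state.

  \<^item> Waiting times multiplied by their rates are standard exponential variables. A Chernoff bound
    (\<open>elapsed_deviation\<close>) and the assumption on the intensity show that, outside an event of vanishing
    probability, every reveal \<open>k\<close> takes place when the cumulative intensity is close to \<open>k / n\<close>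
    (\<open>timing_good\<close>).
  \<^item> If the premium at reveal \<open>k\<close> were a deterministic number \<open>a k\<close>, then the conditional probability, given
    the present, that an agent survives the first \<open>K\<close> reveals would be an explicit hypergeometric mixture
    (\<open>survival_prob\<close>). As \<open>n\<close> grows, it tends to a binomial mixture (\<open>survival_prob_tendsto\<close>), which is the
    sum of $b\,\mathcal{S}$ in the statement (\<open>surv_eq\<close>, \<open>survivor_fraction_eq\<close>).
  \<^item> Summed over the agents of one type, these conditional probabilities form a martingale. Its increments
    are bounded, because a reveal changes only one agent. So the number of survivors is close to
    its mean (\<open>solvent_deviation\<close>). The true premiums lie between two schedules \<open>a\<close> that are read off slightly
    too early and slightly too late, and both have the same limit (\<open>insolvent_limit\<close>).

  Consequently, after \<open>n * cum t\<close> reveals the number of unrevealed ruinous half-edges divided by \<open>n\<close> is close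
  to \<open>fW\<close> at \<open>t\<close>. As \<open>fW\<close> is positive before \<open>t_star\<close>, the process passes every earlier time (\<open>reached\<close>); if \<open>fW\<close>
  is negative right after \<open>t_star\<close>, the process cannot get past it (\<open>not_reached\<close>). Otherwise the process ends
  because the intensity or the half-edges are used up. One reveal ruins at most one agent, so the fractions
  of ruined agents at the end are those at \<open>t_star\<close> (\<open>settled_types\<close>). Infinitely many types do no harm,
  since almost all half-edges belong to finitely many types, uniformly in \<open>n\<close> (\<open>limit_weight_tail\<close>).
\<close>

section \<open>The cumulative intensity\<close>

locale reveal_intensity =
  fixes R :: "real \<Rightarrow> real"
  assumes R_continuous: "continuous_on {0..} R"
    and R_positive: "0 \<le> t \<Longrightarrow> 0 < R t"
    and R_integrable: "set_integrable lborel {0..} R"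
begin

definition intensity_measure :: "real measure" where
  "intensity_measure = density lborel (\<lambda>t. ennreal (indicator {0..} t * R t))"

abbreviation cum :: "real \<Rightarrow> real" where "cum t \<equiv> cum_rate R (ereal t)"
abbreviation cum_total :: real where "cum_total \<equiv> cum_rate R \<infinity>"

lemma R_restricted_measurable [measurable]: "(\<lambda>t. indicator {0..} t * R t) \<in> borel_measurable borel"
  using borel_measurable_continuous_on_indicator[OF _ R_continuous] by simp

lemma sets_intensity_measure [measurable_cong, simp]: "sets intensity_measure = sets borel"
  and space_intensity_measure [simp]: "space intensity_measure = UNIV"
  by (auto simp: intensity_measure_def)

lemma cum_rate_eq_measure:
  assumes "{s. ereal s \<le> T} \<in> sets borel"
  shows "emeasure intensity_measure {s. ereal s \<le> T} = ennreal (cum_rate R T)"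
    and "0 \<le> cum_rate R T"
proof -
  have nn: "0 \<le> indicator {0..} s * R s * indicator {s. ereal s \<le> T} s" for s
    using R_positive[of s] by (auto simp: indicator_def)
  have int: "integrable lborel (\<lambda>s. indicator {0..} s * R s * indicator {s. ereal s \<le> T} s)"
    using R_integrable assms unfolding set_integrable_def
    by (intro integrable_real_mult_indicator) auto
  have eq: "cum_rate R T = (\<integral>s. indicator {0..} s * R s * indicator {s. ereal s \<le> T} s \<partial>lborel)"
    unfolding cum_rate_def set_lebesgue_integral_def
    by (intro Bochner_Integration.integral_cong) (auto simp: indicator_def)
  show "0 \<le> cum_rate R T" unfolding eq using nn by (intro integral_nonneg_AE) auto
  have "emeasure intensity_measure {s. ereal s \<le> T}
      = (\<integral>\<^sup>+s. ennreal (indicator {0..} s * R s) * indicator {s. ereal s \<le> T} s \<partial>lborel)"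
    unfolding intensity_measure_def using assms by (subst emeasure_density) auto
  also have "... = (\<integral>\<^sup>+s. ennreal (indicator {0..} s * R s * indicator {s. ereal s \<le> T} s) \<partial>lborel)"
    by (intro nn_integral_cong) (auto simp: indicator_def)
  also have "... = ennreal (cum_rate R T)"
    unfolding eq using int nn by (intro nn_integral_eq_integral) auto
  finally show "emeasure intensity_measure {s. ereal s \<le> T} = ennreal (cum_rate R T)" .
qed

lemma finite_intensity_measure: "finite_measure intensity_measure"
proof
  have "{s. ereal s \<le> \<infinity>} = space intensity_measure" by auto
  then show "emeasure intensity_measure (space intensity_measure) \<noteq> \<infinity>"
    using cum_rate_eq_measure(1)[of \<infinity>] by auto
qed

sublocale finite_measure intensity_measure by (rule finite_intensity_measure)

lemma measure_atMost_eq_cum: "measure intensity_measure {..t} = cum t"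
  using cum_rate_eq_measure[of "ereal t"] by (simp add: measure_def atMost_def)

lemma measure_UNIV_eq_cum_total: "measure intensity_measure UNIV = cum_total"
  using cum_rate_eq_measure[of \<infinity>] by (simp add: measure_def)

lemma measure_Ioc_eq_cum:
  assumes "s \<le> t" shows "measure intensity_measure {s<..t} = cum t - cum s"
proof -
  have "{s<..t} = {..t} - {..s}" by auto
  then show ?thesis using assms
    by (simp add: finite_measure_Diff measure_atMost_eq_cum[symmetric])
qed

lemma AE_intensity_nonneg: "AE w in intensity_measure. 0 \<le> w"
  unfolding intensity_measure_def by (subst AE_density, simp) (auto simp: indicator_def)

lemma AE_intensity_neq: "AE w in intensity_measure. w \<noteq> c"
  unfolding intensity_measure_def using AE_lborel_singleton[of c]
  by (subst AE_density, simp) (elim AE_mp, auto)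

lemma cum_eq_0: "t \<le> 0 \<Longrightarrow> cum t = 0"
proof -
  assume "t \<le> 0"
  have "AE w in intensity_measure. w \<notin> {..t}"
    using AE_intensity_nonneg AE_intensity_neq[of 0] by eventually_elim (use \<open>t \<le> 0\<close> in auto)
  then show ?thesis
    by (subst measure_atMost_eq_cum[symmetric])
      (intro measure_eq_0_null_sets AE_iff_null_sets[THEN iffD2], auto)
qed

lemma cum_nonneg: "0 \<le> cum t" by (simp flip: measure_atMost_eq_cum)
lemma cum_le_total: "cum t \<le> cum_total"
  by (simp flip: measure_atMost_eq_cum measure_UNIV_eq_cum_total add: finite_measure_mono)
lemma cum_mono: "s \<le> t \<Longrightarrow> cum s \<le> cum t"
  by (simp flip: measure_atMost_eq_cum add: finite_measure_mono)

lemma measure_Ioc_pos: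
  assumes "0 \<le> s" "s < t" shows "0 < measure intensity_measure {s<..t}"
proof (rule ccontr)
  assume "\<not> 0 < measure intensity_measure {s<..t}"
  then have "emeasure intensity_measure {s<..t} = 0"
    by (metis emeasure_eq_measure ennreal_0 measure_nonneg order_antisym_conv linorder_not_less)
  then have "AE w in intensity_measure. w \<notin> {s<..t}" by (intro AE_not_in) (auto simp: null_sets_def)
  then have "AE w in lborel. w \<notin> {s<..t}"
    unfolding intensity_measure_def
    apply (subst (asm) AE_density) apply simp
    apply (erule AE_mp) apply (rule AE_I2) using assms(1) R_positive by (auto simp: indicator_def)
  then have "emeasure lborel {s<..t} = 0" by (subst (asm) AE_iff_null_sets[symmetric]) auto
  then show False using assms(2) by simp
qed

lemma cum_strict_mono: "0 \<le> s \<Longrightarrow> s < t \<Longrightarrow> cum s < cum t"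
  using measure_Ioc_pos[of s t] measure_Ioc_eq_cum[of s t] by simp

lemma cum_less_iff: "0 \<le> s \<Longrightarrow> 0 \<le> t \<Longrightarrow> cum s < cum t \<longleftrightarrow> s < t"
  by (metis cum_mono cum_strict_mono linorder_not_less)

lemma cum_le_iff: "0 \<le> s \<Longrightarrow> 0 \<le> t \<Longrightarrow> cum s \<le> cum t \<longleftrightarrow> s \<le> t"
  by (meson cum_less_iff not_le)

lemma cum_less_total: "0 \<le> t \<Longrightarrow> cum t < cum_total"
  using cum_strict_mono[of t "t+1"] cum_le_total[of "t+1"] by simp

lemma cum_tendsto_total: "(cum \<longlongrightarrow> cum_total) at_top"
proof -
  have "(\<lambda>n. measure intensity_measure {..real n}) \<longlonglongrightarrow> measure intensity_measure (\<Union>n. {..real n})"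
    by (intro finite_Lim_measure_incseq) (auto simp: incseq_def)
  also have "(\<Union>n. {..real n}) = UNIV" using real_arch_simple by blast
  finally have seq: "(\<lambda>n. cum (real n)) \<longlonglongrightarrow> cum_total"
    by (simp add: measure_atMost_eq_cum measure_UNIV_eq_cum_total)
  show ?thesis
  proof (rule increasing_tendsto)
    show "\<forall>\<^sub>F t in at_top. cum t \<le> cum_total" using cum_le_total by simp
    fix x assume "x < cum_total"
    then obtain n where "x < cum (real n)"
      using order_tendstoD(1)[OF seq] by (auto simp: eventually_sequentially)
    then show "\<forall>\<^sub>F t in at_top. x < cum t"
      unfolding eventually_at_top_linorder by (intro exI[of _ "real n"]) (use cum_mono[of "real n"] in fastforce)
  qed
qed

lemma isCont_cum: "isCont cum t"
proof (rule isCont_iff[THEN iffD2])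
  have "cum u = cdf intensity_measure u" for u by (simp add: cdf_def measure_atMost_eq_cum)
  moreover interpret finite_borel_measure intensity_measure
    by (unfold_locales) auto
  have "measure intensity_measure {t} = 0"
    using AE_intensity_neq[of t] by (intro measure_eq_0_null_sets AE_iff_null_sets[THEN iffD2]) auto
  then have "isCont (cdf intensity_measure) t" by (simp add: isCont_cdf)
  ultimately show "(\<lambda>h. cum (t + h)) \<midarrow>0\<rightarrow> cum t" by (simp add: isCont_iff)
qed

definition cum_inv :: "real \<Rightarrow> real" where
  "cum_inv y = (SOME t. 0 \<le> t \<and> cum t = y)"

lemma cum_inv:
  assumes "0 \<le> y" "y < cum_total" shows "0 \<le> cum_inv y" "cum (cum_inv y) = y"
proof -
  obtain N where N: "y < cum t" if "t \<ge> N" for t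
    using order_tendstoD(1)[OF cum_tendsto_total assms(2)] by (auto simp: eventually_at_top_linorder)
  have "\<exists>t\<ge>0. t \<le> max 0 N \<and> cum t = y"
    by (rule IVT) (use assms N[of "max 0 N"] isCont_cum in \<open>auto simp: cum_eq_0 isCont_def\<close>)
  then have "\<exists>t. 0 \<le> t \<and> cum t = y" by auto
  from someI_ex[OF this] show "0 \<le> cum_inv y" "cum (cum_inv y) = y"
    by (auto simp: cum_inv_def)
qed

lemma cum_inv_mono: "0 \<le> y \<Longrightarrow> y \<le> z \<Longrightarrow> z < cum_total \<Longrightarrow> cum_inv y \<le> cum_inv z"
  using cum_inv[of y] cum_inv[of z] cum_le_iff[of "cum_inv y" "cum_inv z"] by auto

lemma cum_inv_cum: "0 \<le> t \<Longrightarrow> cum_inv (cum t) = t"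
  using cum_inv[of "cum t"] cum_less_total[of t] cum_nonneg[of t] cum_le_iff[of t "cum_inv (cum t)"]
    cum_le_iff[of "cum_inv (cum t)" t] by auto

text \<open>An inverse of a strictly increasing function is continuous, also at the boundary value \<open>t = 0\<close>.\<close>

lemma cum_inv_tendsto:
  assumes y: "y \<longlonglongrightarrow> cum t" and nn: "\<And>n. 0 \<le> y n" and t: "0 \<le> t"
  shows "(\<lambda>n. cum_inv (y n)) \<longlonglongrightarrow> t"
proof (rule order_tendstoI)
  have ev: "\<forall>\<^sub>F n in sequentially. y n < cum_total"
    using order_tendstoD(2)[OF y cum_less_total[OF t]] .
  { fix a assume "a < t"
    show "\<forall>\<^sub>F n in sequentially. a < cum_inv (y n)"
    proof (cases "a < 0")
      case True
      show ?thesis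
        using ev by (rule eventually_mono) (rule less_le_trans[OF True cum_inv(1)[OF nn]])
    next
      case False
      then have "cum a < cum t" using \<open>a < t\<close> cum_strict_mono by simp
      from ev order_tendstoD(1)[OF y this] show ?thesis
      proof eventually_elim
        case (elim n)
        then show ?case using cum_inv[OF nn elim(1)] cum_less_iff[of a "cum_inv (y n)"] False by simp
      qed
    qed }
  { fix a assume "t < a"
    then have "cum t < cum a" using t cum_strict_mono by simp
    from ev order_tendstoD(2)[OF y this]
    show "\<forall>\<^sub>F n in sequentially. cum_inv (y n) < a"
    proof eventually_elim
      case (elim n)
      then show ?case
        using cum_inv[OF nn elim(1)] cum_less_iff[of "cum_inv (y n)" a] \<open>t < a\<close> t by simp
    qed }
qed

end

section \<open>Chains of survived losses\<close>

text \<open>Laws without atoms: the capital of an agent then almost surely never hits 0 exactly, so strict and weak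
  inequalities for it need not be told apart.\<close>

locale diffuse_law = prob_space L for L :: "real measure" +
  assumes sets_L [measurable_cong, simp]: "sets L = sets borel"
    and AE_neq: "AE l in L. l \<noteq> z"
begin

lemma space_L [simp]: "space L = UNIV"
  using sets_eq_imp_space_eq[OF sets_L] by simp

lemma measure_L_UNIV [simp]: "measure L UNIV = 1"
  using prob_space by simp

text \<open>The operator that describes one loss of an agent with cash \<open>c\<close> at a moment when its premium is \<open>b\<close>: the
  agent has to survive, and goes on with cash \<open>c - l\<close>.\<close>

definition after_loss :: "real \<Rightarrow> (real \<Rightarrow> real) \<Rightarrow> real \<Rightarrow> real" where
  "after_loss b f c = (\<integral>l. indicator {..<c + b} l * f (c - l) \<partial>L)"

lemma after_loss_measurable [measurable]:
  assumes [measurable]: "b \<in> borel_measurable M" "c \<in> borel_measurable M"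
    "(\<lambda>(x, y). f x y) \<in> borel_measurable (M \<Otimes>\<^sub>M borel)"
  shows "(\<lambda>x. after_loss (b x) (f x) (c x)) \<in> borel_measurable M"
proof -
  have [measurable]: "Measurable.pred (M \<Otimes>\<^sub>M L) (\<lambda>(x, l). l < c x + b x)" by measurable
  have "(\<lambda>(x, l). indicator {..<c x + b x} l * f x (c x - l) :: real)
    = (\<lambda>(x, l). (if l < c x + b x then 1 else 0) * f x (c x - l))" by (auto simp: fun_eq_iff)
  moreover have "(\<lambda>(x, l). (if l < c x + b x then 1 else 0) * f x (c x - l)) \<in> borel_measurable (M \<Otimes>\<^sub>M L)"
    by measurable
  ultimately show ?thesis unfolding after_loss_def by (intro borel_measurable_lebesgue_integral) simp
qed

lemma after_loss_integrable:
  fixes B :: real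
  assumes "f \<in> borel_measurable borel" "\<And>y. \<bar>f y\<bar> \<le> B"
  shows "integrable L (\<lambda>l. indicator {..<c + b} l * f (c - l))"
proof (rule integrable_const_bound[of _ B])
  have "0 \<le> B" using assms(2)[of 0] by simp
  then show "AE l in L. norm (indicator {..<c + b} l * f (c - l)) \<le> B"
    using assms(2) by (auto simp: indicator_def)
qed (use assms(1) in measurable)

lemma after_loss_nonneg: "(\<And>y. 0 \<le> f y) \<Longrightarrow> 0 \<le> after_loss b f c"
  unfolding after_loss_def by (intro Bochner_Integration.integral_nonneg) simp

lemma after_loss_mono:
  assumes "f \<in> borel_measurable borel" "g \<in> borel_measurable borel"
    and "\<And>y. 0 \<le> f y" "\<And>y. f y \<le> g y" "\<And>y. g y \<le> B"
  shows "after_loss b f c \<le> after_loss b g c"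
  unfolding after_loss_def
proof (intro integral_mono after_loss_integrable)
  have "0 \<le> g y" for y using assms(3,4) order.trans by blast
  then show "\<bar>f y\<bar> \<le> B" "\<bar>g y\<bar> \<le> B" for y using assms(3-5)[of y] by (auto simp: abs_if)
qed (use assms in \<open>auto intro: mult_left_mono\<close>)

lemma after_loss_le:
  assumes "f \<in> borel_measurable borel" "\<And>y. 0 \<le> f y" "\<And>y. f y \<le> B"
  shows "after_loss b f c \<le> B"
proof -
  have "after_loss b f c \<le> (\<integral>l. B \<partial>L)"
    unfolding after_loss_def using assms(2,3) order.trans[OF assms(2,3)]
    by (intro integral_mono after_loss_integrable[where B=B] assms(1))
       (auto simp: indicator_def abs_of_nonneg)
  then show ?thesis by simp
qed

lemma after_loss_add:
  assumes "f \<in> borel_measurable borel" "\<And>y. \<bar>f y\<bar> \<le> B"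
    and "g \<in> borel_measurable borel" "\<And>y. \<bar>g y\<bar> \<le> B'"
  shows "after_loss b (\<lambda>y. f y + g y) c = after_loss b f c + after_loss b g c"
  unfolding after_loss_def
  using after_loss_integrable[OF assms(1,2)] after_loss_integrable[OF assms(3,4)]
  by (simp add: distrib_left)

lemma after_loss_cmult: "after_loss b (\<lambda>y. r * f y) c = r * after_loss b f c"
  unfolding after_loss_def by (subst integral_mult_right_zero[symmetric]) (simp add: mult_ac)

lemma after_loss_sum:
  assumes "\<And>i. i \<in> I \<Longrightarrow> f i \<in> borel_measurable borel" "\<And>i y. i \<in> I \<Longrightarrow> \<bar>f i y\<bar> \<le> B i"
  shows "after_loss b (\<lambda>y. \<Sum>i\<in>I. f i y) c = (\<Sum>i\<in>I. after_loss b (f i) c)"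
  unfolding after_loss_def sum_distrib_left
  by (intro Bochner_Integration.integral_sum after_loss_integrable[OF assms])

text \<open>A diffuse loss law makes the survival indicator continuous in the threshold, almost surely.\<close>

lemma after_loss_tendsto:
  assumes f: "\<And>n. f n \<in> borel_measurable borel" "g \<in> borel_measurable borel"
    and B: "\<And>n y. \<bar>f n y\<bar> \<le> B" and b: "b \<longlonglongrightarrow> b'" and fg: "\<And>y. (\<lambda>n. f n y) \<longlonglongrightarrow> g y"
  shows "(\<lambda>n. after_loss (b n) (f n) c) \<longlonglongrightarrow> after_loss b' g c"
  unfolding after_loss_def
proof (rule integral_dominated_convergence)
  show "AE l in L. (\<lambda>n. indicator {..<c + b n} l * f n (c - l)) \<longlonglongrightarrow> indicator {..<c + b'} l * g (c - l)"
    using AE_neq[of "c + b'"]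
  proof eventually_elim
    case (elim l)
    have cb: "(\<lambda>n. c + b n) \<longlonglongrightarrow> c + b'" by (intro tendsto_intros b)
    have "\<forall>\<^sub>F n in sequentially. indicator {..<c + b'} l = (indicator {..<c + b n} l :: real)"
    proof (cases "l < c + b'")
      case True
      from order_tendstoD(1)[OF cb this] show ?thesis by eventually_elim (simp add: True)
    next
      case False
      with elim have "c + b' < l" by simp
      from order_tendstoD(2)[OF cb this] show ?thesis by eventually_elim (simp add: False)
    qed
    then have "(\<lambda>n. indicator {..<c + b n} l :: real) \<longlonglongrightarrow> indicator {..<c + b'} l"
      by (rule tendsto_eventually[OF eventually_mono]) simp
    then show ?case by (intro tendsto_mult fg)
  qed
  have "0 \<le> B" using B[of 0 0] by simp
  then show "AE l in L. norm (indicator {..<c + b n} l * f n (c - l)) \<le> B" for n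
    using B by (auto simp: indicator_def)
qed (use f in measurable)

text \<open>\<open>chain_sum a K th k c\<close> adds up, over all choices of \<open>th\<close> reveals among \<open>k + 1, \<dots>, K\<close>, the probabilities
  that an agent with cash \<open>c\<close> survives losses at just these reveals. In \<open>chain_int\<close> the times of the losses
  are integrated with respect to \<open>N\<close> instead. The premium at the time of the loss is all that matters, so the
  recursion runs from the first loss to the last.\<close>

primrec chain_sum :: "(nat \<Rightarrow> real) \<Rightarrow> nat \<Rightarrow> nat \<Rightarrow> nat \<Rightarrow> real \<Rightarrow> real" where
  "chain_sum a K 0 = (\<lambda>k c. 1)"
| "chain_sum a K (Suc th) = (\<lambda>k c. \<Sum>p\<in>{k<..K}. after_loss (a p) (chain_sum a K th p) c)"

primrec chain_int :: "real measure \<Rightarrow> (real \<Rightarrow> real) \<Rightarrow> real \<Rightarrow> nat \<Rightarrow> real \<Rightarrow> real \<Rightarrow> real" where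
  "chain_int N a t 0 = (\<lambda>T c. 1)"
| "chain_int N a t (Suc th) =
     (\<lambda>T c. \<integral>w. indicator {T<..t} w * after_loss (a w) (chain_int N a t th w) c \<partial>N)"

lemma chain_sum_measurable [measurable]: "chain_sum a K th k \<in> borel_measurable borel"
  by (induction th arbitrary: k) (auto intro!: borel_measurable_sum after_loss_measurable
     intro: measurable_compose[OF measurable_snd])

lemma chain_sum_nonneg: "0 \<le> chain_sum a K th k c"
  by (induction th arbitrary: k c) (auto intro!: sum_nonneg after_loss_nonneg)

lemma chain_sum_le: "chain_sum a K th k c \<le> real K ^ th"
proof (induction th arbitrary: k c)
  case (Suc th)
  have "chain_sum a K (Suc th) k c \<le> (\<Sum>p\<in>{k<..K}. real K ^ th)"
    unfolding chain_sum.simps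
    by (intro sum_mono after_loss_le chain_sum_measurable chain_sum_nonneg Suc)
  also have "... \<le> real K * real K ^ th" by (auto intro!: mult_right_mono)
  finally show ?case by simp
qed simp

context
  fixes N :: "real measure" and a :: "real \<Rightarrow> real"
  assumes N: "finite_measure N" and sets_N [measurable_cong, simp]: "sets N = sets borel"
    and a [measurable]: "a \<in> borel_measurable borel"
begin

interpretation N: finite_measure N by (rule N)

lemma space_N [simp]: "space N = UNIV"
  using sets_eq_imp_space_eq[OF sets_N] by simp

lemma chain_int_measurable2: "(\<lambda>(T, c). chain_int N a t th T c) \<in> borel_measurable (borel \<Otimes>\<^sub>M borel)"
proof (induction th)
  case (Suc th)
  have [measurable]: "(\<lambda>x. chain_int N a t th (f x) (g x)) \<in> borel_measurable M"
    if "f \<in> borel_measurable M" "g \<in> borel_measurable M" for f g and M :: "'q measure"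
    using measurable_compose[OF measurable_Pair[OF that] Suc] by simp
  have "(\<lambda>((T, c), w). indicator {T<..t} w * after_loss (a w) (chain_int N a t th w) c :: real)
    = (\<lambda>((T, c), w). (if T < w \<and> w \<le> t then 1 else 0) * after_loss (a w) (chain_int N a t th w) c)"
    by (auto simp: fun_eq_iff)
  also have "... \<in> borel_measurable ((borel \<Otimes>\<^sub>M borel) \<Otimes>\<^sub>M N)"
    unfolding split_beta' by measurable
  finally show ?case
    by (auto simp: split_beta' intro!: N.borel_measurable_lebesgue_integral)
qed simp

lemma chain_int_measurable [measurable (raw)]:
  assumes "f \<in> borel_measurable M" "g \<in> borel_measurable M"
  shows "(\<lambda>x. chain_int N a t th (f x) (g x)) \<in> borel_measurable M"
  using measurable_compose[OF measurable_Pair[OF assms] chain_int_measurable2] by simp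

lemma chain_int_nonneg: "0 \<le> chain_int N a t th T c"
  by (induction th arbitrary: T c)
     (auto intro!: Bochner_Integration.integral_nonneg mult_nonneg_nonneg after_loss_nonneg)

lemma chain_int_le_integrable:
  "chain_int N a t th T c \<le> measure N UNIV ^ th \<and>
   integrable N (\<lambda>w. indicator {T<..t} w * after_loss (a w) (chain_int N a t th w) c)"
proof (induction th arbitrary: T c)
  case (Suc th)
  have le: "chain_int N a t (Suc th) T c \<le> measure N UNIV ^ Suc th" for T c
  proof -
    have "chain_int N a t (Suc th) T c \<le> (\<integral>w. measure N UNIV ^ th \<partial>N)"
      unfolding chain_int.simps
      by (intro integral_mono) (use Suc chain_int_nonneg in
         \<open>auto intro!: after_loss_le after_loss_nonneg simp: indicator_def\<close>)
    then show ?thesis by simp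
  qed
  have "integrable N (\<lambda>w. indicator {T<..t} w * after_loss (a w) (chain_int N a t (Suc th) w) c)"
    using le chain_int_nonneg
    by (intro N.integrable_const_bound[of _ "measure N UNIV ^ Suc th"] AE_I2)
       (auto simp del: chain_int.simps simp: abs_mult indicator_def abs_of_nonneg after_loss_nonneg
          intro!: after_loss_le)
  with le show ?case by blast
qed (auto intro!: N.integrable_const_bound[of _ 1] AE_I2 simp: abs_mult indicator_def abs_of_nonneg after_loss_nonneg
          intro!: after_loss_le)

lemmas chain_int_le = chain_int_le_integrable[THEN conjunct1]
lemmas chain_int_integrable = chain_int_le_integrable[THEN conjunct2]

text \<open>Prolonging the time interval only adds chains whose last point lies in \<open>{t<..t'}\<close>.\<close>

lemma chain_int_lipschitz:
  assumes "t \<le> t'"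
  shows "chain_int N a t th T c \<le> chain_int N a t' th T c \<and>
    chain_int N a t' th T c \<le> chain_int N a t th T c + th * measure N UNIV ^ (th - 1) * measure N {t<..t'}"
proof (induction th arbitrary: T c)
  case (Suc th)
  let ?C = "measure N UNIV" and ?m = "measure N {t<..t'}"
  define D where "D = th * ?C ^ (th - 1) * ?m"
  have D: "0 \<le> D" by (simp add: D_def)
  have CD: "?C * D \<le> th * ?C ^ th * ?m" by (cases th) (simp_all add: D_def)
  let ?f = "\<lambda>t w. after_loss (a w) (chain_int N a t th w) c"
  have f0: "0 \<le> ?f t w" for t w by (intro after_loss_nonneg chain_int_nonneg)
  have f1: "?f t w \<le> ?C ^ th" for t w
    by (intro after_loss_le chain_int_nonneg chain_int_le) measurable
  have f2: "?f t w \<le> ?f t' w" for w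
    by (intro after_loss_mono[where B="?C ^ th"] chain_int_nonneg chain_int_le)
       (use Suc in \<open>simp_all, measurable\<close>)
  have f3: "?f t' w \<le> ?f t w + D" for w
  proof -
    have "?f t' w \<le> after_loss (a w) (\<lambda>y. chain_int N a t th w y + D) c"
      using D chain_int_le[of t th] Suc
      by (intro after_loss_mono[where B="?C ^ th + D"] chain_int_nonneg)
         (simp_all add: D_def)
    also have "... = ?f t w + after_loss (a w) (\<lambda>y. D) c"
      using D chain_int_le[of t th w] chain_int_nonneg[of t th w]
      by (intro after_loss_add[where B="?C ^ th" and B'=D]) (simp_all add: abs_of_nonneg)
    also have "after_loss (a w) (\<lambda>y. D) c \<le> D" using D by (intro after_loss_le) auto
    finally show ?thesis by simp
  qed
  have "chain_int N a t (Suc th) T c \<le> chain_int N a t' (Suc th) T c"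
    unfolding chain_int.simps using assms f0 f2
    by (intro integral_mono chain_int_integrable) (auto simp: indicator_def)
  moreover have ind: "integrable N (\<lambda>w. ?C ^ th * indicator {t<..t'} w)"
    by (intro integrable_mult_right integrable_real_indicator) (auto simp: less_top[symmetric])
  have "chain_int N a t' (Suc th) T c \<le>
      (\<integral>w. (indicator {T<..t} w * ?f t w + D) + ?C ^ th * indicator {t<..t'} w \<partial>N)"
    unfolding chain_int.simps
  proof (intro integral_mono chain_int_integrable Bochner_Integration.integrable_add ind)
    show "indicator {T<..t'} w * ?f t' w \<le> indicator {T<..t} w * ?f t w + D + ?C ^ th * indicator {t<..t'} w" for w
      using D f0[of w t] f0[of w t'] f1[of w t'] f3[of w] assms by (auto simp: indicator_def)
  qed simp
  moreover have "... = chain_int N a t (Suc th) T c + ?C * D + ?C ^ th * ?m"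
    using ind by (simp add: chain_int_integrable)
  ultimately show ?case using CD by (simp add: algebra_simps)
qed simp

end

end

context reveal_intensity
begin

text \<open>The reveal whose number is closest above \<open>n * cum w\<close> takes place at about time \<open>w\<close>.\<close>

definition reveal_index :: "nat \<Rightarrow> real \<Rightarrow> nat" where
  "reveal_index n w = nat \<lceil>real n * cum w\<rceil>"

lemma cum_measurable [measurable]: "cum \<in> borel_measurable borel"
  using isCont_cum by (intro borel_measurable_continuous_onI) (simp add: continuous_at_imp_continuous_on)

lemma reveal_index_measurable [measurable]: "reveal_index n \<in> borel \<rightarrow>\<^sub>M count_space UNIV"
  unfolding reveal_index_def by measurable

text \<open>This is what makes \<open>cum\<close> the right clock: each reveal carries the same mass.\<close>

lemma measure_reveal_index:
  assumes "0 < n" "1 \<le> p" "real p / real n < cum_total"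
  shows "measure intensity_measure {w. reveal_index n w = p} = 1 / real n"
proof -
  define s where "s = cum_inv ((real p - 1) / n)"
  define t where "t = cum_inv (real p / n)"
  have "(real p - 1) / n < cum_total"
    using assms by (intro le_less_trans[OF _ assms(3)]) (auto intro: divide_right_mono)
  then have s: "0 \<le> s" "cum s = (real p - 1) / n" using assms(1,2) cum_inv by (auto simp: s_def)
  have t: "0 \<le> t" "cum t = real p / n" using assms cum_inv by (auto simp: t_def)
  have st: "s \<le> t" using s t assms(1) cum_le_iff[of s t] by (auto intro: divide_right_mono)
  have "reveal_index n w = p \<longleftrightarrow> w \<in> {s<..t}" for w
  proof -
    have "reveal_index n w = p \<longleftrightarrow> real p - 1 < n * cum w \<and> n * cum w \<le> p"
    proof -
      have "0 \<le> n * cum w" using cum_nonneg[of w] by simp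
      then have "reveal_index n w = p \<longleftrightarrow> \<lceil>n * cum w\<rceil> = int p"
        unfolding reveal_index_def using assms(2) by linarith
      also have "... \<longleftrightarrow> real p - 1 < n * cum w \<and> n * cum w \<le> p"
        by (simp add: ceiling_eq_iff)
      finally show ?thesis .
    qed
    also have "... \<longleftrightarrow> cum s < cum w \<and> cum w \<le> cum t"
      using assms(1) by (simp add: s t field_simps)
    also have "... \<longleftrightarrow> w \<in> {s<..t}"
      using s(1) t(1) cum_mono[of w s] cum_strict_mono[of s w] cum_mono[of w t] cum_strict_mono[of t w]
      by (auto simp: not_le not_less) (meson linorder_not_le)+
    finally show ?thesis .
  qed
  then have "{w. reveal_index n w = p} = {s<..t}" by blast
  then show ?thesis using st by (simp add: measure_Ioc_eq_cum s t diff_divide_distrib)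
qed

lemma sum_eq_integral_reveal_index:
  fixes f :: "nat \<Rightarrow> real"
  assumes "0 < n" "real K / real n < cum_total"
  shows "(\<Sum>p\<in>{k<..K}. f p) / n
    = (\<integral>w. indicator {k<..K} (reveal_index n w) * f (reveal_index n w) \<partial>intensity_measure)"
proof -
  have "(\<integral>w. indicator {k<..K} (reveal_index n w) * f (reveal_index n w) \<partial>intensity_measure)
    = (\<integral>w. (\<Sum>p\<in>{k<..K}. indicator {w. reveal_index n w = p} w * f p) \<partial>intensity_measure)"
    by (intro Bochner_Integration.integral_cong) (auto simp: indicator_def of_bool_def if_distrib[of "\<lambda>x. x * _"] sum.delta cong: if_cong)
  also have "... = (\<Sum>p\<in>{k<..K}. measure intensity_measure {w. reveal_index n w = p} * f p)"
  proof (subst Bochner_Integration.integral_sum)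
    have "{w. reveal_index n w = p} \<in> sets intensity_measure" for p by measurable
    then have "integrable intensity_measure (indicat_real {w. reveal_index n w = p})" for p
      by (intro integrable_real_indicator) (auto simp: less_top[symmetric])
    then show "integrable intensity_measure (\<lambda>w. indicator {w. reveal_index n w = p} w * f p)" for p
      by (rule integrable_mult_left)
  qed simp
  also have "... = (\<Sum>p\<in>{k<..K}. 1 / n * f p)"
  proof (intro sum.cong refl arg_cong2[of _ _ _ _ "(*)"] measure_reveal_index assms(1))
    fix p assume p: "p \<in> {k<..K}"
    then show "1 \<le> p" by auto
    have "real p / n \<le> real K / n" using p by (auto intro: divide_right_mono)
    then show "real p / n < cum_total" using assms(2) by simp
  qed
  finally show ?thesis by (simp add: sum_divide_distrib)
qed

lemma real_reveal_index: "real n * cum w \<le> reveal_index n w" "reveal_index n w < real n * cum w + 1"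
  using cum_nonneg[of w] by (simp_all add: reveal_index_def) (linarith+)?

lemma reveal_index_le: "0 \<le> w \<Longrightarrow> w < t \<Longrightarrow> \<forall>\<^sub>F n in sequentially. reveal_index n w < nat \<lfloor>real n * cum t\<rfloor>"
proof -
  assume w: "0 \<le> w" "w < t"
  then have d: "0 < cum t - cum w" using cum_strict_mono by simp
  have "filterlim (\<lambda>n. (cum t - cum w) * real n) at_top sequentially"
    using d by (intro filterlim_tendsto_pos_mult_at_top[OF tendsto_const] filterlim_real_sequentially)
  then have "\<forall>\<^sub>F n in sequentially. 3 \<le> (cum t - cum w) * real n"
    unfolding filterlim_at_top by blast
  then show ?thesis
  proof eventually_elim
    case (elim n)
    have "real (reveal_index n w) < real n * cum t - 1" using elim real_reveal_index(2)[of n w] by (simp add: algebra_simps)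
    also have "... < real (nat \<lfloor>real n * cum t\<rfloor>)" by linarith
    finally show ?case by simp
  qed
qed

end

text \<open>By \<open>sum_eq_integral_reveal_index\<close> a sum over reveals divided by \<open>n\<close> is an integral with respect to the
  intensity measure. Dominated convergence then applies to one sum after the other. Null sets of times
  are excluded where the indicators of \<open>{T<..t}\<close> need not converge.\<close>

lemma (in diffuse_law) chain_sum_tendsto:
  assumes R: "reveal_intensity R" and t: "0 \<le> t"
    and \<alpha> [measurable]: "\<alpha> \<in> borel_measurable borel"
    and a: "\<And>w. 0 < w \<Longrightarrow> w < t \<Longrightarrow> (\<lambda>n. a n (reveal_intensity.reveal_index R n w)) \<longlonglongrightarrow> \<alpha> w"
  shows "(\<lambda>n. chain_sum (a n) (nat \<lfloor>real n * cum_rate R (ereal t)\<rfloor>) th (reveal_intensity.reveal_index R n T) c / real n ^ th)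
    \<longlonglongrightarrow> chain_int (reveal_intensity.intensity_measure R) \<alpha> t th T c"
proof -
  interpret R: reveal_intensity R by (rule R)
  let ?N = "R.intensity_measure" and ?i = R.reveal_index
  define K where "K n = nat \<lfloor>real n * cum_rate R (ereal t)\<rfloor>" for n
  have K: "real (K n) \<le> n * cum_rate R (ereal t)" for n
    using R.cum_nonneg[of t] by (simp add: K_def)
  note [measurable] = chain_int_measurable[OF R.finite_intensity_measure R.sets_intensity_measure \<alpha>]
  show ?thesis unfolding K_def[symmetric]
  proof (induction th arbitrary: T c)
    case (Suc th)
    define g where "g n w = indicator {?i n T<..K n} (?i n w) *
      after_loss (a n (?i n w)) (\<lambda>y. chain_sum (a n) (K n) th (?i n w) y / real n ^ th) c" for n w
    have bd: "0 \<le> chain_sum (a n) (K n) th k y / real n ^ th"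
      "chain_sum (a n) (K n) th k y / real n ^ th \<le> cum_rate R (ereal t) ^ th" for n k y
    proof -
      show "0 \<le> chain_sum (a n) (K n) th k y / real n ^ th" by (simp add: chain_sum_nonneg)
      show "chain_sum (a n) (K n) th k y / real n ^ th \<le> cum_rate R (ereal t) ^ th"
      proof (cases "n = 0")
        case True then show ?thesis using R.cum_nonneg[of t] by (cases th) auto
      next
        case False
        have "chain_sum (a n) (K n) th k y \<le> real (K n) ^ th" by (rule chain_sum_le)
        also have "... \<le> (n * cum_rate R (ereal t)) ^ th" by (intro power_mono K) simp
        finally show ?thesis using False by (simp add: power_mult_distrib divide_le_eq mult.commute)
      qed
    qed
    have eq: "chain_sum (a n) (K n) (Suc th) (?i n T) c / real n ^ Suc th = (\<integral>w. g n w \<partial>?N)" if "0 < n" for n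
    proof -
      have "real (K n) / n \<le> cum_rate R (ereal t)" using K[of n] that by (simp add: divide_le_eq mult.commute)
      then have Kn: "real (K n) / n < cum_rate R \<infinity>" using R.cum_less_total[OF t] by simp
      have "chain_sum (a n) (K n) (Suc th) (?i n T) c / real n ^ Suc th
        = (\<Sum>p\<in>{?i n T<..K n}. after_loss (a n p) (\<lambda>y. chain_sum (a n) (K n) th p y / real n ^ th) c) / n"
        using after_loss_cmult[of _ "1 / real n ^ th"] by (simp add: sum_divide_distrib mult.commute)
      also have "... = (\<integral>w. g n w \<partial>?N)"
        unfolding g_def by (rule R.sum_eq_integral_reveal_index[OF that Kn])
      finally show ?thesis .
    qed
    have "(\<lambda>n. \<integral>w. g n w \<partial>?N) \<longlonglongrightarrow> (\<integral>w. indicator {T<..t} w * after_loss (\<alpha> w) (chain_int ?N \<alpha> t th w) c \<partial>?N)"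
    proof (rule integral_dominated_convergence[where w="\<lambda>_. cum_rate R (ereal t) ^ th"])
      show "AE w in ?N. (\<lambda>n. g n w) \<longlonglongrightarrow> indicator {T<..t} w * after_loss (\<alpha> w) (chain_int ?N \<alpha> t th w) c"
        using R.AE_intensity_nonneg R.AE_intensity_neq[of 0] R.AE_intensity_neq[of T] R.AE_intensity_neq[of t]
      proof eventually_elim
        case (elim w)
        then have w: "0 < w" by simp
        show ?case
        proof (cases "T < w \<and> w < t")
          case True
          have "\<forall>\<^sub>F n in sequentially. ?i n T < ?i n w"
          proof -
            have "\<forall>\<^sub>F n in sequentially. ?i n (max 0 T) < nat \<lfloor>real n * cum_rate R (ereal w)\<rfloor>"
              using True w by (intro R.reveal_index_le) auto
            then show ?thesis
            proof eventually_elim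
              case (elim n)
              have "?i n T \<le> ?i n (max 0 T)" unfolding R.reveal_index_def
                by (intro nat_mono ceiling_mono mult_left_mono R.cum_mono) auto
              moreover have "nat \<lfloor>real n * cum_rate R (ereal w)\<rfloor> \<le> ?i n w"
                unfolding R.reveal_index_def by (intro nat_mono) linarith
              ultimately show ?case using elim by linarith
            qed
          qed
          moreover have "\<forall>\<^sub>F n in sequentially. ?i n w < K n"
            unfolding K_def using True w by (intro R.reveal_index_le) auto
          ultimately have "\<forall>\<^sub>F n in sequentially. after_loss (a n (?i n w)) (\<lambda>y. chain_sum (a n) (K n) th (?i n w) y / real n ^ th) c = g n w"
            by eventually_elim (simp add: g_def)
          moreover have "(\<lambda>n. after_loss (a n (?i n w)) (\<lambda>y. chain_sum (a n) (K n) th (?i n w) y / real n ^ th) c)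
            \<longlonglongrightarrow> after_loss (\<alpha> w) (chain_int ?N \<alpha> t th w) c"
            using bd by (intro after_loss_tendsto[where B="cum_rate R (ereal t) ^ th"] Suc a w)
              (simp_all add: True chain_sum_nonneg)
          ultimately show ?thesis using True by (simp add: tendsto_cong)
        next
          case False
          have "\<forall>\<^sub>F n in sequentially. g n w = 0"
          proof (cases "w < T")
            case True
            have "?i n w \<le> ?i n T" for n unfolding R.reveal_index_def
                by (intro nat_mono ceiling_mono mult_left_mono R.cum_mono) (use True in auto)
            then have "g n w = 0" for n using leD by (auto simp: g_def indicator_def)
            then show ?thesis by simp
          next
            case False
            with elim \<open>\<not> (T < w \<and> w < t)\<close> have "t < w" by auto
            from R.reveal_index_le[OF t this] show ?thesis
            proof eventually_elim
              case (elim n)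
              have "K n \<le> ?i n t" unfolding R.reveal_index_def K_def by (intro nat_mono) linarith
              moreover have "nat \<lfloor>real n * cum_rate R (ereal w)\<rfloor> \<le> ?i n w"
                unfolding R.reveal_index_def by (intro nat_mono) linarith
              ultimately show ?case using elim by (auto simp: g_def indicator_def)
            qed
          qed
          then have "(\<lambda>n. g n w) \<longlonglongrightarrow> 0" by (rule tendsto_eventually)
          moreover have "w \<notin> {T<..t}" using False elim by auto
          ultimately show ?thesis by simp
        qed
      qed
      show "AE w in ?N. norm (g n w) \<le> cum_rate R (ereal t) ^ th" for n
        using bd R.cum_nonneg[of t]
        by (intro AE_I2) (auto simp: g_def indicator_def abs_of_nonneg after_loss_nonneg intro!: after_loss_le)
      have "(\<lambda>p. indicator {?i n T<..K n} p * after_loss (a n p) (\<lambda>y. chain_sum (a n) (K n) th p y / real n ^ th) c)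
         \<in> borel_measurable (count_space UNIV)" for n by simp
      from measurable_compose[OF R.reveal_index_measurable this]
      show "g n \<in> borel_measurable ?N" for n unfolding g_def by simp
    qed (simp_all, measurable)
    then have "(\<lambda>n. \<integral>w. g n w \<partial>?N) \<longlonglongrightarrow> chain_int ?N \<alpha> t (Suc th) T c" by simp
    then show ?case
      by (rule Lim_transform_eventually) (auto simp: eq[symmetric] eventually_sequentially simp del: chain_sum.simps intro!: exI[of _ 1])
  qed simp
qed

section \<open>Survival of a single agent\<close>

lemma binomial_asymptotics:
  fixes x :: "nat \<Rightarrow> nat"
  assumes x: "(\<lambda>n. real (x n) / real n) \<longlonglongrightarrow> y"
  shows "(\<lambda>n. real (x n choose j) / real n ^ j) \<longlonglongrightarrow> y ^ j / fact j"
proof -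
  have "(\<lambda>n. (\<Prod>i<j. real (x n) / n - real i * (1 / real n)) / fact j) \<longlonglongrightarrow> (\<Prod>i<j. y - real i * 0) / fact j"
    by (intro tendsto_divide tendsto_prod tendsto_diff x tendsto_mult tendsto_const lim_1_over_n) simp
  moreover have "\<forall>\<^sub>F n in sequentially. (\<Prod>i<j. real (x n) / n - real i * (1 / real n)) / fact j = real (x n choose j) / real n ^ j"
    using eventually_gt_at_top[of 0]
  proof eventually_elim
    case (elim n)
    have "(\<Prod>i<j. real (x n) / n - real i * (1 / real n)) = (\<Prod>i<j. (real (x n) - real i) / real n)"
      by (simp add: diff_divide_distrib)
    also have "... = (\<Prod>i<j. real (x n) - real i) / real n ^ j" by (simp add: prod_dividef)
    finally show ?case by (simp add: binomial_gbinomial gbinomial_prod_rev atLeast0LessThan)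
  qed
  ultimately have "(\<lambda>n. real (x n choose j) / real n ^ j) \<longlonglongrightarrow> (\<Prod>i<j. y - real i * 0) / fact j"
    by (rule Lim_transform_eventually)
  then show ?thesis by simp
qed

context diffuse_law
begin

text \<open>The conditional probability that an agent with cash \<open>c\<close> and \<open>r\<close> of the \<open>m - k\<close> incoming half-edges that are
  free after \<open>k\<close> reveals survives up to reveal \<open>K\<close>. Given \<open>th\<close> of the remaining reveals, the agent is hit by
  these and no others for \<open>(m - K) choose (r - th)\<close> of the \<open>(m - k) choose r\<close> possible positions of its half-edges.\<close>

definition survival_prob :: "(nat \<Rightarrow> real) \<Rightarrow> nat \<Rightarrow> nat \<Rightarrow> nat \<Rightarrow> nat \<Rightarrow> real \<Rightarrow> real" where
  "survival_prob a m K k r c =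
     (\<Sum>th\<le>r. real ((m - K) choose (r - th)) * chain_sum a K th k c) / real ((m - k) choose r)"

lemma survival_prob_measurable [measurable]: "survival_prob a m K k r \<in> borel_measurable borel"
  unfolding survival_prob_def by measurable

lemma survival_prob_nonneg: "0 \<le> survival_prob a m K k r c"
  unfolding survival_prob_def by (intro divide_nonneg_nonneg sum_nonneg mult_nonneg_nonneg chain_sum_nonneg) simp_all

lemma survival_prob_final:
  assumes "r \<le> m - K" shows "survival_prob a m K K r c = 1"
proof -
  have "(\<Sum>th\<le>r. real ((m - K) choose (r - th)) * chain_sum a K th K c)
    = (\<Sum>th\<le>r. if th = 0 then real ((m - K) choose r) else 0)"
    by (intro sum.cong) (auto simp: gr0_conv_Suc)
  then show ?thesis using assms by (simp add: survival_prob_def)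
qed

lemma chain_sum_step:
  assumes "k < K"
  shows "chain_sum a K (Suc th) k c = chain_sum a K (Suc th) (Suc k) c + after_loss (a (Suc k)) (chain_sum a K th (Suc k)) c"
proof -
  have "{k<..K} = insert (Suc k) {Suc k<..K}" using assms by auto
  then show ?thesis by simp
qed

text \<open>The next reveal hits the agent with probability \<open>r / (m - k)\<close>. For the hypergeometric mixture this comes down
  to absorption identities for binomial coefficients.\<close>

lemma survival_prob_step:
  assumes k: "k < K" "K \<le> m" and r: "r \<le> m - K"
  shows "survival_prob a m K k r c = (1 - real r / real (m - k)) * survival_prob a m K (Suc k) r c
    + real r / real (m - k) * after_loss (a (Suc k)) (survival_prob a m K (Suc k) (r - 1)) c"
proof -
  define A where "A k r c = (\<Sum>th\<le>r. real ((m - K) choose (r - th)) * chain_sum a K th k c)" for k r c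
  define M where "M = m - Suc k"
  have M: "m - k = Suc M" "r \<le> M" using k r by (auto simp: M_def)
  have sp: "survival_prob a m K k r c = A k r c / real (Suc M choose r)"
    "survival_prob a m K (Suc k) r c = A (Suc k) r c / real (M choose r)" for r c
    by (simp_all add: survival_prob_def A_def M M_def)
  show ?thesis
  proof (cases r)
    case 0
    then show ?thesis by (simp add: survival_prob_def)
  next
    case (Suc q)
    have "A k r c = A (Suc k) r c + after_loss (a (Suc k)) (A (Suc k) q) c"
    proof -
      have "after_loss (a (Suc k)) (A (Suc k) q) c = (\<Sum>th\<le>q. after_loss (a (Suc k)) (\<lambda>y. real ((m - K) choose (q - th)) * chain_sum a K th (Suc k) y) c)"
        unfolding A_def
        by (intro after_loss_sum[where B="\<lambda>th. real ((m - K) choose (q - th)) * real K ^ th"])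
           (auto simp: abs_mult abs_of_nonneg chain_sum_nonneg intro!: mult_left_mono chain_sum_le)
      then show ?thesis
        unfolding Suc A_def sum.atMost_Suc_shift using k(1)
        by (simp add: chain_sum_step after_loss_cmult distrib_left sum.distrib del: chain_sum.simps(2))
    qed
    moreover have "(1 - real r / real (Suc M)) * (A (Suc k) r c / real (M choose r)) = A (Suc k) r c / real (Suc M choose r)"
    proof -
      have "real (Suc M - r) * real (Suc M choose r) = real (Suc M) * real (M choose r)"
        using binomial_absorb_comp[of "Suc M" r] by (metis diff_Suc_1 of_nat_mult)
      then have "(1 - real r / real (Suc M)) * real (Suc M choose r) = real (M choose r)"
        using M(2) by (simp add: of_nat_diff field_simps)
      then show ?thesis using M(2) by (simp add: divide_simps)
    qed
    moreover have "real r / real (Suc M) * after_loss (a (Suc k)) (survival_prob a m K (Suc k) q) c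
      = after_loss (a (Suc k)) (A (Suc k) q) c / real (Suc M choose r)"
    proof -
      have "after_loss (a (Suc k)) (survival_prob a m K (Suc k) q) c = after_loss (a (Suc k)) (A (Suc k) q) c / real (M choose q)"
        using after_loss_cmult[of "a (Suc k)" "1 / real (M choose q)" "A (Suc k) q" c] by (simp add: sp(2)[abs_def])
      moreover have "real r * real (Suc M choose r) = real (Suc M) * real (M choose q)"
        using times_binomial_minus1_eq[of r "Suc M"] Suc by (metis diff_Suc_1 of_nat_mult zero_less_Suc)
      moreover have "r / N * (z / Y) = z / X" if "r * X = N * Y" "0 < X" "0 < Y" "0 < N" for r X N Y z :: real
        using that by (simp add: divide_simps)
      ultimately show ?thesis using M(2) Suc by (simp del: binomial_Suc_Suc)
    qed
    ultimately show ?thesis unfolding M(1) sp by (simp add: Suc add_divide_distrib)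
  qed
qed

lemma survival_prob_le_1:
  assumes "k \<le> K" "K \<le> m" "r \<le> m - K"
  shows "survival_prob a m K k r c \<le> 1"
  using assms
proof (induction k arbitrary: r c rule: inc_induct)
  case base then show ?case by (simp add: survival_prob_final)
next
  case (step k)
  have "after_loss (a (Suc k)) (survival_prob a m K (Suc k) (r - 1)) c \<le> 1"
    using step.prems by (intro after_loss_le survival_prob_nonneg step.IH) auto
  moreover have "survival_prob a m K (Suc k) r c \<le> 1" using step by auto
  moreover have "real r / real (m - k) \<le> 1" using step by (simp add: divide_le_eq)
  ultimately have "(1 - real r / real (m - k)) * survival_prob a m K (Suc k) r c
      + real r / real (m - k) * after_loss (a (Suc k)) (survival_prob a m K (Suc k) (r - 1)) c \<le> 1"
    by (intro convex_bound_le) auto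
  then show ?case using step by (subst survival_prob_step) auto
qed

lemma survival_prob_change:
  assumes "k < K" "K \<le> m" "r \<le> m - K"
  shows "\<bar>survival_prob a m K (Suc k) r c - survival_prob a m K k r c\<bar> \<le> real r / real (m - k)"
proof -
  let ?p = "survival_prob a m K (Suc k) r c"
  let ?q = "after_loss (a (Suc k)) (survival_prob a m K (Suc k) (r - 1)) c"
  have "?p - survival_prob a m K k r c = real r / real (m - k) * (?p - ?q)"
    by (subst survival_prob_step[OF assms]) (simp add: algebra_simps)
  moreover have "0 \<le> ?p" "?p \<le> 1" "0 \<le> ?q" "?q \<le> 1"
    using assms by (auto intro!: survival_prob_nonneg survival_prob_le_1 after_loss_nonneg after_loss_le)
  then have "\<bar>?p - ?q\<bar> \<le> 1" by (simp add: abs_le_iff)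
  ultimately show ?thesis by (simp add: abs_mult divide_right_mono mult_left_le)
qed

text \<open>A choice of \<open>th\<close> reveals has order \<open>n ^ th\<close>, and the binomial coefficients have orders \<open>n ^ (d - th)\<close> and
  \<open>n ^ d\<close>, so the powers of \<open>n\<close> cancel.\<close>

lemma survival_prob_tendsto:
  assumes R: "reveal_intensity R" and t: "0 \<le> t" and \<alpha>: "\<alpha> \<in> borel_measurable borel"
    and a: "\<And>w. 0 < w \<Longrightarrow> w < t \<Longrightarrow> (\<lambda>n. a n (reveal_intensity.reveal_index R n w)) \<longlonglongrightarrow> \<alpha> w"
    and m: "(\<lambda>n. real (m n) / real n) \<longlonglongrightarrow> lam" and less: "cum_rate R (ereal t) < lam"
  shows "(\<lambda>n. survival_prob (a n) (m n) (nat \<lfloor>real n * cum_rate R (ereal t)\<rfloor>) 0 d c) \<longlonglongrightarrow>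
    (\<Sum>th\<le>d. real (d choose th) * fact th * (lam - cum_rate R (ereal t)) ^ (d - th) / lam ^ d
       * chain_int (reveal_intensity.intensity_measure R) \<alpha> t th 0 c)"
proof -
  interpret R: reveal_intensity R by (rule R)
  define s where "s = cum_rate R (ereal t)"
  have s: "0 \<le> s" "s < lam" using less R.cum_nonneg by (auto simp: s_def)
  define K where "K n = nat \<lfloor>real n * s\<rfloor>" for n
  have i0: "R.reveal_index n 0 = 0" for n by (simp add: R.reveal_index_def R.cum_eq_0)
  have Kn: "(\<lambda>n. real (K n) / n) \<longlonglongrightarrow> s"
  proof (rule tendsto_sandwich)
    have "s - 1 / n \<le> real (K n) / n" if "1 \<le> n" for n
    proof -
      have "real n * s - 1 \<le> real (K n)" unfolding K_def by linarith
      from divide_right_mono[OF this, of n] show ?thesis using that by (simp add: diff_divide_distrib)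
    qed
    then show "\<forall>\<^sub>F n in sequentially. s - 1 / n \<le> real (K n) / n" by (auto simp: eventually_sequentially)
    have "real (K n) / n \<le> s" if "1 \<le> n" for n
    proof -
      have "real (K n) \<le> real n * s" unfolding K_def using s(1) by simp
      from divide_right_mono[OF this, of n] show ?thesis using that by simp
    qed
    then show "\<forall>\<^sub>F n in sequentially. real (K n) / n \<le> s" by (auto simp: eventually_sequentially)
    show "(\<lambda>n. s - 1 / real n) \<longlonglongrightarrow> s" using tendsto_diff[OF tendsto_const lim_1_over_n, of s] by simp
  qed simp
  have "\<forall>\<^sub>F n in sequentially. real (K n) / n < real (m n) / n"
    using order_tendstoD(2)[OF tendsto_diff[OF Kn m], of 0] s by simp
  then have ev: "\<forall>\<^sub>F n in sequentially. K n \<le> m n \<and> 0 < n"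
    using eventually_gt_at_top[of 0] by eventually_elim (auto simp: divide_less_cancel)
  have mK: "(\<lambda>n. real (m n - K n) / n) \<longlonglongrightarrow> lam - s"
    by (rule Lim_transform_eventually[OF tendsto_diff[OF m Kn]])
       (use ev in eventually_elim, auto simp: of_nat_diff diff_divide_distrib)
  have chain: "(\<lambda>n. chain_sum (a n) (K n) th 0 c / real n ^ th) \<longlonglongrightarrow> chain_int R.intensity_measure \<alpha> t th 0 c" for th
    using chain_sum_tendsto[OF R t \<alpha> a, of th 0 c] by (simp add: i0 K_def s_def)
  have "(\<lambda>n. (\<Sum>th\<le>d. real ((m n - K n) choose (d - th)) / real n ^ (d - th) * (chain_sum (a n) (K n) th 0 c / real n ^ th))
      / (real (m n choose d) / real n ^ d)) \<longlonglongrightarrow>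
    (\<Sum>th\<le>d. (lam - s) ^ (d - th) / fact (d - th) * chain_int R.intensity_measure \<alpha> t th 0 c) / (lam ^ d / fact d)"
    using s by (intro binomial_asymptotics[OF m] binomial_asymptotics[OF mK] chain
        tendsto_divide tendsto_sum tendsto_mult tendsto_const) simp
  moreover have "\<forall>\<^sub>F n in sequentially. (\<Sum>th\<le>d. real ((m n - K n) choose (d - th)) / real n ^ (d - th) * (chain_sum (a n) (K n) th 0 c / real n ^ th))
      / (real (m n choose d) / real n ^ d) = survival_prob (a n) (m n) (K n) 0 d c"
    using ev
  proof eventually_elim
    case (elim n)
    have "real ((m n - K n) choose (d - th)) / real n ^ (d - th) * (chain_sum (a n) (K n) th 0 c / real n ^ th)
      = real ((m n - K n) choose (d - th)) * chain_sum (a n) (K n) th 0 c / real n ^ d" if "th \<le> d" for th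
      using that by (simp flip: power_add)
    then have "(\<Sum>th\<le>d. real ((m n - K n) choose (d - th)) / real n ^ (d - th) * (chain_sum (a n) (K n) th 0 c / real n ^ th))
      = (\<Sum>th\<le>d. real ((m n - K n) choose (d - th)) * chain_sum (a n) (K n) th 0 c) / real n ^ d"
      unfolding sum_divide_distrib by (intro sum.cong) auto
    then show ?case using elim by (simp add: survival_prob_def)
  qed
  ultimately have "(\<lambda>n. survival_prob (a n) (m n) (K n) 0 d c) \<longlonglongrightarrow>
    (\<Sum>th\<le>d. (lam - s) ^ (d - th) / fact (d - th) * chain_int R.intensity_measure \<alpha> t th 0 c) / (lam ^ d / fact d)"
    by (rule Lim_transform_eventually)
  also have "(\<Sum>th\<le>d. (lam - s) ^ (d - th) / fact (d - th) * chain_int R.intensity_measure \<alpha> t th 0 c) / (lam ^ d / fact d)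
      = (\<Sum>th\<le>d. real (d choose th) * fact th * (lam - s) ^ (d - th) / lam ^ d * chain_int R.intensity_measure \<alpha> t th 0 c)"
    unfolding sum_divide_distrib using s
    by (intro sum.cong refl) (simp add: binomial_fact field_simps)
  finally show ?thesis by (simp add: K_def s_def)
qed

end

section \<open>Order statistics\<close>

definition sorted_values :: "(nat \<Rightarrow> real) \<Rightarrow> nat set \<Rightarrow> real list" where
  "sorted_values u I = sorted_list_of_multiset (image_mset u (mset_set I))"

lemma length_sorted_values [simp]: "length (sorted_values u I) = card I"
  by (simp add: sorted_values_def flip: size_mset)

lemma set_sorted_values: "finite I \<Longrightarrow> set (sorted_values u I) = u ` I"
  by (simp add: sorted_values_def)

lemma sorted_values_cong: "(\<And>i. i \<in> I \<Longrightarrow> u i = v i) \<Longrightarrow> sorted_values u I = sorted_values v I"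
  unfolding sorted_values_def
  by (cases "finite I") (auto intro!: arg_cong[of _ _ sorted_list_of_multiset] image_mset_cong)

lemma order_stat_eq_sorted_values: "order_stat th u i = sorted_values u {1..th} ! (i - 1)"
proof -
  have "image_mset u (mset_set {1..th}) = mset (map u [1..<Suc th])"
    by (simp add: atLeastLessThanSuc_atLeastAtMost del: upt_Suc)
  then show ?thesis
    unfolding order_stat_def sorted_values_def by (simp only: sorted_list_of_multiset_mset)
qed

lemma sorted_values_min:
  assumes "finite I" "i \<in> I" "\<And>j. j \<in> I \<Longrightarrow> u i \<le> u j"
  shows "sorted_values u I = u i # sorted_values u (I - {i})"
proof -
  have "mset_set I = add_mset i (mset_set (I - {i}))" using assms by (simp add: mset_set.remove)
  then have "sorted_values u I = insort (u i) (sorted_values u (I - {i}))"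
    by (simp add: sorted_values_def)
  also have "... = u i # sorted_values u (I - {i})"
    using assms by (intro insort_is_Cons) (auto simp: set_sorted_values)
  finally show ?thesis .
qed

lemma borel_measurable_indicator_Collect:
  assumes "{x \<in> space M. P x} \<in> sets M"
  shows "(\<lambda>x. indicator {x. P x} x :: ennreal) \<in> borel_measurable M"
  using borel_measurable_indicator[OF assms] by (rule measurable_cong[THEN iffD1, rotated]) (simp add: indicator_def)

text \<open>Ties are broken by the index, which makes the first minimum a measurable choice.\<close>

definition first_min :: "(nat \<Rightarrow> real) \<Rightarrow> nat set \<Rightarrow> nat" where
  "first_min u I = (LEAST i. i \<in> I \<and> (\<forall>j\<in>I. u i \<le> u j))"

lemma first_min:
  assumes "finite I" "I \<noteq> {}"
  shows "first_min u I \<in> I" "j \<in> I \<Longrightarrow> u (first_min u I) \<le> u j"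
proof -
  have "\<exists>i. i \<in> I \<and> (\<forall>j\<in>I. u i \<le> u j)"
    using assms by (intro exI[of _ "arg_min_on u I"]) (auto intro: arg_min_if_finite arg_min_least)
  from LeastI_ex[OF this] show "first_min u I \<in> I" "j \<in> I \<Longrightarrow> u (first_min u I) \<le> u j"
    unfolding first_min_def by auto
qed

lemma first_min_eq_iff:
  assumes "finite I" "i \<in> I"
  shows "first_min u I = i \<longleftrightarrow> (\<forall>j\<in>I. u i \<le> u j \<and> (j < i \<longrightarrow> u i < u j))"
proof
  assume eq: "first_min u I = i"
  have min: "u i \<le> u j" if "j \<in> I" for j using first_min(2)[of I j u] assms that eq by auto
  moreover have "u i < u j" if "j \<in> I" "j < i" for j
  proof (rule ccontr)
    assume "\<not> u i < u j"
    then have "j \<in> I \<and> (\<forall>k\<in>I. u j \<le> u k)" using min that by (meson linorder_not_less order.trans)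
    then have "first_min u I \<le> j" unfolding first_min_def by (rule Least_le)
    then show False using that eq by simp
  qed
  ultimately show "\<forall>j\<in>I. u i \<le> u j \<and> (j < i \<longrightarrow> u i < u j)" by blast
next
  assume r: "\<forall>j\<in>I. u i \<le> u j \<and> (j < i \<longrightarrow> u i < u j)"
  show "first_min u I = i" unfolding first_min_def
  proof (rule Least_equality)
    show "i \<in> I \<and> (\<forall>j\<in>I. u i \<le> u j)" using assms r by blast
    fix j assume j: "j \<in> I \<and> (\<forall>k\<in>I. u j \<le> u k)"
    then have "u j \<le> u i" using assms by blast
    then show "i \<le> j" using r j by (meson linorder_not_le)
  qed
qed

lemma sorted_values_nth_measurable:
  assumes "finite I" "k < card I"
  shows "(\<lambda>u. sorted_values u I ! k) \<in> borel_measurable (PiM I (\<lambda>_. borel))"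
  using assms
proof (induction "card I" arbitrary: I k)
  case (Suc m I k)
  note [measurable] = measurable_component_singleton
  have m1: "(\<lambda>u. case k of 0 \<Rightarrow> u i | Suc k' \<Rightarrow> sorted_values (restrict u (I - {i})) (I - {i}) ! k')
      \<in> borel_measurable (PiM I (\<lambda>_. borel))" if "i \<in> I" for i
  proof (cases k)
    case 0 then show ?thesis using that by simp
  next
    case (Suc k')
    have "(\<lambda>u. sorted_values u (I - {i}) ! k') \<in> borel_measurable (PiM (I - {i}) (\<lambda>_. borel))"
      using Suc Suc.prems Suc.hyps(2) that by (intro Suc.hyps(1)) auto
    moreover have "(\<lambda>u. restrict u (I - {i})) \<in> PiM I (\<lambda>_. borel :: real measure) \<rightarrow>\<^sub>M PiM (I - {i}) (\<lambda>_. borel)"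
      by (rule measurable_restrict_subset) auto
    ultimately have "(\<lambda>u. sorted_values (restrict u (I - {i})) (I - {i}) ! k') \<in> borel_measurable (PiM I (\<lambda>_. borel))"
      by (rule measurable_compose[rotated])
    then show ?thesis by (simp only: Suc nat.case)
  qed
  have m2: "{u \<in> space (PiM I (\<lambda>_. borel)). first_min u I = i} \<in> sets (PiM I (\<lambda>_. borel))" if "i \<in> I" for i
  proof -
    have "(\<lambda>u. u j) \<in> borel_measurable (PiM I (\<lambda>_. borel))" if "j \<in> I" for j
      by (rule measurable_component_singleton[OF that])
    then show ?thesis
      unfolding first_min_eq_iff[OF Suc.prems(1) that] using Suc.prems(1) that
      by (intro sets.sets_Collect_finite_All sets.sets_Collect_conj sets.sets_Collect_imp
           borel_measurable_less borel_measurable_le) auto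
  qed
  have "(\<lambda>u. \<Sum>i\<in>I. if first_min u I = i then
       (case k of 0 \<Rightarrow> u i | Suc k' \<Rightarrow> sorted_values (restrict u (I - {i})) (I - {i}) ! k') else 0)
     \<in> borel_measurable (PiM I (\<lambda>_. borel))"
    by (intro borel_measurable_sum measurable_If m1 m2 measurable_const) (assumption | simp)+
  moreover have "(\<Sum>i\<in>I. if first_min u I = i then
       (case k of 0 \<Rightarrow> u i | Suc k' \<Rightarrow> sorted_values (restrict u (I - {i})) (I - {i}) ! k') else 0)
     = sorted_values u I ! k" for u
  proof -
    let ?i = "first_min u I"
    have ne: "I \<noteq> {}" using Suc.hyps(2) by auto
    have "sorted_values u I = u ?i # sorted_values (restrict u (I - {?i})) (I - {?i})"
    proof -
      have "sorted_values u (I - {?i}) = sorted_values (restrict u (I - {?i})) (I - {?i})"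
        by (intro sorted_values_cong) simp
      then show ?thesis
        using first_min[OF Suc.prems(1) ne] Suc.prems(1) sorted_values_min[of I ?i u] by simp
    qed
    then show ?thesis
      using first_min(1)[OF Suc.prems(1) ne, of u] Suc.prems(1) by (simp add: sum.delta' split: nat.split)
  qed
  ultimately show ?case by (simp only:)
qed simp

context diffuse_law
begin

primrec losses_survival :: "(real \<Rightarrow> real) \<Rightarrow> real list \<Rightarrow> real \<Rightarrow> real" where
  "losses_survival \<alpha> [] = (\<lambda>c. 1)"
| "losses_survival \<alpha> (w # ws) = after_loss (\<alpha> w) (losses_survival \<alpha> ws)"

lemma losses_survival_measurable [measurable]: "losses_survival \<alpha> ws \<in> borel_measurable borel"
  by (induction ws) (auto intro!: after_loss_measurable intro: measurable_compose[OF measurable_snd])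

lemma losses_survival_nonneg: "0 \<le> losses_survival \<alpha> ws c"
  by (induction ws arbitrary: c) (auto intro!: after_loss_nonneg)

lemma losses_survival_le_1: "losses_survival \<alpha> ws c \<le> 1"
  by (induction ws arbitrary: c) (auto intro!: after_loss_le losses_survival_nonneg)

lemma ennreal_after_loss:
  assumes "f \<in> borel_measurable borel" "\<And>y. 0 \<le> f y" "\<And>y. f y \<le> B"
  shows "ennreal (after_loss b f c) = (\<integral>\<^sup>+l. indicator {..<c + b} l * ennreal (f (c - l)) \<partial>L)"
proof -
  have "(\<integral>\<^sup>+l. indicator {..<c + b} l * ennreal (f (c - l)) \<partial>L) = (\<integral>\<^sup>+l. ennreal (indicator {..<c + b} l * f (c - l)) \<partial>L)"
    by (intro nn_integral_cong) (simp add: indicator_def)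
  also have "... = ennreal (after_loss b f c)"
    unfolding after_loss_def using assms order.trans[OF assms(2,3)]
    by (intro nn_integral_eq_integral after_loss_integrable[where B=B] assms(1)) (auto simp: abs_of_nonneg)
  finally show ?thesis by simp
qed

text \<open>The losses are independent and identically distributed, so they may be integrated out in the order in
  which they occur.\<close>

lemma losses_survival_eq_emeasure:
  assumes "b + length ws \<le> d"
  shows "(\<integral>\<^sup>+l. indicator {l. \<forall>i<length ws. (\<Sum>j\<in>{b<..b + Suc i}. l j) < c + \<alpha> (ws ! i)} l \<partial>PiM {b<..d} (\<lambda>_. L))
    = ennreal (losses_survival \<alpha> ws c)"
  using assms
proof (induction ws arbitrary: b c)
  case Nil
  interpret P: prob_space "PiM {b<..d} (\<lambda>_. L)" by (intro prob_space_PiM prob_space_axioms)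
  show ?case by (simp add: P.emeasure_space_1)
next
  case (Cons w ws b c)
  interpret product_sigma_finite "\<lambda>_::nat. L" by unfold_locales
  have I: "{b<..d} = insert (Suc b) {Suc b<..d}" using Cons.prems by auto
  let ?A = "\<lambda>b c ws. {l. \<forall>i<length ws. (\<Sum>j\<in>{b<..b + Suc i}. l j) < c + \<alpha> (ws ! i)}"
  have eq: "indicator (?A b c (w # ws)) (x(Suc b := y)) = (indicator {..<c + \<alpha> w} y * indicator (?A (Suc b) (c - y) ws) x :: ennreal)"
    for x :: "nat \<Rightarrow> real" and y
  proof -
    have "(\<Sum>j\<in>{b<..b + Suc (Suc i)}. (x(Suc b := y)) j) = y + (\<Sum>j\<in>{Suc b<..Suc b + Suc i}. x j)" for i
    proof -
      have "{b<..b + Suc (Suc i)} = insert (Suc b) {Suc b<..Suc b + Suc i}" by auto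
      then show ?thesis by simp
    qed
    moreover have "{b<..b + Suc 0} = {Suc b}" by auto
    ultimately have "x(Suc b := y) \<in> ?A b c (w # ws) \<longleftrightarrow> y < c + \<alpha> w \<and> x \<in> ?A (Suc b) (c - y) ws"
      by (auto simp: All_less_Suc2 algebra_simps less_Suc_eq_0_disj)
    then show ?thesis by (simp add: indicator_def)
  qed
  have meas: "(\<lambda>l. indicator (?A b c (w # ws)) l :: ennreal) \<in> borel_measurable (PiM {b<..d} (\<lambda>_. L))"
  proof -
    have "(\<lambda>l. \<Sum>j\<in>{b<..b + Suc i}. l j) \<in> borel_measurable (PiM {b<..d} (\<lambda>_. L))" if "i < length (w # ws)" for i
    proof (intro borel_measurable_sum)
      fix j assume "j \<in> {b<..b + Suc i}"
      then have "j \<in> {b<..d}" using that Cons.prems by simp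
      from measurable_component_singleton[OF this, of "\<lambda>_. L"]
      show "(\<lambda>l. l j) \<in> borel_measurable (PiM {b<..d} (\<lambda>_. L))"
        by (simp add: measurable_cong_sets[OF refl sets_L])
    qed
    then have "{l \<in> space (PiM {b<..d} (\<lambda>_. L)). \<forall>i\<in>{..<length (w # ws)}. (\<Sum>j\<in>{b<..b + Suc i}. l j) < c + \<alpha> ((w # ws) ! i)} \<in> sets (PiM {b<..d} (\<lambda>_. L))"
      by (intro sets.sets_Collect_finite_All borel_measurable_less) auto
    then show ?thesis
      by (intro borel_measurable_indicator_Collect) (simp only: Ball_def lessThan_iff)
  qed
  have "(\<integral>\<^sup>+l. indicator (?A b c (w # ws)) l \<partial>PiM {b<..d} (\<lambda>_. L))
    = (\<integral>\<^sup>+y. \<integral>\<^sup>+x. indicator (?A b c (w # ws)) (x(Suc b := y)) \<partial>PiM {Suc b<..d} (\<lambda>_. L) \<partial>L)"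
    unfolding I by (rule product_nn_integral_insert_rev[OF _ _ meas[unfolded I]]) simp_all
  also have "... = (\<integral>\<^sup>+y. indicator {..<c + \<alpha> w} y * ennreal (losses_survival \<alpha> ws (c - y)) \<partial>L)"
  proof (intro nn_integral_cong)
    fix y
    have "(\<integral>\<^sup>+x. indicator (?A b c (w # ws)) (x(Suc b := y)) \<partial>PiM {Suc b<..d} (\<lambda>_. L))
      = indicator {..<c + \<alpha> w} y * (\<integral>\<^sup>+x. indicator (?A (Suc b) (c - y) ws) x \<partial>PiM {Suc b<..d} (\<lambda>_. L))"
      unfolding eq by (cases "y < c + \<alpha> w") auto
    then show "(\<integral>\<^sup>+x. indicator (?A b c (w # ws)) (x(Suc b := y)) \<partial>PiM {Suc b<..d} (\<lambda>_. L))
      = indicator {..<c + \<alpha> w} y * ennreal (losses_survival \<alpha> ws (c - y))"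
      using Cons.prems by (subst (asm) Cons.IH) auto
  qed
  also have "... = ennreal (losses_survival \<alpha> (w # ws) c)"
    by (simp add: ennreal_after_loss[where B=1] losses_survival_nonneg losses_survival_le_1)
  finally show ?case by simp
qed

lemma prob_space_PiM_L: "prob_space (PiM I (\<lambda>_. L))"
  by (intro prob_space_PiM prob_space_axioms)

lemma sets_PiM_L: "sets (PiM I (\<lambda>_. L)) = sets (PiM I (\<lambda>_. borel))"
  by (intro sets_PiM_cong) auto

lemma AE_component_neq:
  fixes I :: "nat set"
  assumes "finite I" shows "AE x in PiM I (\<lambda>_. L). \<forall>j\<in>I. x j \<noteq> y"
proof -
  have "AE x in PiM I (\<lambda>_. L). x j \<noteq> y" if "j \<in> I" for j
    by (rule AE_PiM_component) (use that AE_neq prob_space_axioms in auto)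
  then show ?thesis using assms by (intro AE_finite_allI) auto
qed

lemma losses_survival_sorted_measurable:
  assumes "finite I" and [measurable]: "\<alpha> \<in> borel_measurable borel"
  shows "(\<lambda>(u, c). losses_survival \<alpha> (sorted_values u I) c) \<in> borel_measurable (PiM I (\<lambda>_. borel) \<Otimes>\<^sub>M borel)"
proof -
  define d where "d = card I"
  let ?P = "PiM {0<..d} (\<lambda>_::nat. L)"
  interpret P: prob_space ?P by (rule prob_space_PiM_L)
  define A where "A u c = {l. \<forall>i<d. (\<Sum>j\<in>{0<..Suc i}. l j) < c + \<alpha> (sorted_values u I ! i)}" for u :: "nat \<Rightarrow> real" and c :: real
  have "(\<lambda>p. indicator (A (fst (fst p)) (snd (fst p))) (snd p) :: ennreal)
     \<in> borel_measurable ((PiM I (\<lambda>_. borel) \<Otimes>\<^sub>M borel) \<Otimes>\<^sub>M ?P)" (is "_ \<in> borel_measurable ?M")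
  proof -
    have "(\<lambda>p. \<Sum>j\<in>{0<..Suc i}. snd p j) \<in> borel_measurable ?M" if "i < d" for i
    proof (intro borel_measurable_sum)
      fix j assume "j \<in> {0<..Suc i}"
      then have "j \<in> {0<..d}" using that by simp
      from measurable_component_singleton[OF this, of "\<lambda>_. L"]
      have "(\<lambda>l. l j) \<in> borel_measurable ?P" by (simp add: measurable_cong_sets[OF refl sets_L])
      then show "(\<lambda>p. snd p j) \<in> borel_measurable ?M" by (rule measurable_compose[OF measurable_snd])
    qed
    moreover have "(\<lambda>p. snd (fst p) + \<alpha> (sorted_values (fst (fst p)) I ! i)) \<in> borel_measurable ?M" if "i < d" for i
    proof -
      have "(\<lambda>u. \<alpha> (sorted_values u I ! i)) \<in> borel_measurable (PiM I (\<lambda>_. borel))"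
        using sorted_values_nth_measurable[OF assms(1)] that unfolding d_def by measurable
      then have "(\<lambda>p. \<alpha> (sorted_values (fst (fst p)) I ! i)) \<in> borel_measurable ?M"
        by (rule measurable_compose[OF measurable_compose[OF measurable_fst measurable_fst]])
      then show ?thesis
        by (rule borel_measurable_add[OF measurable_compose[OF measurable_fst measurable_snd]])
    qed
    ultimately have "{p \<in> space ?M. \<forall>i\<in>{..<d}. (\<Sum>j\<in>{0<..Suc i}. snd p j) < snd (fst p) + \<alpha> (sorted_values (fst (fst p)) I ! i)} \<in> sets ?M"
      by (intro sets.sets_Collect_finite_All borel_measurable_less) auto
    then have "(\<lambda>p. indicator {p. \<forall>i\<in>{..<d}. (\<Sum>j\<in>{0<..Suc i}. snd p j) < snd (fst p) + \<alpha> (sorted_values (fst (fst p)) I ! i)} p :: ennreal) \<in> borel_measurable ?M"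
      by (rule borel_measurable_indicator_Collect)
    moreover have "indicator {p. \<forall>i\<in>{..<d}. (\<Sum>j\<in>{0<..Suc i}. snd p j) < snd (fst p) + \<alpha> (sorted_values (fst (fst p)) I ! i)} p
        = (indicator (A (fst (fst p)) (snd (fst p))) (snd p) :: ennreal)" for p
      by (simp add: A_def indicator_def Ball_def)
    ultimately show ?thesis by (simp only:)
  qed
  then have "(\<lambda>p. \<integral>\<^sup>+l. indicator (A (fst p) (snd p)) l \<partial>?P) \<in> borel_measurable (PiM I (\<lambda>_. borel) \<Otimes>\<^sub>M borel)"
    by (intro P.borel_measurable_nn_integral) (simp only: split_beta')
  moreover have "(\<integral>\<^sup>+l. indicator (A u c) l \<partial>?P) = ennreal (losses_survival \<alpha> (sorted_values u I) c)" for u c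
    using losses_survival_eq_emeasure[of 0 "sorted_values u I" d c \<alpha>] by (simp add: A_def d_def)
  ultimately have "(\<lambda>p. ennreal (losses_survival \<alpha> (sorted_values (fst p) I) (snd p))) \<in> borel_measurable (PiM I (\<lambda>_. borel) \<Otimes>\<^sub>M borel)"
    by (simp only:)
  then have "(\<lambda>p. enn2real (ennreal (losses_survival \<alpha> (sorted_values (fst p) I) (snd p)))) \<in> borel_measurable (PiM I (\<lambda>_. borel) \<Otimes>\<^sub>M borel)"
    by (rule borel_measurable_enn2real)
  then show ?thesis by (simp only: split_beta' enn2real_ennreal[OF losses_survival_nonneg])
qed

text \<open>An ordered sample arises from \<open>fact (card I)\<close> unordered ones. The induction splits off the least point:
  each index carries it with the same contribution, and the other points form a smaller sample on
  \<open>{y<..t}\<close>.\<close>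

lemma order_statistics_integral:
  assumes N: "diffuse_law N" and \<alpha> [measurable]: "\<alpha> \<in> borel_measurable borel" and I: "finite I"
  shows "(\<integral>\<^sup>+u. indicator {u. \<forall>i\<in>I. v < u i \<and> u i \<le> t} u * ennreal (losses_survival \<alpha> (sorted_values u I) c) \<partial>PiM I (\<lambda>_. N))
    = ennreal (fact (card I) * chain_int N \<alpha> t (card I) v c)"
  using I
proof (induction "card I" arbitrary: I v c)
  case 0
  then have "I = {}" by simp
  interpret product_sigma_finite "\<lambda>_::nat. N"
    using diffuse_law.axioms(1)[OF N] by (auto simp: product_sigma_finite_def prob_space_imp_sigma_finite)
  show ?case by (simp add: \<open>I = {}\<close> sorted_values_def
      prob_space.emeasure_space_1[OF diffuse_law.prob_space_PiM_L[OF N]])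
next
  case (Suc m I v c)
  let ?P = "\<lambda>J. PiM J (\<lambda>_. N)"
  interpret N: diffuse_law N by (rule N)
  interpret PN: product_sigma_finite "\<lambda>_::nat. N" by unfold_locales
  note ci_meas [measurable] = chain_int_measurable[OF N.finite_measure_axioms N.sets_L \<alpha>]
  note ci_le = chain_int_le[OF N.finite_measure_axioms N.sets_L \<alpha>, simplified]
  note ci_nn = chain_int_nonneg[OF N.finite_measure_axioms N.sets_L \<alpha>]
  have fin: "finite I" and ne: "I \<noteq> {}" using Suc by auto
  define LS where "LS u J = losses_survival \<alpha> (sorted_values u J)" for u J
  have LS: "LS u J \<in> borel_measurable borel" "0 \<le> LS u J y" "LS u J y \<le> 1" for u J y
    by (simp_all add: LS_def losses_survival_nonneg losses_survival_le_1)
  define G where "G i u = indicator {u. first_min u I = i \<and> (\<forall>j\<in>I. v < u j \<and> u j \<le> t)} u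
     * ennreal (LS u I c)" for i u
  have split: "indicator {u. \<forall>i\<in>I. v < u i \<and> u i \<le> t} u * ennreal (LS u I c) = (\<Sum>i\<in>I. G i u)" for u
  proof -
    have "(\<Sum>i\<in>I. G i u) = (\<Sum>i\<in>I. if first_min u I = i then indicator {u. \<forall>i\<in>I. v < u i \<and> u i \<le> t} u * ennreal (LS u I c) else 0)"
      by (intro sum.cong) (auto simp: G_def indicator_def)
    then show ?thesis using first_min(1)[OF fin ne, of u] fin by (simp add: sum.delta')
  qed
  have LS_meas: "(\<lambda>p. LS (fst p) J (snd p)) \<in> borel_measurable (?P J \<Otimes>\<^sub>M borel)" if "finite J" for J
    using losses_survival_sorted_measurable[OF that \<alpha>]
    by (simp only: LS_def split_beta' measurable_cong_sets[OF sets_pair_measure_cong[OF N.sets_PiM_L refl] refl])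
  have LS_meas1: "(\<lambda>u. LS u J y) \<in> borel_measurable (?P J)" if "finite J" for J y
    using measurable_Pair1[OF LS_meas[OF that], of y] by (simp only: fst_conv snd_conv space_borel UNIV_I)
  have comp: "(\<lambda>u. u j) \<in> borel_measurable (?P J)" if "j \<in> J" for j J
    using measurable_component_singleton[OF that, of "\<lambda>_. N"] by (simp add: measurable_cong_sets[OF refl N.sets_L])
  have G_meas: "G i \<in> borel_measurable (?P I)" if "i \<in> I" for i
  proof -
    have "{u \<in> space (?P I). \<forall>j\<in>I. (u i \<le> u j \<and> (j < i \<longrightarrow> u i < u j)) \<and> v < u j \<and> u j \<le> t} \<in> sets (?P I)"
      using fin that comp
      by (intro sets.sets_Collect_finite_All sets.sets_Collect_conj sets.sets_Collect_imp borel_measurable_less borel_measurable_le) auto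
    then have 1: "(\<lambda>u. indicator {u. first_min u I = i \<and> (\<forall>j\<in>I. v < u j \<and> u j \<le> t)} u :: ennreal) \<in> borel_measurable (?P I)"
      unfolding first_min_eq_iff[OF fin that]
      by (intro borel_measurable_indicator_Collect) (simp only: ball_conj_distrib conj_assoc)
    have "(\<lambda>u. LS u I c) \<in> borel_measurable (?P I)"
      by (rule LS_meas1[OF fin])
    with 1 show ?thesis unfolding G_def by measurable
  qed
  have G_int: "(\<integral>\<^sup>+u. G i u \<partial>?P I) = ennreal (fact m * chain_int N \<alpha> t (Suc m) v c)" if i: "i \<in> I" for i
  proof -
    define J where "J = I - {i}"
    have J: "finite J" "i \<notin> J" "I = insert i J" "card J = m" using i fin Suc.hyps(2) by (auto simp: J_def)
    interpret PJ: prob_space "?P J" by (rule N.prob_space_PiM_L)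
    interpret PL: pair_sigma_finite "?P J" L by unfold_locales
    define B where "B y = {x. \<forall>j\<in>J. y < x j \<and> x j \<le> t}" for y :: real
    have B_meas: "(\<lambda>x. indicator (B y) x :: ennreal) \<in> borel_measurable (?P J)" for y
    proof -
      have "{u \<in> space (?P J). \<forall>j\<in>J. y < u j \<and> u j \<le> t} \<in> sets (?P J)"
        using J(1) comp by (intro sets.sets_Collect_finite_All sets.sets_Collect_conj borel_measurable_less borel_measurable_le) auto
      then show ?thesis unfolding B_def by (rule borel_measurable_indicator_Collect)
    qed
    have inner: "(\<integral>\<^sup>+x. G i (x(i := y)) \<partial>?P J)
        = indicator {v<..t} y * (ennreal (fact m) * ennreal (after_loss (\<alpha> y) (chain_int N \<alpha> t m y) c))" for y
    proof -
      have "(\<integral>\<^sup>+x. G i (x(i := y)) \<partial>?P J)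
        = (\<integral>\<^sup>+x. indicator {v<..t} y * (indicator (B y) x * ennreal (after_loss (\<alpha> y) (LS x J) c)) \<partial>?P J)"
      proof (rule nn_integral_cong_AE)
        show "AE x in ?P J. G i (x(i := y)) = indicator {v<..t} y * (indicator (B y) x * ennreal (after_loss (\<alpha> y) (LS x J) c))"
          using N.AE_component_neq[OF J(1), of y]
        proof eventually_elim
          case (elim x)
          let ?u = "x(i := y)"
          have u: "?u j = x j" if "j \<in> J" for j using that J(2) by auto
          have 1: "first_min ?u I = i \<longleftrightarrow> (\<forall>j\<in>J. y < x j)"
            unfolding first_min_eq_iff[OF fin i] using elim J(2) by (auto simp: J(3) less_le)
          have 2: "LS ?u I c = after_loss (\<alpha> y) (LS x J) c" if "\<forall>j\<in>J. y < x j"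
          proof -
            have "sorted_values ?u I = ?u i # sorted_values ?u J" unfolding J_def
              using that u J by (intro sorted_values_min fin i) (auto simp: less_imp_le)
            moreover have "sorted_values ?u J = sorted_values x J" by (intro sorted_values_cong u)
            ultimately show ?thesis by (simp add: LS_def)
          qed
          have 3: "(first_min ?u I = i \<and> (\<forall>j\<in>I. v < ?u j \<and> ?u j \<le> t)) \<longleftrightarrow> (v < y \<and> y \<le> t \<and> x \<in> B y)"
            unfolding 1 using u J(2) by (auto simp: J(3) B_def)
          show ?case
          proof (cases "v < y \<and> y \<le> t \<and> x \<in> B y")
            case True
            then show ?thesis unfolding G_def using 2 3 by (auto simp: B_def)
          next
            case False
            then show ?thesis unfolding G_def using 3 by (auto simp: indicator_def)
          qed
        qed
      qed
      also have "... = indicator {v<..t} y * (\<integral>\<^sup>+x. indicator (B y) x * ennreal (after_loss (\<alpha> y) (LS x J) c) \<partial>?P J)"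
        by (cases "y \<in> {v<..t}") auto
      also have "(\<integral>\<^sup>+x. indicator (B y) x * ennreal (after_loss (\<alpha> y) (LS x J) c) \<partial>?P J)
        = (\<integral>\<^sup>+x. \<integral>\<^sup>+l. indicator (B y) x * (indicator {..<c + \<alpha> y} l * ennreal (LS x J (c - l))) \<partial>L \<partial>?P J)"
        using LS by (intro nn_integral_cong) (simp add: ennreal_after_loss[where B=1] nn_integral_cmult)
      also have "... = (\<integral>\<^sup>+l. \<integral>\<^sup>+x. indicator (B y) x * (indicator {..<c + \<alpha> y} l * ennreal (LS x J (c - l))) \<partial>?P J \<partial>L)"
      proof (rule PL.Fubini'[symmetric])
        have "(\<lambda>p. (fst p, c - snd p)) \<in> ?P J \<Otimes>\<^sub>M L \<rightarrow>\<^sub>M ?P J \<Otimes>\<^sub>M borel" by measurable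
        from measurable_compose[OF this LS_meas[OF J(1)]]
        have [measurable]: "(\<lambda>p. LS (fst p) J (c - snd p)) \<in> borel_measurable (?P J \<Otimes>\<^sub>M L)"
          by (simp only: fst_conv snd_conv)
        have [measurable]: "(\<lambda>p. indicator (B y) (fst p) :: ennreal) \<in> borel_measurable (?P J \<Otimes>\<^sub>M L)"
          by (rule measurable_compose[OF measurable_fst B_meas])
        show "(\<lambda>(x, l). indicator (B y) x * (indicator {..<c + \<alpha> y} l * ennreal (LS x J (c - l)))) \<in> borel_measurable (?P J \<Otimes>\<^sub>M L)"
          unfolding split_beta' by measurable
      qed
      also have "... = (\<integral>\<^sup>+l. indicator {..<c + \<alpha> y} l * (ennreal (fact m) * ennreal (chain_int N \<alpha> t m y (c - l))) \<partial>L)"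
      proof (intro nn_integral_cong)
        fix l
        have "(\<lambda>x. LS x J (c - l)) \<in> borel_measurable (?P J)"
          by (rule LS_meas1[OF J(1)])
        then have "(\<integral>\<^sup>+x. indicator (B y) x * (indicator {..<c + \<alpha> y} l * ennreal (LS x J (c - l))) \<partial>?P J)
          = indicator {..<c + \<alpha> y} l * (\<integral>\<^sup>+x. indicator (B y) x * ennreal (LS x J (c - l)) \<partial>?P J)"
          by (cases "l < c + \<alpha> y") auto
        also have "(\<integral>\<^sup>+x. indicator (B y) x * ennreal (LS x J (c - l)) \<partial>?P J) = ennreal (fact m * chain_int N \<alpha> t m y (c - l))"
          using Suc.hyps(1)[of J y "c - l"] J by (simp add: B_def LS_def)
        also have "... = ennreal (fact m) * ennreal (chain_int N \<alpha> t m y (c - l))"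
          using ci_nn by (intro ennreal_mult) auto
        finally show "(\<integral>\<^sup>+x. indicator (B y) x * (indicator {..<c + \<alpha> y} l * ennreal (LS x J (c - l))) \<partial>?P J)
          = indicator {..<c + \<alpha> y} l * (ennreal (fact m) * ennreal (chain_int N \<alpha> t m y (c - l)))" .
      qed
      also have "... = (\<integral>\<^sup>+l. ennreal (fact m) * (indicator {..<c + \<alpha> y} l * ennreal (chain_int N \<alpha> t m y (c - l))) \<partial>L)"
        by (intro nn_integral_cong) (simp add: mult_ac)
      also have "... = ennreal (fact m) * ennreal (after_loss (\<alpha> y) (chain_int N \<alpha> t m y) c)"
        by (subst nn_integral_cmult) (use ci_nn ci_le in \<open>simp_all add: ennreal_after_loss[where B=1]\<close>)
      finally show ?thesis .
    qed
    have "(\<integral>\<^sup>+u. G i u \<partial>?P I) = (\<integral>\<^sup>+y. \<integral>\<^sup>+x. G i (x(i := y)) \<partial>?P J \<partial>N)"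
      unfolding J(3) by (rule PN.product_nn_integral_insert_rev[OF J(1,2) G_meas[OF i, unfolded J(3)]])
    also have "... = (\<integral>\<^sup>+y. ennreal (fact m) * ennreal (indicator {v<..t} y * after_loss (\<alpha> y) (chain_int N \<alpha> t m y) c) \<partial>N)"
      unfolding inner by (intro nn_integral_cong) (auto simp: indicator_def)
    also have "... = ennreal (fact m) * (\<integral>\<^sup>+y. ennreal (indicator {v<..t} y * after_loss (\<alpha> y) (chain_int N \<alpha> t m y) c) \<partial>N)"
      by (rule nn_integral_cmult) measurable
    also have "(\<integral>\<^sup>+y. ennreal (indicator {v<..t} y * after_loss (\<alpha> y) (chain_int N \<alpha> t m y) c) \<partial>N) = ennreal (chain_int N \<alpha> t (Suc m) v c)"
      unfolding chain_int.simps
      by (intro nn_integral_eq_integral chain_int_integrable[OF N.finite_measure_axioms N.sets_L \<alpha>] AE_I2)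
         (auto intro!: mult_nonneg_nonneg after_loss_nonneg ci_nn)
    finally show ?thesis by (simp add: ennreal_mult' del: chain_int.simps)
  qed
  have "(\<integral>\<^sup>+u. indicator {u. \<forall>i\<in>I. v < u i \<and> u i \<le> t} u * ennreal (LS u I c) \<partial>?P I)
    = (\<Sum>i\<in>I. ennreal (fact m * chain_int N \<alpha> t (Suc m) v c))"
    unfolding split using G_meas by (subst nn_integral_sum) (auto simp: G_int simp del: chain_int.simps)
  also have "... = ennreal (real (card I) * (fact m * chain_int N \<alpha> t (Suc m) v c))"
    by (simp add: ennreal_mult' ennreal_of_nat_eq_real_of_nat del: chain_int.simps)
  also have "real (card I) * (fact m * chain_int N \<alpha> t (Suc m) v c) = fact (card I) * chain_int N \<alpha> t (card I) v c"
    unfolding Suc.hyps(2)[symmetric] by (simp del: chain_int.simps)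
  finally show ?case by (simp add: LS_def)
qed

end

section \<open>The survival probabilities of the limit\<close>

text \<open>Monotonicity allows for rational times only, which makes the event a countable union.\<close>

lemma crossing_time_less_iff:
  fixes f :: "real \<Rightarrow> real"
  assumes f: "mono_on {0..} f"
  shows "Inf {ereal t | t. 0 \<le> t \<and> s \<le> f t} < ereal u \<longleftrightarrow> (\<exists>q::rat. 0 \<le> q \<and> of_rat q < u \<and> s \<le> f (of_rat q))"
proof
  assume "Inf {ereal t | t. 0 \<le> t \<and> s \<le> f t} < ereal u"
  then obtain t where t: "0 \<le> t" "s \<le> f t" "t < u" by (auto simp: Inf_less_iff)
  then obtain q where q: "t < of_rat q" "of_rat q < u" using of_rat_dense by blast
  have "(0 :: real) < of_rat q" using t(1) q(1) by linarith
  then have "0 \<le> q" by simp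
  moreover have "f t \<le> f (of_rat q)" using f t(1) q(1) \<open>0 \<le> q\<close> by (intro mono_onD[OF f]) auto
  ultimately show "\<exists>q::rat. 0 \<le> q \<and> of_rat q < u \<and> s \<le> f (of_rat q)" using t(2) q(2) by (intro exI[of _ q]) auto
next
  assume "\<exists>q::rat. 0 \<le> q \<and> of_rat q < u \<and> s \<le> f (of_rat q)"
  then obtain q :: rat where "0 \<le> q" "of_rat q < u" "s \<le> f (of_rat q)" by blast
  then show "Inf {ereal t | t. 0 \<le> t \<and> s \<le> f t} < ereal u"
    by (auto simp: Inf_less_iff intro!: exI[of _ "of_rat q"])
qed

lemma crossing_time_eq_0_iff:
  fixes f :: "real \<Rightarrow> real"
  assumes f: "continuous_on {0..} f"
  shows "Inf {ereal t | t. 0 \<le> t \<and> s \<le> f t} = 0 \<longleftrightarrow> s \<le> f 0"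
proof
  assume "s \<le> f 0"
  then have "Inf {ereal t | t. 0 \<le> t \<and> s \<le> f t} \<le> ereal 0" by (intro Inf_lower) auto
  moreover have "0 \<le> Inf {ereal t | t. 0 \<le> t \<and> s \<le> f t}" by (intro Inf_greatest) auto
  ultimately show "Inf {ereal t | t. 0 \<le> t \<and> s \<le> f t} = 0" by (simp add: zero_ereal_def)
next
  assume Inf: "Inf {ereal t | t. 0 \<le> t \<and> s \<le> f t} = 0"
  show "s \<le> f 0"
  proof (rule ccontr)
    assume "\<not> s \<le> f 0"
    then obtain d where d: "0 < d" "\<And>t. 0 \<le> t \<Longrightarrow> t < d \<Longrightarrow> dist (f t) (f 0) < s - f 0"
      using f[unfolded continuous_on_iff, rule_format, of 0 "s - f 0"] by (auto simp: dist_real_def)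
    have "ereal d \<le> Inf {ereal t | t. 0 \<le> t \<and> s \<le> f t}"
      using d(2) by (intro Inf_greatest) (fastforce simp: dist_real_def not_less[symmetric])
    then show False using d(1) by (simp add: Inf zero_ereal_def)
  qed
qed

lemma diffuse_law_density:
  assumes "f \<in> borel_measurable borel" "prob_space (density lborel f)"
  shows "diffuse_law (density lborel f)"
proof -
  interpret prob_space "density lborel f" by fact
  show ?thesis
  proof
    show "AE l in density lborel f. l \<noteq> z" for z
      using AE_lborel_singleton[of z] assms(1) by (subst AE_density) (auto elim: AE_mp)
  qed simp
qed

locale network =
  fixes P :: "'x network"
  assumes params: "network_params P"
begin

lemma cap0_pos: "0 < cap0 P x"
  and prem_continuous: "continuous_on {0..} (prem P x)"
  and prem_mono: "mono_on {0..} (prem P x)"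
  using params by (auto simp: network_params_def)

sublocale loss_law: diffuse_law "loss_law P x" for x
  using params unfolding network_params_def loss_law_def by (intro diffuse_law_density) auto

sublocale shock_law: diffuse_law "shock_law P x" for x
  using params unfolding network_params_def shock_law_def by (intro diffuse_law_density) auto

definition cash :: "'x \<Rightarrow> real \<Rightarrow> real" where
  "cash x e = cap0 P x * (1 - e) - claims P x"

definition premium :: "'x \<Rightarrow> real \<Rightarrow> real" where
  "premium x t = prem P x (max 0 t)"

lemma cash_measurable [measurable]: "cash x \<in> borel_measurable borel"
  unfolding cash_def by measurable

lemma isCont_premium: "isCont (premium x) t"
proof -
  have "continuous_on UNIV (prem P x \<circ> max 0)"
    by (intro continuous_on_compose continuous_intros continuous_on_subset[OF prem_continuous]) auto
  then show ?thesis by (simp add: premium_def[abs_def] continuous_on_eq_continuous_at o_def)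
qed

lemma premium_measurable [measurable]: "premium x \<in> borel_measurable borel"
  by (intro borel_measurable_continuous_onI) (simp add: continuous_at_imp_continuous_on isCont_premium)

lemma premium_mono: "s \<le> t \<Longrightarrow> premium x s \<le> premium x t"
  unfolding premium_def by (intro mono_onD[OF prem_mono]) auto

lemma premium_nonneg: "0 \<le> t \<Longrightarrow> premium x t = prem P x t"
  by (simp add: premium_def)

lemma AE_cash_neq: "AE e in shock_law P x. cash x e \<noteq> z"
proof -
  have "cash x e = z \<longleftrightarrow> e = 1 - (z + claims P x) / cap0 P x" for e
    using cap0_pos[where x=x] by (auto simp: cash_def field_simps)
  then show ?thesis using shock_law.AE_neq[where x=x and z="1 - (z + claims P x) / cap0 P x"] by simp
qed

lemma tau_0_eq_0_iff: "tau P x 0 e l = 0 \<longleftrightarrow> 0 \<le> cash x e + premium x 0"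
proof -
  have "tau P x 0 e l = Inf {ereal t | t. 0 \<le> t \<and> 0 \<le> cap0 P x * (1 - e) + prem P x t - claims P x}"
    by (simp add: tau_def)
  also have "... = 0 \<longleftrightarrow> 0 \<le> cap0 P x * (1 - e) + prem P x 0 - claims P x"
    by (rule crossing_time_eq_0_iff) (intro continuous_intros prem_continuous)
  finally show ?thesis by (simp add: cash_def premium_def algebra_simps)
qed

lemma tau_less_iff:
  "tau P x i e l < ereal u \<longleftrightarrow> (\<exists>q::rat. 0 \<le> q \<and> of_rat q < u \<and> (\<Sum>j=1..i. l j) \<le> cash x e + premium x (of_rat q))"
proof -
  have "tau P x i e l < ereal u \<longleftrightarrow> (\<exists>q::rat. 0 \<le> q \<and> of_rat q < u \<and>
      (\<Sum>j=1..i. l j) \<le> cap0 P x * (1 - e) + prem P x (of_rat q) - claims P x)"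
    unfolding tau_def
    by (rule crossing_time_less_iff) (auto intro!: monotone_onI diff_right_mono add_left_mono mono_onD[OF prem_mono])
  also have "... \<longleftrightarrow> (\<exists>q::rat. 0 \<le> q \<and> of_rat q < u \<and> (\<Sum>j=1..i. l j) \<le> cash x e + premium x (of_rat q))"
    by (intro ex_cong1 conj_cong refl) (simp add: cash_def premium_nonneg algebra_simps)
  finally show ?thesis .
qed

lemma tau_less_iff_solvent:
  assumes "0 < u" "(\<Sum>j=1..i. l j) \<noteq> cash x e + premium x u"
  shows "tau P x i e l < ereal u \<longleftrightarrow> (\<Sum>j=1..i. l j) < cash x e + premium x u"
proof
  assume "tau P x i e l < ereal u"
  then obtain q :: rat where q: "0 \<le> q" "of_rat q < u" "(\<Sum>j=1..i. l j) \<le> cash x e + premium x (of_rat q)"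
    by (auto simp: tau_less_iff)
  with premium_mono[where s="of_rat q" and t=u and x=x] assms(2) show "(\<Sum>j=1..i. l j) < cash x e + premium x u" by simp
next
  assume less: "(\<Sum>j=1..i. l j) < cash x e + premium x u"
  have "((\<lambda>v. cash x e + premium x v) \<longlongrightarrow> cash x e + premium x u) (at_left u)"
    using isCont_premium[where x=x and t=u] by (intro tendsto_intros) (auto simp: isCont_def intro: filterlim_at_split[THEN iffD1, THEN conjunct1])
  from order_tendstoD(1)[OF this less] obtain b where b: "b < u" "\<And>v. b < v \<Longrightarrow> v < u \<Longrightarrow> (\<Sum>j=1..i. l j) < cash x e + premium x v"
    by (auto simp: eventually_at_left_field)
  obtain q where q: "max 0 b < of_rat q" "of_rat q < u" using of_rat_dense[of "max 0 b" u] assms(1) b(1) by auto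
  then show "tau P x i e l < ereal u"
    unfolding tau_less_iff using b(2)[of "of_rat q"] by (intro exI[of _ q]) (auto simp: less_imp_le)
qed

end

context reveal_intensity
begin

lemma diffuse_law_reveal_time_law:
  assumes t: "0 < t" shows "diffuse_law (reveal_time_law R t)"
proof -
  have pos: "0 < cum t" using cum_strict_mono[of 0 t] cum_eq_0[of 0] t by simp
  have eq: "indicator {0..t} s * R s / cum t = indicator {..t} s * (indicator {0..} s * R s) / cum t" for s
    by (auto simp: indicator_def)
  have meas: "(\<lambda>s. ennreal (indicator {0..t} s * R s / cum t)) \<in> borel_measurable borel"
    unfolding eq by measurable
  have "emeasure (reveal_time_law R t) UNIV = (\<integral>\<^sup>+s. ennreal (indicator {0..t} s * R s / cum t) \<partial>lborel)"
    unfolding reveal_time_law_def using meas by (subst emeasure_density) auto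
  also have "... = (\<integral>\<^sup>+s. ennreal (1 / cum t) * (ennreal (indicator {0..} s * R s) * indicator {..t} s) \<partial>lborel)"
  proof (intro nn_integral_cong)
    fix s
    show "ennreal (indicator {0..t} s * R s / cum t) = ennreal (1 / cum t) * (ennreal (indicator {0..} s * R s) * indicator {..t} s)"
      using pos R_positive[of s] by (auto simp: indicator_def simp flip: ennreal_mult)
  qed
  also have "... = ennreal (1 / cum t) * emeasure intensity_measure {..t}"
    unfolding intensity_measure_def by (subst nn_integral_cmult) (auto simp: emeasure_density)
  also have "... = 1"
    using pos by (simp add: emeasure_eq_measure measure_atMost_eq_cum flip: ennreal_mult)
  finally have "prob_space (reveal_time_law R t)" by (intro prob_spaceI) (simp add: reveal_time_law_def)
  then show ?thesis using meas unfolding reveal_time_law_def by (intro diffuse_law_density) auto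
qed

lemma AE_reveal_time_law: "AE s in reveal_time_law R t. 0 < s \<and> s \<le> t"
proof -
  have eq: "indicator {0..t} s * R s / cum t = indicator {..t} s * (indicator {0..} s * R s) / cum t" for s
    by (auto simp: indicator_def)
  have "(\<lambda>s. ennreal (indicator {0..t} s * R s / cum t)) \<in> borel_measurable lborel"
    unfolding eq by measurable
  moreover have "AE s in lborel. 0 < ennreal (indicator {0..t} s * R s / cum t) \<longrightarrow> 0 < s \<and> s \<le> t"
    using AE_lborel_singleton[of 0] by (rule eventually_mono) (auto simp: indicator_def split: if_splits)
  ultimately show ?thesis
    unfolding reveal_time_law_def by (simp only: AE_density)
qed

lemma integral_reveal_time_law:
  assumes [measurable]: "g \<in> borel_measurable borel"
  shows "(\<integral>w. indicator {T<..t} w * g w \<partial>reveal_time_law R t) = (\<integral>w. indicator {T<..t} w * g w \<partial>intensity_measure) / cum t"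
proof -
  have eq: "indicator {0..t} s * R s / cum t = indicator {..t} s * (indicator {0..} s * R s) / cum t" for s
    by (auto simp: indicator_def)
  have [measurable]: "(\<lambda>s. indicator {0..t} s * R s / cum t) \<in> borel_measurable borel"
    unfolding eq by measurable
  have "(\<integral>w. indicator {T<..t} w * g w \<partial>reveal_time_law R t)
    = (\<integral>w. (indicator {0..t} w * R w / cum t) * (indicator {T<..t} w * g w) \<partial>lborel)"
    unfolding reveal_time_law_def
  proof (subst integral_density)
    show "AE s in lborel. 0 \<le> indicator {0..t} s * R s / cum t"
      using R_positive cum_nonneg by (intro AE_I2) (auto simp: indicator_def less_imp_le)
  qed simp_all
  also have "... = (\<integral>w. (indicator {0..} w * R w) * (indicator {T<..t} w * g w) / cum t \<partial>lborel)"
    by (intro Bochner_Integration.integral_cong) (auto simp: indicator_def)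
  also have "... = (\<integral>w. (indicator {0..} w * R w) * (indicator {T<..t} w * g w) \<partial>lborel) / cum t"
    by (rule integral_divide_zero)
  also have "(\<integral>w. (indicator {0..} w * R w) * (indicator {T<..t} w * g w) \<partial>lborel) = (\<integral>w. indicator {T<..t} w * g w \<partial>intensity_measure)"
    unfolding intensity_measure_def
  proof (subst integral_density)
    show "AE s in lborel. 0 \<le> indicator {0..} s * R s"
      using R_positive by (intro AE_I2) (auto simp: indicator_def less_imp_le)
  qed simp_all
  finally show ?thesis .
qed

end

lemma (in diffuse_law) chain_int_reveal_time_law:
  assumes "reveal_intensity R" and \<alpha> [measurable]: "\<alpha> \<in> borel_measurable borel"
  shows "chain_int (reveal_time_law R t) \<alpha> t th T c
    = chain_int (reveal_intensity.intensity_measure R) \<alpha> t th T c / cum_rate R (ereal t) ^ th"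
proof -
  interpret R: reveal_intensity R by fact
  note [measurable] = chain_int_measurable[OF R.finite_intensity_measure R.sets_intensity_measure \<alpha>]
  show ?thesis
  proof (induction th arbitrary: T c)
    case (Suc th)
    let ?N = R.intensity_measure and ?C = "cum_rate R (ereal t)"
    have "after_loss b (\<lambda>y. chain_int ?N \<alpha> t th w y / ?C ^ th) c = after_loss b (chain_int ?N \<alpha> t th w) c / ?C ^ th" for b w
      using after_loss_cmult[of b "1 / ?C ^ th"] by simp
    moreover have "chain_int (reveal_time_law R t) \<alpha> t th w = (\<lambda>y. chain_int ?N \<alpha> t th w y / ?C ^ th)" for w
      using Suc by blast
    ultimately have "chain_int (reveal_time_law R t) \<alpha> t (Suc th) T c
      = (\<integral>w. indicator {T<..t} w * (after_loss (\<alpha> w) (chain_int ?N \<alpha> t th w) c / ?C ^ th) \<partial>reveal_time_law R t)"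
      by simp
    also have "... = (\<integral>w. indicator {T<..t} w * (after_loss (\<alpha> w) (chain_int ?N \<alpha> t th w) c / ?C ^ th) \<partial>?N) / ?C"
      by (rule R.integral_reveal_time_law) measurable
    also have "... = (\<integral>w. indicator {T<..t} w * after_loss (\<alpha> w) (chain_int ?N \<alpha> t th w) c / ?C ^ th \<partial>?N) / ?C"
      by simp
    also have "... = chain_int ?N \<alpha> t (Suc th) T c / ?C ^ Suc th"
      by (subst integral_divide_zero) (simp add: mult.commute)
    finally show ?case .
  qed simp
qed

context network
begin

lemma surv_0: "surv P R x 0 t = measure (shock_law P x) {e. 0 < cash x e + premium x 0}"
proof -
  define z where "z = (cap0 P x + prem P x 0 - claims P x) / cap0 P x"
  have "cdf (shock_law P x) z = measure (shock_law P x) {..z}" by (simp add: cdf_def)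
  also have "... = measure (shock_law P x) {e. 0 < cash x e + premium x 0}"
  proof (rule shock_law.finite_measure_eq_AE)
    show "AE e in shock_law P x. e \<in> {..z} \<longleftrightarrow> e \<in> {e. 0 < cash x e + premium x 0}"
      using AE_cash_neq[where x=x and z="- premium x 0"]
      by eventually_elim (use cap0_pos[where x=x] in \<open>auto simp: z_def cash_def premium_def field_simps\<close>)
  qed (simp, measurable)
  finally show ?thesis by (simp add: surv_def q0_def z_def)
qed

lemma indicator_eqI: "(x \<in> A \<longleftrightarrow> y \<in> B) \<Longrightarrow> indicator A x = (indicator B y :: 'b::zero_neq_one)"
  by (simp add: indicator_def)

text \<open>Up to null sets the event in \<open>surv\<close> says that each loss is strictly exceeded by the cash and the premium at
  the time of the loss. Given the shock and the times, the losses are integrated out by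
  \<open>losses_survival_eq_emeasure\<close>; then the ordered times by \<open>order_statistics_integral\<close>.\<close>

lemma surv_eq:
  assumes R: "reveal_intensity R" and t: "0 < t" and th: "1 \<le> th" "th \<le> indeg P x"
  shows "surv P R x th t = fact th / cum_rate R (ereal t) ^ th *
    (\<integral>e. indicator {e. 0 < cash x e + premium x 0} e
        * loss_law.chain_int x (reveal_intensity.intensity_measure R) (premium x) t th 0 (cash x e) \<partial>shock_law P x)"
proof -
  interpret R: reveal_intensity R by (rule R)
  interpret U: diffuse_law "reveal_time_law R t" by (rule R.diffuse_law_reveal_time_law[OF t])
  define E where "E = shock_law P x"
  define PL where "PL = PiM {1..indeg P x} (\<lambda>_. loss_law P x)"
  define PU where "PU = PiM {1..th} (\<lambda>_. reveal_time_law R t)"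
  interpret E: diffuse_law E unfolding E_def by (rule shock_law.diffuse_law_axioms)
  interpret PL: prob_space PL unfolding PL_def by (rule loss_law.prob_space_PiM_L)
  interpret PU: prob_space PU unfolding PU_def by (rule U.prob_space_PiM_L)
  interpret LU: pair_prob_space PL PU ..
  interpret S: pair_prob_space E "PL \<Otimes>\<^sub>M PU" ..
  let ?S = "E \<Otimes>\<^sub>M (PL \<Otimes>\<^sub>M PU)"
  define s where "s i p = (\<Sum>j=1..i. fst (snd p) j)" for i and p :: "real \<times> (nat \<Rightarrow> real) \<times> (nat \<Rightarrow> real)"
  define ord where "ord i p = order_stat th (snd (snd p)) i" for i and p :: "real \<times> (nat \<Rightarrow> real) \<times> (nat \<Rightarrow> real)"
  define c where "c p = cash x (fst p)" for p :: "real \<times> (nat \<Rightarrow> real) \<times> (nat \<Rightarrow> real)"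
  have c_meas [measurable]: "c \<in> borel_measurable ?S"
    unfolding c_def by measurable
  have comp_l: "(\<lambda>l. l j) \<in> borel_measurable PL" if "j \<in> {1..indeg P x}" for j
    using measurable_component_singleton[OF that, of "\<lambda>_. loss_law P x"]
    unfolding PL_def by (simp only: measurable_cong_sets[OF refl loss_law.sets_L])
  have comp_u: "(\<lambda>u. u j) \<in> borel_measurable PU" if "j \<in> {1..th}" for j
    using measurable_component_singleton[OF that, of "\<lambda>_. reveal_time_law R t"]
    unfolding PU_def by (simp only: measurable_cong_sets[OF refl U.sets_L])
  have s_meas: "s i \<in> borel_measurable ?S" if "i \<in> {1..th}" for i
    unfolding s_def
  proof (intro borel_measurable_sum)
    fix j assume "j \<in> {1..i}"
    then have "j \<in> {1..indeg P x}" using that th by auto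
    from measurable_compose[OF measurable_compose[OF measurable_snd measurable_fst] comp_l[OF this]]
    show "(\<lambda>p. fst (snd p) j) \<in> borel_measurable ?S" .
  qed
  have ord_meas: "ord i \<in> borel_measurable ?S" if "i \<in> {1..th}" for i
  proof -
    have "(\<lambda>u. sorted_values u {1..th} ! (i - 1)) \<in> borel_measurable (PiM {1..th} (\<lambda>_. borel))"
      using that by (intro sorted_values_nth_measurable) auto
    then have "(\<lambda>u. sorted_values u {1..th} ! (i - 1)) \<in> borel_measurable PU"
      unfolding PU_def by (simp only: measurable_cong_sets[OF U.sets_PiM_L refl])
    from measurable_compose[OF measurable_compose[OF measurable_snd measurable_snd] this]
    show ?thesis unfolding ord_def order_stat_eq_sorted_values .
  qed
  define A where "A = {(e, l, u) \<in> space ?S. tau P x 0 e l = 0 \<and> (\<forall>i\<in>{1..th}. ereal (order_stat th u i) > tau P x i e l)}"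
  define B where "B = {p \<in> space ?S. 0 < c p + premium x 0 \<and> (\<forall>i\<in>{1..th}. s i p < c p + premium x (ord i p))}"
  have A_eq: "A = {p \<in> space ?S. 0 \<le> c p + premium x 0 \<and>
      (\<forall>i\<in>{1..th}. \<exists>q::rat. 0 \<le> q \<and> of_rat q < ord i p \<and> s i p \<le> c p + premium x (of_rat q))}"
    unfolding A_def tau_0_eq_0_iff tau_less_iff by (auto simp: c_def s_def ord_def)
  have A_sets: "A \<in> sets ?S" unfolding A_eq
    using s_meas ord_meas c_meas
    by (intro sets.sets_Collect_conj sets.sets_Collect_finite_All sets.sets_Collect_countable_Ex sets.sets_Collect_const
        borel_measurable_le borel_measurable_less borel_measurable_add borel_measurable_const) simp_all
  have prem_ord: "(\<lambda>p. premium x (ord i p)) \<in> borel_measurable ?S" if "i \<in> {1..th}" for i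
    by (rule measurable_compose[OF ord_meas[OF that] premium_measurable])
  have B_sets: "B \<in> sets ?S" unfolding B_def
    using s_meas prem_ord c_meas
    by (intro sets.sets_Collect_conj sets.sets_Collect_finite_All
        borel_measurable_less borel_measurable_add borel_measurable_const) simp_all
  have AE_pos: "AE p in ?S. \<forall>i\<in>{1..th}. 0 < snd (snd p) i"
  proof -
    have "AE u in PU. 0 < u i" if "i \<in> {1..th}" for i
      unfolding PU_def
      by (rule AE_PiM_component) (use that R.AE_reveal_time_law[of t] U.prob_space_axioms in auto)
    then have u: "AE u in PU. \<forall>i\<in>{1..th}. 0 < u i" by (intro AE_finite_allI) auto
    have "{u \<in> space PU. \<forall>i\<in>{1..th}. 0 < u i} \<in> sets PU"
      using comp_u by (intro sets.sets_Collect_finite_All borel_measurable_less borel_measurable_const) simp_all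
    then have p: "Measurable.pred PU (\<lambda>u. \<forall>i\<in>{1..th}. 0 < u i)" by (simp only: pred_def)
    have "AE q in PL \<Otimes>\<^sub>M PU. \<forall>i\<in>{1..th}. 0 < snd q i"
      using u measurable_compose[OF measurable_snd p, of PL] by (intro LU.AE_pair_measure) (simp_all only: pred_def snd_conv AE_I2)
    then show ?thesis
      using measurable_compose[OF measurable_compose[OF measurable_snd measurable_snd] p, of E PL]
      by (intro S.AE_pair_measure) (simp_all only: pred_def snd_conv AE_I2)
  qed
  have AE_neq: "AE p in ?S. c p \<noteq> - premium x 0 \<and> (\<forall>i\<in>{1..th}. c p \<noteq> s i p - premium x (ord i p))"
  proof -
    let ?Q = "\<lambda>p. c p \<noteq> - premium x 0 \<and> (\<forall>i\<in>{1..th}. c p \<noteq> s i p - premium x (ord i p))"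
    have Q_sets: "{p \<in> space ?S. ?Q p} \<in> sets ?S"
      using s_meas prem_ord c_meas
      by (intro sets.sets_Collect_conj sets.sets_Collect_finite_All borel_measurable_neq borel_measurable_diff
           borel_measurable_const) simp_all
    have inner: "AE e in E. ?Q (e, q)" for q
    proof -
      have "AE e in E. cash x e \<noteq> - premium x 0 \<and> (\<forall>i\<in>{1..th}. cash x e \<noteq> s i (0, q) - premium x (ord i (0, q)))"
        unfolding E_def by (intro AE_conjI AE_finite_allI AE_cash_neq) auto
      then show ?thesis by (simp add: c_def s_def ord_def)
    qed
    have "AE q in PL \<Otimes>\<^sub>M PU. AE e in E. ?Q (e, q)" by (rule AE_I2[OF inner])
    then have "AE e in E. AE q in PL \<Otimes>\<^sub>M PU. ?Q (e, q)"
      using Q_sets by (subst S.AE_commute) simp_all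
    then show ?thesis by (intro S.AE_pair_measure Q_sets) simp
  qed
  have AB: "measure ?S A = measure ?S B"
  proof (rule S.finite_measure_eq_AE[OF _ A_sets B_sets])
    show "AE p in ?S. p \<in> A \<longleftrightarrow> p \<in> B"
      using AE_pos AE_neq AE_space
    proof eventually_elim
      case (elim p)
      have pos: "0 < ord i p" if "i \<in> {1..th}" for i
      proof -
        have "ord i p \<in> set (sorted_values (snd (snd p)) {1..th})"
          unfolding ord_def order_stat_eq_sorted_values using that by (intro nth_mem) auto
        then show ?thesis using elim(1) by (auto simp: set_sorted_values)
      qed
      have "(\<exists>q::rat. 0 \<le> q \<and> of_rat q < ord i p \<and> s i p \<le> c p + premium x (of_rat q)) \<longleftrightarrow> s i p < c p + premium x (ord i p)"
        if "i \<in> {1..th}" for i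
      proof -
        have "s i p \<noteq> c p + premium x (ord i p)"
          using conjunct2[OF elim(2), THEN bspec, OF that] by linarith
        then show ?thesis
          using tau_less_iff_solvent[OF pos[OF that], of "fst (snd p)" i x "fst p"]
          by (simp add: tau_less_iff s_def c_def)
      qed
      moreover have "0 \<le> c p + premium x 0 \<longleftrightarrow> 0 < c p + premium x 0" using elim(2) by auto
      ultimately show ?case using elim(3) unfolding A_eq B_def by auto
    qed
  qed
  have idx: "{1..indeg P x} = {0<..indeg P x}" by auto
  let ?ci = "loss_law.chain_int x (reveal_time_law R t) (premium x) t th 0"
  have LS_le: "0 \<le> ?ci y" for y
    by (rule loss_law.chain_int_nonneg[OF U.finite_measure_axioms U.sets_L premium_measurable])
  have slice: "emeasure (PL \<Otimes>\<^sub>M PU) (Pair e -` B)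
      = ennreal (indicator {e. 0 < cash x e + premium x 0} e * (fact th * ?ci (cash x e)))" for e
  proof (cases "0 < cash x e + premium x 0")
    case False
    then have "Pair e -` B = {}" by (auto simp: B_def c_def)
    then show ?thesis using False by simp
  next
    case True
    have sl: "Pair e -` B \<in> sets (PL \<Otimes>\<^sub>M PU)" by (rule sets_Pair1[OF B_sets])
    have "emeasure (PL \<Otimes>\<^sub>M PU) (Pair e -` B) = (\<integral>\<^sup>+u. emeasure PL ((\<lambda>l. (l, u)) -` (Pair e -` B)) \<partial>PU)"
      by (rule LU.emeasure_pair_measure_alt2[OF sl])
    also have "... = (\<integral>\<^sup>+u. indicator {u. \<forall>i\<in>{1..th}. 0 < u i \<and> u i \<le> t} u * ennreal (loss_law.losses_survival x (premium x) (sorted_values u {1..th}) (cash x e)) \<partial>PU)"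
    proof (rule nn_integral_cong_AE)
      have "AE u in PU. 0 < u i \<and> u i \<le> t" if "i \<in> {1..th}" for i
        unfolding PU_def
        by (rule AE_PiM_component) (use that R.AE_reveal_time_law[of t] U.prob_space_axioms in auto)
      then have "AE u in PU. \<forall>i\<in>{1..th}. 0 < u i \<and> u i \<le> t" by (intro AE_finite_allI) auto
      then show "AE u in PU. emeasure PL ((\<lambda>l. (l, u)) -` (Pair e -` B)) =
         indicator {u. \<forall>i\<in>{1..th}. 0 < u i \<and> u i \<le> t} u * ennreal (loss_law.losses_survival x (premium x) (sorted_values u {1..th}) (cash x e))"
        using AE_space
      proof eventually_elim
        case (elim u)
        let ?ws = "sorted_values u {1..th}"
        let ?C = "{l. \<forall>i<length ?ws. (\<Sum>j\<in>{0<..0 + Suc i}. l j) < cash x e + premium x (?ws ! i)}"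
        have "l \<in> (\<lambda>l. (l, u)) -` (Pair e -` B) \<longleftrightarrow> l \<in> ?C" if "l \<in> space PL" for l
        proof -
          have "l \<in> (\<lambda>l. (l, u)) -` (Pair e -` B) \<longleftrightarrow> (\<forall>i\<in>{1..th}. (\<Sum>j=1..i. l j) < cash x e + premium x (?ws ! (i - 1)))"
            using True that elim(2)
            by (simp add: B_def c_def s_def ord_def order_stat_eq_sorted_values space_pair_measure E_def)
          also have "... \<longleftrightarrow> (\<forall>i\<in>Suc ` {..<th}. (\<Sum>j=1..i. l j) < cash x e + premium x (?ws ! (i - 1)))"
            by (simp only: image_Suc_lessThan)
          also have "... \<longleftrightarrow> l \<in> ?C"
            by (auto simp: atLeastSucAtMost_greaterThanAtMost)
          finally show ?thesis .
        qed
        then have "(\<integral>\<^sup>+l. indicator ((\<lambda>l. (l, u)) -` (Pair e -` B)) l \<partial>PL) = (\<integral>\<^sup>+l. indicator ?C l \<partial>PL)"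
          by (intro nn_integral_cong indicator_eqI)
        then have "emeasure PL ((\<lambda>l. (l, u)) -` (Pair e -` B)) = (\<integral>\<^sup>+l. indicator ?C l \<partial>PL)"
          by (simp only: nn_integral_indicator[OF sets_Pair2[OF sl]])
        also have "... = ennreal (loss_law.losses_survival x (premium x) ?ws (cash x e))"
          unfolding PL_def idx by (rule loss_law.losses_survival_eq_emeasure) (use th in simp)
        finally show ?case using elim(1) by simp
      qed
    qed
    also have "... = ennreal (fact th * ?ci (cash x e))"
      unfolding PU_def
      using loss_law.order_statistics_integral[OF U.diffuse_law_axioms premium_measurable, of "{1..th}" 0 t x x "cash x e"] by simp
    finally show ?thesis using True by simp
  qed
  have "emeasure ?S B = (\<integral>\<^sup>+e. emeasure (PL \<Otimes>\<^sub>M PU) (Pair e -` B) \<partial>E)"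
    by (rule sigma_finite_measure.emeasure_pair_measure_alt[OF _ B_sets])
       (intro prob_space_imp_sigma_finite prob_space_pair PL.prob_space_axioms PU.prob_space_axioms)
  also have "... = (\<integral>\<^sup>+e. ennreal (indicator {e. 0 < cash x e + premium x 0} e * (fact th * ?ci (cash x e))) \<partial>E)"
    by (simp only: slice)
  finally have "measure ?S B = (\<integral>e. indicator {e. 0 < cash x e + premium x 0} e * (fact th * ?ci (cash x e)) \<partial>E)"
    unfolding measure_def
  proof (subst integral_eq_nn_integral)
    note [measurable] = loss_law.chain_int_measurable[OF U.finite_measure_axioms U.sets_L premium_measurable]
    show "(\<lambda>e. indicator {e. 0 < cash x e + premium x 0} e * (fact th * ?ci (cash x e))) \<in> borel_measurable E"
      by measurable
  qed (use LS_le in simp_all)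
  also have "... = (\<integral>e. fact th / cum_rate R (ereal t) ^ th * (indicator {e. 0 < cash x e + premium x 0} e
        * loss_law.chain_int x (reveal_intensity.intensity_measure R) (premium x) t th 0 (cash x e)) \<partial>E)"
    by (simp add: loss_law.chain_int_reveal_time_law[OF R premium_measurable] mult_ac)
  also have "... = fact th / cum_rate R (ereal t) ^ th * (\<integral>e. indicator {e. 0 < cash x e + premium x 0} e
        * loss_law.chain_int x (reveal_intensity.intensity_measure R) (premium x) t th 0 (cash x e) \<partial>E)"
    by (rule integral_mult_right_zero)
  finally have "measure ?S B = ..." .
  moreover have "surv P R x th t = measure ?S A"
    using th by (simp add: surv_def Let_def A_def E_def PL_def PU_def)
  ultimately show ?thesis using AB unfolding E_def by (simp only:)
qed

end

locale limit_model = network P + reveal_intensity R for P :: "'x network" and R :: "real \<Rightarrow> real" +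
  fixes lam :: real
  assumes lam_pos: "0 < lam"
begin

definition chain_mass :: "'x \<Rightarrow> nat \<Rightarrow> real \<Rightarrow> real" where
  "chain_mass x th t = (\<integral>e. indicator {e. 0 < cash x e + premium x 0} e
     * loss_law.chain_int x intensity_measure (premium x) t th 0 (cash x e) \<partial>shock_law P x)"

text \<open>The probability that an agent survives until time \<open>t\<close> if each of its incoming half-edges is independently
  revealed at a time with density \<open>R / lam\<close>, or never. In contrast to the sum of \<open>surv\<close>, this form makes sense
  at \<open>t = 0\<close> and is visibly continuous.\<close>

definition survivor_fraction :: "'x \<Rightarrow> real \<Rightarrow> real" where
  "survivor_fraction x t = (\<Sum>th\<le>indeg P x. real (indeg P x choose th) * fact th
     * (lam - cum t) ^ (indeg P x - th) / lam ^ indeg P x * chain_mass x th t)"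

lemmas chain_int_nonneg = loss_law.chain_int_nonneg[OF finite_measure_axioms sets_intensity_measure premium_measurable]
lemmas chain_int_le = loss_law.chain_int_le[OF finite_measure_axioms sets_intensity_measure premium_measurable]
lemmas chain_int_meas [measurable] = loss_law.chain_int_measurable[OF finite_measure_axioms sets_intensity_measure premium_measurable]
lemmas chain_int_lipschitz = loss_law.chain_int_lipschitz[OF finite_measure_axioms sets_intensity_measure premium_measurable]

lemma cum_total_pos: "0 < cum_total"
  using cum_less_total[of 0] cum_nonneg[of 0] by simp

lemma chain_mass_integrable:
  "integrable (shock_law P x) (\<lambda>e. indicator {e. 0 < cash x e + premium x 0} e
     * loss_law.chain_int x intensity_measure (premium x) t th 0 (cash x e))"
  using chain_int_le chain_int_nonneg cum_total_pos
  by (intro shock_law.integrable_const_bound[where B="cum_total ^ th"] AE_I2)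
     (auto simp: indicator_def abs_mult measure_UNIV_eq_cum_total)

lemma chain_mass_mono:
  assumes "s \<le> t" shows "chain_mass x th s \<le> chain_mass x th t"
  unfolding chain_mass_def
  using chain_int_lipschitz[OF assms] by (intro integral_mono chain_mass_integrable mult_left_mono) auto

lemma chain_mass_le: "chain_mass x th t \<le> cum_total ^ th"
proof -
  have "chain_mass x th t \<le> (\<integral>e. cum_total ^ th \<partial>shock_law P x)"
    unfolding chain_mass_def using chain_int_le[where th=th] cum_le_total[of 0] cum_nonneg[of 0]
    by (intro integral_mono chain_mass_integrable) (auto simp: indicator_def measure_UNIV_eq_cum_total)
  then show ?thesis by simp
qed

lemma chain_mass_lipschitz:
  assumes "s \<le> t" shows "chain_mass x th t \<le> chain_mass x th s + th * cum_total ^ (th - 1) * (cum t - cum s)"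
proof -
  let ?D = "th * cum_total ^ (th - 1) * (cum t - cum s)"
  have D: "0 \<le> ?D" using cum_mono[OF assms] cum_le_total[of 0] cum_nonneg[of 0] by simp
  have "chain_mass x th t \<le> (\<integral>e. indicator {e. 0 < cash x e + premium x 0} e
     * loss_law.chain_int x intensity_measure (premium x) s th 0 (cash x e) + ?D \<partial>shock_law P x)"
    unfolding chain_mass_def
    using chain_int_lipschitz[OF assms, where th=th] D
    by (intro integral_mono chain_mass_integrable Bochner_Integration.integrable_add)
       (auto simp: indicator_def measure_UNIV_eq_cum_total measure_Ioc_eq_cum[OF assms])
  also have "... = chain_mass x th s + ?D"
    using chain_mass_integrable by (simp add: chain_mass_def)
  finally show ?thesis .
qed

lemma isCont_chain_mass: "isCont (chain_mass x th) t"
proof -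
  let ?D = "\<lambda>s. th * cum_total ^ (th - 1) * \<bar>cum s - cum t\<bar>"
  have bound: "norm (chain_mass x th s - chain_mass x th t) \<le> ?D s" for s
    unfolding real_norm_def
    using chain_mass_lipschitz[of s t x th] chain_mass_lipschitz[of t s x th] chain_mass_mono[of s t x th]
      chain_mass_mono[of t s x th] cum_mono[of s t] cum_mono[of t s]
    by (cases "s \<le> t") (auto simp: abs_if)
  have "?D \<midarrow>t\<rightarrow> th * cum_total ^ (th - 1) * \<bar>cum t - cum t\<bar>"
    using isCont_cum[of t] by (intro tendsto_intros) (simp add: isCont_def)
  then have D: "?D \<midarrow>t\<rightarrow> 0" by simp
  have "(\<lambda>s. chain_mass x th s - chain_mass x th t) \<midarrow>t\<rightarrow> 0"
    by (rule Lim_null_comparison[OF always_eventually[OF allI[OF bound]] D])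
  then show ?thesis by (simp add: isCont_def LIM_zero_iff)
qed

lemma isCont_survivor_fraction: "isCont (survivor_fraction x) t"
  unfolding survivor_fraction_def[abs_def]
  using isCont_chain_mass isCont_cum lam_pos by (intro continuous_intros) auto

lemma phi_eq:
  assumes "0 \<le> t" "cum t \<le> lam" shows "phi R lam t = cum t / lam"
proof -
  have "ereal t \<le> t_full R lam"
  proof (cases "cum_total \<le> lam")
    case False
    have "ereal t \<le> Inf {ereal t | t. 0 \<le> t \<and> cum t \<ge> lam}"
    proof (rule Inf_greatest)
      fix y assume "y \<in> {ereal t | t. 0 \<le> t \<and> cum t \<ge> lam}"
      then obtain u where "y = ereal u" "0 \<le> u" "lam \<le> cum u" by blast
      then show "ereal t \<le> y" using assms cum_le_iff[of t u] by simp
    qed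
    then show ?thesis using False by (simp add: t_full_def)
  qed (simp add: t_full_def)
  then show ?thesis by (simp add: phi_def min_absorb1)
qed

lemma surv_0_eq_chain_mass: "surv P R x 0 t = chain_mass x 0 s"
proof -
  have "{e. 0 < cash x e + premium x 0} \<in> sets (shock_law P x)" by measurable
  then show ?thesis by (simp add: surv_0 chain_mass_def)
qed

lemma surv_eq_chain_mass:
  assumes "0 < t" "th \<le> indeg P x"
  shows "surv P R x th t = fact th / cum t ^ th * chain_mass x th t"
proof (cases "th = 0")
  case True
  then show ?thesis using surv_0_eq_chain_mass by simp
next
  case False
  then show ?thesis
    unfolding chain_mass_def using assms by (intro surv_eq reveal_intensity_axioms) auto
qed

lemma survivor_fraction_eq:
  assumes t: "0 \<le> t" "cum t \<le> lam"
  shows "(\<Sum>th\<le>indeg P x. binom_prob (indeg P x) (phi R lam t) th * surv P R x th t) = survivor_fraction x t"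
  unfolding survivor_fraction_def
proof (intro sum.cong refl)
  fix th assume "th \<in> {..indeg P x}"
  then have th: "th \<le> indeg P x" by simp
  let ?d = "indeg P x"
  have pw: "lam ^ ?d = lam ^ th * lam ^ (?d - th)" using th by (simp flip: power_add)
  have one: "1 - cum t / lam = (lam - cum t) / lam" using lam_pos by (simp add: diff_divide_distrib)
  show "binom_prob ?d (phi R lam t) th * surv P R x th t
    = real (?d choose th) * fact th * (lam - cum t) ^ (?d - th) / lam ^ ?d * chain_mass x th t"
  proof (cases "th = 0")
    case True
    then show ?thesis
      using surv_0_eq_chain_mass[of x t t] t
      by (simp add: binom_prob_def phi_eq one power_divide)
  next
    case False
    show ?thesis
    proof (cases "t = 0")
      case True
      obtain j where "th = Suc j" using False by (cases th) auto
      then show ?thesis using True lam_pos False by (simp add: binom_prob_def phi_eq cum_eq_0 chain_mass_def)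
    next
      case False
      then have pos: "0 < t" using t by simp
      then have "0 < cum t" using cum_strict_mono[of 0 t] cum_eq_0[of 0] by simp
      then show ?thesis
        using lam_pos t
        by (simp add: binom_prob_def phi_eq surv_eq_chain_mass[OF pos th] one power_divide pw)
    qed
  qed
qed

text \<open>The masses \<open>chain_mass\<close> increase in \<open>t\<close> and are bounded, hence converge.\<close>

lemma survivor_fraction_tendsto:
  assumes total: "cum_total \<le> lam"
  shows "(survivor_fraction x \<longlongrightarrow>
    (\<Sum>th\<le>indeg P x. binom_prob (indeg P x) (cum_total / lam) th * surv_lim P R x th)) at_top"
proof -
  have lim: "((\<lambda>t. surv P R x th t) \<longlongrightarrow> surv_lim P R x th) at_top" if "th \<le> indeg P x" for th
  proof -
    have bdd: "bdd_above (range (chain_mass x th))" using chain_mass_le by (intro bdd_aboveI) auto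
    have "(chain_mass x th \<longlongrightarrow> (SUP t. chain_mass x th t)) at_top"
    proof (rule increasing_tendsto)
      show "\<forall>\<^sub>F t in at_top. chain_mass x th t \<le> (SUP t. chain_mass x th t)"
        by (intro always_eventually allI cSUP_upper bdd) simp
      fix y assume "y < (SUP t. chain_mass x th t)"
      then obtain t where "y < chain_mass x th t" using bdd by (auto simp: less_cSUP_iff)
      then show "\<forall>\<^sub>F t in at_top. y < chain_mass x th t"
        unfolding eventually_at_top_linorder using chain_mass_mono[of t] less_le_trans by blast
    qed
    moreover have "cum_total ^ th \<noteq> 0" using cum_less_total[of 0] cum_nonneg[of 0] by simp
    ultimately have "((\<lambda>t. fact th / cum t ^ th * chain_mass x th t) \<longlongrightarrow> fact th / cum_total ^ th * (SUP t. chain_mass x th t)) at_top"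
      by (intro tendsto_intros cum_tendsto_total)
    then have "((\<lambda>t. surv P R x th t) \<longlongrightarrow> fact th / cum_total ^ th * (SUP t. chain_mass x th t)) at_top"
      by (rule Lim_transform_eventually) (auto simp: eventually_at_top_dense surv_eq_chain_mass[OF _ that] intro!: exI[of _ 0])
    then show ?thesis unfolding surv_lim_def by (simp add: tendsto_Lim)
  qed
  have "((\<lambda>t. \<Sum>th\<le>indeg P x. binom_prob (indeg P x) (cum t / lam) th * surv P R x th t) \<longlongrightarrow>
    (\<Sum>th\<le>indeg P x. binom_prob (indeg P x) (cum_total / lam) th * surv_lim P R x th)) at_top"
    unfolding binom_prob_def using lam_pos by (intro tendsto_intros cum_tendsto_total lim) auto
  moreover have "(\<Sum>th\<le>indeg P x. binom_prob (indeg P x) (cum t / lam) th * surv P R x th t) = survivor_fraction x t" if "0 \<le> t" for t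
    using survivor_fraction_eq[of t x] phi_eq[of t] that cum_le_total[of t] total by simp
  ultimately show ?thesis
    by (rule Lim_transform_eventually[OF _ eventually_mono[OF eventually_ge_at_top[of 0]]])
qed

end

section \<open>Paths of the loss reveal process\<close>

locale reveal_process = network P for P :: "'x network" +
  fixes n :: nat and Z :: "('x, 'w) reveal_run"
  assumes process: "loss_reveal_process P n Z"
begin

abbreviation M :: "'w measure" where "M \<equiv> PM Z"
abbreviation live :: "nat \<Rightarrow> 'w set" where "live \<equiv> active P n Z"

definition occurred :: "nat \<Rightarrow> 'w set" where
  "occurred k = {z \<in> space M. time Z k z \<noteq> \<infinity>}"

definition rtime :: "nat \<Rightarrow> 'w \<Rightarrow> real" where
  "rtime k z = real_of_ereal (time Z k z)"

text \<open>The capital without the premium. It changes at reveals only, so ruin has to be checked only there.\<close>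

definition net :: "nat \<Rightarrow> nat \<Rightarrow> 'w \<Rightarrow> real" where
  "net i k z = cash (atype Z i) (shock Z i z) - (\<Sum>j | j \<in> {1..k} \<and> fst (tgt Z j z) = i. loss Z j z)"

definition insolvent :: "nat \<Rightarrow> nat \<Rightarrow> 'w \<Rightarrow> bool" where
  "insolvent i k z \<longleftrightarrow> (\<exists>j\<le>k. net i j z + premium (atype Z i) (rtime j z) \<le> 0)"

definition ruined_out :: "nat \<Rightarrow> 'w \<Rightarrow> nat" where
  "ruined_out k z = (\<Sum>i\<in>{1..n}. if insolvent i k z then outdeg P (atype Z i) else 0)"

definition in_count :: nat where "in_count = card (in_half_edges P n Z)"

lemma finite_in_half_edges: "finite (in_half_edges P n Z)"
  and finite_out_half_edges: "finite (out_half_edges P n Z)"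
  by (auto simp: in_half_edges_def out_half_edges_def)

lemma in_count_eq: "in_count = (\<Sum>i\<in>{1..n}. indeg P (atype Z i))"
  by (simp add: in_count_def in_half_edges_def)

lemma time_0: "z \<in> space M \<Longrightarrow> time Z 0 z = 0"
  and rate_nonneg: "z \<in> space M \<Longrightarrow> 0 \<le> rate Z k z"
  and active_step: "z \<in> live k \<Longrightarrow> time Z k z < time Z (Suc k) z \<and>
    src Z (Suc k) z \<in> unrevealed_ruinous P n Z (time Z k z) z \<and> tgt Z (Suc k) z \<in> free_in P n Z k z"
  and inactive_step: "z \<in> space M \<Longrightarrow> z \<notin> live k \<Longrightarrow> time Z (Suc k) z = \<infinity>"
proof -
  have *: "\<forall>z\<in>space M. time Z 0 z = 0 \<and>
        (\<forall>k. 0 \<le> rate Z k z \<and>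
           (if z \<in> live k
            then time Z k z < time Z (Suc k) z \<and>
                 src Z (Suc k) z \<in> unrevealed_ruinous P n Z (time Z k z) z \<and>
                 tgt Z (Suc k) z \<in> free_in P n Z k z
            else time Z (Suc k) z = \<infinity>))"
    using process unfolding loss_reveal_process_def by (elim conjE)
  show "z \<in> space M \<Longrightarrow> time Z 0 z = 0" "z \<in> space M \<Longrightarrow> 0 \<le> rate Z k z"
    using * by auto
  show "z \<in> live k \<Longrightarrow> time Z k z < time Z (Suc k) z \<and>
    src Z (Suc k) z \<in> unrevealed_ruinous P n Z (time Z k z) z \<and> tgt Z (Suc k) z \<in> free_in P n Z k z"
    using * unfolding active_def by fastforce
  show "z \<in> space M \<Longrightarrow> z \<notin> live k \<Longrightarrow> time Z (Suc k) z = \<infinity>"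
    using * by auto
qed

lemma occurred_space: "z \<in> occurred k \<Longrightarrow> z \<in> space M" by (simp add: occurred_def)

lemma occurred_0: "occurred 0 = space M" using time_0 by (auto simp: occurred_def)

lemma active_subset_occurred: "live k \<subseteq> occurred k"
  by (auto simp: active_def occurred_def)

lemma occurred_Suc_subset_active: "occurred (Suc k) \<subseteq> live k"
  using inactive_step by (auto simp: occurred_def)

lemma occurred_antimono: "j \<le> k \<Longrightarrow> occurred k \<subseteq> occurred j"
proof (induction k rule: dec_induct)
  case (step k) then show ?case using occurred_Suc_subset_active active_subset_occurred by blast
qed simp

lemma time_less_Suc: "z \<in> occurred k \<Longrightarrow> time Z k z < time Z (Suc k) z"
  using active_step inactive_step by (cases "z \<in> live k") (auto simp: occurred_def)

lemma time_mono: "z \<in> space M \<Longrightarrow> j \<le> k \<Longrightarrow> time Z j z \<le> time Z k z"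
proof (rule lift_Suc_mono_le[of "\<lambda>k. time Z k z"])
  fix k assume w: "z \<in> space M"
  show "time Z k z \<le> time Z (Suc k) z"
  proof (cases "z \<in> occurred k")
    case True then show ?thesis using time_less_Suc by (simp add: less_imp_le)
  next
    case False
    then have "z \<notin> occurred (Suc k)" using occurred_antimono[of k "Suc k"] by auto
    then show ?thesis using w by (simp add: occurred_def)
  qed
qed

lemma time_nonneg: "z \<in> space M \<Longrightarrow> 0 \<le> time Z k z"
  using time_mono[of z 0 k] time_0 by simp

lemma time_eq_rtime: "z \<in> occurred k \<Longrightarrow> time Z k z = ereal (rtime k z)"
  using time_nonneg[OF occurred_space, of z k k] by (cases "time Z k z") (auto simp: rtime_def occurred_def)

lemma rtime_nonneg: "z \<in> space M \<Longrightarrow> 0 \<le> rtime k z"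
  using time_nonneg[of z k] by (simp add: rtime_def real_of_ereal_pos)

lemma rtime_mono: "z \<in> occurred k \<Longrightarrow> j \<le> k \<Longrightarrow> rtime j z \<le> rtime k z"
  using time_mono[OF occurred_space, of z k j k] time_eq_rtime occurred_antimono[of j k] by (metis ereal_less_eq(3) subsetD)

text \<open>The state of the process at time \<open>t\<close> is the one right after the \<open>k\<close>-th reveal.\<close>

definition current :: "nat \<Rightarrow> ereal \<Rightarrow> 'w \<Rightarrow> bool" where
  "current k t z \<longleftrightarrow> z \<in> occurred k \<and> time Z k z \<le> t \<and> (t < time Z (Suc k) z \<or> time Z (Suc k) z = \<infinity>)"

lemma current_at_reveal: "z \<in> occurred k \<Longrightarrow> current k (time Z k z) z"
  using time_less_Suc by (auto simp: current_def)

lemma reveals_current: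
  assumes "current k t z" shows "reveals Z t z = {1..k}"
proof -
  have w: "z \<in> occurred k" "z \<in> space M" using assms occurred_space by (auto simp: current_def)
  have "time Z j z \<le> t \<and> time Z j z \<noteq> \<infinity>" if "j \<le> k" for j
    using time_mono[OF w(2) that] occurred_antimono[OF that] w assms by (auto simp: current_def occurred_def)
  moreover have "\<not> (time Z j z \<le> t \<and> time Z j z \<noteq> \<infinity>)" if "\<not> j \<le> k" for j
    using time_mono[OF w(2), of "Suc k" j] that assms by (auto simp: current_def)
  ultimately show ?thesis unfolding reveals_def by fastforce
qed

lemma insolvent_mono: "insolvent i j z \<Longrightarrow> j \<le> k \<Longrightarrow> insolvent i k z"
  unfolding insolvent_def by (meson order.trans)

lemma capital_current:
  assumes "current k (ereal t) z"
  shows "capital P Z i t z = net i k z + premium (atype Z i) t"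
proof -
  have "0 \<le> t" using time_nonneg[OF occurred_space, of z k k] assms by (auto simp: current_def intro: order.trans simp flip: ereal_less_eq(5))
  then show ?thesis
    unfolding capital_def reveals_current[OF assms] net_def cash_def by (simp add: premium_nonneg)
qed

lemma current_exists_below:
  assumes "current k t z" "0 \<le> s" "ereal s \<le> t"
  shows "\<exists>j\<le>k. current j (ereal s) z"
proof -
  have w: "z \<in> occurred k" "z \<in> space M" using assms occurred_space by (auto simp: current_def)
  define j where "j = (GREATEST j. j \<le> k \<and> time Z j z \<le> ereal s)"
  have "0 \<le> k \<and> time Z 0 z \<le> ereal s" using time_0[OF w(2)] assms(2) by simp
  then have j: "j \<le> k \<and> time Z j z \<le> ereal s" unfolding j_def by (rule GreatestI_nat[of _ _ k]) simp
  have "j = k \<or> ereal s < time Z (Suc j) z"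
  proof (rule ccontr)
    assume "\<not> (j = k \<or> ereal s < time Z (Suc j) z)"
    then have "Suc j \<le> k \<and> time Z (Suc j) z \<le> ereal s" using j by auto
    then have "Suc j \<le> j" unfolding j_def by (rule Greatest_le_nat[of _ _ k]) simp
    then show False by simp
  qed
  then have "current j (ereal s) z"
    using j w assms occurred_antimono[of j k] by (auto simp: current_def)
  then show ?thesis using j by blast
qed

text \<open>Between two reveals the capital does not decrease. If it is not positive at some time, then neither was it
  at the last reveal before.\<close>

lemma ruined_current:
  assumes "current k t z"
  shows "ruined P Z i t z \<longleftrightarrow> insolvent i k z"
proof
  assume "ruined P Z i t z"
  then obtain s where s: "0 \<le> s" "ereal s \<le> t" "capital P Z i s z \<le> 0" by (auto simp: ruined_def)
  from current_exists_below[OF assms s(1,2)] obtain j where j: "j \<le> k" "current j (ereal s) z" by blast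
  then have "z \<in> occurred j" "time Z j z \<le> ereal s" by (auto simp: current_def)
  then have "rtime j z \<le> s" by (simp add: time_eq_rtime)
  then have "net i j z + premium (atype Z i) (rtime j z) \<le> 0"
    using premium_mono[where s="rtime j z" and t=s and x="atype Z i"] s(3) capital_current[OF j(2), of i] by simp
  then show "insolvent i k z" using j(1) by (auto simp: insolvent_def)
next
  assume "insolvent i k z"
  then obtain j where j: "j \<le> k" "net i j z + premium (atype Z i) (rtime j z) \<le> 0" by (auto simp: insolvent_def)
  have w: "z \<in> occurred j" "z \<in> space M" using assms occurred_space occurred_antimono[OF j(1)] by (auto simp: current_def)
  have "capital P Z i (rtime j z) z \<le> 0"
    using capital_current[of j "rtime j z" z i] current_at_reveal[OF w(1)] j(2) by (simp add: time_eq_rtime[OF w(1)])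
  moreover have "ereal (rtime j z) \<le> t"
    using time_mono[OF w(2) j(1)] assms by (auto simp: current_def simp flip: time_eq_rtime[OF w(1)])
  ultimately show "ruined P Z i t z" using rtime_nonneg[OF w(2)] by (auto simp: ruined_def)
qed

lemma src_occurred:
  assumes "z \<in> occurred k"
  shows "inj_on (\<lambda>j. src Z j z) {1..k} \<and>
    (\<lambda>j. src Z j z) ` {1..k} \<subseteq> {e \<in> out_half_edges P n Z. insolvent (fst e) k z}"
  using assms
proof (induction k)
  case (Suc k)
  then have act: "z \<in> live k" using occurred_Suc_subset_active by blast
  then have occ: "z \<in> occurred k" using active_subset_occurred by blast
  note IH = Suc.IH[OF occ]
  have "src Z (Suc k) z \<in> unrevealed_ruinous P n Z (time Z k z) z" using active_step[OF act] by blast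
  then have new: "src Z (Suc k) z \<in> {e \<in> out_half_edges P n Z. insolvent (fst e) k z} - (\<lambda>j. src Z j z) ` {1..k}"
    unfolding unrevealed_ruinous_def reveals_current[OF current_at_reveal[OF occ]] ruined_current[OF current_at_reveal[OF occ]] .
  have "{1..Suc k} = insert (Suc k) {1..k}" by auto
  then show ?case using IH new insolvent_mono[of _ k z "Suc k"] by (auto simp: inj_on_insert)
qed simp

lemma card_ruined_out: "card {e \<in> out_half_edges P n Z. insolvent (fst e) k z} = ruined_out k z"
proof -
  have "{e \<in> out_half_edges P n Z. insolvent (fst e) k z} = (SIGMA i:{i \<in> {1..n}. insolvent i k z}. {..<outdeg P (atype Z i)})"
    by (auto simp: out_half_edges_def)
  then show ?thesis by (simp add: ruined_out_def sum.If_cases Int_def)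
qed

lemma occurred_le_ruined_out:
  assumes "z \<in> occurred k" shows "k \<le> ruined_out k z"
proof -
  have "card ((\<lambda>j. src Z j z) ` {1..k}) \<le> card {e \<in> out_half_edges P n Z. insolvent (fst e) k z}"
    using src_occurred[OF assms] finite_out_half_edges by (intro card_mono) auto
  then show ?thesis using src_occurred[OF assms] by (simp add: card_image card_ruined_out)
qed

lemma unrevealed_count_current:
  assumes "current k t z"
  shows "unrevealed_count P n Z t z = ruined_out k z - k"
proof -
  have w: "z \<in> occurred k" using assms by (simp add: current_def)
  have "unrevealed_count P n Z t z = card ({e \<in> out_half_edges P n Z. insolvent (fst e) k z} - (\<lambda>j. src Z j z) ` {1..k})"
    unfolding unrevealed_count_def unrevealed_ruinous_def reveals_current[OF assms] ruined_current[OF assms] ..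
  also have "... = ruined_out k z - k"
    using src_occurred[OF w] finite_out_half_edges by (subst card_Diff_subset) (auto simp: card_image card_ruined_out)
  finally show ?thesis .
qed

lemma active_iff: "z \<in> live k \<longleftrightarrow> z \<in> occurred k \<and> k < ruined_out k z"
  using unrevealed_count_current[OF current_at_reveal, of z k] by (auto simp: active_def occurred_def)

lemma tgt_occurred:
  assumes "z \<in> occurred k"
  shows "inj_on (\<lambda>j. tgt Z j z) {1..k} \<and> (\<lambda>j. tgt Z j z) ` {1..k} \<subseteq> in_half_edges P n Z"
  using assms
proof (induction k)
  case (Suc k)
  then have act: "z \<in> live k" using occurred_Suc_subset_active by blast
  then have occ: "z \<in> occurred k" using active_subset_occurred by blast
  have "tgt Z (Suc k) z \<in> free_in P n Z k z" using active_step[OF act] by blast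
  moreover have "{1..Suc k} = insert (Suc k) {1..k}" by auto
  ultimately show ?case using Suc.IH[OF occ] by (auto simp: inj_on_insert free_in_def)
qed simp

lemma card_free_in: "z \<in> occurred k \<Longrightarrow> card (free_in P n Z k z) = in_count - k"
  unfolding free_in_def in_count_def using tgt_occurred[of z k] finite_in_half_edges
  by (subst card_Diff_subset) (auto simp: card_image)

lemma occurred_le_in_count: "z \<in> occurred k \<Longrightarrow> k \<le> in_count"
  using tgt_occurred[of z k] card_mono[OF finite_in_half_edges, of "(\<lambda>j. tgt Z j z) ` {1..k}"]
  by (simp add: card_image in_count_def)

definition last_reveal :: "'w \<Rightarrow> nat" where
  "last_reveal z = (GREATEST k. z \<in> occurred k)"

lemma last_reveal:
  assumes "z \<in> space M"
  shows "z \<in> occurred (last_reveal z)" "z \<in> occurred k \<longleftrightarrow> k \<le> last_reveal z" "time Z (Suc (last_reveal z)) z = \<infinity>"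
proof -
  have 0: "z \<in> occurred 0" using assms occurred_0 by simp
  show 1: "z \<in> occurred (last_reveal z)"
    unfolding last_reveal_def by (rule GreatestI_nat[where k=0 and b=in_count]) (use 0 occurred_le_in_count in auto)
  have 2: "k \<le> last_reveal z" if "z \<in> occurred k" for k
    unfolding last_reveal_def by (rule Greatest_le_nat[where b=in_count]) (use that occurred_le_in_count in auto)
  show "z \<in> occurred k \<longleftrightarrow> k \<le> last_reveal z" using 1 2 occurred_antimono by blast
  show "time Z (Suc (last_reveal z)) z = \<infinity>"
    using 2[of "Suc (last_reveal z)"] assms by (auto simp: occurred_def)
qed

lemma last_reveal_le: "z \<in> space M \<Longrightarrow> last_reveal z \<le> in_count"
  using last_reveal(1) occurred_le_in_count by blast

lemma current_exists: "z \<in> space M \<Longrightarrow> 0 \<le> s \<Longrightarrow> \<exists>j\<le>last_reveal z. current j (ereal s) z"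
proof -
  assume w: "z \<in> space M" and s: "0 \<le> s"
  have "current (last_reveal z) \<infinity> z" using last_reveal[OF w] by (simp add: current_def)
  from current_exists_below[OF this s] show ?thesis by simp
qed

text \<open>The process may get stuck: if the rate becomes 0, there are unrevealed half-edges forever, and the
  stopping time is infinite.\<close>

lemma stop_time_eq:
  assumes w: "z \<in> space M"
  shows "stop_time P n Z z = (if z \<in> live (last_reveal z) then \<infinity> else time Z (last_reveal z) z)"
proof -
  have zero_iff: "unrevealed_count P n Z (ereal t) z = 0 \<longleftrightarrow> z \<notin> live (last_reveal z) \<and> time Z (last_reveal z) z \<le> ereal t"
    if t: "0 \<le> t" for t
  proof -
    obtain j where j: "j \<le> last_reveal z" "current j (ereal t) z" using current_exists[OF w t] by blast
    then have occ: "z \<in> occurred j" by (simp add: current_def)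
    have "unrevealed_count P n Z (ereal t) z = 0 \<longleftrightarrow> z \<notin> live j"
      using unrevealed_count_current[OF j(2)] active_iff[of z j] occ by auto
    also have "... \<longleftrightarrow> z \<notin> live (last_reveal z) \<and> time Z (last_reveal z) z \<le> ereal t"
    proof (cases "j = last_reveal z")
      case True
      then show ?thesis using j(2) by (auto simp: current_def)
    next
      case False
      then have le: "Suc j \<le> last_reveal z" using j(1) by simp
      then have S: "z \<in> occurred (Suc j)" using last_reveal(2)[OF w] by blast
      have "ereal t < time Z (Suc j) z" using j(2) S by (auto simp: current_def occurred_def)
      also have "... \<le> time Z (last_reveal z) z" by (rule time_mono[OF w le])
      finally show ?thesis using S occurred_Suc_subset_active by auto
    qed
    finally show ?thesis .
  qed
  show ?thesis
  proof (cases "z \<in> live (last_reveal z)")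
    case True
    then have "{ereal t | t. 0 \<le> t \<and> unrevealed_count P n Z (ereal t) z = 0} = {}" using zero_iff by blast
    then show ?thesis using True unfolding stop_time_def by (simp only: Inf_empty top_ereal_def if_True)
  next
    case False
    note tm = time_eq_rtime[OF last_reveal(1)[OF w]]
    have "stop_time P n Z z = ereal (rtime (last_reveal z) z)"
      unfolding stop_time_def
    proof (rule antisym)
      show "Inf {ereal t | t. 0 \<le> t \<and> unrevealed_count P n Z (ereal t) z = 0} \<le> ereal (rtime (last_reveal z) z)"
        using rtime_nonneg[OF w] zero_iff False tm by (intro Inf_lower) auto
      show "ereal (rtime (last_reveal z) z) \<le> Inf {ereal t | t. 0 \<le> t \<and> unrevealed_count P n Z (ereal t) z = 0}"
        using zero_iff tm by (intro Inf_greatest) auto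
    qed
    then show ?thesis using False tm by simp
  qed
qed

lemma current_stop_time:
  assumes "z \<in> space M" shows "current (last_reveal z) (stop_time P n Z z) z"
  using last_reveal[OF assms] by (auto simp: current_def stop_time_eq[OF assms])

lemma occurred_le_stop_time: "z \<in> occurred k \<Longrightarrow> time Z k z \<le> stop_time P n Z z"
  using last_reveal(2)[OF occurred_space, of z k k] time_mono[OF occurred_space, of z k k "last_reveal z"]
    stop_time_eq[OF occurred_space, of z k] by auto

lemma ruined_stop_time: "z \<in> space M \<Longrightarrow> ruined P Z i (stop_time P n Z z) z \<longleftrightarrow> insolvent i (last_reveal z) z"
  by (rule ruined_current[OF current_stop_time])

lemma net_Suc: "net i (Suc k) z = (if fst (tgt Z (Suc k) z) = i then net i k z - loss Z (Suc k) z else net i k z)"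
proof -
  have "{j. j \<in> {1..Suc k} \<and> fst (tgt Z j z) = i} =
    (if fst (tgt Z (Suc k) z) = i then insert (Suc k) {j. j \<in> {1..k} \<and> fst (tgt Z j z) = i} else {j. j \<in> {1..k} \<and> fst (tgt Z j z) = i})"
    by (auto simp: le_Suc_eq)
  then show ?thesis by (simp add: net_def)
qed

lemma insolvent_Suc:
  assumes "z \<in> occurred (Suc k)" "insolvent i (Suc k) z" "\<not> insolvent i k z"
  shows "fst (tgt Z (Suc k) z) = i"
proof (rule ccontr)
  assume "fst (tgt Z (Suc k) z) \<noteq> i"
  then have "net i (Suc k) z = net i k z" by (simp add: net_Suc)
  moreover have "net i (Suc k) z + premium (atype Z i) (rtime (Suc k) z) \<le> 0"
    using assms(2,3) by (auto simp: insolvent_def le_Suc_eq)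
  moreover have "premium (atype Z i) (rtime k z) \<le> premium (atype Z i) (rtime (Suc k) z)"
    by (intro premium_mono rtime_mono[OF assms(1)]) simp
  ultimately have "insolvent i k z" by (auto simp: insolvent_def intro!: exI[of _ k])
  then show False using assms(3) by simp
qed

text \<open>A reveal can only ruin the owner of the incoming half-edge that is hit.\<close>

lemma card_insolvent_le:
  assumes "z \<in> occurred k" "j \<le> k" "I \<subseteq> {1..n}"
  shows "card {i \<in> I. insolvent i k z} \<le> card {i \<in> I. insolvent i j z} + (k - j)"
  using assms(2,1)
proof (induction k rule: dec_induct)
  case (step k)
  have fin: "finite I" using assms(3) finite_subset by blast
  have "{i \<in> I. insolvent i (Suc k) z} \<subseteq> insert (fst (tgt Z (Suc k) z)) {i \<in> I. insolvent i k z}"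
    using insolvent_Suc[OF step.prems] by blast
  then have "card {i \<in> I. insolvent i (Suc k) z} \<le> card (insert (fst (tgt Z (Suc k) z)) {i \<in> I. insolvent i k z})"
    using fin by (intro card_mono) auto
  also have "... \<le> Suc (card {i \<in> I. insolvent i k z})" by (rule card_insert_le_m1) simp_all
  also have "... \<le> Suc (card {i \<in> I. insolvent i j z} + (k - j))"
    using step.IH step.prems occurred_antimono[of k "Suc k"] by auto
  finally show ?case using step by simp
qed simp

end

section \<open>The law of one reveal\<close>

context reveal_process
begin

abbreviation chance :: "nat \<times> nat \<Rightarrow> nat \<Rightarrow> 'w \<Rightarrow> real" where
  "chance h k z \<equiv> indicator {z. h \<in> free_in P n Z k z} z / real (in_count - k)"

lemma prob_space_M: "prob_space M"
  and hist_subalgebra: "subalgebra M (hist Z k)"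
  and hist_Suc: "subalgebra (hist Z (Suc k)) (hist Z k)"
  and shock_measurable_0: "i \<in> {1..n} \<Longrightarrow> shock Z i \<in> borel_measurable (hist Z 0)"
  and shock_distributed: "i \<in> {1..n} \<Longrightarrow> distributed M lborel (shock Z i) (\<lambda>y. ennreal (shock_dens P (atype Z i) y))"
  and shock_indep: "prob_space.indep_vars M (\<lambda>_. borel) (shock Z) {1..n}"
  and rate_measurable: "rate Z k \<in> borel_measurable (hist Z k)"
  and tgt_measurable_Suc: "tgt Z (Suc k) \<in> hist Z (Suc k) \<rightarrow>\<^sub>M count_space UNIV"
  and loss_measurable_Suc: "loss Z (Suc k) \<in> borel_measurable (hist Z (Suc k))"
  and time_measurable_Suc: "time Z (Suc k) \<in> borel_measurable (hist Z (Suc k))"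
  using process unfolding loss_reveal_process_def by blast+

lemma reveal_law:
  "A \<in> sets (hist Z k) \<Longrightarrow> h \<in> in_half_edges P n Z \<Longrightarrow> B \<in> sets borel \<Longrightarrow> 0 \<le> s \<Longrightarrow>
    measure M {z \<in> A \<inter> live k.
        tgt Z (Suc k) z = h \<and> loss Z (Suc k) z \<in> B \<and> time Z (Suc k) z > time Z k z + ereal s}
    = (LINT z:A \<inter> live k|M.
         (if h \<in> free_in P n Z k z then 1 / real (card (free_in P n Z k z)) else 0)
         * measure (loss_law P (atype Z (fst h))) B * exp (- rate Z k z * s))"
  using process unfolding loss_reveal_process_def by blast

sublocale prob_space M by (rule prob_space_M)

lemma space_hist: "space (hist Z k) = space M"
  using hist_subalgebra by (simp add: subalgebra_def)

lemma hist_mono: "j \<le> k \<Longrightarrow> subalgebra (hist Z k) (hist Z j)"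
proof (induction k rule: dec_induct)
  case base show ?case by (simp add: subalgebra_def)
next
  case (step k)
  then show ?case using hist_Suc[of k] unfolding subalgebra_def by auto
qed

lemma measurable_hist_mono: "f \<in> hist Z j \<rightarrow>\<^sub>M N \<Longrightarrow> j \<le> k \<Longrightarrow> f \<in> hist Z k \<rightarrow>\<^sub>M N"
  using hist_mono measurable_from_subalg by blast

lemma measurable_hist_M: "f \<in> hist Z k \<rightarrow>\<^sub>M N \<Longrightarrow> f \<in> M \<rightarrow>\<^sub>M N"
  using hist_subalgebra measurable_from_subalg by blast

lemma sets_hist_M: "A \<in> sets (hist Z k) \<Longrightarrow> A \<in> sets M"
  using hist_subalgebra[of k] by (auto simp: subalgebra_def)

lemma shock_measurable: "i \<in> {1..n} \<Longrightarrow> shock Z i \<in> borel_measurable (hist Z k)"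
  using measurable_hist_mono[OF shock_measurable_0] by blast

lemma tgt_measurable: "1 \<le> j \<Longrightarrow> j \<le> k \<Longrightarrow> tgt Z j \<in> hist Z k \<rightarrow>\<^sub>M count_space UNIV"
  and loss_measurable: "1 \<le> j \<Longrightarrow> j \<le> k \<Longrightarrow> loss Z j \<in> borel_measurable (hist Z k)"
  using measurable_hist_mono[OF tgt_measurable_Suc, of "j - 1" k] measurable_hist_mono[OF loss_measurable_Suc, of "j - 1" k]
  by auto

lemma time_measurable: "time Z k \<in> borel_measurable (hist Z k)"
proof (cases k)
  case 0
  have "(\<lambda>z. 0 :: ereal) \<in> borel_measurable (hist Z 0)" by simp
  then show ?thesis unfolding 0
    by (rule measurable_cong[THEN iffD1, rotated]) (simp add: space_hist time_0)
next
  case (Suc j) then show ?thesis using time_measurable_Suc by simp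
qed

lemma rtime_measurable: "rtime k \<in> borel_measurable (hist Z k)"
  unfolding rtime_def[abs_def] by (rule borel_measurable_real_of_ereal[OF time_measurable])

lemma occurred_sets: "occurred k \<in> sets (hist Z k)"
proof -
  have "{z \<in> space (hist Z k). time Z k z \<noteq> \<infinity>} \<in> sets (hist Z k)"
    by (intro borel_measurable_neq time_measurable borel_measurable_const)
  then show ?thesis by (simp add: occurred_def space_hist)
qed

lemma tgt_sets: "1 \<le> j \<Longrightarrow> j \<le> k \<Longrightarrow> {z \<in> space M. Q (tgt Z j z)} \<in> sets (hist Z k)"
proof -
  assume j: "1 \<le> j" "j \<le> k"
  have "tgt Z j -` {h. Q h} \<inter> space (hist Z k) \<in> sets (hist Z k)"
    by (rule measurable_sets[OF tgt_measurable[OF j]]) simp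
  moreover have "tgt Z j -` {h. Q h} \<inter> space (hist Z k) = {z \<in> space M. Q (tgt Z j z)}"
    by (auto simp: space_hist)
  ultimately show ?thesis by simp
qed

lemma net_measurable:
  assumes "i \<in> {1..n}" shows "net i k \<in> borel_measurable (hist Z k)"
proof -
  have "net i k = (\<lambda>z. cash (atype Z i) (shock Z i z) - (\<Sum>j\<in>{1..k}. if fst (tgt Z j z) = i then loss Z j z else 0))"
    by (rule ext) (simp only: net_def sum.inter_filter[OF finite_atLeastAtMost])
  also have "... \<in> borel_measurable (hist Z k)"
  proof (intro borel_measurable_diff borel_measurable_sum measurable_If borel_measurable_const)
    show "(\<lambda>z. cash (atype Z i) (shock Z i z)) \<in> borel_measurable (hist Z k)"
      by (rule measurable_compose[OF shock_measurable[OF assms] cash_measurable])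
    fix j assume "j \<in> {1..k}"
    then show "loss Z j \<in> borel_measurable (hist Z k)" "{z \<in> space (hist Z k). fst (tgt Z j z) = i} \<in> sets (hist Z k)"
      using loss_measurable tgt_sets by (simp_all add: space_hist)
  qed
  finally show ?thesis .
qed

lemma insolvent_sets:
  assumes "i \<in> {1..n}" shows "{z \<in> space M. insolvent i k z} \<in> sets (hist Z k)"
proof -
  have "{z \<in> space (hist Z k). \<exists>j\<in>{..k}. net i j z + premium (atype Z i) (rtime j z) \<le> 0} \<in> sets (hist Z k)"
    by (intro sets.sets_Collect_finite_Ex borel_measurable_le borel_measurable_add borel_measurable_const
         measurable_hist_mono[OF net_measurable[OF assms]]
         measurable_hist_mono[OF measurable_compose[OF rtime_measurable premium_measurable]]) auto
  moreover have "{z \<in> space (hist Z k). \<exists>j\<in>{..k}. net i j z + premium (atype Z i) (rtime j z) \<le> 0} = {z \<in> space M. insolvent i k z}"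
    by (auto simp: space_hist insolvent_def)
  ultimately show ?thesis by simp
qed

lemma ruined_out_measurable: "(\<lambda>z. real (ruined_out k z)) \<in> borel_measurable (hist Z k)"
proof -
  have "(\<lambda>z. \<Sum>i\<in>{1..n}. if insolvent i k z then real (outdeg P (atype Z i)) else 0) \<in> borel_measurable (hist Z k)"
    using insolvent_sets by (intro borel_measurable_sum measurable_If borel_measurable_const) (simp add: space_hist)
  moreover have "(\<Sum>i\<in>{1..n}. if insolvent i k z then real (outdeg P (atype Z i)) else 0) = real (ruined_out k z)" for z
    unfolding ruined_out_def of_nat_sum by (intro sum.cong) auto
  ultimately show ?thesis by (simp only:)
qed

lemma active_sets: "live k \<in> sets (hist Z k)"
proof -
  have "{z \<in> space (hist Z k). real k < real (ruined_out k z)} \<in> sets (hist Z k)"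
    by (intro borel_measurable_less ruined_out_measurable borel_measurable_const)
  then have "occurred k \<inter> {z \<in> space (hist Z k). real k < real (ruined_out k z)} \<in> sets (hist Z k)"
    using occurred_sets by blast
  moreover have "occurred k \<inter> {z \<in> space (hist Z k). real k < real (ruined_out k z)} = live k"
    using occurred_space by (auto simp: active_iff space_hist)
  ultimately show ?thesis by simp
qed

lemma free_in_sets: "{z \<in> space M. h \<in> free_in P n Z k z} \<in> sets (hist Z k)"
proof -
  have "{z \<in> space (hist Z k). h \<in> in_half_edges P n Z \<and> (\<forall>j\<in>{1..k}. tgt Z j z \<noteq> h)} \<in> sets (hist Z k)"
    using tgt_sets by (intro sets.sets_Collect_conj sets.sets_Collect_finite_All sets.sets_Collect_const) (simp_all add: space_hist)
  moreover have "{z \<in> space (hist Z k). h \<in> in_half_edges P n Z \<and> (\<forall>j\<in>{1..k}. tgt Z j z \<noteq> h)} = {z \<in> space M. h \<in> free_in P n Z k z}"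
    by (auto simp: space_hist free_in_def)
  ultimately show ?thesis by simp
qed

text \<open>On the event that \<open>h\<close> is hit, the joint law of the past and the loss is a product measure. It suffices to
  compare the two measures on rectangles, which is what \<open>reveal_law\<close> is about.\<close>

lemma reveal_integral:
  fixes f :: "'w \<times> real \<Rightarrow> real"
  assumes h: "h \<in> in_half_edges P n Z"
    and f: "f \<in> borel_measurable (hist Z k \<Otimes>\<^sub>M borel)" and bound: "\<And>p. \<bar>f p\<bar> \<le> B"
  shows "(\<integral>z. indicator (live k) z * (indicator {z. tgt Z (Suc k) z = h} z * f (z, loss Z (Suc k) z)) \<partial>M)
    = (\<integral>z. indicator (live k) z * (chance h k z
        * (\<integral>l. f (z, l) \<partial>loss_law P (atype Z (fst h)))) \<partial>M)"
proof -
  let ?L = "loss_law P (atype Z (fst h))" and ?A = "live k" and ?H = "hist Z k"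
  define G where "G = ?A \<inter> {z \<in> space M. tgt Z (Suc k) z = h}"
  define q :: "'w \<Rightarrow> real" where "q z = indicator (?A \<inter> {z \<in> space M. h \<in> free_in P n Z k z}) z / real (in_count - k)" for z
  have G_sets: "G \<in> sets M" unfolding G_def
    using sets_hist_M[OF active_sets] sets_hist_M[OF tgt_sets[of "Suc k" "Suc k"]] by auto
  have q_meas: "q \<in> borel_measurable ?H" unfolding q_def
    using active_sets free_in_sets by (intro borel_measurable_divide borel_measurable_indicator borel_measurable_const) auto
  have q_nn: "0 \<le> q z" for z by (simp add: q_def)
  have q_le: "q z \<le> 1" for z by (auto simp: q_def indicator_def divide_le_eq)
  define N1 where "N1 = distr (density M (indicator G)) (?H \<Otimes>\<^sub>M borel) (\<lambda>z. (z, loss Z (Suc k) z))"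
  define N0 where "N0 = density (restr_to_subalg M ?H) (\<lambda>z. ennreal (q z))"
  have restr_meas: "f \<in> borel_measurable (restr_to_subalg M ?H)" if "f \<in> borel_measurable ?H" for f :: "'w \<Rightarrow> 'b::topological_space"
    using that by (rule measurable_in_subalg[OF hist_subalgebra])
  have loss_M: "loss Z (Suc k) \<in> borel_measurable M" by (rule measurable_hist_M[OF loss_measurable_Suc])
  have pair_meas: "(\<lambda>z. (z, loss Z (Suc k) z)) \<in> M \<rightarrow>\<^sub>M ?H \<Otimes>\<^sub>M borel"
    by (intro measurable_Pair loss_M measurable_hist_M[OF measurable_ident, unfolded id_def])
  have sets_N0: "sets N0 = sets ?H" by (simp add: N0_def sets_restr_to_subalg[OF hist_subalgebra])
  have emN0: "emeasure N0 A = ennreal (\<integral>z. indicator A z * q z \<partial>M)" if A: "A \<in> sets ?H" for A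
  proof -
    have "emeasure N0 A = (\<integral>\<^sup>+z. ennreal (q z) * indicator A z \<partial>restr_to_subalg M ?H)"
      unfolding N0_def using A restr_meas[OF q_meas]
      by (intro emeasure_density) (auto simp: sets_restr_to_subalg[OF hist_subalgebra])
    also have "... = (\<integral>\<^sup>+z. ennreal (q z) * indicator A z \<partial>M)"
      using A q_meas by (intro nn_integral_subalgebra2[OF hist_subalgebra]) simp
    also have "... = (\<integral>\<^sup>+z. ennreal (indicator A z * q z) \<partial>M)"
      by (intro nn_integral_cong) (simp add: indicator_def)
    also have "... = ennreal (\<integral>z. indicator A z * q z \<partial>M)"
      using q_nn q_le sets_hist_M[OF A] measurable_hist_M[OF q_meas]
      by (intro nn_integral_eq_integral integrable_const_bound[of _ 1]) (auto simp: indicator_def)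
    finally show ?thesis .
  qed
  have "finite_measure N0"
  proof
    show "emeasure N0 (space N0) \<noteq> \<infinity>"
      using emN0[of "space M"] sets.top[of ?H] by (simp add: sets_eq_imp_space_eq[OF sets_N0] space_hist)
  qed
  then interpret N0: finite_measure N0 .
  have "N0 \<Otimes>\<^sub>M ?L = N1"
  proof (rule pair_measure_eqI)
    show "sigma_finite_measure N0" by unfold_locales
    show "sigma_finite_measure ?L" by (rule prob_space_imp_sigma_finite) (rule loss_law.prob_space_axioms)
    show "sets (N0 \<Otimes>\<^sub>M ?L) = sets N1"
      unfolding N1_def sets_distr by (rule sets_pair_measure_cong[OF sets_N0 loss_law.sets_L])
    fix A B assume "A \<in> sets N0" "B \<in> sets ?L"
    then have A: "A \<in> sets ?H" and B: "B \<in> sets borel" by (simp_all add: sets_N0)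
    have AM: "A \<subseteq> space M" using sets.sets_into_space[OF A] by (simp add: space_hist)
    have "emeasure N1 (A \<times> B) = emeasure (density M (indicator G)) ((\<lambda>z. (z, loss Z (Suc k) z)) -` (A \<times> B) \<inter> space M)"
      unfolding N1_def using A B pair_meas by (subst emeasure_distr) auto
    also have "(\<lambda>z. (z, loss Z (Suc k) z)) -` (A \<times> B) \<inter> space M = {z \<in> A. loss Z (Suc k) z \<in> B}"
      using AM by auto
    also have "emeasure (density M (indicator G)) {z \<in> A. loss Z (Suc k) z \<in> B} = emeasure M (G \<inter> {z \<in> A. loss Z (Suc k) z \<in> B})"
    proof (rule emeasure_restricted[OF G_sets])
      have "A \<inter> (loss Z (Suc k) -` B \<inter> space M) \<in> sets M" using sets_hist_M[OF A] measurable_sets[OF loss_M B] by auto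
      moreover have "A \<inter> (loss Z (Suc k) -` B \<inter> space M) = {z \<in> A. loss Z (Suc k) z \<in> B}" using AM by auto
      ultimately show "{z \<in> A. loss Z (Suc k) z \<in> B} \<in> sets M" by simp
    qed
    also have "G \<inter> {z \<in> A. loss Z (Suc k) z \<in> B} = {z \<in> A \<inter> ?A. tgt Z (Suc k) z = h \<and> loss Z (Suc k) z \<in> B \<and> time Z (Suc k) z > time Z k z + ereal 0}"
      using AM active_step by (auto simp: G_def)
    also have "emeasure M ... = ennreal (LINT z:A \<inter> ?A|M. (if h \<in> free_in P n Z k z then 1 / real (card (free_in P n Z k z)) else 0) * measure ?L B)"
      unfolding emeasure_eq_measure reveal_law[OF A h B order.refl] by simp
    also have "(LINT z:A \<inter> ?A|M. (if h \<in> free_in P n Z k z then 1 / real (card (free_in P n Z k z)) else 0) * measure ?L B)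
        = (\<integral>z. (indicator A z * q z) * measure ?L B \<partial>M)"
      unfolding set_lebesgue_integral_def
    proof (intro Bochner_Integration.integral_cong refl)
      fix z assume "z \<in> space M"
      then show "indicator (A \<inter> ?A) z *\<^sub>R ((if h \<in> free_in P n Z k z then 1 / real (card (free_in P n Z k z)) else 0) * measure ?L B)
         = (indicator A z * q z) * measure ?L B"
        using card_free_in[of z k] active_iff[of z k] by (auto simp: q_def indicator_def)
    qed
    also have "... = (\<integral>z. indicator A z * q z \<partial>M) * measure ?L B" by (rule integral_mult_left_zero)
    also have "ennreal ... = emeasure N0 A * emeasure ?L B"
      unfolding emN0[OF A] loss_law.emeasure_eq_measure using q_nn by (intro ennreal_mult) auto
    finally show "emeasure N0 A * emeasure ?L B = emeasure N1 (A \<times> B)" by simp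
  qed
  note N = this
  have f_N: "f \<in> borel_measurable (N0 \<Otimes>\<^sub>M ?L)"
    using f by (simp only: measurable_cong_sets[OF sets_pair_measure_cong[OF sets_N0 loss_law.sets_L] refl])
  have int_L: "(\<lambda>z. \<integral>l. f (z, l) \<partial>?L) \<in> borel_measurable ?H"
  proof (rule loss_law.borel_measurable_lebesgue_integral)
    show "(\<lambda>(z, l). f (z, l)) \<in> borel_measurable (?H \<Otimes>\<^sub>M ?L)"
      using f by (simp add: measurable_cong_sets[OF sets_pair_measure_cong[OF refl loss_law.sets_L] refl])
  qed
  interpret NL: pair_sigma_finite N0 ?L
    by (intro pair_sigma_finite.intro N0.sigma_finite_measure_axioms prob_space_imp_sigma_finite loss_law.prob_space_axioms)
  interpret NLf: finite_measure "N0 \<Otimes>\<^sub>M ?L"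
    by (intro finite_measure_pair_measure N0.finite_measure_axioms loss_law.finite_measure_axioms)
  have "(\<integral>p. f p \<partial>N1) = (\<integral>z. f (z, loss Z (Suc k) z) \<partial>density M (indicator G))"
    unfolding N1_def using pair_meas f by (intro integral_distr) simp_all
  also have "... = (\<integral>z. f (z, loss Z (Suc k) z) \<partial>density M (\<lambda>z. ennreal (indicator G z)))"
    by (simp add: ennreal_indicator)
  also have "... = (\<integral>z. indicator G z *\<^sub>R f (z, loss Z (Suc k) z) \<partial>M)"
    using G_sets measurable_compose[OF pair_meas f] by (intro integral_density) simp_all
  also have "... = (\<integral>z. indicator ?A z * (indicator {z. tgt Z (Suc k) z = h} z * f (z, loss Z (Suc k) z)) \<partial>M)"
    by (intro Bochner_Integration.integral_cong) (auto simp: G_def indicator_def)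
  finally have 1: "(\<integral>p. f p \<partial>N1) = ..." .
  have "(\<integral>p. f p \<partial>N1) = (\<integral>p. f p \<partial>(N0 \<Otimes>\<^sub>M ?L))" by (simp add: N)
  also have "... = (\<integral>z. \<integral>l. f (z, l) \<partial>?L \<partial>N0)"
    using bound f_N by (intro NL.integral_fst'[symmetric] NLf.integrable_const_bound[of _ B]) auto
  also have "... = (\<integral>z. q z *\<^sub>R (\<integral>l. f (z, l) \<partial>?L) \<partial>restr_to_subalg M ?H)"
    unfolding N0_def using q_nn by (intro integral_density restr_meas q_meas int_L) auto
  also have "... = (\<integral>z. q z *\<^sub>R (\<integral>l. f (z, l) \<partial>?L) \<partial>M)"
    by (intro integral_subalgebra2 hist_subalgebra borel_measurable_scaleR q_meas int_L)
  also have "... = (\<integral>z. indicator ?A z * (chance h k z * (\<integral>l. f (z, l) \<partial>?L)) \<partial>M)"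
    by (intro Bochner_Integration.integral_cong) (auto simp: q_def indicator_def)
  finally show ?thesis using 1 by simp
qed

end

section \<open>The martingale of conditional survival probabilities\<close>

lemma borel_measurable_indicator_Collect_real:
  assumes "{x \<in> space M. P x} \<in> sets M"
  shows "(\<lambda>x. indicator {x. P x} x :: real) \<in> borel_measurable M"
  using borel_measurable_indicator[OF assms] by (rule measurable_cong[THEN iffD1, rotated]) (simp add: indicator_def)

context reveal_process
begin

definition free_count :: "nat \<Rightarrow> nat \<Rightarrow> 'w \<Rightarrow> nat" where
  "free_count i k z = card {h \<in> free_in P n Z k z. fst h = i}"

definition solvent :: "(nat \<Rightarrow> real) \<Rightarrow> nat \<Rightarrow> nat \<Rightarrow> 'w \<Rightarrow> bool" where
  "solvent a i k z \<longleftrightarrow> (\<forall>j\<le>k. 0 < net i j z + a j)"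

lemma finite_free_in: "finite (free_in P n Z k z)"
  using finite_in_half_edges by (simp add: free_in_def)

lemma free_count_le: "i \<in> {1..n} \<Longrightarrow> free_count i k z \<le> indeg P (atype Z i)"
proof -
  assume i: "i \<in> {1..n}"
  have "{h \<in> free_in P n Z k z. fst h = i} \<subseteq> Pair i ` {..<indeg P (atype Z i)}"
    by (auto simp: free_in_def in_half_edges_def)
  from card_mono[OF _ this] show ?thesis by (simp add: free_count_def card_image inj_on_def)
qed

lemma free_count_0: "i \<in> {1..n} \<Longrightarrow> free_count i 0 z = indeg P (atype Z i)"
proof -
  assume i: "i \<in> {1..n}"
  have "{h \<in> free_in P n Z 0 z. fst h = i} = Pair i ` {..<indeg P (atype Z i)}"
    using i by (auto simp: free_in_def in_half_edges_def)
  then show ?thesis by (simp add: free_count_def card_image inj_on_def)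
qed

lemma sum_free_count_le:
  assumes "z \<in> occurred k" "finite I" shows "(\<Sum>i\<in>I. free_count i k z) \<le> in_count - k"
proof -
  have "(\<Sum>i\<in>I. free_count i k z) = card (\<Union>i\<in>I. {h \<in> free_in P n Z k z. fst h = i})"
    unfolding free_count_def using finite_free_in assms(2) by (intro card_UN_disjoint[symmetric]) auto
  also have "... \<le> card (free_in P n Z k z)" by (intro card_mono finite_free_in) auto
  finally show ?thesis using card_free_in[OF assms(1)] by simp
qed

lemma free_count_Suc:
  assumes "z \<in> live k"
  shows "free_count i (Suc k) z = (if fst (tgt Z (Suc k) z) = i then free_count i k z - 1 else free_count i k z)"
proof -
  have eq: "free_in P n Z (Suc k) z = free_in P n Z k z - {tgt Z (Suc k) z}"
    unfolding free_in_def by (auto simp: atLeastAtMostSuc_conv)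
  show ?thesis
  proof (cases "fst (tgt Z (Suc k) z) = i")
    case True
    then have "tgt Z (Suc k) z \<in> {h \<in> free_in P n Z k z. fst h = i}" using active_step[OF assms] by simp
    moreover have "{h \<in> free_in P n Z (Suc k) z. fst h = i} = {h \<in> free_in P n Z k z. fst h = i} - {tgt Z (Suc k) z}"
      unfolding eq by auto
    ultimately show ?thesis using True by (simp add: free_count_def)
  next
    case False
    then have "{h \<in> free_in P n Z (Suc k) z. fst h = i} = {h \<in> free_in P n Z k z. fst h = i}" unfolding eq by auto
    then show ?thesis using False by (simp add: free_count_def)
  qed
qed

lemma free_count_eq_sum: "real (free_count i k z) = (\<Sum>h\<in>{h \<in> in_half_edges P n Z. fst h = i}. indicator {z. h \<in> free_in P n Z k z} z)"
proof -
  have "(\<Sum>h\<in>{h \<in> in_half_edges P n Z. fst h = i}. indicator {z. h \<in> free_in P n Z k z} z)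
    = (\<Sum>h\<in>{h \<in> in_half_edges P n Z. fst h = i}. if h \<in> free_in P n Z k z then 1 else (0::real))"
    by (intro sum.cong) (auto simp: indicator_def)
  also have "... = real (card {h \<in> {h \<in> in_half_edges P n Z. fst h = i}. h \<in> free_in P n Z k z})"
    using finite_in_half_edges by (subst sum.inter_filter[symmetric]) simp_all
  also have "{h \<in> {h \<in> in_half_edges P n Z. fst h = i}. h \<in> free_in P n Z k z} = {h \<in> free_in P n Z k z. fst h = i}"
    by (auto simp: free_in_def)
  finally show ?thesis by (simp add: free_count_def)
qed

lemma free_count_measurable: "free_count i k \<in> hist Z k \<rightarrow>\<^sub>M count_space UNIV"
proof -
  have "(\<lambda>z. real (free_count i k z)) \<in> borel_measurable (hist Z k)"
    unfolding free_count_eq_sum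
    by (intro borel_measurable_sum) (rule borel_measurable_indicator', use free_in_sets in \<open>simp add: space_hist\<close>)
  then have "(\<lambda>z. nat \<lfloor>real (free_count i k z)\<rfloor>) \<in> hist Z k \<rightarrow>\<^sub>M count_space UNIV" by measurable
  then show ?thesis by simp
qed

lemma solvent_sets:
  assumes "i \<in> {1..n}" shows "{z \<in> space M. solvent a i k z} \<in> sets (hist Z k)"
proof -
  have "{z \<in> space (hist Z k). \<forall>j\<in>{..k}. 0 < net i j z + a j} \<in> sets (hist Z k)"
    by (intro sets.sets_Collect_finite_All borel_measurable_less borel_measurable_add borel_measurable_const
         measurable_hist_mono[OF net_measurable[OF assms]]) auto
  moreover have "{z \<in> space (hist Z k). \<forall>j\<in>{..k}. 0 < net i j z + a j} = {z \<in> space M. solvent a i k z}"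
    by (auto simp: space_hist solvent_def)
  ultimately show ?thesis by simp
qed

end

text \<open>A premium schedule \<open>a\<close> stands for the premiums at the reveal times, and the survival of the first
  \<open>K\<close> reveals by the agents of type \<open>x\<close> is predicted from it.\<close>

locale scheduled_process = reveal_process P n Z for P :: "'x network" and n and Z :: "('x, 'w) reveal_run" +
  fixes x :: 'x and a :: "nat \<Rightarrow> real" and K :: nat
  assumes a_mono: "mono_on {..K} a" and few: "indeg P x \<le> in_count - K" and K_le: "K \<le> in_count"
begin

definition agents :: "nat set" where "agents = {i \<in> {1..n}. atype Z i = x}"

abbreviation surv_prob :: "nat \<Rightarrow> nat \<Rightarrow> real \<Rightarrow> real" where
  "surv_prob \<equiv> loss_law.survival_prob x a in_count K"

text \<open>The conditional probability, after \<open>k\<close> reveals, that agent \<open>i\<close> is still solvent after \<open>K\<close> reveals, if these take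
  place and the premiums follow the schedule.\<close>

definition prediction :: "nat \<Rightarrow> nat \<Rightarrow> 'w \<Rightarrow> real" where
  "prediction i k z = indicator {z. solvent a i k z} z * surv_prob k (free_count i k z) (net i k z)"

definition total_prediction :: "nat \<Rightarrow> 'w \<Rightarrow> real" where
  "total_prediction k z = (\<Sum>i\<in>agents. prediction i k z)"

lemma agentsD: "i \<in> agents \<Longrightarrow> i \<in> {1..n}" "i \<in> agents \<Longrightarrow> atype Z i = x"
  by (auto simp: agents_def)

lemma finite_agents: "finite agents" by (simp add: agents_def)

lemma card_agents_le: "card agents \<le> n"
proof -
  have "agents \<subseteq> {1..n}" by (auto simp: agents_def)
  from card_mono[OF _ this] show ?thesis by simp
qed

lemma free_count_few: "i \<in> agents \<Longrightarrow> free_count i k z \<le> in_count - K"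
  using free_count_le[OF agentsD(1)] agentsD(2) few order.trans by metis

lemma prediction_bounds: "i \<in> agents \<Longrightarrow> k \<le> K \<Longrightarrow> 0 \<le> prediction i k z \<and> prediction i k z \<le> 1"
  using loss_law.survival_prob_nonneg loss_law.survival_prob_le_1[OF _ K_le free_count_few, of k i]
  by (auto simp: prediction_def indicator_def)

lemma surv_prob_measurable2:
  assumes c: "c \<in> borel_measurable N" and r: "r \<in> N \<rightarrow>\<^sub>M count_space UNIV"
  shows "(\<lambda>z. surv_prob k (r z) (c z)) \<in> borel_measurable N"
  by (rule measurable_compose_countable[OF _ r]) (rule measurable_compose[OF c loss_law.survival_prob_measurable])

lemma prediction_measurable: "i \<in> agents \<Longrightarrow> prediction i k \<in> borel_measurable (hist Z k)"
  unfolding prediction_def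
  using solvent_sets[OF agentsD(1)]
  by (intro borel_measurable_times borel_measurable_indicator' surv_prob_measurable2 net_measurable free_count_measurable)
     (auto simp: space_hist dest: agentsD)

lemma solvent_Suc:
  assumes "Suc k \<le> K"
  shows "solvent a i (Suc k) z \<longleftrightarrow> solvent a i k z \<and> (fst (tgt Z (Suc k) z) = i \<longrightarrow> 0 < net i k z - loss Z (Suc k) z + a (Suc k))"
proof -
  have "a k \<le> a (Suc k)" using assms by (intro mono_onD[OF a_mono]) auto
  then have "0 < net i k z + a (Suc k)" if "solvent a i k z" using that unfolding solvent_def by fastforce
  then show ?thesis by (auto simp: solvent_def le_Suc_eq net_Suc)
qed

text \<open>The value of \<open>prediction\<close> after the next reveal, if it hits agent \<open>i\<close> with loss \<open>l\<close> and if it misses.\<close>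

definition hit :: "nat \<Rightarrow> nat \<Rightarrow> 'w \<times> real \<Rightarrow> real" where
  "hit i k p = indicator {z. solvent a i k z} (fst p) * (indicator {..<net i k (fst p) + a (Suc k)} (snd p)
     * surv_prob (Suc k) (free_count i k (fst p) - 1) (net i k (fst p) - snd p))"

definition miss :: "nat \<Rightarrow> nat \<Rightarrow> 'w \<Rightarrow> real" where
  "miss i k z = indicator {z. solvent a i k z} z * surv_prob (Suc k) (free_count i k z) (net i k z)"

lemma prediction_Suc:
  assumes "z \<in> live k" "Suc k \<le> K"
  shows "prediction i (Suc k) z = (if fst (tgt Z (Suc k) z) = i then hit i k (z, loss Z (Suc k) z) else miss i k z)"
  unfolding prediction_def hit_def miss_def
  using solvent_Suc[OF assms(2), of i z] free_count_Suc[OF assms(1), of i]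
  by (auto simp: indicator_def net_Suc algebra_simps)

lemma hit_bounds: "i \<in> agents \<Longrightarrow> Suc k \<le> K \<Longrightarrow> 0 \<le> hit i k p \<and> hit i k p \<le> 1"
  using loss_law.survival_prob_nonneg loss_law.survival_prob_le_1[OF _ K_le, of "Suc k" "free_count i k (fst p) - 1"]
    free_count_few[of i k "fst p"]
  by (auto simp: hit_def indicator_def)

lemma miss_bounds: "i \<in> agents \<Longrightarrow> Suc k \<le> K \<Longrightarrow> 0 \<le> miss i k z \<and> miss i k z \<le> 1"
  using loss_law.survival_prob_nonneg loss_law.survival_prob_le_1[OF _ K_le free_count_few, of "Suc k" i]
  by (auto simp: miss_def indicator_def)

lemma miss_measurable: "i \<in> agents \<Longrightarrow> miss i k \<in> borel_measurable (hist Z k)"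
  unfolding miss_def
  using solvent_sets[OF agentsD(1)]
  by (intro borel_measurable_times borel_measurable_indicator' surv_prob_measurable2 net_measurable free_count_measurable)
     (auto simp: space_hist dest: agentsD)

lemma hit_measurable:
  assumes i: "i \<in> agents" shows "hit i k \<in> borel_measurable (hist Z k \<Otimes>\<^sub>M borel)"
proof -
  let ?N = "hist Z k \<Otimes>\<^sub>M (borel :: real measure)"
  have net: "(\<lambda>p. net i k (fst p)) \<in> borel_measurable ?N"
    by (rule measurable_compose[OF measurable_fst net_measurable[OF agentsD(1)[OF i]]])
  have sol: "(\<lambda>p. indicator {z. solvent a i k z} (fst p) :: real) \<in> borel_measurable ?N"
    by (rule measurable_compose[OF measurable_fst])
       (rule borel_measurable_indicator', use solvent_sets[OF agentsD(1)[OF i]] in \<open>simp add: space_hist\<close>)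
  have snd: "snd \<in> borel_measurable ?N" by (rule measurable_snd)
  have ind: "(\<lambda>p. indicator {..<net i k (fst p) + a (Suc k)} (snd p) :: real) \<in> borel_measurable ?N"
  proof -
    have "(\<lambda>p. if snd p < net i k (fst p) + a (Suc k) then 1 else 0 :: real) \<in> borel_measurable ?N"
      by (intro measurable_If borel_measurable_const borel_measurable_less snd borel_measurable_add net)
    then show ?thesis by (simp add: indicator_def of_bool_def)
  qed
  have fc: "(\<lambda>p. free_count i k (fst p) - 1) \<in> ?N \<rightarrow>\<^sub>M count_space UNIV"
    by (rule measurable_compose[OF measurable_compose[OF measurable_fst free_count_measurable]]) simp
  show ?thesis unfolding hit_def
    by (intro borel_measurable_times sol ind surv_prob_measurable2 fc borel_measurable_diff net snd)
qed

lemma integral_hit: "(\<integral>l. hit i k (z, l) \<partial>loss_law P x)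
    = indicator {z. solvent a i k z} z * loss_law.after_loss x (a (Suc k)) (surv_prob (Suc k) (free_count i k z - 1)) (net i k z)"
  unfolding hit_def loss_law.after_loss_def by simp

lemma prediction_eq:
  assumes "i \<in> agents" "Suc k \<le> K"
  shows "prediction i k z = miss i k z + real (free_count i k z) / real (in_count - k) * ((\<integral>l. hit i k (z, l) \<partial>loss_law P x) - miss i k z)"
  unfolding prediction_def miss_def integral_hit
  using assms K_le loss_law.survival_prob_step[OF _ K_le free_count_few[OF assms(1)], of k, where x=x and a=a]
  by (cases "solvent a i k z") (simp_all add: algebra_simps)

lemma integrable_bounded:
  fixes f :: "'w \<Rightarrow> real"
  assumes "f \<in> borel_measurable M" "\<And>z. z \<in> space M \<Longrightarrow> \<bar>f z\<bar> \<le> B"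
  shows "integrable M f"
  using assms by (intro integrable_const_bound[of _ B] AE_I2) auto

text \<open>\<open>prediction_eq\<close> averages over the next reveal: the agent is hit with probability
  \<open>free_count / (in_count - k)\<close>. The factor \<open>g\<close> stands for any information about the past.\<close>

lemma prediction_martingale:
  assumes i: "i \<in> agents" and k: "Suc k \<le> K"
    and g: "g \<in> borel_measurable (hist Z k)" and B: "\<And>z. \<bar>g z\<bar> \<le> B"
  shows "(\<integral>z. indicator (live k) z * (g z * (prediction i (Suc k) z - prediction i k z)) \<partial>M) = 0"
proof -
  let ?A = "live k"
  let ?S = "{h \<in> in_half_edges P n Z. fst h = i}"
  have finS: "finite ?S" using finite_in_half_edges by simp
  have B0: "0 \<le> B" using B[of undefined] by simp
  define F where "F p = g (fst p) * (hit i k p - miss i k (fst p))" for p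
  have F_meas: "F \<in> borel_measurable (hist Z k \<Otimes>\<^sub>M borel)"
    unfolding F_def
    by (intro borel_measurable_times borel_measurable_diff hit_measurable[OF i] measurable_compose[OF measurable_fst g]
        measurable_compose[OF measurable_fst miss_measurable[OF i]])
  have F_bd: "\<bar>F p\<bar> \<le> B" for p
  proof -
    have "\<bar>hit i k p - miss i k (fst p)\<bar> \<le> 1" using hit_bounds[OF i k, of p] miss_bounds[OF i k, of "fst p"] by linarith
    then have "\<bar>g (fst p)\<bar> * \<bar>hit i k p - miss i k (fst p)\<bar> \<le> B * 1" by (intro mult_mono B B0) auto
    then show ?thesis by (simp add: F_def abs_mult)
  qed
  have A_M: "?A \<in> sets M" by (rule sets_hist_M[OF active_sets])
  have loss_M: "loss Z (Suc k) \<in> borel_measurable M" by (rule measurable_hist_M[OF loss_measurable_Suc])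
  have pair_meas: "(\<lambda>z. (z, loss Z (Suc k) z)) \<in> M \<rightarrow>\<^sub>M hist Z k \<Otimes>\<^sub>M borel"
    by (intro measurable_Pair loss_M measurable_hist_M[OF measurable_ident, unfolded id_def])
  have FL_meas: "(\<lambda>z. F (z, loss Z (Suc k) z)) \<in> borel_measurable M" by (rule measurable_compose[OF pair_meas F_meas])
  have int1: "integrable M (\<lambda>z. indicator ?A z * (indicator {z. tgt Z (Suc k) z = h} z * F (z, loss Z (Suc k) z)))" for h
  proof (rule integrable_bounded[where B=B])
    have ind_t: "(\<lambda>z. indicator {z. tgt Z (Suc k) z = h} z :: real) \<in> borel_measurable M"
      using sets_hist_M[OF tgt_sets[of "Suc k" "Suc k" "\<lambda>t. t = h"]] by (intro borel_measurable_indicator_Collect_real) simp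
    then show "(\<lambda>z. indicator ?A z * (indicator {z. tgt Z (Suc k) z = h} z * F (z, loss Z (Suc k) z))) \<in> borel_measurable M"
      by (intro borel_measurable_times FL_meas ind_t borel_measurable_indicator A_M)
  qed (use F_bd B0 in \<open>auto simp: indicator_def\<close>)
  have tilde: "(\<lambda>z. g z * (prediction i k z - miss i k z)) \<in> borel_measurable M"
    by (rule measurable_hist_M[where k=k]) (intro borel_measurable_times borel_measurable_diff g prediction_measurable[OF i] miss_measurable[OF i])
  have int2: "integrable M (\<lambda>z. indicator ?A z * (g z * (prediction i k z - miss i k z)))"
  proof (rule integrable_bounded[where B=B])
    show "\<bar>indicator ?A z * (g z * (prediction i k z - miss i k z))\<bar> \<le> B" for z
    proof -
      have "\<bar>prediction i k z - miss i k z\<bar> \<le> 1" using prediction_bounds[OF i, of k z] miss_bounds[OF i k, of z] k by linarith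
      then have "\<bar>g z\<bar> * \<bar>prediction i k z - miss i k z\<bar> \<le> B * 1" by (intro mult_mono B B0) auto
      then show ?thesis using B0 by (auto simp: abs_mult indicator_def)
    qed
  qed (use A_M tilde in simp)
  have pw: "indicator ?A z * (g z * (prediction i (Suc k) z - prediction i k z))
     = (\<Sum>h\<in>?S. indicator ?A z * (indicator {z. tgt Z (Suc k) z = h} z * F (z, loss Z (Suc k) z)))
       - indicator ?A z * (g z * (prediction i k z - miss i k z))" for z
  proof (cases "z \<in> ?A")
    case True
    have tgt_in: "tgt Z (Suc k) z \<in> in_half_edges P n Z" using active_step[OF True] by (simp add: free_in_def)
    have "(\<Sum>h\<in>?S. indicator {z. tgt Z (Suc k) z = h} z * F (z, loss Z (Suc k) z))
      = (\<Sum>h\<in>?S. if tgt Z (Suc k) z = h then F (z, loss Z (Suc k) z) else 0)"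
      by (intro sum.cong) (auto simp: indicator_def)
    also have "... = (if fst (tgt Z (Suc k) z) = i then F (z, loss Z (Suc k) z) else 0)"
      using finS tgt_in by (simp add: sum.delta)
    finally show ?thesis using True prediction_Suc[OF True k, of i] by (simp add: F_def algebra_simps)
  qed simp
  have "(\<integral>z. indicator ?A z * (g z * (prediction i (Suc k) z - prediction i k z)) \<partial>M)
    = (\<Sum>h\<in>?S. \<integral>z. indicator ?A z * (indicator {z. tgt Z (Suc k) z = h} z * F (z, loss Z (Suc k) z)) \<partial>M)
      - (\<integral>z. indicator ?A z * (g z * (prediction i k z - miss i k z)) \<partial>M)"
    unfolding pw using int1 int2 by (simp add: Bochner_Integration.integral_sum)
  also have "(\<Sum>h\<in>?S. \<integral>z. indicator ?A z * (indicator {z. tgt Z (Suc k) z = h} z * F (z, loss Z (Suc k) z)) \<partial>M)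
    = (\<Sum>h\<in>?S. \<integral>z. indicator ?A z * (chance h k z * (\<integral>l. F (z, l) \<partial>loss_law P x)) \<partial>M)"
  proof (intro sum.cong refl)
    fix h assume h: "h \<in> ?S"
    then have "atype Z (fst h) = x" using agentsD(2)[OF i] by simp
    then show "(\<integral>z. indicator ?A z * (indicator {z. tgt Z (Suc k) z = h} z * F (z, loss Z (Suc k) z)) \<partial>M)
      = (\<integral>z. indicator ?A z * (chance h k z * (\<integral>l. F (z, l) \<partial>loss_law P x)) \<partial>M)"
      using reveal_integral[OF _ F_meas F_bd, of h] h by simp
  qed
  also have "... = (\<integral>z. (\<Sum>h\<in>?S. indicator ?A z * (chance h k z * (\<integral>l. F (z, l) \<partial>loss_law P x))) \<partial>M)"
  proof (rule Bochner_Integration.integral_sum[symmetric])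
    fix h
    have FI_meas: "(\<lambda>z. \<integral>l. F (z, l) \<partial>loss_law P x) \<in> borel_measurable (hist Z k)"
    proof (rule loss_law.borel_measurable_lebesgue_integral)
      show "(\<lambda>(z, l). F (z, l)) \<in> borel_measurable (hist Z k \<Otimes>\<^sub>M loss_law P x)"
        using F_meas by (simp add: measurable_cong_sets[OF sets_pair_measure_cong[OF refl loss_law.sets_L] refl])
    qed
    have FI_bd: "\<bar>\<integral>l. F (z, l) \<partial>loss_law P x\<bar> \<le> B" for z
    proof -
      have "\<bar>\<integral>l. F (z, l) \<partial>loss_law P x\<bar> \<le> (\<integral>l. \<bar>F (z, l)\<bar> \<partial>loss_law P x)" by (rule integral_abs_bound)
      also have "... \<le> (\<integral>l. B \<partial>loss_law P x)"
        by (rule integral_mono') (use F_bd B0 in auto)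
      finally show ?thesis by simp
    qed
    show "integrable M (\<lambda>z. indicator ?A z * (chance h k z * (\<integral>l. F (z, l) \<partial>loss_law P x)))"
    proof (rule integrable_bounded[where B=B])
      have ind_f: "(\<lambda>z. indicator {z. h \<in> free_in P n Z k z} z :: real) \<in> borel_measurable M"
        by (intro borel_measurable_indicator_Collect_real sets_hist_M[OF free_in_sets])
      then show "(\<lambda>z. indicator ?A z * (chance h k z * (\<integral>l. F (z, l) \<partial>loss_law P x))) \<in> borel_measurable M"
        by (intro borel_measurable_times borel_measurable_divide borel_measurable_const
            measurable_hist_M[OF FI_meas] ind_f borel_measurable_indicator A_M)
      show "\<bar>indicator ?A z * (chance h k z * (\<integral>l. F (z, l) \<partial>loss_law P x))\<bar> \<le> B" for z
      proof -
        have "\<bar>indicator ?A z * (chance h k z) :: real\<bar> \<le> 1"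
          by (auto simp: indicator_def divide_le_eq)
        then have "\<bar>indicator ?A z * (chance h k z) :: real\<bar> * \<bar>\<integral>l. F (z, l) \<partial>loss_law P x\<bar> \<le> 1 * B"
          by (intro mult_mono FI_bd) auto
        then show ?thesis by (simp add: abs_mult mult.assoc)
      qed
    qed
  qed
  also have "... = (\<integral>z. indicator ?A z * (g z * (prediction i k z - miss i k z)) \<partial>M)"
  proof (intro Bochner_Integration.integral_cong refl)
    fix z
    have "(\<integral>l. F (z, l) \<partial>loss_law P x) = g z * ((\<integral>l. hit i k (z, l) \<partial>loss_law P x) - miss i k z)"
    proof -
      have "integrable (loss_law P x) (\<lambda>l. hit i k (z, l))"
      proof (rule loss_law.integrable_const_bound[where B=1])
        show "(\<lambda>l. hit i k (z, l)) \<in> borel_measurable (loss_law P x)"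
          unfolding hit_def fst_conv snd_conv
          by (intro borel_measurable_times borel_measurable_const measurable_compose[OF _ loss_law.survival_prob_measurable])
             simp_all
      qed (use hit_bounds[OF i k] in auto)
      then show ?thesis by (simp add: F_def)
    qed
    then have "(\<Sum>h\<in>?S. indicator ?A z * (chance h k z * (\<integral>l. F (z, l) \<partial>loss_law P x)))
      = indicator ?A z * (real (free_count i k z) / real (in_count - k) * (g z * ((\<integral>l. hit i k (z, l) \<partial>loss_law P x) - miss i k z)))"
      unfolding free_count_eq_sum by (simp add: sum_distrib_left sum_distrib_right sum_divide_distrib mult_ac)
    also have "... = indicator ?A z * (g z * (prediction i k z - miss i k z))"
      unfolding prediction_eq[OF i k] by (simp add: mult_ac)
    finally show "(\<Sum>h\<in>?S. indicator ?A z * (chance h k z * (\<integral>l. F (z, l) \<partial>loss_law P x)))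
      = indicator ?A z * (g z * (prediction i k z - miss i k z))" .
  qed
  finally show ?thesis by simp
qed

lemma total_prediction_measurable: "total_prediction k \<in> borel_measurable (hist Z k)"
  unfolding total_prediction_def by (intro borel_measurable_sum prediction_measurable)

lemma total_prediction_bounds:
  assumes "k \<le> K" shows "0 \<le> total_prediction k z" "total_prediction k z \<le> real n"
proof -
  show "0 \<le> total_prediction k z"
    unfolding total_prediction_def using prediction_bounds assms by (intro sum_nonneg) blast
  have "total_prediction k z \<le> (\<Sum>i\<in>agents. 1)"
    unfolding total_prediction_def using prediction_bounds assms by (intro sum_mono) blast
  then show "total_prediction k z \<le> real n" using card_agents_le by simp
qed

lemma total_prediction_martingale:
  assumes k: "Suc k \<le> K" and g: "g \<in> borel_measurable (hist Z k)" and B: "\<And>z. \<bar>g z\<bar> \<le> B"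
  shows "(\<integral>z. indicator (live k) z * (g z * (total_prediction (Suc k) z - total_prediction k z)) \<partial>M) = 0"
proof -
  have B0: "0 \<le> B" using B[of undefined] by simp
  have "(\<integral>z. indicator (live k) z * (g z * (total_prediction (Suc k) z - total_prediction k z)) \<partial>M)
    = (\<integral>z. (\<Sum>i\<in>agents. indicator (live k) z * (g z * (prediction i (Suc k) z - prediction i k z))) \<partial>M)"
    unfolding total_prediction_def sum_subtractf[symmetric] sum_distrib_left ..
  also have "... = (\<Sum>i\<in>agents. \<integral>z. indicator (live k) z * (g z * (prediction i (Suc k) z - prediction i k z)) \<partial>M)"
  proof (rule Bochner_Integration.integral_sum)
    fix i assume i: "i \<in> agents"
    show "integrable M (\<lambda>z. indicator (live k) z * (g z * (prediction i (Suc k) z - prediction i k z)))"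
    proof (rule integrable_bounded[where B=B])
      show "(\<lambda>z. indicator (live k) z * (g z * (prediction i (Suc k) z - prediction i k z))) \<in> borel_measurable M"
        by (intro borel_measurable_times borel_measurable_diff borel_measurable_indicator sets_hist_M[OF active_sets]
            measurable_hist_M[OF g] measurable_hist_M[OF prediction_measurable[OF i]])
      show "\<bar>indicator (live k) z * (g z * (prediction i (Suc k) z - prediction i k z))\<bar> \<le> B" for z
      proof -
        have "\<bar>prediction i (Suc k) z - prediction i k z\<bar> \<le> 1"
          using prediction_bounds[OF i, of k z] prediction_bounds[OF i, of "Suc k" z] k by linarith
        then have "\<bar>g z\<bar> * \<bar>prediction i (Suc k) z - prediction i k z\<bar> \<le> B * 1" by (intro mult_mono B B0) auto
        then show ?thesis using B0 by (auto simp: abs_mult indicator_def)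
      qed
    qed
  qed
  also have "... = 0" using prediction_martingale[OF _ k g B] by simp
  finally show ?thesis .
qed

text \<open>A reveal changes the state of one agent only. The predictions for the others change by at most the
  probability of being hit, and these probabilities add up to at most 1.\<close>

lemma total_prediction_change:
  assumes z: "z \<in> live k" and k: "Suc k \<le> K"
  shows "\<bar>total_prediction (Suc k) z - total_prediction k z\<bar> \<le> 2"
proof -
  have occ: "z \<in> occurred k" using z active_subset_occurred by blast
  have each: "\<bar>prediction i (Suc k) z - prediction i k z\<bar>
      \<le> (if fst (tgt Z (Suc k) z) = i then 1 else 0) + real (free_count i k z) / real (in_count - k)" if i: "i \<in> agents" for i
  proof (cases "fst (tgt Z (Suc k) z) = i")
    case True
    have "\<bar>prediction i (Suc k) z - prediction i k z\<bar> \<le> 1"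
      using prediction_bounds[OF i, of k z] prediction_bounds[OF i, of "Suc k" z] k by linarith
    moreover have "0 \<le> real (free_count i k z) / real (in_count - k)" by simp
    ultimately have "\<bar>prediction i (Suc k) z - prediction i k z\<bar> \<le> 1 + real (free_count i k z) / real (in_count - k)"
      by (rule add_increasing2[rotated])
    then show ?thesis by (simp only: if_P[OF True])
  next
    case False
    have "prediction i (Suc k) z - prediction i k z = indicator {z. solvent a i k z} z *
       (surv_prob (Suc k) (free_count i k z) (net i k z) - surv_prob k (free_count i k z) (net i k z))"
      using prediction_Suc[OF z k, of i] False by (simp add: miss_def prediction_def right_diff_distrib)
    moreover have "\<bar>surv_prob (Suc k) (free_count i k z) (net i k z) - surv_prob k (free_count i k z) (net i k z)\<bar>
      \<le> real (free_count i k z) / real (in_count - k)"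
      by (rule loss_law.survival_prob_change[OF _ K_le free_count_few[OF i]]) (use k in simp)
    ultimately show ?thesis using False by (auto simp: indicator_def)
  qed
  have "\<bar>total_prediction (Suc k) z - total_prediction k z\<bar> \<le> (\<Sum>i\<in>agents. \<bar>prediction i (Suc k) z - prediction i k z\<bar>)"
    unfolding total_prediction_def sum_subtractf[symmetric] by (rule sum_abs)
  also have "... \<le> (\<Sum>i\<in>agents. (if fst (tgt Z (Suc k) z) = i then 1 else 0) + real (free_count i k z) / real (in_count - k))"
    by (intro sum_mono each)
  also have "... = (\<Sum>i\<in>agents. if fst (tgt Z (Suc k) z) = i then 1 else 0) + real (\<Sum>i\<in>agents. free_count i k z) / real (in_count - k)"
    by (simp add: sum.distrib sum_divide_distrib)
  also have "(\<Sum>i\<in>agents. if fst (tgt Z (Suc k) z) = i then 1 else (0::real)) \<le> 1"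
    using finite_agents by (simp add: sum.delta)
  also have "real (\<Sum>i\<in>agents. free_count i k z) / real (in_count - k) \<le> 1"
  proof -
    have "u / v \<le> 1" if "u \<le> v" "0 \<le> u" for u v :: real using that by (auto simp: divide_le_eq_1)
    moreover have "real (\<Sum>i\<in>agents. free_count i k z) \<le> real (in_count - k)"
      using sum_free_count_le[OF occ finite_agents] by (simp only: of_nat_le_iff)
    ultimately show ?thesis using of_nat_0_le_iff by blast
  qed
  finally show ?thesis by simp
qed

text \<open>Increments of a martingale are orthogonal to the past, and each of them has square at most 4. The process
  may stop early, so everything is restricted to the event that the reveals take place.\<close>

lemma second_moment:
  assumes "k \<le> K"
  shows "(\<integral>z. indicator (occurred k) z * (total_prediction k z - total_prediction 0 z)\<^sup>2 \<partial>M) \<le> 4 * real k"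
  using assms
proof (induction k)
  case (Suc k)
  let ?A = "live k"
  define Y where "Y k z = total_prediction k z - total_prediction 0 z" for k z
  have Y_bd: "\<bar>Y j z\<bar> \<le> real n" if "j \<le> K" for j z
    using total_prediction_bounds[OF that, of z] total_prediction_bounds[of 0 z] by (auto simp: Y_def abs_le_iff)
  have Y_sq: "(Y j z)\<^sup>2 \<le> (real n)\<^sup>2" if "j \<le> K" for j z
    using power_mono[OF Y_bd[OF that], where n=2] by simp
  have Y_meas: "Y j \<in> borel_measurable (hist Z k)" if "j \<le> k" for j k unfolding Y_def
    by (intro borel_measurable_diff measurable_hist_mono[OF total_prediction_measurable] that) simp
  define D where "D z = total_prediction (Suc k) z - total_prediction k z" for z
  have D_bd: "\<bar>D z\<bar> \<le> real n" for z
    using total_prediction_bounds[OF Suc.prems, of z] total_prediction_bounds[of k z] Suc.prems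
    by (auto simp: D_def abs_le_iff)
  have D_M: "D \<in> borel_measurable M" unfolding D_def
    by (intro borel_measurable_diff measurable_hist_M[OF total_prediction_measurable])
  have A_M: "?A \<in> sets M" by (rule sets_hist_M[OF active_sets])
  have int_sq: "integrable M (\<lambda>z. indicator S z * (Y j z)\<^sup>2)" if "S \<in> sets M" "j \<le> K" for S j
    using Y_sq[OF that(2)] that(1)
    by (intro integrable_bounded[where B="(real n)\<^sup>2"] borel_measurable_times borel_measurable_power borel_measurable_indicator
         measurable_hist_M[OF Y_meas[OF order.refl]]) (auto simp: indicator_def)
  have int_YD: "integrable M (\<lambda>z. indicator ?A z * (2 * Y k z * D z))"
  proof (intro integrable_bounded[where B="2 * real n * real n"])
    show "(\<lambda>z. indicator ?A z * (2 * Y k z * D z)) \<in> borel_measurable M"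
      by (intro borel_measurable_times borel_measurable_const borel_measurable_indicator A_M D_M measurable_hist_M[OF Y_meas[OF order.refl]])
    have "\<bar>Y k z\<bar> * \<bar>D z\<bar> \<le> real n * real n" for z using Suc.prems by (intro mult_mono Y_bd D_bd) auto
    then show "\<bar>indicator ?A z * (2 * Y k z * D z)\<bar> \<le> 2 * real n * real n" for z
      by (auto simp: indicator_def abs_mult)
  qed
  have int_4: "integrable M (\<lambda>z. indicator ?A z * (4::real))"
    by (intro integrable_bounded[where B=4] borel_measurable_times borel_measurable_const borel_measurable_indicator A_M) (simp add: indicator_def)
  have "(\<integral>z. indicator (occurred (Suc k)) z * (Y (Suc k) z)\<^sup>2 \<partial>M)
     \<le> (\<integral>z. indicator ?A z * (Y k z)\<^sup>2 + indicator ?A z * (2 * Y k z * D z) + indicator ?A z * 4 \<partial>M)"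
  proof (intro integral_mono int_sq Bochner_Integration.integrable_add int_YD int_4 sets_hist_M[OF occurred_sets] A_M)
    fix z
    show "indicator (occurred (Suc k)) z * (Y (Suc k) z)\<^sup>2 \<le> indicator ?A z * (Y k z)\<^sup>2 + indicator ?A z * (2 * Y k z * D z) + indicator ?A z * 4"
    proof (cases "z \<in> ?A")
      case True
      have "Y (Suc k) z = Y k z + D z" by (simp add: Y_def D_def)
      moreover have "(D z)\<^sup>2 \<le> 4"
        using power_mono[OF total_prediction_change[OF True Suc.prems], where n=2] by (simp add: D_def)
      ultimately have "(Y (Suc k) z)\<^sup>2 \<le> (Y k z)\<^sup>2 + 2 * Y k z * D z + 4" by (simp add: power2_sum)
      moreover have "indicator (occurred (Suc k)) z * (Y (Suc k) z)\<^sup>2 \<le> (Y (Suc k) z)\<^sup>2" by (simp add: indicator_def)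
      ultimately show ?thesis using True by simp
    next
      case False
      then have "z \<notin> occurred (Suc k)" using occurred_Suc_subset_active by blast
      then show ?thesis using False by simp
    qed
  qed (use Suc.prems in auto)
  also have "... = (\<integral>z. indicator ?A z * (Y k z)\<^sup>2 \<partial>M) + (\<integral>z. indicator ?A z * (2 * Y k z * D z) \<partial>M) + 4 * prob ?A"
    using int_sq[OF A_M, of k] Suc.prems int_YD int_4 A_M by simp
  also have "(\<integral>z. indicator ?A z * (2 * Y k z * D z) \<partial>M) = 0"
    unfolding D_def
  proof (rule total_prediction_martingale[OF Suc.prems, where B="2 * real n"])
    show "(\<lambda>z. 2 * Y k z) \<in> borel_measurable (hist Z k)" by (intro borel_measurable_times borel_measurable_const Y_meas order.refl)
    show "\<bar>2 * Y k z\<bar> \<le> 2 * real n" for z using Y_bd[of k z] Suc.prems by simp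
  qed
  also have "(\<integral>z. indicator ?A z * (Y k z)\<^sup>2 \<partial>M) \<le> (\<integral>z. indicator (occurred k) z * (Y k z)\<^sup>2 \<partial>M)"
    using active_subset_occurred[of k] Suc.prems
    by (intro integral_mono int_sq A_M sets_hist_M[OF occurred_sets]) (auto simp: indicator_def)
  also have "... \<le> 4 * real k" using Suc by (simp add: Y_def)
  finally have "(\<integral>z. indicator (occurred (Suc k)) z * (Y (Suc k) z)\<^sup>2 \<partial>M) \<le> 4 * real k + 0 + 4 * prob ?A" by simp
  also have "... \<le> 4 * real (Suc k)" using prob_le_1[of ?A] by simp
  finally show ?case by (simp only: Y_def)
qed simp

lemma prediction_deviation:
  assumes e: "0 < e"
  shows "prob {z \<in> occurred K. e \<le> \<bar>total_prediction K z - total_prediction 0 z\<bar>} \<le> 4 * real K / e\<^sup>2"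
proof -
  let ?S = "{z \<in> occurred K. e \<le> \<bar>total_prediction K z - total_prediction 0 z\<bar>}"
  have meas: "(\<lambda>z. total_prediction K z - total_prediction 0 z) \<in> borel_measurable M"
    by (intro borel_measurable_diff measurable_hist_M[OF total_prediction_measurable])
  have "{z \<in> space M. e \<le> \<bar>total_prediction K z - total_prediction 0 z\<bar>} \<in> sets M"
    by (intro borel_measurable_le borel_measurable_const borel_measurable_abs meas)
  then have "occurred K \<inter> {z \<in> space M. e \<le> \<bar>total_prediction K z - total_prediction 0 z\<bar>} \<in> sets M"
    using sets_hist_M[OF occurred_sets] by blast
  moreover have "occurred K \<inter> {z \<in> space M. e \<le> \<bar>total_prediction K z - total_prediction 0 z\<bar>} = ?S"
    using occurred_space by blast
  ultimately have S: "?S \<in> sets M" by simp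
  have "e\<^sup>2 * prob ?S = (\<integral>z. e\<^sup>2 * indicator ?S z \<partial>M)" using S by simp
  also have "... \<le> (\<integral>z. indicator (occurred K) z * (total_prediction K z - total_prediction 0 z)\<^sup>2 \<partial>M)"
  proof (rule integral_mono)
    show "integrable M (\<lambda>z. e\<^sup>2 * indicator ?S z)"
      using S by (intro integrable_mult_right integrable_real_indicator) (auto simp: less_top[symmetric])
    have "\<bar>total_prediction K z - total_prediction 0 z\<bar> \<le> real n" for z
      using total_prediction_bounds[of K z] total_prediction_bounds[of 0 z] by (auto simp: abs_le_iff)
    from power_mono[OF this, where n=2] have "(total_prediction K z - total_prediction 0 z)\<^sup>2 \<le> (real n)\<^sup>2" for z by simp
    then show "integrable M (\<lambda>z. indicator (occurred K) z * (total_prediction K z - total_prediction 0 z)\<^sup>2)"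
      by (intro integrable_bounded[where B="(real n)\<^sup>2"] borel_measurable_times borel_measurable_power borel_measurable_indicator
          sets_hist_M[OF occurred_sets] meas) (auto simp: indicator_def)
    show "e\<^sup>2 * indicator ?S z \<le> indicator (occurred K) z * (total_prediction K z - total_prediction 0 z)\<^sup>2" for z
      using power_mono[of e "\<bar>total_prediction K z - total_prediction 0 z\<bar>" 2] e by (auto simp: indicator_def)
  qed
  also have "... \<le> 4 * real K" by (rule second_moment) simp
  finally show ?thesis using e by (simp add: field_simps)
qed

lemma total_prediction_final: "total_prediction K z = real (card {i \<in> agents. solvent a i K z})"
proof -
  have "total_prediction K z = (\<Sum>i\<in>agents. if solvent a i K z then 1 else 0)"
    unfolding total_prediction_def prediction_def
    by (intro sum.cong refl) (simp add: loss_law.survival_prob_final[OF free_count_few] indicator_def)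
  then show ?thesis using finite_agents by (simp flip: sum.inter_filter)
qed

definition initial_prediction :: "real \<Rightarrow> real" where
  "initial_prediction e = indicator {e. 0 < cash x e + a 0} e * surv_prob 0 (indeg P x) (cash x e)"

lemma initial_prediction_measurable [measurable]: "initial_prediction \<in> borel_measurable borel"
  unfolding initial_prediction_def
  by (intro borel_measurable_times measurable_compose[OF cash_measurable loss_law.survival_prob_measurable]) measurable

lemma initial_prediction_bounds: "0 \<le> initial_prediction e" "initial_prediction e \<le> 1"
  using loss_law.survival_prob_nonneg loss_law.survival_prob_le_1[of 0 K in_count "indeg P x"] K_le few
  by (auto simp: initial_prediction_def indicator_def)

lemma total_prediction_0: "total_prediction 0 z = (\<Sum>i\<in>agents. initial_prediction (shock Z i z))"
  unfolding total_prediction_def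
proof (intro sum.cong refl)
  fix i assume i: "i \<in> agents"
  have "net i 0 z = cash x (shock Z i z)" using agentsD[OF i] by (simp add: net_def)
  then show "prediction i 0 z = initial_prediction (shock Z i z)"
    using agentsD[OF i] by (simp add: prediction_def initial_prediction_def solvent_def free_count_0 indicator_def)
qed

lemma expectation_initial_prediction:
  assumes i: "i \<in> agents"
  shows "expectation (\<lambda>z. initial_prediction (shock Z i z)) = (\<integral>e. initial_prediction e \<partial>shock_law P x)"
proof -
  have "distributed M lborel (shock Z i) (\<lambda>y. ennreal (shock_dens P x y))"
    using shock_distributed[OF agentsD(1)[OF i]] agentsD(2)[OF i] by simp
  from distributed_distr_eq_density[OF this] distributed_measurable[OF this]
  have d: "distr M lborel (shock Z i) = shock_law P x" and m: "shock Z i \<in> M \<rightarrow>\<^sub>M lborel" by (simp_all add: shock_law_def)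
  have "initial_prediction \<in> borel_measurable lborel" by simp
  from integral_distr[OF m this] show ?thesis by (simp only: d)
qed

text \<open>At the beginning the predictions are independent, being functions of the shocks; Hoeffding's inequality
  applies.\<close>

lemma initial_deviation:
  assumes e: "0 < e" and n: "0 < n"
  shows "prob {z \<in> space M. e * real n \<le> \<bar>total_prediction 0 z - real (card agents) * (\<integral>e. initial_prediction e \<partial>shock_law P x)\<bar>}
    \<le> 2 * exp (- 2 * e\<^sup>2 * real n)"
proof (cases "agents = {}")
  case True
  then show ?thesis using e n by (simp add: total_prediction_0 mult_le_0_iff)
next
  case False
  then have card: "0 < card agents" using finite_agents by (simp add: card_gt_0_iff)
  interpret H: Hoeffding_ineq M agents "\<lambda>i z. initial_prediction (shock Z i z)" "\<lambda>_. 0" "\<lambda>_. 1"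
      "\<Sum>i\<in>agents. expectation (\<lambda>z. initial_prediction (shock Z i z))"
  proof unfold_locales
    show "finite agents" by (rule finite_agents)
    have "indep_vars (\<lambda>_. borel) (shock Z) agents"
      by (rule indep_vars_subset[OF shock_indep]) (auto simp: agents_def)
    then show "indep_vars (\<lambda>_. borel) (\<lambda>i z. initial_prediction (shock Z i z)) agents"
      by (rule indep_vars_compose2) simp
    show "AE z in M. initial_prediction (shock Z i z) \<in> {0..1}" for i
      using initial_prediction_bounds by simp
  qed simp
  have "prob {z \<in> space M. e * real n \<le> \<bar>total_prediction 0 z - real (card agents) * (\<integral>e. initial_prediction e \<partial>shock_law P x)\<bar>}
    \<le> 2 * exp (- 2 * (e * real n)\<^sup>2 / real (card agents))"
    using H.Hoeffding_ineq_abs_ge[of "e * real n"] e n card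
    by (simp add: total_prediction_0 expectation_initial_prediction)
  also have "... \<le> 2 * exp (- 2 * e\<^sup>2 * real n)"
  proof -
    have "e\<^sup>2 * real n * real (card agents) \<le> e\<^sup>2 * real n * real n"
      using card_agents_le by (intro mult_left_mono) auto
    then have "e\<^sup>2 * real n \<le> (e * real n)\<^sup>2 / real (card agents)"
      using card by (simp add: le_divide_eq power_mult_distrib power2_eq_square mult_ac)
    then show ?thesis by simp
  qed
  finally show ?thesis .
qed

text \<open>After the last of the \<open>K\<close> reveals the total prediction is the number of survivors. It is close to the initial
  one by Chebyshev's inequality, and this is close to its mean.\<close>

lemma solvent_deviation:
  assumes e: "0 < e" and n: "0 < n"
  shows "prob {z \<in> occurred K. 2 * e * real n \<le> \<bar>real (card {i \<in> agents. solvent a i K z}) - real (card agents) * (\<integral>e. initial_prediction e \<partial>shock_law P x)\<bar>}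
    \<le> 4 * real K / (e * real n)\<^sup>2 + 2 * exp (- 2 * e\<^sup>2 * real n)"
proof -
  let ?m = "real (card agents) * (\<integral>e. initial_prediction e \<partial>shock_law P x)"
  let ?S1 = "{z \<in> occurred K. e * real n \<le> \<bar>total_prediction K z - total_prediction 0 z\<bar>}"
  let ?S2 = "{z \<in> space M. e * real n \<le> \<bar>total_prediction 0 z - ?m\<bar>}"
  have tp: "total_prediction k \<in> borel_measurable M" for k by (rule measurable_hist_M[OF total_prediction_measurable])
  have "{z \<in> space M. e * real n \<le> \<bar>total_prediction K z - total_prediction 0 z\<bar>} \<in> sets M"
    by (intro borel_measurable_le borel_measurable_const borel_measurable_abs borel_measurable_diff tp)
  then have "occurred K \<inter> {z \<in> space M. e * real n \<le> \<bar>total_prediction K z - total_prediction 0 z\<bar>} \<in> sets M"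
    using sets_hist_M[OF occurred_sets] by blast
  moreover have "occurred K \<inter> {z \<in> space M. e * real n \<le> \<bar>total_prediction K z - total_prediction 0 z\<bar>} = ?S1"
    using occurred_space by blast
  ultimately have S1: "?S1 \<in> sets M" by simp
  have S2: "?S2 \<in> sets M"
    by (intro borel_measurable_le borel_measurable_const borel_measurable_abs borel_measurable_diff tp)
  have "prob {z \<in> occurred K. 2 * e * real n \<le> \<bar>real (card {i \<in> agents. solvent a i K z}) - ?m\<bar>} \<le> prob (?S1 \<union> ?S2)"
  proof (rule finite_measure_mono)
    show "{z \<in> occurred K. 2 * e * real n \<le> \<bar>real (card {i \<in> agents. solvent a i K z}) - ?m\<bar>} \<subseteq> ?S1 \<union> ?S2"
      using occurred_space by (auto simp: total_prediction_final[symmetric])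
  qed (use S1 S2 in auto)
  also have "... \<le> prob ?S1 + prob ?S2" by (rule measure_Un_le[OF S1 S2])
  also have "... \<le> 4 * real K / (e * real n)\<^sup>2 + 2 * exp (- 2 * e\<^sup>2 * real n)"
    using prediction_deviation[of "e * real n"] initial_deviation[OF e n] e n by (intro add_mono) auto
  finally show ?thesis .
qed

end

section \<open>Reveal times\<close>

context reveal_process
begin

lemma occurred_sets_M: "occurred k \<in> sets M" by (rule sets_hist_M[OF occurred_sets])
lemma active_sets_M: "live k \<in> sets M" by (rule sets_hist_M[OF active_sets])

lemma time_measurable_M: "time Z k \<in> borel_measurable M"
  by (rule measurable_hist_M[OF time_measurable])

text \<open>Summing over all half-edges that may be hit leaves the law of the waiting time.\<close>

lemma wait_measure:
  assumes A: "A \<in> sets (hist Z k)" and s: "0 \<le> s"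
  shows "measure M {z \<in> A \<inter> live k. time Z k z + ereal s < time Z (Suc k) z}
    = (\<integral>z. indicator (A \<inter> live k) z * exp (- rate Z k z * s) \<partial>M)"
proof -
  let ?H = "in_half_edges P n Z"
  let ?E = "\<lambda>h. {z \<in> A \<inter> live k. tgt Z (Suc k) z = h \<and> loss Z (Suc k) z \<in> UNIV \<and> time Z (Suc k) z > time Z k z + ereal s}"
  have AM: "A \<subseteq> space M" using sets.sets_into_space[OF A] by (simp add: space_hist)
  have A_M: "A \<inter> live k \<in> sets M" using sets_hist_M[OF A] active_sets_M by blast
  have E_sets: "?E h \<in> sets M" for h
  proof -
    have 1: "{z \<in> space M. tgt Z (Suc k) z = h} \<in> sets M"
      by (rule sets_hist_M[OF tgt_sets[of "Suc k" "Suc k" "\<lambda>t. t = h"]]) simp_all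
    have 2: "{z \<in> space M. time Z k z + ereal s < time Z (Suc k) z} \<in> sets M"
      by (intro borel_measurable_less borel_measurable_ereal_add borel_measurable_const time_measurable_M)
    have "?E h = (A \<inter> live k) \<inter> {z \<in> space M. tgt Z (Suc k) z = h} \<inter> {z \<in> space M. time Z k z + ereal s < time Z (Suc k) z}"
      using AM by auto
    then show ?thesis using A_M 1 2 by (simp only: sets.Int)
  qed
  have "{z \<in> A \<inter> live k. time Z k z + ereal s < time Z (Suc k) z} = (\<Union>h\<in>?H. ?E h)"
    using active_step by (fastforce simp: free_in_def)
  then have "measure M {z \<in> A \<inter> live k. time Z k z + ereal s < time Z (Suc k) z} = measure M (\<Union>h\<in>?H. ?E h)"
    by (simp only:)
  also have "... = (\<Sum>h\<in>?H. measure M (?E h))"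
    using E_sets finite_in_half_edges by (intro finite_measure_finite_Union) (auto simp: disjoint_family_on_def)
  also have "... = (\<Sum>h\<in>?H. \<integral>z. indicator (A \<inter> live k) z * (chance h k z * exp (- rate Z k z * s)) \<partial>M)"
  proof (intro sum.cong refl)
    fix h assume h: "h \<in> ?H"
    have UNIV_sets: "(UNIV :: real set) \<in> sets borel" by simp
    show "measure M (?E h) = (\<integral>z. indicator (A \<inter> live k) z * (chance h k z * exp (- rate Z k z * s)) \<partial>M)"
      unfolding reveal_law[OF A h UNIV_sets s] set_lebesgue_integral_def
    proof (intro Bochner_Integration.integral_cong refl)
      fix z
      show "indicator (A \<inter> live k) z *\<^sub>R ((if h \<in> free_in P n Z k z then 1 / real (card (free_in P n Z k z)) else 0)
           * measure (loss_law P (atype Z (fst h))) UNIV * exp (- rate Z k z * s))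
         = indicator (A \<inter> live k) z * (chance h k z * exp (- rate Z k z * s))"
        using card_free_in[of z k] active_iff[of z k] by (auto simp: indicator_def)
    qed
  qed
  also have "... = (\<integral>z. (\<Sum>h\<in>?H. indicator (A \<inter> live k) z * (chance h k z * exp (- rate Z k z * s))) \<partial>M)"
  proof (rule Bochner_Integration.integral_sum[symmetric])
    fix h
    have ind_f: "(\<lambda>z. indicator {z. h \<in> free_in P n Z k z} z :: real) \<in> borel_measurable M"
      by (intro borel_measurable_indicator_Collect_real sets_hist_M[OF free_in_sets])
    have ex: "(\<lambda>z. exp (- rate Z k z * s)) \<in> borel_measurable M"
      by (rule measurable_compose[OF _ borel_measurable_exp])
         (intro borel_measurable_times borel_measurable_uminus borel_measurable_const measurable_hist_M[OF rate_measurable])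
    show "integrable M (\<lambda>z. indicator (A \<inter> live k) z * (chance h k z * exp (- rate Z k z * s)))"
    proof (rule integrable_const_bound[where B=1])
      show "AE z in M. norm (indicator (A \<inter> live k) z * (chance h k z * exp (- rate Z k z * s)) :: real) \<le> 1"
      proof (rule AE_I2)
        fix z assume "z \<in> space M"
        then have "exp (- rate Z k z * s) \<le> 1" using rate_nonneg[of z k] s by simp
        moreover have "\<bar>chance h k z\<bar> \<le> (1::real)"
          by (auto simp: indicator_def divide_le_eq_1)
        ultimately have "\<bar>chance h k z\<bar> * exp (- rate Z k z * s) \<le> (1::real) * 1"
          by (intro mult_mono) auto
        then show "norm (indicator (A \<inter> live k) z * (chance h k z * exp (- rate Z k z * s)) :: real) \<le> 1"
          by (cases "z \<in> A \<inter> live k") (simp_all add: abs_mult)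
      qed
    qed (intro borel_measurable_times borel_measurable_divide ind_f ex borel_measurable_indicator A_M borel_measurable_const)
  qed
  also have "... = (\<integral>z. indicator (A \<inter> live k) z * exp (- rate Z k z * s) \<partial>M)"
  proof (intro Bochner_Integration.integral_cong refl)
    fix z
    show "(\<Sum>h\<in>?H. indicator (A \<inter> live k) z * (chance h k z * exp (- rate Z k z * s)))
      = indicator (A \<inter> live k) z * exp (- rate Z k z * s)"
    proof (cases "z \<in> A \<inter> live k")
      case True
      then have act: "z \<in> live k" by blast
      then have occ: "z \<in> occurred k" using active_subset_occurred by blast
      have "tgt Z (Suc k) z \<in> free_in P n Z k z" using active_step[OF act] by blast
      then have pos: "0 < card (free_in P n Z k z)" using finite_free_in by (auto simp: card_gt_0_iff)
      have "(\<Sum>h\<in>?H. indicator {z. h \<in> free_in P n Z k z} z) = (\<Sum>h\<in>?H. if h \<in> free_in P n Z k z then 1 else (0::real))"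
        by (intro sum.cong) (auto simp: indicator_def)
      also have "... = real (card (?H \<inter> free_in P n Z k z))"
        using finite_in_half_edges by (simp add: sum.If_cases Int_def)
      also have "?H \<inter> free_in P n Z k z = free_in P n Z k z" by (auto simp: free_in_def)
      finally have "(\<Sum>h\<in>?H. indicator {z. h \<in> free_in P n Z k z} z) = real (in_count - k)"
        by (simp only: card_free_in[OF occ])
      moreover have "(\<Sum>h\<in>?H. indicator (A \<inter> live k) z * (chance h k z * exp (- rate Z k z * s)))
        = (\<Sum>h\<in>?H. indicator {z. h \<in> free_in P n Z k z} z) / real (in_count - k) * exp (- rate Z k z * s)"
        using True by (simp add: sum_distrib_right sum_divide_distrib)
      ultimately show ?thesis using True pos card_free_in[OF occ] by simp
    qed simp
  qed
  finally show ?thesis .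
qed

text \<open>The densities \<open>f\<close> and \<open>g\<close> define measures that coincide when restricted to the past, and \<open>V\<close> depends on the past
  only.\<close>

lemma measure_eq_on_hist:
  assumes f: "f \<in> borel_measurable M" and g: "g \<in> borel_measurable M" and V: "V \<in> borel_measurable (hist Z k)"
    and eq: "\<And>A. A \<in> sets (hist Z k) \<Longrightarrow> (\<integral>\<^sup>+z. f z * indicator A z \<partial>M) = (\<integral>\<^sup>+z. g z * indicator A z \<partial>M)"
  shows "(\<integral>\<^sup>+z. f z * V z \<partial>M) = (\<integral>\<^sup>+z. g z * V z \<partial>M)"
proof -
  have sub: "subalgebra (density M h) (hist Z k)" for h
    using hist_subalgebra[of k] by (simp add: subalgebra_def)
  have D: "(\<integral>\<^sup>+z. V z \<partial>restr_to_subalg (density M h) (hist Z k)) = (\<integral>\<^sup>+z. h z * V z \<partial>M)" if h: "h \<in> borel_measurable M" for h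
    using nn_integral_subalgebra2[OF sub V] measurable_hist_M[OF V] h by (simp add: nn_integral_density)
  have "restr_to_subalg (density M f) (hist Z k) = restr_to_subalg (density M g) (hist Z k)"
  proof (rule measure_eqI)
    show "sets (restr_to_subalg (density M f) (hist Z k)) = sets (restr_to_subalg (density M g) (hist Z k))"
      by (simp add: sets_restr_to_subalg[OF sub])
    fix A assume "A \<in> sets (restr_to_subalg (density M f) (hist Z k))"
    then have A: "A \<in> sets (hist Z k)" by (simp add: sets_restr_to_subalg[OF sub])
    have "emeasure (restr_to_subalg (density M h) (hist Z k)) A = (\<integral>\<^sup>+z. h z * indicator A z \<partial>M)" if h: "h \<in> borel_measurable M" for h
      using emeasure_restr_to_subalg[OF sub A, of h] sets_hist_M[OF A] h by (simp add: emeasure_density)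
    then show "emeasure (restr_to_subalg (density M f) (hist Z k)) A = emeasure (restr_to_subalg (density M g) (hist Z k)) A"
      using f g eq[OF A] by simp
  qed
  then show ?thesis using D[OF f] D[OF g] by simp
qed

lemma exp_rate_measurable: "(\<lambda>z. exp (c * rate Z k z * s)) \<in> borel_measurable (hist Z k)"
  by (rule measurable_compose[OF _ borel_measurable_exp])
     (intro borel_measurable_times borel_measurable_const rate_measurable)

definition longer :: "nat \<Rightarrow> real \<Rightarrow> 'w set" where
  "longer k s = {z \<in> live k. time Z k z + ereal s < time Z (Suc k) z}"

lemma longer_sets: "longer k s \<in> sets M"
proof -
  have "{z \<in> space M. time Z k z + ereal s < time Z (Suc k) z} \<in> sets M"
    by (intro borel_measurable_less borel_measurable_ereal_add borel_measurable_const time_measurable_M)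
  then have "live k \<inter> {z \<in> space M. time Z k z + ereal s < time Z (Suc k) z} \<in> sets M"
    using active_sets_M by blast
  moreover have "live k \<inter> {z \<in> space M. time Z k z + ereal s < time Z (Suc k) z} = longer k s"
    using sets.sets_into_space[OF active_sets_M] by (auto simp: longer_def)
  ultimately show ?thesis by simp
qed

lemma longer_subset: "longer k s \<subseteq> live k" by (auto simp: longer_def)

lemma emeasure_longer:
  assumes A: "A \<in> sets (hist Z k)" and s: "0 \<le> s"
  shows "emeasure M (longer k s \<inter> A) = ennreal (\<integral>z. indicator (A \<inter> live k) z * exp (- rate Z k z * s) \<partial>M)"
proof -
  have "longer k s \<inter> A = {z \<in> A \<inter> live k. time Z k z + ereal s < time Z (Suc k) z}" by (auto simp: longer_def)
  then show ?thesis using wait_measure[OF A s] by (simp add: emeasure_eq_measure)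
qed

lemma nn_integral_longer:
  assumes V: "V \<in> borel_measurable (hist Z k)" and s: "0 \<le> s"
  shows "(\<integral>\<^sup>+z. indicator (longer k s) z * V z \<partial>M)
    = (\<integral>\<^sup>+z. (indicator (live k) z * ennreal (exp (- rate Z k z * s))) * V z \<partial>M)"
proof (rule measure_eq_on_hist[OF _ _ V])
  have ex: "(\<lambda>z. exp (- rate Z k z * s)) \<in> borel_measurable M"
    using measurable_hist_M[OF exp_rate_measurable[of "-1" k s]] by simp
  show "(\<lambda>z. indicator (live k) z * ennreal (exp (- rate Z k z * s))) \<in> borel_measurable M"
    using ex active_sets_M by simp
  show "indicator (longer k s) \<in> borel_measurable M" using longer_sets by simp
  fix A assume A: "A \<in> sets (hist Z k)"
  have "(\<integral>\<^sup>+z. indicator (longer k s) z * indicator A z \<partial>M) = emeasure M (longer k s \<inter> A)"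
    using longer_sets sets_hist_M[OF A] by (simp flip: indicator_inter_arith)
  also have "... = (\<integral>\<^sup>+z. ennreal (indicator (A \<inter> live k) z * exp (- rate Z k z * s)) \<partial>M)"
    unfolding emeasure_longer[OF A s]
  proof (rule nn_integral_eq_integral[symmetric])
    show "integrable M (\<lambda>z. indicator (A \<inter> live k) z * exp (- rate Z k z * s))"
      using rate_nonneg s ex sets_hist_M[OF A] active_sets_M
      by (intro integrable_const_bound[where B=1] AE_I2) (auto simp: indicator_def)
  qed simp
  also have "... = (\<integral>\<^sup>+z. (indicator (live k) z * ennreal (exp (- rate Z k z * s))) * indicator A z \<partial>M)"
    by (intro nn_integral_cong) (auto simp: indicator_def)
  finally show "(\<integral>\<^sup>+z. indicator (longer k s) z * indicator A z \<partial>M) = ..." .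
qed

lemma nn_integral_not_longer:
  assumes V: "V \<in> borel_measurable (hist Z k)" and s: "0 \<le> s"
  shows "(\<integral>\<^sup>+z. indicator (live k - longer k s) z * V z \<partial>M)
    = (\<integral>\<^sup>+z. (indicator (live k) z * ennreal (1 - exp (- rate Z k z * s))) * V z \<partial>M)"
proof (rule measure_eq_on_hist[OF _ _ V])
  have ex: "(\<lambda>z. exp (- rate Z k z * s)) \<in> borel_measurable M"
    using measurable_hist_M[OF exp_rate_measurable[of "-1" k s]] by simp
  show "(\<lambda>z. indicator (live k) z * ennreal (1 - exp (- rate Z k z * s))) \<in> borel_measurable M"
    using ex active_sets_M by simp
  show "indicator (live k - longer k s) \<in> borel_measurable M" using longer_sets active_sets_M by simp
  fix A assume A: "A \<in> sets (hist Z k)"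
  note A_M = sets_hist_M[OF A]
  have int: "integrable M (\<lambda>z. indicator (A \<inter> live k) z * exp (- rate Z k z * s))"
    using rate_nonneg s ex A_M active_sets_M
    by (intro integrable_const_bound[where B=1] AE_I2) (auto simp: indicator_def)
  have int1: "integrable M (\<lambda>z. indicator (A \<inter> live k) z :: real)"
    using A_M active_sets_M by (intro integrable_real_indicator) (auto simp: less_top[symmetric])
  have "(\<integral>\<^sup>+z. indicator (live k - longer k s) z * indicator A z \<partial>M) = emeasure M ((live k - longer k s) \<inter> A)"
    using longer_sets active_sets_M A_M by (simp flip: indicator_inter_arith)
  also have "(live k - longer k s) \<inter> A = (A \<inter> live k) - (longer k s \<inter> A)" by auto
  also have "emeasure M ... = ennreal (measure M (A \<inter> live k) - measure M (longer k s \<inter> A))"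
    using longer_sets active_sets_M A_M longer_subset[of k s]
    by (subst emeasure_eq_measure) (subst finite_measure_Diff, auto)
  also have "measure M (longer k s \<inter> A) = (\<integral>z. indicator (A \<inter> live k) z * exp (- rate Z k z * s) \<partial>M)"
    unfolding measure_def emeasure_longer[OF A s] by (intro enn2real_ennreal Bochner_Integration.integral_nonneg) simp
  also have "measure M (A \<inter> live k) - ... = (\<integral>z. indicator (A \<inter> live k) z - indicator (A \<inter> live k) z * exp (- rate Z k z * s) \<partial>M)"
    using int int1 A_M active_sets_M by simp
  also have "ennreal ... = (\<integral>\<^sup>+z. ennreal (indicator (A \<inter> live k) z - indicator (A \<inter> live k) z * exp (- rate Z k z * s)) \<partial>M)"
    using int int1 rate_nonneg s
    by (intro nn_integral_eq_integral[symmetric] Bochner_Integration.integrable_diff AE_I2) (auto simp: indicator_def)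
  also have "... = (\<integral>\<^sup>+z. (indicator (live k) z * ennreal (1 - exp (- rate Z k z * s))) * indicator A z \<partial>M)"
    by (intro nn_integral_cong) (auto simp: indicator_def)
  finally show "(\<integral>\<^sup>+z. indicator (live k - longer k s) z * indicator A z \<partial>M) = ..." .
qed

end

lemma exp_decay:
  fixes b :: real
  assumes "0 < b" shows "((\<lambda>s. exp (- b * s)) \<longlongrightarrow> 0) at_top"
proof -
  have "filterlim (\<lambda>s. - b * s) at_bot at_top"
    using assms by (intro filterlim_tendsto_neg_mult_at_bot[OF tendsto_const _ filterlim_ident]) simp
  then show ?thesis by (rule filterlim_compose[OF exp_at_bot])
qed

lemma nn_integral_exp_atLeast:
  fixes b c :: real
  assumes "0 < b" "0 \<le> c"
  shows "(\<integral>\<^sup>+s. ennreal (c * exp (- b * s)) * indicator {a..} s \<partial>lborel) = ennreal (c / b * exp (- b * a))"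
proof -
  have "(\<integral>\<^sup>+s. ennreal (c * exp (- b * s)) * indicator {a..} s \<partial>lborel) = ennreal (0 - (- c / b * exp (- b * a)))"
  proof (rule nn_integral_FTC_atLeast)
    show "((\<lambda>s. - c / b * exp (- b * s)) has_real_derivative c * exp (- b * s)) (at s)" for s
      using assms by (auto intro!: derivative_eq_intros)
    from tendsto_mult[OF tendsto_const exp_decay[OF assms(1)], of "- c / b"]
    show "((\<lambda>s. - c / b * exp (- b * s)) \<longlongrightarrow> 0) at_top" by simp
  qed (use assms in auto)
  then show ?thesis by simp
qed

context reveal_process
begin

text \<open>Given the past, each summand is a standard exponential variable as long as the process goes on at a positive
  rate, so \<open>elapsed k\<close> is about \<open>k\<close>.\<close>

definition elapsed :: "nat \<Rightarrow> 'w \<Rightarrow> real" where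
  "elapsed k z = (\<Sum>j<k. rate Z j z * (rtime (Suc j) z - rtime j z))"

lemma elapsed_measurable: "elapsed k \<in> borel_measurable (hist Z k)"
  unfolding elapsed_def
  by (intro borel_measurable_sum borel_measurable_times borel_measurable_times_ennreal borel_measurable_diff
       measurable_hist_mono[OF rate_measurable] measurable_hist_mono[OF rtime_measurable]) auto

lemma longer_iff:
  assumes "z \<in> occurred (Suc k)"
  shows "z \<in> longer k s \<longleftrightarrow> s < rtime (Suc k) z - rtime k z"
proof -
  have "z \<in> occurred k" using assms occurred_antimono[of k "Suc k"] by auto
  then show ?thesis
    using assms occurred_Suc_subset_active[of k] by (auto simp: longer_def time_eq_rtime algebra_simps)
qed

lemma rtime_less: "z \<in> occurred (Suc k) \<Longrightarrow> rtime k z < rtime (Suc k) z"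
  using time_less_Suc[of z k] occurred_antimono[of k "Suc k"] time_eq_rtime[of z k] time_eq_rtime[of z "Suc k"] by auto

lemma longer_pair_measurable:
  "(\<lambda>p. indicator (longer k (snd p)) (fst p) :: ennreal) \<in> borel_measurable (M \<Otimes>\<^sub>M borel)"
proof -
  let ?N = "M \<Otimes>\<^sub>M (borel :: real measure)"
  have t: "(\<lambda>p. time Z j (fst p)) \<in> borel_measurable ?N" for j
    by (rule measurable_compose[OF measurable_fst time_measurable_M])
  have e: "(\<lambda>p. ereal (snd p)) \<in> borel_measurable ?N"
    by (rule measurable_compose[OF measurable_snd]) simp
  have 1: "{p \<in> space ?N. time Z k (fst p) + ereal (snd p) < time Z (Suc k) (fst p)} \<in> sets ?N"
    by (intro borel_measurable_less borel_measurable_ereal_add t e)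
  have 2: "live k \<times> UNIV \<in> sets ?N" using active_sets_M by simp
  have "(\<lambda>p. indicator (live k \<times> UNIV \<inter> {p \<in> space ?N. time Z k (fst p) + ereal (snd p) < time Z (Suc k) (fst p)}) p :: ennreal) \<in> borel_measurable ?N"
    using 1 2 by (intro borel_measurable_indicator) blast
  then show ?thesis
    by (rule measurable_cong[THEN iffD1, rotated]) (auto simp: longer_def indicator_def space_pair_measure)
qed

text \<open>A function of the waiting time is the integral of its derivative \<open>f\<close> over those \<open>s\<close> that the waiting time
  exceeds, or has not reached. The event \<open>S s\<close> stands for either case and \<open>q\<close> for its conditional probability;
  the two integrations are exchanged.\<close>

lemma waiting_time_integral:
  fixes f q :: "real \<Rightarrow> real \<Rightarrow> real"
  assumes V: "V \<in> borel_measurable (hist Z k)"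
    and f: "(\<lambda>p. f (fst p) (snd p)) \<in> borel_measurable (borel \<Otimes>\<^sub>M borel)"
    and q: "(\<lambda>p. q (fst p) (snd p)) \<in> borel_measurable (borel \<Otimes>\<^sub>M borel)"
    and S: "(\<lambda>p. indicator (S (snd p)) (fst p) :: ennreal) \<in> borel_measurable (M \<Otimes>\<^sub>M borel)"
    and id: "\<And>V s. V \<in> borel_measurable (hist Z k) \<Longrightarrow> 0 \<le> s \<Longrightarrow>
      (\<integral>\<^sup>+z. indicator (S s) z * V z \<partial>M) = (\<integral>\<^sup>+z. (indicator (live k) z * ennreal (q (rate Z k z) s)) * V z \<partial>M)"
  shows "(\<integral>\<^sup>+z. (\<integral>\<^sup>+s. ennreal (f (rate Z k z) s) * indicator {0..} s * indicator (S s) z \<partial>lborel) * V z \<partial>M)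
    = (\<integral>\<^sup>+z. indicator (live k) z * (\<integral>\<^sup>+s. ennreal (q (rate Z k z) s) * (ennreal (f (rate Z k z) s) * indicator {0..} s) \<partial>lborel) * V z \<partial>M)"
proof -
  interpret L: pair_sigma_finite M lborel ..
  let ?A = "live k"
  let ?g = "\<lambda>z s. ennreal (f (rate Z k z) s) * indicator {0..} s"
  let ?N = "M \<Otimes>\<^sub>M (lborel :: real measure)"
  have VM: "V \<in> borel_measurable M" by (rule measurable_hist_M[OF V])
  have Vp: "(\<lambda>p. V (fst p)) \<in> borel_measurable ?N" by (rule measurable_compose[OF measurable_fst VM])
  have rM: "rate Z k \<in> borel_measurable M" by (rule measurable_hist_M[OF rate_measurable])
  have sets_N: "sets ?N = sets (M \<Otimes>\<^sub>M borel)" by (intro sets_pair_measure_cong) simp_all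
  have rs: "(\<lambda>p. (rate Z k (fst p), snd p)) \<in> ?N \<rightarrow>\<^sub>M borel \<Otimes>\<^sub>M borel"
    by (intro measurable_Pair measurable_compose[OF measurable_fst rM] measurable_compose[OF measurable_snd]) simp
  have fp: "(\<lambda>p. ennreal (f (rate Z k (fst p)) (snd p))) \<in> borel_measurable ?N"
    using measurable_compose[OF measurable_compose[OF rs f] measurable_ennreal] by (simp only: fst_conv snd_conv)
  have qp: "(\<lambda>p. ennreal (q (rate Z k (fst p)) (snd p))) \<in> borel_measurable ?N"
    using measurable_compose[OF measurable_compose[OF rs q] measurable_ennreal] by (simp only: fst_conv snd_conv)
  have ip: "(\<lambda>p. indicator {0..} (snd p) :: ennreal) \<in> borel_measurable ?N"
    by (rule measurable_compose[OF measurable_snd]) simp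
  have Sp: "(\<lambda>p. indicator (S (snd p)) (fst p) :: ennreal) \<in> borel_measurable ?N"
    using S by (simp only: measurable_cong_sets[OF sets_N refl])
  have Ap: "(\<lambda>p. indicator ?A (fst p) :: ennreal) \<in> borel_measurable ?N"
    by (rule measurable_compose[OF measurable_fst borel_measurable_indicator[OF active_sets_M]])
  have sec: "(\<lambda>s. h (z, s)) \<in> borel_measurable lborel" if "h \<in> borel_measurable ?N" "z \<in> space M" for h :: "'w \<times> real \<Rightarrow> ennreal" and z
    by (rule measurable_Pair2[OF that])
  have "(\<integral>\<^sup>+z. (\<integral>\<^sup>+s. ?g z s * indicator (S s) z \<partial>lborel) * V z \<partial>M)
    = (\<integral>\<^sup>+z. (\<integral>\<^sup>+s. ?g z s * indicator (S s) z * V z \<partial>lborel) \<partial>M)"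
  proof (intro nn_integral_cong nn_integral_multc[symmetric])
    fix z assume w: "z \<in> space M"
    have "(\<lambda>p. ennreal (f (rate Z k (fst p)) (snd p)) * indicator {0..} (snd p) * indicator (S (snd p)) (fst p)) \<in> borel_measurable ?N"
      by (intro borel_measurable_times borel_measurable_times_ennreal fp ip Sp)
    from sec[OF this w] show "(\<lambda>s. ?g z s * indicator (S s) z) \<in> borel_measurable lborel"
      by (simp only: fst_conv snd_conv)
  qed
  also have "... = (\<integral>\<^sup>+s. (\<integral>\<^sup>+z. ?g z s * indicator (S s) z * V z \<partial>M) \<partial>lborel)"
  proof (rule L.Fubini'[symmetric])
    show "(\<lambda>(z, s). ?g z s * indicator (S s) z * V z) \<in> borel_measurable ?N"
      unfolding split_beta' by (intro borel_measurable_times borel_measurable_times_ennreal fp ip Sp Vp)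
  qed
  also have "... = (\<integral>\<^sup>+s. (\<integral>\<^sup>+z. (indicator ?A z * ennreal (q (rate Z k z) s)) * (?g z s * V z) \<partial>M) \<partial>lborel)"
  proof (rule nn_integral_cong)
    fix s :: real
    have fs: "(\<lambda>z. ennreal (f (rate Z k z) s)) \<in> borel_measurable (hist Z k)"
    proof -
      have "(\<lambda>z. (rate Z k z, s)) \<in> hist Z k \<rightarrow>\<^sub>M borel \<Otimes>\<^sub>M borel"
        by (intro measurable_Pair rate_measurable measurable_const) simp
      from measurable_compose[OF measurable_compose[OF this f] measurable_ennreal] show ?thesis by (simp only: fst_conv snd_conv)
    qed
    have W: "(\<lambda>z. ?g z s * V z) \<in> borel_measurable (hist Z k)"
      by (intro borel_measurable_times borel_measurable_times_ennreal fs V borel_measurable_const)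
    show "(\<integral>\<^sup>+z. ?g z s * indicator (S s) z * V z \<partial>M)
      = (\<integral>\<^sup>+z. (indicator ?A z * ennreal (q (rate Z k z) s)) * (?g z s * V z) \<partial>M)"
    proof (cases "0 \<le> s")
      case True
      from id[OF W True] show ?thesis by (simp only: mult_ac)
    qed simp
  qed
  also have "... = (\<integral>\<^sup>+z. (\<integral>\<^sup>+s. (indicator ?A z * ennreal (q (rate Z k z) s)) * (?g z s * V z) \<partial>lborel) \<partial>M)"
  proof (rule L.Fubini')
    show "(\<lambda>(z, s). (indicator ?A z * ennreal (q (rate Z k z) s)) * (?g z s * V z)) \<in> borel_measurable ?N"
      unfolding split_beta' by (intro borel_measurable_times borel_measurable_times_ennreal fp qp ip Ap Vp)
  qed
  also have "... = (\<integral>\<^sup>+z. indicator ?A z * (\<integral>\<^sup>+s. ennreal (q (rate Z k z) s) * ?g z s \<partial>lborel) * V z \<partial>M)"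
  proof (intro nn_integral_cong)
    fix z assume w: "z \<in> space M"
    have "(\<lambda>p. ennreal (q (rate Z k (fst p)) (snd p)) * (ennreal (f (rate Z k (fst p)) (snd p)) * indicator {0..} (snd p))) \<in> borel_measurable ?N"
      by (intro borel_measurable_times borel_measurable_times_ennreal fp ip qp)
    from sec[OF this w] have m: "(\<lambda>s. ennreal (q (rate Z k z) s) * ?g z s) \<in> borel_measurable lborel"
      by (simp only: fst_conv snd_conv)
    have "(\<integral>\<^sup>+s. (indicator ?A z * ennreal (q (rate Z k z) s)) * (?g z s * V z) \<partial>lborel)
      = (\<integral>\<^sup>+s. (indicator ?A z * V z) * (ennreal (q (rate Z k z) s) * ?g z s) \<partial>lborel)"
      by (simp only: mult_ac)
    also have "... = (indicator ?A z * V z) * (\<integral>\<^sup>+s. ennreal (q (rate Z k z) s) * ?g z s \<partial>lborel)"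
      by (rule nn_integral_cmult[OF m])
    finally show "(\<integral>\<^sup>+s. (indicator ?A z * ennreal (q (rate Z k z) s)) * (?g z s * V z) \<partial>lborel)
      = indicator ?A z * (\<integral>\<^sup>+s. ennreal (q (rate Z k z) s) * ?g z s \<partial>lborel) * V z"
      by (simp only: mult_ac)
  qed
  finally show ?thesis .
qed

lemma elapsed_Suc: "elapsed (Suc k) z = elapsed k z + rate Z k z * (rtime (Suc k) z - rtime k z)"
  by (simp add: elapsed_def)

lemma V_measurable: "(\<lambda>z. ennreal (exp (th * elapsed k z))) \<in> borel_measurable (hist Z k)"
  by (rule measurable_compose[OF measurable_compose[OF _ borel_measurable_exp] measurable_ennreal])
     (intro borel_measurable_times borel_measurable_times_ennreal borel_measurable_const elapsed_measurable)

text \<open>Given the past, an exponential moment of a standard exponential variable is \<open>1 / (1 - th)\<close>; there is only an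
  inequality, since the next reveal may fail to take place.\<close>

lemma exp_elapsed_upper:
  assumes th: "0 < th" "th < 1"
  shows "(\<integral>\<^sup>+z. indicator (occurred k) z * ennreal (exp (th * elapsed k z)) \<partial>M) \<le> ennreal ((1 / (1 - th)) ^ k)"
proof (induction k)
  case 0
  have "(\<integral>\<^sup>+z. indicator (occurred 0) z * ennreal (exp (th * elapsed 0 z)) \<partial>M) = (\<integral>\<^sup>+z. indicator (occurred 0) z \<partial>M)"
    by (simp add: elapsed_def)
  also have "... = emeasure M (occurred 0)" using occurred_sets_M by simp
  also have "... \<le> 1" by (rule emeasure_le_1)
  finally show ?case by simp
next
  case (Suc k)
  let ?A = "live k"
  define V where "V z = ennreal (exp (th * elapsed k z))" for z
  have V: "V \<in> borel_measurable (hist Z k)" unfolding V_def by (rule V_measurable)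
  define f where "f r s = th * r * exp (th * r * s)" for r s :: real
  let ?g = "\<lambda>z s. ennreal (f (rate Z k z) s) * indicator {0..} s"
  define I where "I z = (\<integral>\<^sup>+s. ?g z s * indicator (longer k s) z \<partial>lborel)" for z
  have f_meas: "(\<lambda>p. f (fst p) (snd p)) \<in> borel_measurable (borel \<Otimes>\<^sub>M borel)" unfolding f_def by measurable
  have pw: "indicator (occurred (Suc k)) z * ennreal (exp (th * elapsed (Suc k) z)) \<le> indicator ?A z * V z + I z * V z" for z
  proof (cases "z \<in> occurred (Suc k)")
    case True
    then have act: "z \<in> ?A" using occurred_Suc_subset_active by blast
    define r where "r = rate Z k z"
    define w where "w = rtime (Suc k) z - rtime k z"
    have r: "0 \<le> r" using rate_nonneg[OF occurred_space[OF True]] by (simp add: r_def)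
    have w: "0 \<le> w" using rtime_less[OF True] by (simp add: w_def)
    have "I z = (\<integral>\<^sup>+s. ennreal (f r s) * indicator {0..w} s \<partial>lborel)"
      unfolding I_def r_def[symmetric]
    proof (rule nn_integral_cong_AE)
      show "AE s in lborel. ennreal (f r s) * indicator {0..} s * indicator (longer k s) z = ennreal (f r s) * indicator {0..w} s"
        using AE_lborel_singleton[of w] by eventually_elim (auto simp: indicator_def longer_iff[OF True] w_def)
    qed
    also have "... = ennreal (exp (th * r * w) - exp (th * r * 0))"
    proof (rule nn_integral_FTC_Icc)
      show "((\<lambda>s. exp (th * r * s)) has_real_derivative f r s) (at s)" for s
        unfolding f_def by (auto intro!: derivative_eq_intros)
      show "0 \<le> f r s" for s using th r by (simp add: f_def)
      show "f r \<in> borel_measurable borel" unfolding f_def by measurable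
    qed (rule w)
    finally have "1 + I z = ennreal (exp (th * r * w))"
      using th r w by (simp add: ennreal_1[symmetric] del: ennreal_1 flip: ennreal_plus)
    then have "ennreal (exp (th * elapsed (Suc k) z)) = (1 + I z) * V z"
      unfolding elapsed_Suc V_def by (simp add: distrib_left exp_add r_def w_def mult.assoc mult.commute flip: ennreal_mult)
    then show ?thesis using True act by (simp add: distrib_right)
  qed simp
  have I_le: "(\<integral>\<^sup>+s. ennreal (exp (- r * s)) * (ennreal (f r s) * indicator {0..} s) \<partial>lborel) \<le> ennreal (th / (1 - th))" if r: "0 \<le> r" for r
  proof (cases "r = 0")
    case True then show ?thesis by (simp add: f_def)
  next
    case False
    then have r: "0 < r" using r by simp
    have "(\<integral>\<^sup>+s. ennreal (exp (- r * s)) * (ennreal (f r s) * indicator {0..} s) \<partial>lborel)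
      = (\<integral>\<^sup>+s. ennreal (th * r * exp (- ((1 - th) * r) * s)) * indicator {0..} s \<partial>lborel)"
    proof (intro nn_integral_cong)
      fix s :: real
      have "ennreal (exp (- r * s)) * ennreal (f r s) = ennreal (exp (- r * s) * f r s)"
        using th r by (simp add: f_def ennreal_mult)
      also have "exp (- r * s) * f r s = th * r * exp (- ((1 - th) * r) * s)"
        by (simp add: f_def algebra_simps flip: exp_add)
      finally show "ennreal (exp (- r * s)) * (ennreal (f r s) * indicator {0..} s) = ennreal (th * r * exp (- ((1 - th) * r) * s)) * indicator {0..} s"
        by (simp only: mult.assoc[symmetric])
    qed
    also have "... = ennreal (th * r / ((1 - th) * r) * exp (- ((1 - th) * r) * 0))"
      using th r by (intro nn_integral_exp_atLeast) auto
    also have "... = ennreal (th / (1 - th))" using r by simp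
    finally show ?thesis by simp
  qed
  have I_meas: "I \<in> borel_measurable M"
  proof -
    have fp: "(\<lambda>p. ennreal (f (rate Z k (fst p)) (snd p))) \<in> borel_measurable (M \<Otimes>\<^sub>M lborel)"
    proof -
      have "(\<lambda>p. (rate Z k (fst p), snd p)) \<in> M \<Otimes>\<^sub>M lborel \<rightarrow>\<^sub>M borel \<Otimes>\<^sub>M borel"
        by (intro measurable_Pair measurable_compose[OF measurable_fst measurable_hist_M[OF rate_measurable]] measurable_compose[OF measurable_snd]) simp
      from measurable_compose[OF measurable_compose[OF this f_meas] measurable_ennreal] show ?thesis by (simp only: fst_conv snd_conv)
    qed
    have ip: "(\<lambda>p. indicator {0..} (snd p) :: ennreal) \<in> borel_measurable (M \<Otimes>\<^sub>M (lborel :: real measure))"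
      by (rule measurable_compose[OF measurable_snd]) simp
    have sets_N: "sets (M \<Otimes>\<^sub>M (lborel :: real measure)) = sets (M \<Otimes>\<^sub>M borel)" by (intro sets_pair_measure_cong) simp_all
    have "(\<lambda>p. indicator (longer k (snd p)) (fst p) :: ennreal) \<in> borel_measurable (M \<Otimes>\<^sub>M lborel)"
      using longer_pair_measurable by (simp only: measurable_cong_sets[OF sets_N refl])
    with fp ip have "(\<lambda>(z, s). ?g z s * indicator (longer k s) z) \<in> borel_measurable (M \<Otimes>\<^sub>M lborel)"
      unfolding split_beta' by (intro borel_measurable_times borel_measurable_times_ennreal)
    then show ?thesis unfolding I_def by (rule lborel.borel_measurable_nn_integral)
  qed
  have VM: "V \<in> borel_measurable M" by (rule measurable_hist_M[OF V])
  have "(\<integral>\<^sup>+z. indicator (occurred (Suc k)) z * ennreal (exp (th * elapsed (Suc k) z)) \<partial>M)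
    \<le> (\<integral>\<^sup>+z. indicator ?A z * V z + I z * V z \<partial>M)"
    by (intro nn_integral_mono pw)
  also have "... = (\<integral>\<^sup>+z. indicator ?A z * V z \<partial>M) + (\<integral>\<^sup>+z. I z * V z \<partial>M)"
    by (intro nn_integral_add borel_measurable_times borel_measurable_times_ennreal borel_measurable_indicator active_sets_M VM I_meas)
  also have "(\<integral>\<^sup>+z. I z * V z \<partial>M) = (\<integral>\<^sup>+z. indicator ?A z * (\<integral>\<^sup>+s. ennreal (exp (- rate Z k z * s)) * (?g z s) \<partial>lborel) * V z \<partial>M)"
    unfolding I_def
    by (rule waiting_time_integral[OF V f_meas _ longer_pair_measurable nn_integral_longer]) measurable
  also have "... \<le> (\<integral>\<^sup>+z. ennreal (th / (1 - th)) * (indicator ?A z * V z) \<partial>M)"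
  proof (intro nn_integral_mono)
    fix z assume "z \<in> space M"
    from I_le[OF rate_nonneg[OF this]]
    have "indicator ?A z * (\<integral>\<^sup>+s. ennreal (exp (- rate Z k z * s)) * (?g z s) \<partial>lborel) * V z
      \<le> indicator ?A z * ennreal (th / (1 - th)) * V z"
      by (intro mult_right_mono mult_left_mono) auto
    then show "indicator ?A z * (\<integral>\<^sup>+s. ennreal (exp (- rate Z k z * s)) * (?g z s) \<partial>lborel) * V z
      \<le> ennreal (th / (1 - th)) * (indicator ?A z * V z)" by (simp only: mult_ac)
  qed
  also have "... = ennreal (th / (1 - th)) * (\<integral>\<^sup>+z. indicator ?A z * V z \<partial>M)"
    by (intro nn_integral_cmult borel_measurable_times borel_measurable_times_ennreal borel_measurable_indicator active_sets_M VM)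
  finally have "(\<integral>\<^sup>+z. indicator (occurred (Suc k)) z * ennreal (exp (th * elapsed (Suc k) z)) \<partial>M)
    \<le> (1 + ennreal (th / (1 - th))) * (\<integral>\<^sup>+z. indicator ?A z * V z \<partial>M)" by (simp add: distrib_right add_left_mono)
  also have "(\<integral>\<^sup>+z. indicator ?A z * V z \<partial>M) \<le> (\<integral>\<^sup>+z. indicator (occurred k) z * V z \<partial>M)"
    using active_subset_occurred[of k] by (intro nn_integral_mono mult_right_mono) (auto simp: indicator_def)
  also have "... \<le> ennreal ((1 / (1 - th)) ^ k)" using Suc by (simp add: V_def)
  also have "1 + ennreal (th / (1 - th)) = ennreal (1 / (1 - th))"
    using th by (simp add: ennreal_1[symmetric] divide_simps del: ennreal_1 flip: ennreal_plus)
  also have "ennreal (1 / (1 - th)) * ennreal ((1 / (1 - th)) ^ k) = ennreal ((1 / (1 - th)) ^ Suc k)"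
    using th by (simp flip: ennreal_mult)
  finally show ?case by (simp add: mult_left_mono)
qed

text \<open>At rate 0 the waiting time exceeds every \<open>N\<close>.\<close>

lemma AE_rate_pos: "AE z in M. z \<in> occurred (Suc k) \<longrightarrow> 0 < rate Z k z"
proof -
  let ?A = "live k"
  have "AE z in M. \<not> (z \<in> ?A - longer k (real N) \<and> rate Z k z = 0)" for N :: nat
  proof -
    define V where "V z = (indicator {z \<in> space (hist Z k). rate Z k z = 0} z :: ennreal)" for z
    have V: "V \<in> borel_measurable (hist Z k)" unfolding V_def
      by (intro borel_measurable_indicator borel_measurable_eq rate_measurable borel_measurable_const)
    have "(\<integral>\<^sup>+z. indicator (?A - longer k (real N)) z * V z \<partial>M)
      = (\<integral>\<^sup>+z. (indicator ?A z * ennreal (1 - exp (- rate Z k z * real N))) * V z \<partial>M)"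
      by (rule nn_integral_not_longer[OF V]) simp
    also have "... = (\<integral>\<^sup>+z. 0 \<partial>M)"
      by (intro nn_integral_cong) (auto simp: V_def indicator_def)
    finally have "(\<integral>\<^sup>+z. indicator (?A - longer k (real N)) z * V z \<partial>M) = 0" by simp
    moreover have "(\<lambda>z. indicator (?A - longer k (real N)) z * V z) \<in> borel_measurable M"
      using active_sets_M longer_sets
      by (intro borel_measurable_times_ennreal borel_measurable_indicator measurable_hist_M[OF V]) blast
    ultimately have "AE z in M. indicator (?A - longer k (real N)) z * V z = 0"
      by (simp only: nn_integral_0_iff_AE)
    then show ?thesis using AE_space
      by eventually_elim (auto simp: V_def indicator_def space_hist split: if_splits)
  qed
  then have "AE z in M. \<forall>N :: nat. \<not> (z \<in> ?A - longer k (real N) \<and> rate Z k z = 0)"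
    by (simp only: AE_all_countable) blast
  then show ?thesis
  proof eventually_elim
    case (elim z)
    show ?case
    proof
      assume occ: "z \<in> occurred (Suc k)"
      obtain N :: nat where "rtime (Suc k) z - rtime k z \<le> real N" using real_arch_simple by blast
      then have "z \<in> ?A - longer k (real N)"
        using occ occurred_Suc_subset_active[of k] longer_iff[OF occ, of "real N"] by auto
      then have "rate Z k z \<noteq> 0" using elim by blast
      then show "0 < rate Z k z" using rate_nonneg[OF occurred_space[OF occ], of k] by simp
    qed
  qed
qed

text \<open>As in \<open>exp_elapsed_upper\<close>, but a decreasing function is the integral of its derivative over those \<open>s\<close> that the
  waiting time has not reached; then waiting times that are infinite contribute nothing.\<close>

lemma exp_elapsed_lower:
  assumes th: "0 < th"
  shows "(\<integral>\<^sup>+z. indicator (occurred k) z * ennreal (exp (- th * elapsed k z)) \<partial>M) \<le> ennreal ((1 / (1 + th)) ^ k)"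
proof (induction k)
  case 0
  have "(\<integral>\<^sup>+z. indicator (occurred 0) z * ennreal (exp (- th * elapsed 0 z)) \<partial>M) = (\<integral>\<^sup>+z. indicator (occurred 0) z \<partial>M)"
    by (simp add: elapsed_def)
  also have "... = emeasure M (occurred 0)" using occurred_sets_M by simp
  also have "... \<le> 1" by (rule emeasure_le_1)
  finally show ?case by simp
next
  case (Suc k)
  let ?A = "live k"
  define V where "V z = ennreal (exp (- th * elapsed k z))" for z
  have V: "V \<in> borel_measurable (hist Z k)" unfolding V_def by (rule V_measurable)
  define f where "f r s = (if 0 \<le> r then th * r * exp (- (th * r) * s) else 0)" for r s :: real
  let ?g = "\<lambda>z s. ennreal (f (rate Z k z) s) * indicator {0..} s"
  define I where "I z = (\<integral>\<^sup>+s. ?g z s * indicator (?A - longer k s) z \<partial>lborel)" for z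
  have f_meas: "(\<lambda>p. f (fst p) (snd p)) \<in> borel_measurable (borel \<Otimes>\<^sub>M borel)" unfolding f_def by measurable
  have pw: "AE z in M. indicator (occurred (Suc k)) z * ennreal (exp (- th * elapsed (Suc k) z)) \<le> I z * V z"
    using AE_rate_pos[of k]
  proof eventually_elim
    case (elim z)
    show ?case
    proof (cases "z \<in> occurred (Suc k)")
      case True
      then have act: "z \<in> ?A" using occurred_Suc_subset_active by blast
      define r where "r = rate Z k z"
      define w where "w = rtime (Suc k) z - rtime k z"
      have r: "0 < r" using elim True by (simp add: r_def)
      have w: "0 < w" using rtime_less[OF True] by (simp add: w_def)
      have "I z = (\<integral>\<^sup>+s. ennreal (th * r * exp (- (th * r) * s)) * indicator {w..} s \<partial>lborel)"
        unfolding I_def r_def[symmetric]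
        using w r act by (intro nn_integral_cong) (auto simp: indicator_def longer_iff[OF True] w_def f_def)
      also have "... = ennreal (th * r / (th * r) * exp (- (th * r) * w))"
        using th r by (intro nn_integral_exp_atLeast) auto
      finally have "I z = ennreal (exp (- (th * r) * w))" using th r by simp
      then have "ennreal (exp (- th * elapsed (Suc k) z)) = I z * V z"
        unfolding elapsed_Suc V_def by (simp add: r_def w_def algebra_simps exp_diff exp_add exp_minus divide_inverse flip: ennreal_mult)
      then show ?thesis using True by simp
    qed simp
  qed
  have I_le: "(\<integral>\<^sup>+s. ennreal (1 - exp (- r * s)) * (ennreal (f r s) * indicator {0..} s) \<partial>lborel) \<le> ennreal (1 / (1 + th))" if r: "0 \<le> r" for r
  proof (cases "r = 0")
    case True then show ?thesis by (simp add: f_def)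
  next
    case False
    then have r: "0 < r" using r by simp
    have "(\<integral>\<^sup>+s. ennreal (1 - exp (- r * s)) * (ennreal (f r s) * indicator {0..} s) \<partial>lborel)
      = (\<integral>\<^sup>+s. ennreal (th * r * exp (- (th * r) * s) - th * r * exp (- ((1 + th) * r) * s)) * indicator {0..} s \<partial>lborel)"
    proof (intro nn_integral_cong)
      fix s :: real
      show "ennreal (1 - exp (- r * s)) * (ennreal (f r s) * indicator {0..} s)
        = ennreal (th * r * exp (- (th * r) * s) - th * r * exp (- ((1 + th) * r) * s)) * indicator {0..} s"
      proof (cases "0 \<le> s")
        case True
        have "exp (- ((1 + th) * r) * s) = exp (- r * s) * exp (- (th * r) * s)" by (simp add: algebra_simps flip: exp_add)
        then have "(1 - exp (- r * s)) * f r s = th * r * exp (- (th * r) * s) - th * r * exp (- ((1 + th) * r) * s)"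
          using r by (simp add: f_def left_diff_distrib)
        moreover have "ennreal (1 - exp (- r * s)) * ennreal (f r s) = ennreal ((1 - exp (- r * s)) * f r s)"
          using th r True by (intro ennreal_mult[symmetric]) (auto simp: f_def)
        ultimately show ?thesis using True by simp
      qed simp
    qed
    also have "... = ennreal (0 - (- exp (- (th * r) * 0) + th / (1 + th) * exp (- ((1 + th) * r) * 0)))"
    proof (rule nn_integral_FTC_atLeast)
      show "((\<lambda>s. - exp (- (th * r) * s) + th / (1 + th) * exp (- ((1 + th) * r) * s))
        has_real_derivative th * r * exp (- (th * r) * s) - th * r * exp (- ((1 + th) * r) * s)) (at s)" for s
        using th r by (auto intro!: derivative_eq_intros simp: divide_simps) (simp add: algebra_simps)
      show "0 \<le> th * r * exp (- (th * r) * s) - th * r * exp (- ((1 + th) * r) * s)" if "0 \<le> s" for s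
      proof -
        have "exp (- ((1 + th) * r) * s) \<le> exp (- (th * r) * s)" using r that by (simp add: mult_right_mono)
        then have "th * r * exp (- ((1 + th) * r) * s) \<le> th * r * exp (- (th * r) * s)" using th r by (intro mult_left_mono) auto
        then show ?thesis by simp
      qed
      have "((\<lambda>s. - exp (- (th * r) * s) + th / (1 + th) * exp (- ((1 + th) * r) * s)) \<longlongrightarrow> - 0 + th / (1 + th) * 0) at_top"
        using th r by (intro tendsto_add tendsto_minus tendsto_mult tendsto_const exp_decay) auto
      then show "((\<lambda>s. - exp (- (th * r) * s) + th / (1 + th) * exp (- ((1 + th) * r) * s)) \<longlongrightarrow> 0) at_top" by simp
    qed simp
    also have "0 - (- exp (- (th * r) * 0) + th / (1 + th) * exp (- ((1 + th) * r) * 0)) = 1 / (1 + th)"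
      using th by (simp add: divide_simps)
    finally show ?thesis by simp
  qed
  have S_meas: "(\<lambda>p. indicator (?A - longer k (snd p)) (fst p) :: ennreal) \<in> borel_measurable (M \<Otimes>\<^sub>M borel)"
  proof -
    note [measurable] = longer_pair_measurable
    have [measurable]: "(\<lambda>p. indicator ?A (fst p) :: ennreal) \<in> borel_measurable (M \<Otimes>\<^sub>M (borel :: real measure))"
      by (rule measurable_compose[OF measurable_fst borel_measurable_indicator[OF active_sets_M]])
    have "(\<lambda>p. indicator ?A (fst p) - indicator (longer k (snd p)) (fst p) :: ennreal) \<in> borel_measurable (M \<Otimes>\<^sub>M borel)"
      by measurable
    moreover have "indicator ?A z - indicator (longer k s) z = (indicator (?A - longer k s) z :: ennreal)" for z s
      using longer_subset[of k s] by (auto simp: indicator_def)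
    ultimately show ?thesis by (simp only:)
  qed
  have "(\<integral>\<^sup>+z. indicator (occurred (Suc k)) z * ennreal (exp (- th * elapsed (Suc k) z)) \<partial>M) \<le> (\<integral>\<^sup>+z. I z * V z \<partial>M)"
    by (intro nn_integral_mono_AE pw)
  also have "(\<integral>\<^sup>+z. I z * V z \<partial>M) = (\<integral>\<^sup>+z. indicator ?A z * (\<integral>\<^sup>+s. ennreal (1 - exp (- rate Z k z * s)) * (?g z s) \<partial>lborel) * V z \<partial>M)"
    unfolding I_def
    by (rule waiting_time_integral[OF V f_meas _ S_meas nn_integral_not_longer]) measurable
  also have "... \<le> (\<integral>\<^sup>+z. ennreal (1 / (1 + th)) * (indicator (occurred k) z * V z) \<partial>M)"
  proof (intro nn_integral_mono)
    fix z assume "z \<in> space M"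
    from I_le[OF rate_nonneg[OF this]]
    have "indicator ?A z * (\<integral>\<^sup>+s. ennreal (1 - exp (- rate Z k z * s)) * (?g z s) \<partial>lborel) * V z
      \<le> indicator (occurred k) z * ennreal (1 / (1 + th)) * V z"
      using active_subset_occurred[of k] by (intro mult_right_mono mult_mono) (auto simp: indicator_def)
    then show "indicator ?A z * (\<integral>\<^sup>+s. ennreal (1 - exp (- rate Z k z * s)) * (?g z s) \<partial>lborel) * V z
      \<le> ennreal (1 / (1 + th)) * (indicator (occurred k) z * V z)" by (simp only: mult_ac)
  qed
  also have "... = ennreal (1 / (1 + th)) * (\<integral>\<^sup>+z. indicator (occurred k) z * V z \<partial>M)"
    by (intro nn_integral_cmult borel_measurable_times_ennreal borel_measurable_indicator occurred_sets_M measurable_hist_M[OF V])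
  also have "... \<le> ennreal (1 / (1 + th)) * ennreal ((1 / (1 + th)) ^ k)"
    using Suc by (intro mult_left_mono) (simp_all add: V_def)
  also have "... = ennreal ((1 / (1 + th)) ^ Suc k)"
    using th by (simp flip: ennreal_mult)
  finally show ?case .
qed

lemma prob_exp_Markov:
  assumes S: "S \<in> sets M" "S \<subseteq> occurred k" and le: "\<And>z. z \<in> S \<Longrightarrow> u \<le> X z"
    and int: "(\<integral>\<^sup>+z. indicator (occurred k) z * ennreal (exp (X z)) \<partial>M) \<le> ennreal B" and B: "0 \<le> B"
  shows "prob S \<le> exp (- u) * B"
proof -
  have "ennreal (exp u * prob S) = ennreal (exp u) * emeasure M S" by (simp add: emeasure_eq_measure ennreal_mult')
  also have "... = (\<integral>\<^sup>+z. ennreal (exp u) * indicator S z \<partial>M)" using S(1) by (simp add: nn_integral_cmult)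
  also have "... \<le> (\<integral>\<^sup>+z. indicator (occurred k) z * ennreal (exp (X z)) \<partial>M)"
    using S(2) le by (intro nn_integral_mono) (auto simp: indicator_def intro!: ennreal_leI)
  also have "... \<le> ennreal B" by (rule int)
  finally have "exp u * prob S \<le> B" using B by simp
  then show ?thesis by (simp add: exp_minus field_simps)
qed

text \<open>Chernoff bounds with a parameter \<open>th\<close> that is so small that the quadratic error \<open>2 * th\<^sup>2 * k\<close> of the logarithms
  is at most half of the linear gain \<open>th * \<eta> * n\<close>.\<close>

lemma elapsed_deviation:
  assumes \<eta>: "0 < \<eta>" and C: "0 < C" and k: "real k \<le> C * real n"
  defines "th \<equiv> min (1/2) (\<eta> / (4 * C))"
  shows "prob {z \<in> occurred k. \<eta> * real n \<le> \<bar>elapsed k z - real k\<bar>} \<le> 2 * exp (- (th * \<eta> / 2) * real n)"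
proof -
  have th: "0 < th" "th \<le> 1/2" "th \<le> \<eta> / (4 * C)" using \<eta> C by (auto simp: th_def)
  have th_C: "2 * th\<^sup>2 * real k \<le> th * \<eta> / 2 * real n"
  proof -
    have "2 * th\<^sup>2 * real k \<le> 2 * th\<^sup>2 * (C * real n)" by (intro mult_left_mono k) simp
    also have "... = (th * (4 * C)) * (th / 2 * real n)" by (simp add: power2_eq_square)
    also have "... \<le> \<eta> * (th / 2 * real n)"
      using th C by (intro mult_right_mono) (auto simp: le_divide_eq)
    finally show ?thesis by (simp add: mult_ac)
  qed
  let ?U = "{z \<in> occurred k. real k + \<eta> * real n \<le> elapsed k z}"
  let ?L = "{z \<in> occurred k. elapsed k z \<le> real k - \<eta> * real n}"
  have eM: "elapsed k \<in> borel_measurable M" by (rule measurable_hist_M[OF elapsed_measurable])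
  have U: "?U \<in> sets M"
  proof -
    have "occurred k \<inter> {z \<in> space M. real k + \<eta> * real n \<le> elapsed k z} \<in> sets M"
      by (intro sets.Int occurred_sets_M borel_measurable_le borel_measurable_const eM)
    moreover have "occurred k \<inter> {z \<in> space M. real k + \<eta> * real n \<le> elapsed k z} = ?U" using occurred_space by auto
    ultimately show ?thesis by simp
  qed
  have L: "?L \<in> sets M"
  proof -
    have "occurred k \<inter> {z \<in> space M. elapsed k z \<le> real k - \<eta> * real n} \<in> sets M"
      by (intro sets.Int occurred_sets_M borel_measurable_le borel_measurable_const eM)
    moreover have "occurred k \<inter> {z \<in> space M. elapsed k z \<le> real k - \<eta> * real n} = ?L" using occurred_space by auto
    ultimately show ?thesis by simp
  qed
  have "prob ?U \<le> exp (- (th * (real k + \<eta> * real n))) * (1 / (1 - th)) ^ k"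
    by (rule prob_exp_Markov[OF U _ _ exp_elapsed_upper]) (use th in auto)
  also have "... = exp (- (th * (real k + \<eta> * real n)) - real k * ln (1 - th))"
    using th by (simp add: exp_diff exp_of_nat_mult power_one_over)
  also have "... \<le> exp (- (th * \<eta> / 2) * real n)"
  proof -
    have "- th - 2 * th\<^sup>2 \<le> ln (1 - th)" using th by (intro ln_one_minus_pos_lower_bound) auto
    then have "real k * (- th - 2 * th\<^sup>2) \<le> real k * ln (1 - th)" by (intro mult_left_mono) auto
    then show ?thesis using th_C by (simp add: algebra_simps)
  qed
  finally have 1: "prob ?U \<le> exp (- (th * \<eta> / 2) * real n)" .
  have "prob ?L \<le> exp (- (- th * (real k - \<eta> * real n))) * (1 / (1 + th)) ^ k"
    by (rule prob_exp_Markov[OF L _ _ exp_elapsed_lower]) (use th in \<open>auto intro: mult_left_mono_neg\<close>)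
  also have "... = exp (th * (real k - \<eta> * real n) - real k * ln (1 + th))"
    using th by (simp add: exp_diff exp_of_nat_mult power_one_over)
  also have "... \<le> exp (- (th * \<eta> / 2) * real n)"
  proof -
    have "th - th\<^sup>2 \<le> ln (1 + th)" using th by (intro ln_one_plus_pos_lower_bound) auto
    then have "real k * (th - th\<^sup>2) \<le> real k * ln (1 + th)" by (intro mult_left_mono) auto
    moreover have "th\<^sup>2 * real k \<le> th * \<eta> / 2 * real n"
      by (rule order.trans[OF _ th_C]) simp
    ultimately show ?thesis using th_C by (simp add: algebra_simps)
  qed
  finally have 2: "prob ?L \<le> exp (- (th * \<eta> / 2) * real n)" .
  have "{z \<in> occurred k. \<eta> * real n \<le> \<bar>elapsed k z - real k\<bar>} \<subseteq> ?U \<union> ?L" by auto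
  then have "prob {z \<in> occurred k. \<eta> * real n \<le> \<bar>elapsed k z - real k\<bar>} \<le> prob (?U \<union> ?L)"
    using U L by (intro finite_measure_mono) auto
  also have "... \<le> prob ?U + prob ?L" by (rule measure_Un_le[OF U L])
  finally show ?thesis using 1 2 by simp
qed

end

section \<open>Reveal times and the cumulative intensity\<close>

locale timed_process = reveal_process P n Z + reveal_intensity R
  for P :: "'x network" and n and Z :: "('x, 'w) reveal_run" and R :: "real \<Rightarrow> real"
begin

definition R0 :: "real \<Rightarrow> real" where "R0 t = indicator {0..} t * R t"

definition gap :: "nat \<Rightarrow> 'w \<Rightarrow> real set" where
  "gap j z = {t. time Z j z < ereal t \<and> ereal t < time Z (Suc j) z}"

definition gap_error :: "nat \<Rightarrow> 'w \<Rightarrow> ennreal" where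
  "gap_error j z = (\<integral>\<^sup>+t. indicator (live j) z * indicator (gap j z) t * ennreal \<bar>rate Z j z - real n * R0 t\<bar> \<partial>lborel)"

definition rate_error :: "'w \<Rightarrow> ennreal" where
  "rate_error z = (\<integral>\<^sup>+t\<in>{t. 0 \<le> t \<and> ereal t \<le> stop_time P n Z z}.
     ennreal \<bar>intensity P n Z t z - real n * R t\<bar> \<partial>lborel)"

lemma R0_measurable [measurable]: "R0 \<in> borel_measurable borel"
  unfolding R0_def[abs_def] by (rule R_restricted_measurable)

lemma gap_measurable: "(\<lambda>p. indicator (gap j (fst p)) (snd p) :: ennreal) \<in> borel_measurable (M \<Otimes>\<^sub>M lborel)"
proof -
  let ?N = "M \<Otimes>\<^sub>M (lborel :: real measure)"
  have t: "(\<lambda>p. time Z j (fst p)) \<in> borel_measurable ?N" for j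
    by (rule measurable_compose[OF measurable_fst time_measurable_M])
  have e: "(\<lambda>p. ereal (snd p)) \<in> borel_measurable ?N"
    by (rule measurable_compose[OF measurable_snd]) simp
  have "{p \<in> space ?N. time Z j (fst p) < ereal (snd p) \<and> ereal (snd p) < time Z (Suc j) (fst p)} \<in> sets ?N"
    by (intro sets.sets_Collect_conj borel_measurable_less t e)
  then have "(\<lambda>p. indicator {p. time Z j (fst p) < ereal (snd p) \<and> ereal (snd p) < time Z (Suc j) (fst p)} p :: ennreal) \<in> borel_measurable ?N"
    by (rule borel_measurable_indicator_Collect)
  then show ?thesis by (simp add: gap_def indicator_def)
qed

lemma gap_error_measurable: "gap_error j \<in> borel_measurable M"
proof -
  let ?N = "M \<Otimes>\<^sub>M (lborel :: real measure)"
  have a: "(\<lambda>p. indicator (live j) (fst p) :: ennreal) \<in> borel_measurable ?N"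
    by (rule measurable_compose[OF measurable_fst borel_measurable_indicator[OF active_sets_M]])
  have r: "(\<lambda>p. rate Z j (fst p)) \<in> borel_measurable ?N"
    by (rule measurable_compose[OF measurable_fst measurable_hist_M[OF rate_measurable]])
  have R: "(\<lambda>p. R0 (snd p)) \<in> borel_measurable ?N"
    by (rule measurable_compose[OF measurable_snd]) simp
  have e: "(\<lambda>p. ennreal \<bar>rate Z j (fst p) - real n * R0 (snd p)\<bar>) \<in> borel_measurable ?N"
    by (rule measurable_compose[OF _ measurable_ennreal])
       (intro borel_measurable_abs borel_measurable_diff borel_measurable_times borel_measurable_const r R)
  have "(\<lambda>(z, t). indicator (live j) z * indicator (gap j z) t * ennreal \<bar>rate Z j z - real n * R0 t\<bar>) \<in> borel_measurable ?N"
    unfolding split_beta' by (intro borel_measurable_times_ennreal a gap_measurable e)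
  then show ?thesis unfolding gap_error_def by (rule lborel.borel_measurable_nn_integral)
qed

text \<open>The error splits at the reveal times. Each part is an integral that depends measurably on the sample
  point, which makes the whole error measurable.\<close>

lemma rate_error_eq:
  assumes w: "z \<in> space M" shows "rate_error z = (\<Sum>j\<le>in_count. gap_error j z)"
proof -
  let ?g = "\<lambda>j t. indicator (live j) z * indicator (gap j z) t * ennreal \<bar>rate Z j z - real n * R0 t\<bar>"
  have "AE t in lborel. \<forall>c\<in>insert 0 ((\<lambda>j. rtime j z) ` {..in_count}). t \<noteq> c"
    by (intro AE_finite_allI) (auto intro: AE_lborel_singleton)
  then have "rate_error z = (\<integral>\<^sup>+t. (\<Sum>j\<le>in_count. ?g j t) \<partial>lborel)"
    unfolding rate_error_def
  proof (intro nn_integral_cong_AE, eventually_elim)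
    case (elim t)
    show ?case
    proof (cases "0 < t")
      case False
      then have "t < 0" using elim by auto
      then have "t \<notin> gap j z" for j using time_nonneg[OF w, of j] by (auto simp: gap_def intro: order.trans dest: order.strict_trans1)
      then show ?thesis using \<open>t < 0\<close> by simp
    next
      case True
      obtain i where i: "i \<le> last_reveal z" "current i (ereal t) z" using current_exists[OF w less_imp_le[OF True]] by blast
      have im: "i \<le> in_count" using i(1) last_reveal_le[OF w] by simp
      have occ: "z \<in> occurred i" using i(2) by (simp add: current_def)
      have lt: "time Z i z < ereal t"
        using i(2) elim im time_eq_rtime[OF occ] by (auto simp: current_def less_le)
      have stop_iff: "ereal t \<le> stop_time P n Z z \<longleftrightarrow> z \<in> live i"
      proof
        assume "z \<in> live i"
        show "ereal t \<le> stop_time P n Z z"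
        proof (cases "i = last_reveal z")
          case True
          then show ?thesis using \<open>z \<in> live i\<close> stop_time_eq[OF w] by simp
        next
          case False
          then have S: "z \<in> occurred (Suc i)" using i(1) last_reveal(2)[OF w] by simp
          then have "ereal t \<le> time Z (Suc i) z" using i(2) by (auto simp: current_def occurred_def)
          also have "... \<le> stop_time P n Z z" by (rule occurred_le_stop_time[OF S])
          finally show ?thesis .
        qed
      next
        assume le: "ereal t \<le> stop_time P n Z z"
        show "z \<in> live i"
        proof (rule ccontr)
          assume na: "z \<notin> live i"
          then have "z \<notin> occurred (Suc i)" using occurred_Suc_subset_active by blast
          then have "i = last_reveal z" using i(1) last_reveal(2)[OF w] by simp
          then have "stop_time P n Z z = time Z i z" using na stop_time_eq[OF w] by simp
          then show False using le lt by simp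
        qed
      qed
      have gap_iff: "z \<in> live j \<and> t \<in> gap j z \<longleftrightarrow> j = i \<and> z \<in> live i" for j
      proof
        assume j: "z \<in> live j \<and> t \<in> gap j z"
        have "\<not> j < i"
          using j i(2) time_mono[OF w, of "Suc j" i] by (auto simp: gap_def current_def)
        moreover have "\<not> i < j"
          using j i(2) time_mono[OF w, of "Suc i" j] by (auto simp: gap_def current_def)
        ultimately show "j = i \<and> z \<in> live i" using j by auto
      next
        assume "j = i \<and> z \<in> live i"
        then show "z \<in> live j \<and> t \<in> gap j z" using lt i(2) by (auto simp: gap_def current_def)
      qed
      have "(\<Sum>j\<le>in_count. ?g j t) = (\<Sum>j\<le>in_count. if j = i then indicator (live i) z * ennreal \<bar>rate Z i z - real n * R0 t\<bar> else 0)"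
        using gap_iff by (intro sum.cong refl) (auto simp: indicator_def)
      also have "... = indicator (live i) z * ennreal \<bar>rate Z i z - real n * R0 t\<bar>" using im by simp
      also have "... = ennreal \<bar>intensity P n Z t z - real n * R t\<bar> * indicator {t. 0 \<le> t \<and> ereal t \<le> stop_time P n Z z} t"
        using True stop_iff reveals_current[OF i(2)] by (auto simp: intensity_def R0_def indicator_def)
      finally show ?thesis by simp
    qed
  qed
  also have "... = (\<Sum>j\<le>in_count. gap_error j z)"
    unfolding gap_error_def
  proof (rule nn_integral_sum)
    fix j
    have "gap j z \<in> sets lborel"
    proof -
      have "{t \<in> space borel. time Z j z < ereal t \<and> ereal t < time Z (Suc j) z} \<in> sets borel"
        by (intro sets.sets_Collect_conj borel_measurable_less borel_measurable_const borel_measurable_ereal)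
           simp_all
      then show ?thesis by (simp add: gap_def)
    qed
    then show "?g j \<in> borel_measurable lborel" by simp
  qed
  finally show ?thesis .
qed

lemma rate_error_measurable: "rate_error \<in> borel_measurable M"
proof -
  have "(\<lambda>z. \<Sum>j\<le>in_count. gap_error j z) \<in> borel_measurable M"
    by (intro borel_measurable_sum gap_error_measurable)
  then show ?thesis by (rule measurable_cong[THEN iffD1, rotated]) (simp add: rate_error_eq)
qed

lemma gap_error_le: "z \<in> space M \<Longrightarrow> j \<le> in_count \<Longrightarrow> gap_error j z \<le> rate_error z"
  unfolding rate_error_eq by (rule member_le_sum) auto

lemma R0_integrable: "integrable lborel R0"
  using R_integrable by (simp add: set_integrable_def R0_def[abs_def])

lemma R0_nonneg: "0 \<le> R0 t" using R_positive[of t] by (auto simp: R0_def indicator_def less_imp_le)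

lemma integral_R0: "A \<in> sets borel \<Longrightarrow> (\<integral>t. indicator A t * R0 t \<partial>lborel) = measure intensity_measure A"
proof -
  assume A: "A \<in> sets borel"
  have "emeasure intensity_measure A = (\<integral>\<^sup>+t. ennreal (R0 t) * indicator A t \<partial>lborel)"
    unfolding intensity_measure_def R0_def using A by (intro emeasure_density) auto
  also have "... = (\<integral>\<^sup>+t. ennreal (indicator A t * R0 t) \<partial>lborel)"
    by (intro nn_integral_cong) (simp add: indicator_def)
  also have "... = ennreal (\<integral>t. indicator A t * R0 t \<partial>lborel)"
    using A R0_integrable R0_nonneg
    by (intro nn_integral_eq_integral AE_I2 mult_nonneg_nonneg) (auto simp: mult.commute[of "indicator A _"] intro: integrable_real_mult_indicator)
  finally show ?thesis
    using R0_nonneg by (simp add: measure_def Bochner_Integration.integral_nonneg)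
qed

text \<open>On the interval between two reveals, \<open>rate * length\<close> is the integral of the intensity.\<close>

lemma gap_error_bound:
  assumes occ: "z \<in> occurred (Suc j)"
  shows "ennreal \<bar>rate Z j z * (rtime (Suc j) z - rtime j z) - real n * (cum (rtime (Suc j) z) - cum (rtime j z))\<bar> \<le> gap_error j z"
proof -
  define a b r where "a = rtime j z" and "b = rtime (Suc j) z" and "r = rate Z j z"
  have occ': "z \<in> occurred j" using occ occurred_antimono[of j "Suc j"] by auto
  have ab: "a < b" using rtime_less[OF occ] by (simp add: a_def b_def)
  have gap: "gap j z = {a<..<b}" using occ occ' by (auto simp: gap_def time_eq_rtime a_def b_def)
  have act: "z \<in> live j" using occ occurred_Suc_subset_active by blast
  have "measure intensity_measure {a<..<b} = measure intensity_measure {a<..b}"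
    by (rule finite_measure_eq_AE) (use AE_intensity_neq[of b] in \<open>auto elim!: eventually_mono\<close>)
  then have cums: "(\<integral>t. indicator {a<..<b} t * R0 t \<partial>lborel) = cum b - cum a"
    using ab by (simp add: integral_R0 measure_Ioc_eq_cum)
  have i1: "integrable lborel (\<lambda>t. r * indicator {a<..<b} t)"
    using ab by (intro integrable_mult_right integrable_real_indicator) auto
  have i2: "integrable lborel (\<lambda>t. real n * (indicator {a<..<b} t * R0 t))"
    using integrable_real_mult_indicator[OF _ R0_integrable, of "{a<..<b}"] by (intro integrable_mult_right) (simp add: mult.commute)
  have eq: "r * (b - a) - real n * (cum b - cum a) = (\<integral>t. r * indicator {a<..<b} t - real n * (indicator {a<..<b} t * R0 t) \<partial>lborel)"
    using i1 i2 ab by (simp add: cums)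
  have "ennreal \<bar>r * (b - a) - real n * (cum b - cum a)\<bar> \<le> (\<integral>\<^sup>+t. ennreal \<bar>r * indicator {a<..<b} t - real n * (indicator {a<..<b} t * R0 t)\<bar> \<partial>lborel)"
    unfolding eq using integral_norm_bound_ennreal[OF Bochner_Integration.integrable_diff[OF i1 i2]] by (simp only: real_norm_def)
  also have "... = gap_error j z"
    unfolding gap_error_def gap r_def[symmetric]
  proof (intro nn_integral_cong)
    fix t :: real
    show "ennreal \<bar>r * indicator {a<..<b} t - real n * (indicator {a<..<b} t * R0 t)\<bar>
      = indicator (live j) z * indicator {a<..<b} t * ennreal \<bar>r - real n * R0 t\<bar>"
      using act by (cases "t \<in> {a<..<b}") simp_all
  qed
  finally show ?thesis by (simp only: a_def b_def r_def)
qed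

lemma elapsed_cum:
  assumes occ: "z \<in> occurred k" and e: "rate_error z \<le> ennreal e" "0 \<le> e"
  shows "\<bar>elapsed k z - real n * cum (rtime k z)\<bar> \<le> e"
proof -
  let ?d = "\<lambda>j. rate Z j z * (rtime (Suc j) z - rtime j z) - real n * (cum (rtime (Suc j) z) - cum (rtime j z))"
  have w: "z \<in> space M" by (rule occurred_space[OF occ])
  have "cum (rtime 0 z) = 0" using time_0[OF w] by (simp add: rtime_def cum_eq_0)
  then have "(\<Sum>j<k. cum (rtime (Suc j) z) - cum (rtime j z)) = cum (rtime k z)"
    using sum_lessThan_telescope[of "\<lambda>j. cum (rtime j z)" k] by simp
  then have "elapsed k z - real n * cum (rtime k z) = (\<Sum>j<k. ?d j)"
    unfolding elapsed_def sum_subtractf[of _ "\<lambda>j. real n * _ j"] sum_distrib_left[symmetric] by simp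
  then have "ennreal \<bar>elapsed k z - real n * cum (rtime k z)\<bar> \<le> ennreal (\<Sum>j<k. \<bar>?d j\<bar>)"
    by (intro ennreal_leI) (simp only: sum_abs)
  also have "... = (\<Sum>j<k. ennreal \<bar>?d j\<bar>)" by (simp add: sum_ennreal)
  also have "... \<le> (\<Sum>j<k. gap_error j z)"
  proof (intro sum_mono gap_error_bound)
    fix j assume "j \<in> {..<k}"
    then show "z \<in> occurred (Suc j)" using occ occurred_antimono[of "Suc j" k] by auto
  qed
  also have "... \<le> (\<Sum>j\<le>in_count. gap_error j z)"
    using occurred_le_in_count[OF occ] by (intro sum_mono2) auto
  also have "... \<le> ennreal e" using e rate_error_eq[OF w] by simp
  finally show ?thesis using e(2) by simp
qed

text \<open>If the process is stuck after its last reveal, then its intensity is 0 forever, so almost all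
  of the total mass of \<open>R\<close> has been used up.\<close>

lemma stuck_cum:
  assumes act: "z \<in> live k" and stuck: "time Z (Suc k) z = \<infinity>" and e: "rate_error z \<le> ennreal e" "0 \<le> e"
  shows "real n * (cum_total - cum (rtime k z)) \<le> e"
proof -
  have occ: "z \<in> occurred k" using act active_subset_occurred by blast
  have w: "z \<in> space M" by (rule occurred_space[OF occ])
  define T r where "T = rtime k z" and "r = rate Z k z"
  have gap: "gap k z = {T<..}" using occ stuck by (auto simp: gap_def time_eq_rtime T_def)
  have r0: "0 \<le> r" using rate_nonneg[OF w] by (simp add: r_def)
  have ge: "(\<integral>\<^sup>+t. indicator {T<..} t * ennreal \<bar>r - real n * R0 t\<bar> \<partial>lborel) \<le> ennreal e"
    using gap_error_le[OF w occurred_le_in_count[OF occ]] e(1) act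
    by (simp add: gap_error_def gap r_def)
  have nnR: "(\<integral>\<^sup>+t. indicator {T<..} t * ennreal (real n * R0 t) \<partial>lborel) = ennreal (real n * (cum_total - cum T))"
  proof -
    have "(\<integral>\<^sup>+t. indicator {T<..} t * ennreal (real n * R0 t) \<partial>lborel) = (\<integral>\<^sup>+t. ennreal (real n) * (ennreal (R0 t) * indicator {T<..} t) \<partial>lborel)"
      using R0_nonneg by (intro nn_integral_cong) (auto simp: indicator_def ennreal_mult')
    also have "... = ennreal (real n) * emeasure intensity_measure {T<..}"
      unfolding intensity_measure_def R0_def[symmetric]
      by (subst nn_integral_cmult) (auto simp: emeasure_density)
    also have "emeasure intensity_measure {T<..} = ennreal (cum_total - cum T)"
    proof -
      have "{T<..} = UNIV - {..T}" by auto
      then show ?thesis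
        by (simp add: emeasure_eq_measure finite_measure_Diff measure_UNIV_eq_cum_total measure_atMost_eq_cum)
    qed
    finally show ?thesis using cum_le_total[of T] by (simp add: ennreal_mult')
  qed
  have "r = 0"
  proof (rule ccontr)
    assume "r \<noteq> 0"
    then have r: "0 < r" using r0 by simp
    have "\<infinity> = (\<integral>\<^sup>+t. ennreal r * indicator {T<..} t \<partial>lborel)"
    proof -
      have "ennreal (real N * r) \<le> (\<integral>\<^sup>+t. ennreal r * indicator {T<..} t \<partial>lborel)" for N :: nat
      proof -
        have "ennreal (real N * r) = (\<integral>\<^sup>+t. ennreal r * indicator {T<..T + real N} t \<partial>lborel)"
          using r by (simp add: nn_integral_cmult ennreal_mult' mult.commute)
        also have "... \<le> (\<integral>\<^sup>+t. ennreal r * indicator {T<..} t \<partial>lborel)"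
          by (intro nn_integral_mono mult_left_mono) (auto simp: indicator_def)
        finally show ?thesis .
      qed
      moreover have "\<exists>N :: nat. y < real N * r" for y using r reals_Archimedean3 by blast
      ultimately show ?thesis
        by (metis ennreal_less_iff infinity_ennreal_def leD less_top linorder_not_less order.strict_trans2 ennreal_cases ennreal_le_iff2 mult_nonneg_nonneg of_nat_0_le_iff order_less_imp_le r)
    qed
    also have "... \<le> (\<integral>\<^sup>+t. indicator {T<..} t * ennreal \<bar>r - real n * R0 t\<bar> + indicator {T<..} t * ennreal (real n * R0 t) \<partial>lborel)"
    proof (intro nn_integral_mono)
      fix t
      have "ennreal r \<le> ennreal (\<bar>r - real n * R0 t\<bar> + real n * R0 t)" by (intro ennreal_leI) simp
      also have "... = ennreal \<bar>r - real n * R0 t\<bar> + ennreal (real n * R0 t)" using R0_nonneg by (intro ennreal_plus) auto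
      finally show "ennreal r * indicator {T<..} t \<le> indicator {T<..} t * ennreal \<bar>r - real n * R0 t\<bar> + indicator {T<..} t * ennreal (real n * R0 t)"
        by (simp add: indicator_def)
    qed
    also have "... = (\<integral>\<^sup>+t. indicator {T<..} t * ennreal \<bar>r - real n * R0 t\<bar> \<partial>lborel) + (\<integral>\<^sup>+t. indicator {T<..} t * ennreal (real n * R0 t) \<partial>lborel)"
      by (rule nn_integral_add) simp_all
    also have "... \<le> ennreal e + ennreal (real n * (cum_total - cum T))" unfolding nnR by (intro add_mono ge order.refl)
    finally show False by (simp add: top_unique flip: ennreal_plus)
  qed
  have "ennreal (real n * (cum_total - cum T)) = (\<integral>\<^sup>+t. indicator {T<..} t * ennreal \<bar>r - real n * R0 t\<bar> \<partial>lborel)"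
    unfolding nnR[symmetric] using R0_nonneg \<open>r = 0\<close> by (intro nn_integral_cong) simp
  then have "ennreal (real n * (cum_total - cum T)) \<le> ennreal e" using ge by simp
  then show ?thesis using e(2) by (simp add: T_def)
qed

end

section \<open>Sequences of processes\<close>

locale loss_reveal_sequence = limit_model P R lam
  for P :: "'x::countable network" and R :: "real \<Rightarrow> real" and lam :: real +
  fixes Z :: "nat \<Rightarrow> ('x, 'w) reveal_run" and \<mu> :: "'x pmf"
  assumes processes: "1 \<le> n \<Longrightarrow> loss_reveal_process P n (Z n)"
    and types: "(\<lambda>n. type_frac n (Z n) x) \<longlonglongrightarrow> pmf \<mu> x"
    and balance: "1 \<le> n \<Longrightarrow>
        (\<Sum>\<^sub>\<infinity>x. real (indeg P x) * type_frac n (Z n) x) = (\<Sum>\<^sub>\<infinity>x. real (outdeg P x) * type_frac n (Z n) x)"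
    and mean_degree: "(\<lambda>n. \<Sum>\<^sub>\<infinity>x. real (indeg P x) * type_frac n (Z n) x) \<longlonglongrightarrow> lam"
    and lam_in: "((\<lambda>x. real (indeg P x) * pmf \<mu> x) has_sum lam) UNIV"
    and lam_out: "((\<lambda>x. real (outdeg P x) * pmf \<mu> x) has_sum lam) UNIV"
    and R_limit: "small_op (\<lambda>n. PM (Z n)) (\<lambda>n z. enn2ereal
        (\<integral>\<^sup>+t\<in>{t. 0 \<le> t \<and> ereal t \<le> stop_time P n (Z n) z}.
            ennreal \<bar>intensity P n (Z n) t z - real n * R t\<bar> \<partial>lborel))"
begin

lemma timed_process: "1 \<le> n \<Longrightarrow> timed_process P n (Z n) R"
  by (intro timed_process.intro reveal_process.intro network_axioms reveal_intensity_axioms reveal_process_axioms.intro processes)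

lemma reveal_process: "1 \<le> n \<Longrightarrow> reveal_process P n (Z n)"
  using timed_process timed_process.axioms(1) by blast

abbreviation occ :: "nat \<Rightarrow> nat \<Rightarrow> 'w set" where "occ n \<equiv> reveal_process.occurred (Z n)"
abbreviation insolv :: "nat \<Rightarrow> nat \<Rightarrow> nat \<Rightarrow> 'w \<Rightarrow> bool" where "insolv n \<equiv> reveal_process.insolvent P (Z n)"
abbreviation final :: "nat \<Rightarrow> 'w \<Rightarrow> nat" where "final n \<equiv> reveal_process.last_reveal (Z n)"
abbreviation in_total :: "nat \<Rightarrow> nat" where "in_total n \<equiv> reveal_process.in_count P n (Z n)"

lemma sum_types:
  fixes w :: "'x \<Rightarrow> real"
  shows "(\<Sum>\<^sub>\<infinity>x. w x * type_frac n (Z n) x) = (\<Sum>i\<in>{1..n}. w (atype (Z n) i)) / real n"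
proof -
  let ?T = "atype (Z n) ` {1..n}"
  have "(\<Sum>\<^sub>\<infinity>x. w x * type_frac n (Z n) x) = (\<Sum>\<^sub>\<infinity>x\<in>?T. w x * type_frac n (Z n) x)"
  proof (rule infsum_cong_neutral)
    fix x assume "x \<in> UNIV - ?T"
    then have "{i \<in> {1..n}. atype (Z n) i = x} = {}" by auto
    then show "w x * type_frac n (Z n) x = 0" by (simp only: type_frac_def) simp
  qed auto
  also have "... = (\<Sum>x\<in>?T. w x * type_frac n (Z n) x)" by simp
  also have "... = (\<Sum>x\<in>?T. (\<Sum>i\<in>{i \<in> {1..n}. atype (Z n) i = x}. w (atype (Z n) i))) / real n"
  proof -
    have "(\<Sum>i\<in>{i \<in> {1..n}. atype (Z n) i = x}. w (atype (Z n) i)) = (\<Sum>i\<in>{i \<in> {1..n}. atype (Z n) i = x}. w x)" for x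
      by (intro sum.cong) auto
    then show ?thesis by (simp add: type_frac_def sum_divide_distrib mult.commute)
  qed
  also have "(\<Sum>x\<in>?T. (\<Sum>i\<in>{i \<in> {1..n}. atype (Z n) i = x}. w (atype (Z n) i))) = (\<Sum>i\<in>{1..n}. w (atype (Z n) i))"
    by (rule sum.image_gen[symmetric]) simp
  finally show ?thesis .
qed

text \<open>\<open>limit_weight w W\<close>: the empirical mean of \<open>w\<close> over the agents' types converges to its mean \<open>W\<close>
  under \<open>\<mu>\<close>, without loss of mass at infinity.\<close>

definition limit_weight :: "('x \<Rightarrow> real) \<Rightarrow> real \<Rightarrow> bool" where
  "limit_weight w W \<longleftrightarrow> (\<forall>x. 0 \<le> w x) \<and> ((\<lambda>x. w x * pmf \<mu> x) has_sum W) UNIV \<and>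
     (\<lambda>n. (\<Sum>i\<in>{1..n}. w (atype (Z n) i)) / real n) \<longlonglongrightarrow> W"

lemma limit_weight_in: "limit_weight (\<lambda>x. real (indeg P x)) lam"
  unfolding limit_weight_def using lam_in mean_degree by (simp add: sum_types)

lemma limit_weight_out: "limit_weight (\<lambda>x. real (outdeg P x)) lam"
proof -
  have "(\<lambda>n. \<Sum>\<^sub>\<infinity>x. real (outdeg P x) * type_frac n (Z n) x) \<longlonglongrightarrow> lam"
    by (rule Lim_transform_eventually[OF mean_degree]) (use balance in \<open>auto simp: eventually_sequentially\<close>)
  then show ?thesis unfolding limit_weight_def using lam_out by (simp add: sum_types)
qed

lemma pmf_has_sum: "(pmf \<mu> has_sum 1) UNIV"
proof -
  have "(\<lambda>x. norm (pmf \<mu> x)) summable_on UNIV"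
    using pmf_abs_summable[of \<mu> UNIV] by (simp only: abs_summable_equivalent)
  then have "(pmf \<mu> has_sum infsum (pmf \<mu>) UNIV) UNIV" by (simp add: has_sum_infsum)
  moreover have "infsum (pmf \<mu>) UNIV = 1"
    using infsetsum_infsum[OF pmf_abs_summable[of \<mu> UNIV]] infsetsum_pmf_eq_1[of \<mu> UNIV] by simp
  ultimately show ?thesis by (simp only:)
qed

lemma limit_weight_1: "limit_weight (\<lambda>x. 1) 1"
proof -
  have "(\<lambda>n. (\<Sum>i\<in>{1..n}. 1) / real n) \<longlonglongrightarrow> 1"
    by (rule Lim_transform_eventually[OF tendsto_const]) (auto simp: eventually_sequentially intro!: exI[of _ 1])
  then show ?thesis unfolding limit_weight_def using pmf_has_sum by simp
qed

lemma in_total_eq: "1 \<le> n \<Longrightarrow> real (in_total n) = (\<Sum>i\<in>{1..n}. real (indeg P (atype (Z n) i)))"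
  using reveal_process.in_count_eq[OF reveal_process] by simp

lemma in_total_limit: "(\<lambda>n. real (in_total n) / real n) \<longlonglongrightarrow> lam"
proof -
  have "(\<lambda>n. (\<Sum>i\<in>{1..n}. real (indeg P (atype (Z n) i))) / real n) \<longlonglongrightarrow> lam"
    using limit_weight_in by (simp add: limit_weight_def)
  then show ?thesis
    by (rule Lim_transform_eventually) (auto simp: eventually_sequentially in_total_eq intro!: exI[of _ 1])
qed

text \<open>Finitely many types carry almost all of the limit \<open>W\<close>. Their share converges, and so does the total, so the
  other types have a small share for all large \<open>n\<close>.\<close>

lemma limit_weight_tail:
  assumes w: "limit_weight w W" and e: "0 < e"
  shows "\<exists>F. finite F \<and> F \<subseteq> set_pmf \<mu> \<and> W - (\<Sum>x\<in>F. w x * pmf \<mu> x) < e \<and> (\<Sum>x\<in>F. w x * pmf \<mu> x) \<le> W \<and>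
    (\<forall>\<^sub>F n in sequentially. (\<Sum>i\<in>{i \<in> {1..n}. atype (Z n) i \<notin> F}. w (atype (Z n) i)) < e * real n)"
proof -
  have w0: "0 \<le> w x" for x using w by (simp add: limit_weight_def)
  have hs: "((\<lambda>x. w x * pmf \<mu> x) has_sum W) UNIV" using w by (simp add: limit_weight_def)
  have lim: "(\<lambda>n. (\<Sum>i\<in>{1..n}. w (atype (Z n) i)) / real n) \<longlonglongrightarrow> W" using w by (simp add: limit_weight_def)
  have "\<forall>\<^sub>F F in finite_subsets_at_top UNIV. W - e/2 < (\<Sum>x\<in>F. w x * pmf \<mu> x)"
    using hs e unfolding has_sum_def by (intro order_tendstoD) auto
  then obtain F0 where F0: "finite F0" "W - e/2 < (\<Sum>x\<in>F0. w x * pmf \<mu> x)"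
    by (auto simp: eventually_finite_subsets_at_top)
  define F where "F = F0 \<inter> set_pmf \<mu>"
  have F: "finite F" "F \<subseteq> set_pmf \<mu>" using F0 by (auto simp: F_def)
  have "(\<Sum>x\<in>F0. w x * pmf \<mu> x) = (\<Sum>x\<in>F. w x * pmf \<mu> x)"
    unfolding F_def using F0(1) by (intro sum.mono_neutral_right) (auto simp: set_pmf_iff)
  then have big: "W - e/2 < (\<Sum>x\<in>F. w x * pmf \<mu> x)" using F0 by simp
  have le: "(\<Sum>x\<in>F. w x * pmf \<mu> x) \<le> W"
    using hs F w0 by (intro has_sum_mono_neutral[OF has_sum_finite[OF F(1)] hs]) auto
  have part: "(\<Sum>i\<in>{i \<in> {1..n}. atype (Z n) i \<in> F}. w (atype (Z n) i)) / real n = (\<Sum>x\<in>F. w x * type_frac n (Z n) x)" for n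
  proof -
    have "(\<Sum>i\<in>{i \<in> {1..n}. atype (Z n) i \<in> F}. w (atype (Z n) i)) = (\<Sum>x\<in>F. \<Sum>i\<in>{i \<in> {i \<in> {1..n}. atype (Z n) i \<in> F}. atype (Z n) i = x}. w (atype (Z n) i))"
      using F(1) by (intro sum.group[symmetric]) auto
    also have "... = (\<Sum>x\<in>F. w x * real (card {i \<in> {1..n}. atype (Z n) i = x}))"
    proof (intro sum.cong refl)
      fix x assume "x \<in> F"
      then have "{i \<in> {i \<in> {1..n}. atype (Z n) i \<in> F}. atype (Z n) i = x} = {i \<in> {1..n}. atype (Z n) i = x}" by auto
      moreover have "(\<Sum>i\<in>{i \<in> {1..n}. atype (Z n) i = x}. w (atype (Z n) i)) = (\<Sum>i\<in>{i \<in> {1..n}. atype (Z n) i = x}. w x)"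
        by (intro sum.cong) auto
      ultimately show "(\<Sum>i\<in>{i \<in> {i \<in> {1..n}. atype (Z n) i \<in> F}. atype (Z n) i = x}. w (atype (Z n) i)) = w x * real (card {i \<in> {1..n}. atype (Z n) i = x})"
        by simp
    qed
    finally show ?thesis by (simp add: type_frac_def sum_divide_distrib)
  qed
  have "(\<lambda>n. (\<Sum>i\<in>{1..n}. w (atype (Z n) i)) / real n - (\<Sum>x\<in>F. w x * type_frac n (Z n) x)) \<longlonglongrightarrow> W - (\<Sum>x\<in>F. w x * pmf \<mu> x)"
    by (intro tendsto_diff lim tendsto_sum tendsto_mult tendsto_const types)
  moreover have "W - (\<Sum>x\<in>F. w x * pmf \<mu> x) < e" using big e by simp
  ultimately have "\<forall>\<^sub>F n in sequentially. (\<Sum>i\<in>{1..n}. w (atype (Z n) i)) / real n - (\<Sum>x\<in>F. w x * type_frac n (Z n) x) < e"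
    by (rule order_tendstoD)
  then have "\<forall>\<^sub>F n in sequentially. (\<Sum>i\<in>{i \<in> {1..n}. atype (Z n) i \<notin> F}. w (atype (Z n) i)) < e * real n"
    using eventually_gt_at_top[of 0]
  proof eventually_elim
    case (elim n)
    have un: "{1..n} = {i \<in> {1..n}. atype (Z n) i \<in> F} \<union> {i \<in> {1..n}. atype (Z n) i \<notin> F}" by blast
    have "(\<Sum>i\<in>{1..n}. w (atype (Z n) i)) = (\<Sum>i\<in>{i \<in> {1..n}. atype (Z n) i \<in> F}. w (atype (Z n) i)) + (\<Sum>i\<in>{i \<in> {1..n}. atype (Z n) i \<notin> F}. w (atype (Z n) i))"
      by (subst (1) un, rule sum.union_disjoint) auto
    then show ?case using elim by (simp add: part[symmetric] field_simps)
  qed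
  then show ?thesis using F big le e by (intro exI[of _ F]) auto
qed

text \<open>Many of the events below are not visibly measurable, so that a vanishing probability is understood in
  the sense of outer measures.\<close>

definition negligible :: "(nat \<Rightarrow> 'w set) \<Rightarrow> bool" where
  "negligible S \<longleftrightarrow> (\<exists>B. (\<forall>\<^sub>F n in sequentially. S n \<subseteq> B n \<and> B n \<in> sets (PM (Z n))) \<and> (\<lambda>n. measure (PM (Z n)) (B n)) \<longlonglongrightarrow> 0)"

lemma negligible_subset:
  assumes "negligible T" "\<forall>\<^sub>F n in sequentially. S n \<subseteq> T n" shows "negligible S"
proof -
  from assms(1) obtain B where B: "\<forall>\<^sub>F n in sequentially. T n \<subseteq> B n \<and> B n \<in> sets (PM (Z n))" "(\<lambda>n. measure (PM (Z n)) (B n)) \<longlonglongrightarrow> 0"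
    by (auto simp: negligible_def)
  from B(1) assms(2) have "\<forall>\<^sub>F n in sequentially. S n \<subseteq> B n \<and> B n \<in> sets (PM (Z n))" by eventually_elim blast
  then show ?thesis using B(2) by (auto simp: negligible_def)
qed

lemma negligible_Un:
  assumes "negligible S" "negligible T" shows "negligible (\<lambda>n. S n \<union> T n)"
proof -
  from assms obtain B C where B: "\<forall>\<^sub>F n in sequentially. S n \<subseteq> B n \<and> B n \<in> sets (PM (Z n))" "(\<lambda>n. measure (PM (Z n)) (B n)) \<longlonglongrightarrow> 0"
    and C: "\<forall>\<^sub>F n in sequentially. T n \<subseteq> C n \<and> C n \<in> sets (PM (Z n))" "(\<lambda>n. measure (PM (Z n)) (C n)) \<longlonglongrightarrow> 0"
    by (auto simp: negligible_def)
  have "(\<lambda>n. measure (PM (Z n)) (B n \<union> C n)) \<longlonglongrightarrow> 0"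
  proof (rule tendsto_sandwich[OF _ _ tendsto_const])
    show "\<forall>\<^sub>F n in sequentially. measure (PM (Z n)) (B n \<union> C n) \<le> measure (PM (Z n)) (B n) + measure (PM (Z n)) (C n)"
      using B(1) C(1) by eventually_elim (auto intro: measure_Un_le)
    show "(\<lambda>n. measure (PM (Z n)) (B n) + measure (PM (Z n)) (C n)) \<longlonglongrightarrow> 0"
      using tendsto_add[OF B(2) C(2)] by simp
  qed simp
  moreover have "\<forall>\<^sub>F n in sequentially. S n \<union> T n \<subseteq> B n \<union> C n \<and> B n \<union> C n \<in> sets (PM (Z n))"
    using B(1) C(1) by eventually_elim auto
  ultimately show ?thesis unfolding negligible_def by (intro exI[of _ "\<lambda>n. B n \<union> C n"] conjI)
qed

lemma negligible_empty: "negligible (\<lambda>n. {})"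
  unfolding negligible_def by (intro exI[of _ "\<lambda>n. {}"]) simp

lemma negligible_UN: "finite I \<Longrightarrow> (\<And>i. i \<in> I \<Longrightarrow> negligible (S i)) \<Longrightarrow> negligible (\<lambda>n. \<Union>i\<in>I. S i n)"
  by (induction I rule: finite_induct) (auto intro: negligible_empty negligible_Un)

lemma negligibleI:
  assumes "\<forall>\<^sub>F n in sequentially. S n \<in> sets (PM (Z n)) \<and> measure (PM (Z n)) (S n) \<le> b n" "b \<longlonglongrightarrow> 0"
  shows "negligible S"
proof -
  have "(\<lambda>n. measure (PM (Z n)) (S n)) \<longlonglongrightarrow> 0"
    by (rule tendsto_sandwich[OF _ _ tendsto_const assms(2)]) (use assms(1) in \<open>auto elim: eventually_mono\<close>)
  then show ?thesis unfolding negligible_def using assms(1) by (intro exI[of _ S]) (auto elim: eventually_mono)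
qed

lemma negligible_measure:
  assumes "negligible S" shows "(\<lambda>n. measure (PM (Z n)) (S n)) \<longlonglongrightarrow> 0"
proof -
  from assms obtain B where B: "\<forall>\<^sub>F n in sequentially. S n \<subseteq> B n \<and> B n \<in> sets (PM (Z n))" "(\<lambda>n. measure (PM (Z n)) (B n)) \<longlonglongrightarrow> 0"
    by (auto simp: negligible_def)
  show ?thesis
  proof (rule tendsto_sandwich[OF _ _ tendsto_const B(2)])
    show "\<forall>\<^sub>F n in sequentially. measure (PM (Z n)) (S n) \<le> measure (PM (Z n)) (B n)"
      using B(1) eventually_ge_at_top[of 1]
    proof eventually_elim
      case (elim n)
      interpret reveal_process P n "Z n" by (rule reveal_process[OF elim(2)])
      show ?case using elim by (intro finite_measure_mono) auto
    qed
  qed simp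
qed

text \<open>Let \<open>\<eta> n = 1 / (j + 1)\<close> for the largest \<open>j \<le> n\<close> for which the event is already unlikely at \<open>n\<close>. Every
  \<open>j\<close> is admissible in the end, so that \<open>\<eta>\<close> tends to 0.\<close>

lemma negligible_diagonal:
  assumes "\<And>\<eta>. 0 < \<eta> \<Longrightarrow> negligible (S \<eta>)"
  shows "\<exists>\<eta>. (\<forall>n. 0 < \<eta> n) \<and> \<eta> \<longlonglongrightarrow> (0::real) \<and> negligible (\<lambda>n. S (\<eta> n) n)"
proof -
  define e where "e j = 1 / real (Suc j)" for j
  have e_pos: "0 < e j" for j by (simp add: e_def)
  define B where "B j = (SOME B. (\<forall>\<^sub>F n in sequentially. S (e j) n \<subseteq> B n \<and> B n \<in> sets (PM (Z n))) \<and> (\<lambda>n. measure (PM (Z n)) (B n)) \<longlonglongrightarrow> 0)" for j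
  have B_both: "(\<forall>\<^sub>F n in sequentially. S (e j) n \<subseteq> B j n \<and> B j n \<in> sets (PM (Z n))) \<and> (\<lambda>n. measure (PM (Z n)) (B j n)) \<longlonglongrightarrow> 0" for j
    unfolding B_def by (rule someI_ex[OF assms[OF e_pos[of j], unfolded negligible_def]])
  note B = conjunct1[OF B_both] conjunct2[OF B_both]
  define good where "good j n \<longleftrightarrow> (S (e j) n \<subseteq> B j n \<and> B j n \<in> sets (PM (Z n)) \<and> measure (PM (Z n)) (B j n) < e j)" for j n
  have good: "\<forall>\<^sub>F n in sequentially. good j n" for j
    using B(1)[of j] order_tendstoD(2)[OF B(2)[of j] e_pos[of j]]
    by eventually_elim (simp add: good_def)
  define J where "J n = (GREATEST j. j \<le> n \<and> (j = 0 \<or> good j n))" for n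
  have J0: "J n \<le> n \<and> (J n = 0 \<or> good (J n) n)" for n
    unfolding J_def by (rule GreatestI_nat[where k=0 and b=n]) auto
  have J_ge: "\<forall>\<^sub>F n in sequentially. j \<le> J n" for j
    using good[of j] eventually_ge_at_top[of j]
  proof eventually_elim
    case (elim n)
    show ?case unfolding J_def by (rule Greatest_le_nat[where b=n]) (use elim in auto)
  qed
  have J_good: "\<forall>\<^sub>F n in sequentially. good (J n) n"
    using good[of 0] J_ge[of 1]
  proof eventually_elim
    case (elim n) then show ?case using J0[of n] by auto
  qed
  have e0: "e \<longlonglongrightarrow> 0" unfolding e_def using LIMSEQ_inverse_real_of_nat by (simp add: inverse_eq_divide)
  have "filterlim J at_top sequentially" using J_ge by (simp add: filterlim_at_top)
  then have eJ: "(\<lambda>n. e (J n)) \<longlonglongrightarrow> 0" by (rule filterlim_compose[OF e0])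
  have "negligible (\<lambda>n. S (e (J n)) n)"
    unfolding negligible_def
  proof (intro exI[of _ "\<lambda>n. B (J n) n"] conjI)
    show "\<forall>\<^sub>F n in sequentially. S (e (J n)) n \<subseteq> B (J n) n \<and> B (J n) n \<in> sets (PM (Z n))"
      using J_good by eventually_elim (auto simp: good_def)
    show "(\<lambda>n. measure (PM (Z n)) (B (J n) n)) \<longlonglongrightarrow> 0"
      by (rule tendsto_sandwich[OF _ _ tendsto_const eJ]) (use J_good in \<open>auto simp: good_def elim: eventually_mono\<close>)
  qed
  then show ?thesis using eJ by (intro exI[of _ "\<lambda>n. e (J n)"]) (auto simp: e_def)
qed

text \<open>The union over all reveals is harmless: there are at most of the order of \<open>n\<close> of them, and the Chernoff
  bounds are exponentially small.\<close>

definition timing_bad :: "real \<Rightarrow> nat \<Rightarrow> 'w set" where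
  "timing_bad \<eta> n = {z \<in> space (PM (Z n)). ennreal (\<eta> * real n) < timed_process.rate_error P n (Z n) R z}
     \<union> (\<Union>k\<le>in_total n. {z \<in> occ n k. \<eta> * real n \<le> \<bar>reveal_process.elapsed (Z n) k z - real k\<bar>})"

lemma timing_bad_negligible:
  assumes \<eta>: "0 < \<eta>" shows "negligible (timing_bad \<eta>)"
  unfolding timing_bad_def
proof (rule negligible_Un)
  show "negligible (\<lambda>n. {z \<in> space (PM (Z n)). ennreal (\<eta> * real n) < timed_process.rate_error P n (Z n) R z})"
  proof (rule negligibleI)
    have "(\<lambda>n. measure (PM (Z n)) {z \<in> space (PM (Z n)). \<bar>enn2ereal
        (\<integral>\<^sup>+t\<in>{t. 0 \<le> t \<and> ereal t \<le> stop_time P n (Z n) z}.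
            ennreal \<bar>intensity P n (Z n) t z - real n * R t\<bar> \<partial>lborel)\<bar> > ereal (\<eta> * real n)}) \<longlonglongrightarrow> 0"
      using R_limit \<eta> by (simp add: small_op_def)
    then show "(\<lambda>n. measure (PM (Z n)) {z \<in> space (PM (Z n)). \<bar>enn2ereal
        (\<integral>\<^sup>+t\<in>{t. 0 \<le> t \<and> ereal t \<le> stop_time P n (Z n) z}.
            ennreal \<bar>intensity P n (Z n) t z - real n * R t\<bar> \<partial>lborel)\<bar> > ereal (\<eta> * real n)}) \<longlonglongrightarrow> 0" .
    show "\<forall>\<^sub>F n in sequentially. {z \<in> space (PM (Z n)). ennreal (\<eta> * real n) < timed_process.rate_error P n (Z n) R z} \<in> sets (PM (Z n)) \<and>
      measure (PM (Z n)) {z \<in> space (PM (Z n)). ennreal (\<eta> * real n) < timed_process.rate_error P n (Z n) R z}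
      \<le> measure (PM (Z n)) {z \<in> space (PM (Z n)). \<bar>enn2ereal
        (\<integral>\<^sup>+t\<in>{t. 0 \<le> t \<and> ereal t \<le> stop_time P n (Z n) z}.
            ennreal \<bar>intensity P n (Z n) t z - real n * R t\<bar> \<partial>lborel)\<bar> > ereal (\<eta> * real n)}"
      using eventually_ge_at_top[of 1]
    proof eventually_elim
      case (elim n)
      interpret timed_process P n "Z n" R by (rule timed_process[OF elim])
      have "ennreal (\<eta> * real n) < c \<longleftrightarrow> \<bar>enn2ereal c\<bar> > ereal (\<eta> * real n)" for c
        using \<eta> by (simp add: less_ennreal.rep_eq abs_ereal_ge0)
      then have "{z \<in> space (PM (Z n)). ennreal (\<eta> * real n) < rate_error z} = {z \<in> space (PM (Z n)). \<bar>enn2ereal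
        (\<integral>\<^sup>+t\<in>{t. 0 \<le> t \<and> ereal t \<le> stop_time P n (Z n) z}.
            ennreal \<bar>intensity P n (Z n) t z - real n * R t\<bar> \<partial>lborel)\<bar> > ereal (\<eta> * real n)}"
        unfolding rate_error_def by simp
      moreover have "{z \<in> space (PM (Z n)). ennreal (\<eta> * real n) < rate_error z} \<in> sets (PM (Z n))"
        by (intro borel_measurable_less borel_measurable_const rate_error_measurable)
      ultimately show ?case by simp
    qed
  qed
next
  define C where "C = 2 * lam"
  have C: "0 < C" using lam_pos by (simp add: C_def)
  define c where "c = min (1/2) (\<eta> / (4 * C)) * \<eta> / 2"
  have c: "0 < c" using \<eta> C by (simp add: c_def)
  have ev: "\<forall>\<^sub>F n in sequentially. real (in_total n) / real n < C"
    using order_tendstoD(2)[OF in_total_limit, of C] lam_pos by (simp add: C_def)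
  show "negligible (\<lambda>n. \<Union>k\<le>in_total n. {z \<in> occ n k. \<eta> * real n \<le> \<bar>reveal_process.elapsed (Z n) k z - real k\<bar>})"
  proof (rule negligibleI)
    show "\<forall>\<^sub>F n in sequentially. (\<Union>k\<le>in_total n. {z \<in> occ n k. \<eta> * real n \<le> \<bar>reveal_process.elapsed (Z n) k z - real k\<bar>}) \<in> sets (PM (Z n)) \<and>
      measure (PM (Z n)) (\<Union>k\<le>in_total n. {z \<in> occ n k. \<eta> * real n \<le> \<bar>reveal_process.elapsed (Z n) k z - real k\<bar>})
       \<le> (C * real n + 1) * (2 * exp (- c * real n))"
      using ev eventually_ge_at_top[of 1]
    proof eventually_elim
      case (elim n)
      interpret timed_process P n "Z n" R by (rule timed_process[OF elim(2)])
      let ?S = "\<lambda>k. {z \<in> occ n k. \<eta> * real n \<le> \<bar>elapsed k z - real k\<bar>}"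
      have Cn: "real in_count \<le> C * real n" using elim by (simp add: divide_less_eq)
      have S: "?S k \<in> sets M" for k
      proof -
        have "occurred k \<inter> {z \<in> space M. \<eta> * real n \<le> \<bar>elapsed k z - real k\<bar>} \<in> sets M"
          by (intro sets.Int occurred_sets_M borel_measurable_le borel_measurable_const borel_measurable_abs borel_measurable_diff
              measurable_hist_M[OF elapsed_measurable])
        moreover have "occurred k \<inter> {z \<in> space M. \<eta> * real n \<le> \<bar>elapsed k z - real k\<bar>} = ?S k" using occurred_space by auto
        ultimately show ?thesis by simp
      qed
      have "measure M (\<Union>k\<le>in_count. ?S k) \<le> (\<Sum>k\<le>in_count. measure M (?S k))"
        using S by (intro measure_UNION_le) auto
      also have "... \<le> (\<Sum>k\<le>in_count. 2 * exp (- c * real n))"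
        using elapsed_deviation[OF \<eta> C] Cn by (intro sum_mono) (auto simp: c_def)
      also have "... = (real in_count + 1) * (2 * exp (- c * real n))" by simp
      also have "... \<le> (C * real n + 1) * (2 * exp (- c * real n))" using Cn by (intro mult_right_mono) auto
      finally show ?case using S by blast
    qed
    have "filterlim (\<lambda>n. c * real n) at_top sequentially"
      by (rule filterlim_tendsto_pos_mult_at_top[OF tendsto_const c filterlim_real_sequentially])
    then have lim: "(\<lambda>n. (c * real n) ^ j / exp (c * real n)) \<longlonglongrightarrow> 0" for j
      by (rule filterlim_compose[OF tendsto_power_div_exp_0])
    have "(\<lambda>n. 2 * C / c * ((c * real n) ^ 1 / exp (c * real n)) + 2 * ((c * real n) ^ 0 / exp (c * real n))) \<longlonglongrightarrow> 2 * C / c * 0 + 2 * 0"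
      by (intro tendsto_add tendsto_mult tendsto_const lim)
    moreover have "2 * C / c * ((c * real n) ^ 1 / exp (c * real n)) + 2 * ((c * real n) ^ 0 / exp (c * real n))
        = (C * real n + 1) * (2 * exp (- c * real n))" for n
      using c by (simp add: exp_minus field_simps)
    ultimately show "(\<lambda>n. (C * real n + 1) * (2 * exp (- c * real n))) \<longlonglongrightarrow> 0" by simp
  qed
qed

lemma timing_good:
  assumes n: "1 \<le> n" and z: "z \<notin> timing_bad \<eta> n" "z \<in> occ n k" and \<eta>: "0 \<le> \<eta>"
  shows "\<bar>real k / real n - cum (reveal_process.rtime (Z n) k z)\<bar> \<le> 2 * \<eta>"
    and "z \<in> active P n (Z n) k \<Longrightarrow> time (Z n) (Suc k) z = \<infinity> \<Longrightarrow> cum_total - cum (reveal_process.rtime (Z n) k z) \<le> \<eta>"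
proof -
  interpret T: timed_process P n "Z n" R by (rule timed_process[OF n])
  have re: "T.rate_error z \<le> ennreal (\<eta> * real n)"
    using z T.occurred_space[OF z(2)] by (auto simp: timing_bad_def not_less)
  have n0: "0 < real n" and en: "0 \<le> \<eta> * real n" using n \<eta> by auto
  have "\<bar>T.elapsed k z - real k\<bar> < \<eta> * real n"
    using z T.occurred_le_in_count[OF z(2)] by (auto simp: timing_bad_def not_le)
  moreover have "\<bar>T.elapsed k z - real n * cum (T.rtime k z)\<bar> \<le> \<eta> * real n"
    by (rule T.elapsed_cum[OF z(2) re en])
  ultimately have "\<bar>real k - real n * cum (T.rtime k z)\<bar> \<le> 2 * \<eta> * real n" by linarith
  then have "\<bar>real k - real n * cum (T.rtime k z)\<bar> / real n \<le> 2 * \<eta>" using n0 by (simp add: divide_le_eq)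
  moreover have "\<bar>real k - real n * cum (T.rtime k z)\<bar> / real n = \<bar>real k / real n - cum (T.rtime k z)\<bar>"
  proof -
    have "(real k - real n * cum (T.rtime k z)) / real n = real k / real n - cum (T.rtime k z)"
      using n0 by (simp add: diff_divide_distrib)
    moreover have "\<bar>(real k - real n * cum (T.rtime k z)) / real n\<bar> = \<bar>real k - real n * cum (T.rtime k z)\<bar> / real n"
      using n0 by (simp add: abs_divide)
    ultimately show ?thesis by (simp only:)
  qed
  ultimately show "\<bar>real k / real n - cum (T.rtime k z)\<bar> \<le> 2 * \<eta>" by simp
  assume "z \<in> active P n (Z n) k" "time (Z n) (Suc k) z = \<infinity>"
  from T.stuck_cum[OF this re en] show "cum_total - cum (T.rtime k z) \<le> \<eta>"
    using n0 by (simp add: mult.commute)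
qed

section \<open>The state at a fixed time\<close>

text \<open>Off a negligible event, the \<open>k\<close>-th reveal takes place when the cumulative intensity is close to
  \<open>k / n\<close>. Reading the premiums at times that are slightly early or late makes the premium at the
  \<open>k\<close>-th reveal deterministic, and bounds the true one from below or above.\<close>

definition shifted_schedule :: "'x \<Rightarrow> (nat \<Rightarrow> real) \<Rightarrow> nat \<Rightarrow> nat \<Rightarrow> real" where
  "shifted_schedule x s n k = premium x (cum_inv (max 0 (real k / real n + s n)))"

definition mean_prediction :: "'x \<Rightarrow> (nat \<Rightarrow> real) \<Rightarrow> nat \<Rightarrow> nat \<Rightarrow> real" where
  "mean_prediction x a m K = (\<integral>e. indicator {e. 0 < cash x e + a 0} e * loss_law.survival_prob x a m K 0 (indeg P x) (cash x e) \<partial>shock_law P x)"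

abbreviation reveals_until :: "real \<Rightarrow> nat \<Rightarrow> nat" where
  "reveals_until t n \<equiv> nat \<lfloor>real n * cum t\<rfloor>"

abbreviation unreached :: "real \<Rightarrow> nat \<Rightarrow> 'w set" where
  "unreached t n \<equiv> {z \<in> space (PM (Z n)). z \<notin> occ n (reveals_until t n)}"

lemma reveal_index_limit: "(\<lambda>n. real (reveal_index n w) / real n) \<longlonglongrightarrow> cum w"
proof (rule tendsto_sandwich[OF _ _ tendsto_const])
  have inv: "(\<lambda>n. 1 / real n) \<longlonglongrightarrow> 0" by (rule lim_1_over_n)
  show "(\<lambda>n. cum w + 1 / real n) \<longlonglongrightarrow> cum w" using tendsto_add[OF tendsto_const inv] by simp
  have nn: "0 \<le> real n * cum w" for n using cum_nonneg by simp
  have rl: "real n * cum w \<le> real (reveal_index n w)" for n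
    unfolding reveal_index_def using nn[of n] by linarith
  have ru: "real (reveal_index n w) \<le> real n * cum w + 1" for n
    unfolding reveal_index_def using nn[of n] by linarith
  show "\<forall>\<^sub>F n in sequentially. cum w \<le> real (reveal_index n w) / real n"
    using eventually_gt_at_top[of 0]
  proof eventually_elim
    case (elim n) then show ?case using rl[of n] by (simp add: le_divide_eq mult.commute)
  qed
  show "\<forall>\<^sub>F n in sequentially. real (reveal_index n w) / real n \<le> cum w + 1 / real n"
    using eventually_gt_at_top[of 0]
  proof eventually_elim
    case (elim n)
    have "real (reveal_index n w) / real n \<le> (real n * cum w + 1) / real n" by (rule divide_right_mono[OF ru]) simp
    also have "... = cum w + 1 / real n" using elim by (simp add: add_divide_distrib)
    finally show ?case .
  qed
qed

lemma shifted_schedule_tendsto: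
  assumes s: "s \<longlonglongrightarrow> 0" and w: "0 \<le> w"
  shows "(\<lambda>n. shifted_schedule x s n (reveal_index n w)) \<longlonglongrightarrow> premium x w"
proof -
  have "(\<lambda>n. max 0 (real (reveal_index n w) / real n + s n)) \<longlonglongrightarrow> max 0 (cum w + 0)"
    by (intro tendsto_max tendsto_const tendsto_add reveal_index_limit s)
  then have "(\<lambda>n. max 0 (real (reveal_index n w) / real n + s n)) \<longlonglongrightarrow> cum w"
    using cum_nonneg[of w] by simp
  then have "(\<lambda>n. cum_inv (max 0 (real (reveal_index n w) / real n + s n))) \<longlonglongrightarrow> w"
    by (rule cum_inv_tendsto) (use w in auto)
  then show ?thesis unfolding shifted_schedule_def by (rule isCont_tendsto_compose[OF isCont_premium])
qed

lemma few_reveals: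
  assumes "0 \<le> t" "cum t < lam"
  shows "\<forall>\<^sub>F n in sequentially. reveals_until t n + d \<le> in_total n"
proof -
  have "(\<lambda>n. real (in_total n) / real n - real d * (1 / real n)) \<longlonglongrightarrow> lam - real d * 0"
    by (intro tendsto_diff in_total_limit tendsto_mult tendsto_const lim_1_over_n)
  then have "(\<lambda>n. real (in_total n) / real n - real d * (1 / real n)) \<longlonglongrightarrow> lam" by simp
  from order_tendstoD(1)[OF this assms(2)] show ?thesis using eventually_gt_at_top[of 0]
  proof eventually_elim
    case (elim n)
    then have "real n * cum t + real d < real (in_total n)" by (simp add: field_simps)
    moreover have "real (reveals_until t n) \<le> real n * cum t" using cum_nonneg[of t] by simp
    ultimately have "real (reveals_until t n) + real d < real (in_total n)" by linarith
    then show ?case by linarith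
  qed
qed

lemma survivor_fraction_eq_integral:
  "survivor_fraction x t = (\<integral>e. indicator {e. 0 < cash x e + premium x 0} e *
     (\<Sum>th\<le>indeg P x. real (indeg P x choose th) * fact th * (lam - cum t) ^ (indeg P x - th) / lam ^ indeg P x
       * loss_law.chain_int x intensity_measure (premium x) t th 0 (cash x e)) \<partial>shock_law P x)"
proof -
  let ?c = "\<lambda>th. real (indeg P x choose th) * fact th * (lam - cum t) ^ (indeg P x - th) / lam ^ indeg P x"
  let ?g = "\<lambda>th e. indicator {e. 0 < cash x e + premium x 0} e * loss_law.chain_int x intensity_measure (premium x) t th 0 (cash x e)"
  have "survivor_fraction x t = (\<Sum>th\<le>indeg P x. \<integral>e. ?c th * ?g th e \<partial>shock_law P x)"
    unfolding survivor_fraction_def chain_mass_def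
    by (intro sum.cong refl Bochner_Integration.integral_mult_right[symmetric] impI chain_mass_integrable)
  also have "... = (\<integral>e. (\<Sum>th\<le>indeg P x. ?c th * ?g th e) \<partial>shock_law P x)"
    by (rule Bochner_Integration.integral_sum[symmetric]) (intro integrable_mult_right impI chain_mass_integrable)
  also have "... = (\<integral>e. indicator {e. 0 < cash x e + premium x 0} e * (\<Sum>th\<le>indeg P x. ?c th
      * loss_law.chain_int x intensity_measure (premium x) t th 0 (cash x e)) \<partial>shock_law P x)"
    by (intro Bochner_Integration.integral_cong refl) (simp only: sum_distrib_left mult_ac)
  finally show ?thesis .
qed

text \<open>Dominated convergence over the shock. The capital at time 0 almost surely differs from 0, so that its sign is
  stable under the small change of the premium.\<close>

lemma mean_prediction_limit:
  assumes s: "s \<longlonglongrightarrow> 0" and t: "0 \<le> t" "cum t < lam"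
  shows "(\<lambda>n. mean_prediction x (shifted_schedule x s n) (in_total n) (reveals_until t n)) \<longlonglongrightarrow> survivor_fraction x t"
proof -
  let ?d = "indeg P x"
  let ?a = "shifted_schedule x s"
  define ok where "ok n \<longleftrightarrow> reveals_until t n + ?d \<le> in_total n" for n
  have ok: "\<forall>\<^sub>F n in sequentially. ok n" unfolding ok_def by (rule few_reveals[OF t])
  define g where "g n e = indicator {e. 0 < cash x e + ?a n 0} e * loss_law.survival_prob x (?a n) (in_total n) (reveals_until t n) 0 ?d (cash x e)" for n e
  define f where "f n e = (if ok n then g n e else 0)" for n e
  define h where "h e = indicator {e. 0 < cash x e + premium x 0} e *
     (\<Sum>th\<le>?d. real (?d choose th) * fact th * (lam - cum t) ^ (?d - th) / lam ^ ?d
       * loss_law.chain_int x intensity_measure (premium x) t th 0 (cash x e))" for e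
  have g_meas: "g n \<in> borel_measurable borel" for n
  proof -
    have "{e. 0 < cash x e + ?a n 0} \<in> sets borel" by measurable
    then show ?thesis unfolding g_def[abs_def]
      by (intro borel_measurable_times borel_measurable_indicator measurable_compose[OF cash_measurable loss_law.survival_prob_measurable])
  qed
  have f_meas: "f n \<in> borel_measurable (shock_law P x)" for n
    using g_meas[of n] by (cases "ok n") (simp_all add: f_def[abs_def] measurable_cong_sets[OF shock_law.sets_L refl])
  have h_meas: "h \<in> borel_measurable (shock_law P x)"
  proof -
    have "{e. 0 < cash x e + premium x 0} \<in> sets borel" by measurable
    moreover have "(\<lambda>e. loss_law.chain_int x intensity_measure (premium x) t th 0 (cash x e)) \<in> borel_measurable borel" for th
      by measurable
    ultimately have "h \<in> borel_measurable borel" unfolding h_def[abs_def]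
      by (intro borel_measurable_times borel_measurable_indicator borel_measurable_sum borel_measurable_const)
    then show ?thesis by (simp add: measurable_cong_sets[OF shock_law.sets_L refl])
  qed
  have a0: "(\<lambda>n. ?a n 0) \<longlonglongrightarrow> premium x 0"
    using shifted_schedule_tendsto[OF s order.refl, of x] cum_eq_0[of 0] by (simp add: reveal_index_def)
  have g_lim: "(\<lambda>n. g n e) \<longlonglongrightarrow> h e" if ne: "cash x e \<noteq> - premium x 0" for e
    unfolding g_def h_def
  proof (rule tendsto_mult)
    show "(\<lambda>n. loss_law.survival_prob x (?a n) (in_total n) (reveals_until t n) 0 ?d (cash x e)) \<longlonglongrightarrow>
      (\<Sum>th\<le>?d. real (?d choose th) * fact th * (lam - cum t) ^ (?d - th) / lam ^ ?d
       * loss_law.chain_int x intensity_measure (premium x) t th 0 (cash x e))"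
      by (rule loss_law.survival_prob_tendsto[where x=x, OF reveal_intensity_axioms t(1) premium_measurable _ in_total_limit t(2)])
         (rule shifted_schedule_tendsto[OF s less_imp_le])
    have lim: "(\<lambda>n. cash x e + ?a n 0) \<longlonglongrightarrow> cash x e + premium x 0" by (intro tendsto_add tendsto_const a0)
    have "\<forall>\<^sub>F n in sequentially. indicator {e. 0 < cash x e + premium x 0} e = (indicator {e. 0 < cash x e + ?a n 0} e :: real)"
    proof (cases "0 < cash x e + premium x 0")
      case True
      show ?thesis using order_tendstoD(1)[OF lim True] by eventually_elim (use True in simp)
    next
      case False
      then have "cash x e + premium x 0 < 0" using ne by linarith
      from order_tendstoD(2)[OF lim this] show ?thesis by eventually_elim (use False in simp)
    qed
    then show "(\<lambda>n. indicator {e. 0 < cash x e + ?a n 0} e :: real) \<longlonglongrightarrow> indicator {e. 0 < cash x e + premium x 0} e"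
      by (rule Lim_transform_eventually[OF tendsto_const])
  qed
  have f_lim: "AE e in shock_law P x. (\<lambda>n. f n e) \<longlonglongrightarrow> h e"
    using AE_cash_neq[of x "- premium x 0"]
  proof eventually_elim
    case (elim e)
    have "\<forall>\<^sub>F n in sequentially. g n e = f n e" using ok by eventually_elim (simp add: f_def)
    then show ?case by (rule Lim_transform_eventually[OF g_lim[OF elim]])
  qed
  have f_bd: "norm (f n e) \<le> 1" for n e
  proof (cases "ok n")
    case True
    have "loss_law.survival_prob x (?a n) (in_total n) (reveals_until t n) 0 ?d (cash x e) \<le> 1"
      by (rule loss_law.survival_prob_le_1) (use True in \<open>auto simp: ok_def\<close>)
    moreover have "0 \<le> loss_law.survival_prob x (?a n) (in_total n) (reveals_until t n) 0 ?d (cash x e)"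
      by (rule loss_law.survival_prob_nonneg)
    ultimately show ?thesis by (simp add: f_def g_def indicator_def)
  qed (simp add: f_def)
  have "(\<lambda>n. \<integral>e. f n e \<partial>shock_law P x) \<longlonglongrightarrow> (\<integral>e. h e \<partial>shock_law P x)"
    by (rule integral_dominated_convergence[where w="\<lambda>_. 1", OF h_meas f_meas _ f_lim]) (use f_bd in auto)
  then have "(\<lambda>n. \<integral>e. f n e \<partial>shock_law P x) \<longlonglongrightarrow> survivor_fraction x t"
    by (simp only: survivor_fraction_eq_integral h_def)
  moreover have "\<forall>\<^sub>F n in sequentially. (\<integral>e. f n e \<partial>shock_law P x) = mean_prediction x (?a n) (in_total n) (reveals_until t n)"
    using ok by eventually_elim (simp add: f_def g_def mean_prediction_def)
  ultimately show ?thesis by (rule Lim_transform_eventually)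
qed

lemma mean_prediction_bounds:
  assumes "K + indeg P x \<le> m"
  shows "0 \<le> mean_prediction x a m K" "mean_prediction x a m K \<le> 1"
proof -
  have b: "0 \<le> indicator {e. 0 < cash x e + a 0} e * loss_law.survival_prob x a m K 0 (indeg P x) (cash x e)"
    "indicator {e. 0 < cash x e + a 0} e * loss_law.survival_prob x a m K 0 (indeg P x) (cash x e) \<le> 1" for e
    using loss_law.survival_prob_nonneg[of x a m K 0 "indeg P x" "cash x e"]
      loss_law.survival_prob_le_1[of 0 K m "indeg P x" x a "cash x e"] assms by (auto simp: indicator_def)
  show "0 \<le> mean_prediction x a m K" unfolding mean_prediction_def by (rule integral_nonneg_AE) (use b in auto)
  have "mean_prediction x a m K \<le> (\<integral>e. 1 \<partial>shock_law P x)" unfolding mean_prediction_def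
    by (rule integral_mono') (use b in auto)
  then show "mean_prediction x a m K \<le> 1" by simp
qed

lemma survivor_fraction_bounds:
  assumes t: "0 \<le> t" "cum t < lam"
  shows "0 \<le> survivor_fraction x t" "survivor_fraction x t \<le> 1"
proof -
  have lim: "(\<lambda>n. mean_prediction x (shifted_schedule x (\<lambda>_. 0) n) (in_total n) (reveals_until t n)) \<longlonglongrightarrow> survivor_fraction x t"
    by (rule mean_prediction_limit[OF tendsto_const t])
  show "0 \<le> survivor_fraction x t"
    by (rule tendsto_lowerbound[OF lim]) (use few_reveals[OF t, of "indeg P x"] in \<open>auto elim!: eventually_mono intro: mean_prediction_bounds\<close>)
  show "survivor_fraction x t \<le> 1"
    by (rule tendsto_upperbound[OF lim]) (use few_reveals[OF t, of "indeg P x"] in \<open>auto elim!: eventually_mono intro: mean_prediction_bounds\<close>)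
qed

lemma scheduled_process_eventually:
  assumes s: "s \<longlonglongrightarrow> 0" and t: "0 \<le> t" "cum t < lam"
  shows "\<forall>\<^sub>F n in sequentially. scheduled_process P n (Z n) x (shifted_schedule x s n) (reveals_until t n)"
proof -
  have "\<forall>\<^sub>F n in sequentially. s n < cum_total - cum t"
    by (rule order_tendstoD(2)[OF s]) (use cum_less_total[OF t(1)] in simp)
  then show ?thesis using few_reveals[OF t, of "indeg P x"] eventually_ge_at_top[of 1]
  proof eventually_elim
    case (elim n)
    show ?case
    proof (intro scheduled_process.intro reveal_process scheduled_process_axioms.intro)
      show "mono_on {..reveals_until t n} (shifted_schedule x s n)"
      proof (rule mono_onI)
        fix j k assume jk: "j \<in> {..reveals_until t n}" "k \<in> {..reveals_until t n}" "j \<le> k"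
        have n0: "0 < real n" using elim by simp
        have "real (reveals_until t n) \<le> real n * cum t" using cum_nonneg[of t] by simp
        then have "real k \<le> real n * cum t" using jk(2) by (meson atMost_iff of_nat_le_iff order_trans)
        then have "real k / real n \<le> cum t" using n0 by (simp add: divide_le_eq mult.commute)
        then have "max 0 (real k / real n + s n) < cum_total" using elim(1) cum_total_pos by simp
        moreover have "max 0 (real j / real n + s n) \<le> max 0 (real k / real n + s n)"
          using jk(3) n0 by (intro max.mono add_mono divide_right_mono) auto
        ultimately show "shifted_schedule x s n j \<le> shifted_schedule x s n k"
          unfolding shifted_schedule_def by (intro premium_mono cum_inv_mono) auto
      qed
    qed (use elim in auto)
  qed
qed

lemma solvent_limit:
  assumes s: "s \<longlonglongrightarrow> 0" and t: "0 \<le> t" "cum t < lam" and \<epsilon>: "0 < \<epsilon>"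
  shows "negligible (\<lambda>n. {z \<in> occ n (reveals_until t n).
    \<epsilon> \<le> \<bar>real (card {i \<in> {1..n}. atype (Z n) i = x \<and> reveal_process.solvent P (Z n) (shifted_schedule x s n) i (reveals_until t n) z}) / real n
      - pmf \<mu> x * survivor_fraction x t\<bar>})" (is "negligible ?S")
proof -
  define e where "e = \<epsilon> / 4"
  have e: "0 < e" using \<epsilon> by (simp add: e_def)
  let ?a = "shifted_schedule x s"
  let ?K = "reveals_until t"
  define mp where "mp n = mean_prediction x (?a n) (in_total n) (?K n)" for n
  define T where "T n = {z \<in> occ n (?K n). 2 * e * real n \<le>
      \<bar>real (card {i \<in> {1..n}. atype (Z n) i = x \<and> reveal_process.solvent P (Z n) (?a n) i (?K n) z}) - real (card {i \<in> {1..n}. atype (Z n) i = x}) * mp n\<bar>}" for n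
  have "negligible T"
  proof (rule negligibleI)
    show "\<forall>\<^sub>F n in sequentially. T n \<in> sets (PM (Z n)) \<and> measure (PM (Z n)) (T n) \<le> 4 * cum t / e\<^sup>2 * (1 / real n) + 2 * exp (- (2 * e\<^sup>2) * real n)"
      using scheduled_process_eventually[OF s t, of x] eventually_ge_at_top[of 1]
    proof eventually_elim
      case (elim n)
      interpret scheduled_process P n "Z n" x "?a n" "?K n" by (rule elim)
      have mp: "(\<integral>e. initial_prediction e \<partial>shock_law P x) = mp n"
        unfolding mp_def mean_prediction_def initial_prediction_def ..
      have ag: "{i \<in> {1..n}. atype (Z n) i = x \<and> solvent (?a n) i (?K n) z} = {i \<in> agents. solvent (?a n) i (?K n) z}" for z
        by (auto simp: agents_def)
      have T: "T n = {z \<in> occurred (?K n). 2 * e * real n \<le> \<bar>real (card {i \<in> agents. solvent (?a n) i (?K n) z}) - real (card agents) * (\<integral>e. initial_prediction e \<partial>shock_law P x)\<bar>}"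
        unfolding T_def ag mp agents_def[symmetric] ..
      have "occurred (?K n) \<inter> {z \<in> space M. 2 * e * real n \<le> \<bar>total_prediction (?K n) z - real (card agents) * mp n\<bar>} \<in> sets M"
        by (intro sets.Int sets_hist_M[OF occurred_sets] borel_measurable_le borel_measurable_const borel_measurable_abs borel_measurable_diff
            measurable_hist_M[OF total_prediction_measurable])
      moreover have "occurred (?K n) \<inter> {z \<in> space M. 2 * e * real n \<le> \<bar>total_prediction (?K n) z - real (card agents) * mp n\<bar>} = T n"
        unfolding T mp total_prediction_final using occurred_space by blast
      ultimately have "T n \<in> sets M" by simp
      moreover have "prob (T n) \<le> 4 * real (?K n) / (e * real n)\<^sup>2 + 2 * exp (- 2 * e\<^sup>2 * real n)"
        unfolding T by (rule solvent_deviation[OF e]) (use elim in simp)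
      moreover have "4 * real (?K n) / (e * real n)\<^sup>2 \<le> 4 * cum t / e\<^sup>2 * (1 / real n)"
      proof -
        have "4 * real (?K n) / (e * real n)\<^sup>2 \<le> 4 * (real n * cum t) / (e * real n)\<^sup>2"
          using cum_nonneg[of t] by (intro divide_right_mono mult_left_mono) auto
        also have "... = 4 * cum t / e\<^sup>2 * (1 / real n)" using elim e by (simp add: power2_eq_square field_simps)
        finally show ?thesis .
      qed
      ultimately show ?case by auto
    qed
    have "(\<lambda>n. exp (- (2 * e\<^sup>2) * real n)) \<longlonglongrightarrow> 0"
    proof (rule filterlim_compose[OF exp_at_bot])
      show "filterlim (\<lambda>n. - (2 * e\<^sup>2) * real n) at_bot sequentially"
        by (rule filterlim_tendsto_neg_mult_at_bot[OF tendsto_const _ filterlim_real_sequentially]) (use e in simp)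
    qed
    then have "(\<lambda>n. 4 * cum t / e\<^sup>2 * (1 / real n) + 2 * exp (- (2 * e\<^sup>2) * real n)) \<longlonglongrightarrow> 4 * cum t / e\<^sup>2 * 0 + 2 * 0"
      by (intro tendsto_add tendsto_mult tendsto_const lim_1_over_n)
    then show "(\<lambda>n. 4 * cum t / e\<^sup>2 * (1 / real n) + 2 * exp (- (2 * e\<^sup>2) * real n)) \<longlonglongrightarrow> 0" by simp
  qed
  moreover have "\<forall>\<^sub>F n in sequentially. ?S n \<subseteq> T n"
  proof -
    have "(\<lambda>n. type_frac n (Z n) x * mp n) \<longlonglongrightarrow> pmf \<mu> x * survivor_fraction x t"
      unfolding mp_def by (intro tendsto_mult types mean_prediction_limit s t)
    then have "\<forall>\<^sub>F n in sequentially. dist (type_frac n (Z n) x * mp n) (pmf \<mu> x * survivor_fraction x t) < 2 * e"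
      by (rule tendstoD) (use e in simp)
    then show ?thesis using eventually_ge_at_top[of 1]
    proof eventually_elim
      case (elim n)
      have n0: "0 < real n" using elim(2) by simp
      show ?case
      proof
        fix z assume "z \<in> ?S n"
        then have z: "z \<in> occ n (?K n)"
          and c: "4 * e \<le> \<bar>real (card {i \<in> {1..n}. atype (Z n) i = x \<and> reveal_process.solvent P (Z n) (?a n) i (?K n) z}) / real n
            - pmf \<mu> x * survivor_fraction x t\<bar>" (is "_ \<le> \<bar>real ?c / _ - _\<bar>") by (auto simp: e_def)
        have d: "\<bar>type_frac n (Z n) x * mp n - pmf \<mu> x * survivor_fraction x t\<bar> < 2 * e" using elim(1) by (simp only: dist_real_def)
        have "2 * e \<le> \<bar>real ?c / real n - type_frac n (Z n) x * mp n\<bar>" using c d by linarith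
        moreover have "real ?c / real n - type_frac n (Z n) x * mp n = (real ?c - real (card {i \<in> {1..n}. atype (Z n) i = x}) * mp n) / real n"
          by (simp add: type_frac_def diff_divide_distrib)
        ultimately have "2 * e \<le> \<bar>real ?c - real (card {i \<in> {1..n}. atype (Z n) i = x}) * mp n\<bar> / real n"
          using n0 by (simp only: abs_divide)
        then have "2 * e * real n \<le> \<bar>real ?c - real (card {i \<in> {1..n}. atype (Z n) i = x}) * mp n\<bar>"
          using n0 by (simp add: le_divide_eq)
        then show "z \<in> T n" using z by (simp add: T_def)
      qed
    qed
  qed
  ultimately show ?thesis by (rule negligible_subset)
qed

lemma schedule_sandwich:
  assumes n: "1 \<le> n" and z: "z \<notin> timing_bad \<eta> n" "z \<in> occ n j" and \<eta>: "0 \<le> \<eta>" and j: "real j \<le> real n * cum t"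
    and small: "2 * \<eta> < cum_total - cum t" and s: "s n = 2 * \<eta>" "s' n = - 2 * \<eta>"
  shows "shifted_schedule x s' n j \<le> premium x (reveal_process.rtime (Z n) j z)"
    and "premium x (reveal_process.rtime (Z n) j z) \<le> shifted_schedule x s n j"
proof -
  interpret T: timed_process P n "Z n" R by (rule timed_process[OF n])
  let ?r = "T.rtime j z"
  have r0: "0 \<le> ?r" by (rule T.rtime_nonneg[OF T.occurred_space[OF z(2)]])
  have r: "cum_inv (cum ?r) = ?r" by (rule cum_inv_cum[OF r0])
  have d: "\<bar>real j / real n - cum ?r\<bar> \<le> 2 * \<eta>" by (rule timing_good(1)[OF n z \<eta>])
  have jn: "real j / real n \<le> cum t" using j n by (simp add: divide_le_eq mult.commute)
  have c0: "0 \<le> cum ?r" by (rule cum_nonneg)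
  have "cum_inv (max 0 (real j / real n + s' n)) \<le> cum_inv (cum ?r)"
    by (rule cum_inv_mono) (use d s c0 cum_less_total[OF r0] in auto)
  then show "shifted_schedule x s' n j \<le> premium x ?r"
    unfolding shifted_schedule_def r by (rule premium_mono)
  have "cum_inv (cum ?r) \<le> cum_inv (max 0 (real j / real n + s n))"
    by (rule cum_inv_mono) (use d s c0 jn small cum_total_pos in auto)
  then show "premium x ?r \<le> shifted_schedule x s n j"
    unfolding shifted_schedule_def r by (rule premium_mono)
qed

text \<open>Whoever is solvent under the early premiums is solvent, and whoever is solvent is so under the late
  premiums. The shifts tend to 0 slowly enough for the timing to be good eventually.\<close>

lemma insolvent_limit:
  assumes t: "0 \<le> t" "cum t < lam" and \<epsilon>: "0 < \<epsilon>"
  shows "negligible (\<lambda>n. {z \<in> occ n (reveals_until t n).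
    \<epsilon> \<le> \<bar>real (card {i \<in> {1..n}. atype (Z n) i = x \<and> insolv n i (reveals_until t n) z}) / real n
      - pmf \<mu> x * (1 - survivor_fraction x t)\<bar>})" (is "negligible ?S")
proof -
  from negligible_diagonal[OF timing_bad_negligible] obtain \<eta>
    where \<eta>_all: "(\<forall>n. 0 < \<eta> n) \<and> \<eta> \<longlonglongrightarrow> (0::real) \<and> negligible (\<lambda>n. timing_bad (\<eta> n) n)" ..
  have \<eta>: "0 < \<eta> n" "\<eta> \<longlonglongrightarrow> 0" "negligible (\<lambda>n. timing_bad (\<eta> n) n)" for n
    using \<eta>_all by simp_all
  define s where "s n = 2 * \<eta> n" for n
  define s' where "s' n = - 2 * \<eta> n" for n
  have s: "s \<longlonglongrightarrow> 0" unfolding s_def using tendsto_mult[OF tendsto_const \<eta>(2), of 2] by simp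
  have s': "s' \<longlonglongrightarrow> 0" unfolding s'_def using tendsto_mult[OF tendsto_const \<eta>(2), of "- 2"] by simp
  let ?K = "reveals_until t"
  let ?v = "pmf \<mu> x * survivor_fraction x t"
  define cnt where "cnt s n z = real (card {i \<in> {1..n}. atype (Z n) i = x \<and> reveal_process.solvent P (Z n) (shifted_schedule x s n) i (?K n) z})" for s n z
  define U where "U s n = {z \<in> occ n (?K n). \<epsilon> / 2 \<le> \<bar>cnt s n z / real n - ?v\<bar>}" for s n
  have "negligible (U s)" "negligible (U s')"
    unfolding U_def[abs_def] cnt_def[abs_def]
    by (rule solvent_limit[OF s t half_gt_zero[OF \<epsilon>]], rule solvent_limit[OF s' t half_gt_zero[OF \<epsilon>]])
  then have "negligible (\<lambda>n. U s n \<union> U s' n \<union> timing_bad (\<eta> n) n)" by (intro negligible_Un \<eta>(3))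
  moreover have "\<forall>\<^sub>F n in sequentially. ?S n \<subseteq> U s n \<union> U s' n \<union> timing_bad (\<eta> n) n"
  proof -
    have "\<forall>\<^sub>F n in sequentially. s n < cum_total - cum t"
      by (rule order_tendstoD(2)[OF s]) (use cum_less_total[OF t(1)] in simp)
    moreover have "\<forall>\<^sub>F n in sequentially. dist (type_frac n (Z n) x) (pmf \<mu> x) < \<epsilon> / 2"
      by (rule tendstoD[OF types]) (use \<epsilon> in simp)
    ultimately show ?thesis using eventually_ge_at_top[of 1]
    proof eventually_elim
      case (elim n)
      interpret T: timed_process P n "Z n" R by (rule timed_process[OF elim(3)])
      have n0: "0 < real n" using elim(3) by simp
      show ?case
      proof
        fix z assume zS: "z \<in> ?S n"
        then have z: "z \<in> occ n (?K n)" by simp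
        show "z \<in> U s n \<union> U s' n \<union> timing_bad (\<eta> n) n"
        proof (rule ccontr)
          assume "z \<notin> U s n \<union> U s' n \<union> timing_bad (\<eta> n) n"
          then have good: "z \<notin> timing_bad (\<eta> n) n"
            and cp: "\<bar>cnt s n z / real n - ?v\<bar> < \<epsilon> / 2" and cm: "\<bar>cnt s' n z / real n - ?v\<bar> < \<epsilon> / 2"
            using z by (auto simp: U_def not_le)
          have Kt: "real (?K n) \<le> real n * cum t" using cum_nonneg[of t] by simp
          have sw: "shifted_schedule x s' n j \<le> premium x (T.rtime j z)" "premium x (T.rtime j z) \<le> shifted_schedule x s n j"
            if "j \<le> ?K n" for j
          proof -
            have 1: "z \<in> occ n j" using z T.occurred_antimono[OF that] by blast
            have 2: "real j \<le> real n * cum t" using that Kt by (meson of_nat_le_iff order_trans)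
            have 3: "2 * \<eta> n < cum_total - cum t" using elim(1) by (simp only: s_def)
            show "shifted_schedule x s' n j \<le> premium x (T.rtime j z)" "premium x (T.rtime j z) \<le> shifted_schedule x s n j"
              by (rule schedule_sandwich[OF elim(3) good 1 less_imp_le[OF \<eta>(1)] 2 3]; simp add: s_def s'_def)+
          qed
          let ?A = "{i \<in> {1..n}. atype (Z n) i = x \<and> \<not> T.insolvent i (?K n) z}"
          let ?B = "{i \<in> {1..n}. atype (Z n) i = x \<and> T.insolvent i (?K n) z}"
          have low: "cnt s' n z \<le> real (card ?A)"
          proof -
            have "{i \<in> {1..n}. atype (Z n) i = x \<and> T.solvent (shifted_schedule x s' n) i (?K n) z} \<subseteq> ?A"
            proof safe
              fix i assume i: "i \<in> {1..n}" "x = atype (Z n) i"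
                and sol: "T.solvent (shifted_schedule (atype (Z n) i) s' n) i (?K n) z" and ins: "T.insolvent i (?K n) z"
              from ins obtain j where j: "j \<le> ?K n" "T.net i j z + premium (atype (Z n) i) (T.rtime j z) \<le> 0"
                unfolding T.insolvent_def by blast
              have "0 < T.net i j z + shifted_schedule (atype (Z n) i) s' n j" using sol j(1) unfolding T.solvent_def by blast
              then show False using j(2) sw(1)[OF j(1)] i(2) by simp
            qed
            then show ?thesis unfolding cnt_def by (simp only: of_nat_le_iff) (rule card_mono, simp)
          qed
          have up: "real (card ?A) \<le> cnt s n z"
          proof -
            have "?A \<subseteq> {i \<in> {1..n}. atype (Z n) i = x \<and> T.solvent (shifted_schedule x s n) i (?K n) z}"
            proof safe
              fix i assume i: "i \<in> {1..n}" "x = atype (Z n) i" and ins: "\<not> T.insolvent i (?K n) z"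
              show "T.solvent (shifted_schedule (atype (Z n) i) s n) i (?K n) z"
                unfolding T.solvent_def
              proof (intro allI impI)
                fix j assume j: "j \<le> ?K n"
                have "0 < T.net i j z + premium (atype (Z n) i) (T.rtime j z)"
                  using ins j unfolding T.insolvent_def by (meson not_le)
                then show "0 < T.net i j z + shifted_schedule (atype (Z n) i) s n j" using sw(2)[OF j] i(2) by simp
              qed
            qed
            then show ?thesis unfolding cnt_def by (simp only: of_nat_le_iff) (rule card_mono, simp)
          qed
          have "card {i \<in> {1..n}. atype (Z n) i = x} = card (?A \<union> ?B)" by (rule arg_cong[where f=card]) blast
          also have "... = card ?A + card ?B" by (rule card_Un_disjoint) auto
          finally have tf: "type_frac n (Z n) x = real (card ?A) / real n + real (card ?B) / real n"
            by (simp add: type_frac_def add_divide_distrib)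
          have "\<bar>real (card ?A) / real n - ?v\<bar> < \<epsilon> / 2"
            using divide_right_mono[OF low, of "real n"] divide_right_mono[OF up, of "real n"] cp cm by linarith
          moreover have "\<bar>type_frac n (Z n) x - pmf \<mu> x\<bar> < \<epsilon> / 2" using elim(2) by (simp only: dist_real_def)
          moreover have "\<epsilon> \<le> \<bar>real (card ?B) / real n - (pmf \<mu> x - ?v)\<bar>" using zS by (simp add: right_diff_distrib)
          ultimately show False unfolding tf by linarith
        qed
      qed
    qed
  qed
  ultimately show ?thesis by (rule negligible_subset)
qed

lemma weight_remainder:
  assumes w: "limit_weight w W" and h: "\<And>x. 0 \<le> h x" "\<And>x. h x \<le> 1"
    and H: "((\<lambda>x. w x * (pmf \<mu> x * h x)) has_sum H) UNIV" and F: "finite F"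
  shows "(\<Sum>x\<in>F. w x * (pmf \<mu> x * h x)) \<le> H"
    and "H - (\<Sum>x\<in>F. w x * (pmf \<mu> x * h x)) \<le> W - (\<Sum>x\<in>F. w x * pmf \<mu> x)"
proof -
  have w0: "0 \<le> w x" for x using w by (simp add: limit_weight_def)
  have hsW: "((\<lambda>x. w x * pmf \<mu> x) has_sum W) UNIV" using w by (simp add: limit_weight_def)
  show "(\<Sum>x\<in>F. w x * (pmf \<mu> x * h x)) \<le> H"
    by (rule has_sum_mono_neutral[OF has_sum_finite[OF F] H]) (use w0 h in auto)
  have "((\<lambda>x. - (w x * (pmf \<mu> x * h x))) has_sum (- H)) UNIV" using H by (simp only: has_sum_uminus minus_minus)
  from has_sum_add[OF hsW this]
  have diff: "((\<lambda>x. w x * pmf \<mu> x - w x * (pmf \<mu> x * h x)) has_sum (W - H)) UNIV" by simp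
  have nn: "0 \<le> w x * pmf \<mu> x - w x * (pmf \<mu> x * h x)" for x
  proof -
    have "w x * pmf \<mu> x * h x \<le> w x * pmf \<mu> x * 1" using h(2) w0 by (intro mult_left_mono) auto
    then show ?thesis by (simp add: mult.assoc)
  qed
  have "(\<Sum>x\<in>F. w x * pmf \<mu> x - w x * (pmf \<mu> x * h x)) \<le> W - H"
    by (rule has_sum_mono_neutral[OF has_sum_finite[OF F] diff]) (use nn in auto)
  then show "H - (\<Sum>x\<in>F. w x * (pmf \<mu> x * h x)) \<le> W - (\<Sum>x\<in>F. w x * pmf \<mu> x)" by (simp add: sum_subtractf)
qed

text \<open>Convergence type by type carries over to weighted totals, because the mass of \<open>w\<close> sits on finitely
  many types up to a small error, uniformly in \<open>n\<close>.\<close>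

lemma weighted_limit:
  assumes w: "limit_weight w W" and h: "\<And>x. 0 \<le> h x" "\<And>x. h x \<le> 1" and \<epsilon>: "0 < \<epsilon>"
    and H: "((\<lambda>x. w x * (pmf \<mu> x * h x)) has_sum H) UNIV"
    and each: "\<And>x \<delta>. 0 < \<delta> \<Longrightarrow> negligible (\<lambda>n. {z \<in> S n. \<delta> \<le> \<bar>real (card {i \<in> {1..n}. atype (Z n) i = x \<and> J n i z}) / real n - pmf \<mu> x * h x\<bar>})"
  shows "negligible (\<lambda>n. {z \<in> S n. \<epsilon> \<le> \<bar>(\<Sum>i\<in>{1..n}. if J n i z then w (atype (Z n) i) else 0) / real n - H\<bar>})"
    (is "negligible ?S")
proof -
  define e where "e = \<epsilon> / 4"
  have e: "0 < e" using \<epsilon> by (simp add: e_def)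
  have w0: "0 \<le> w x" for x using w by (simp add: limit_weight_def)
  obtain F where F: "finite F" "W - (\<Sum>x\<in>F. w x * pmf \<mu> x) < e"
      "\<forall>\<^sub>F n in sequentially. (\<Sum>i\<in>{i \<in> {1..n}. atype (Z n) i \<notin> F}. w (atype (Z n) i)) < e * real n"
    using limit_weight_tail[OF w e] by blast
  have Hlow: "(\<Sum>x\<in>F. w x * (pmf \<mu> x * h x)) \<le> H"
    and Hup: "H - (\<Sum>x\<in>F. w x * (pmf \<mu> x * h x)) \<le> W - (\<Sum>x\<in>F. w x * pmf \<mu> x)"
    using weight_remainder[OF w h H F(1)] by simp_all
  define C where "C = 1 + (\<Sum>x\<in>F. w x)"
  have C: "0 < C" unfolding C_def using sum_nonneg[of F w] w0 by simp
  define \<delta> where "\<delta> = e / C"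
  have \<delta>: "0 < \<delta>" using e C by (simp add: \<delta>_def)
  define c where "c x n z = real (card {i \<in> {1..n}. atype (Z n) i = x \<and> J n i z})" for x n z
  define T where "T n = (\<Union>x\<in>F. {z \<in> S n. \<delta> \<le> \<bar>c x n z / real n - pmf \<mu> x * h x\<bar>})" for n
  have "negligible T"
    unfolding T_def[abs_def] c_def by (rule negligible_UN[OF F(1)]) (rule each[OF \<delta>])
  moreover have "\<forall>\<^sub>F n in sequentially. ?S n \<subseteq> T n"
    using F(3) eventually_ge_at_top[of 1]
  proof eventually_elim
    case (elim n)
    have n0: "0 < real n" using elim(2) by simp
    show ?case
    proof
      fix z assume zS: "z \<in> ?S n"
      let ?f = "\<lambda>i. if J n i z then w (atype (Z n) i) else 0"
      let ?G = "{i \<in> {1..n}. atype (Z n) i \<in> F}" and ?N = "{i \<in> {1..n}. atype (Z n) i \<notin> F}"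
      show "z \<in> T n"
      proof (rule ccontr)
        assume "z \<notin> T n"
        then have small: "\<bar>c x n z / real n - pmf \<mu> x * h x\<bar> < \<delta>" if "x \<in> F" for x
          using that zS by (auto simp: T_def not_le)
        have "(\<Sum>i\<in>{1..n}. ?f i) = (\<Sum>i\<in>?G \<union> ?N. ?f i)" by (rule sum.cong) auto
        also have "... = (\<Sum>i\<in>?G. ?f i) + (\<Sum>i\<in>?N. ?f i)" by (rule sum.union_disjoint) auto
        also have "(\<Sum>i\<in>?G. ?f i) = (\<Sum>x\<in>F. \<Sum>i\<in>{i \<in> ?G. atype (Z n) i = x}. ?f i)"
          by (rule sum.group[symmetric]) (use F(1) in auto)
        also have "... = (\<Sum>x\<in>F. w x * c x n z)"
        proof (rule sum.cong[OF refl])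
          fix x assume x: "x \<in> F"
          have "(\<Sum>i\<in>{i \<in> ?G. atype (Z n) i = x}. ?f i) = (\<Sum>i\<in>{i \<in> {1..n}. atype (Z n) i = x \<and> J n i z}. w x)"
            by (rule sum.mono_neutral_cong_right) (use x in auto)
          then show "(\<Sum>i\<in>{i \<in> ?G. atype (Z n) i = x}. ?f i) = w x * c x n z" by (simp add: c_def)
        qed
        finally have split: "(\<Sum>i\<in>{1..n}. ?f i) / real n = (\<Sum>x\<in>F. w x * c x n z) / real n + (\<Sum>i\<in>?N. ?f i) / real n"
          by (simp add: add_divide_distrib)
        have tail0: "0 \<le> (\<Sum>i\<in>?N. ?f i) / real n" using w0 by (intro divide_nonneg_nonneg sum_nonneg) auto
        have "(\<Sum>i\<in>?N. ?f i) \<le> (\<Sum>i\<in>?N. w (atype (Z n) i))" using w0 by (intro sum_mono) auto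
        then have "(\<Sum>i\<in>?N. ?f i) < e * real n" using elim(1) by linarith
        then have tail: "(\<Sum>i\<in>?N. ?f i) / real n < e" using n0 by (simp add: divide_less_eq)
        have "(\<Sum>x\<in>F. w x * c x n z) / real n - (\<Sum>x\<in>F. w x * (pmf \<mu> x * h x)) = (\<Sum>x\<in>F. w x * (c x n z / real n - pmf \<mu> x * h x))"
          by (simp add: sum_divide_distrib right_diff_distrib sum_subtractf)
        moreover have "\<bar>\<Sum>x\<in>F. w x * (c x n z / real n - pmf \<mu> x * h x)\<bar> \<le> (\<Sum>x\<in>F. w x * \<delta>)"
        proof (rule order_trans[OF sum_abs], rule sum_mono)
          fix x assume "x \<in> F"
          then show "\<bar>w x * (c x n z / real n - pmf \<mu> x * h x)\<bar> \<le> w x * \<delta>"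
            using small[of x] w0[of x] by (simp add: abs_mult mult_left_mono)
        qed
        moreover have "(\<Sum>x\<in>F. w x * \<delta>) \<le> e"
        proof -
          have "(\<Sum>x\<in>F. w x * \<delta>) = (C - 1) * \<delta>" by (simp add: C_def sum_distrib_right)
          also have "... \<le> C * \<delta>" using \<delta> by (simp add: mult_right_mono)
          also have "... = e" using C by (simp add: \<delta>_def)
          finally show ?thesis .
        qed
        ultimately have "\<bar>(\<Sum>x\<in>F. w x * c x n z) / real n - (\<Sum>x\<in>F. w x * (pmf \<mu> x * h x))\<bar> \<le> e" by linarith
        moreover have "4 * e \<le> \<bar>(\<Sum>i\<in>{1..n}. ?f i) / real n - H\<bar>" using zS by (simp add: e_def)
        ultimately show False using split tail0 tail Hlow Hup F(2) e by linarith
      qed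
    qed
  qed
  ultimately show ?thesis by (rule negligible_subset)
qed

end

section \<open>How far the reveals go\<close>

context loss_reveal_sequence
begin

lemma weight_summable:
  assumes w: "limit_weight w W" and h: "\<And>x. 0 \<le> h x" "\<And>x. h x \<le> 1"
  shows "((\<lambda>x. w x * (pmf \<mu> x * h x)) has_sum (\<Sum>\<^sub>\<infinity>x. w x * (pmf \<mu> x * h x))) UNIV"
proof (rule has_sum_infsum)
  have w0: "0 \<le> w x" for x using w by (simp add: limit_weight_def)
  have "(\<lambda>x. w x * pmf \<mu> x) summable_on UNIV"
    using w unfolding limit_weight_def by (intro has_sum_imp_summable) blast
  then show "(\<lambda>x. w x * (pmf \<mu> x * h x)) summable_on UNIV"
  proof (rule summable_on_comparison_test)
    fix x
    have "w x * pmf \<mu> x * h x \<le> w x * pmf \<mu> x * 1" using h(2) w0 by (intro mult_left_mono) auto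
    then show "w x * (pmf \<mu> x * h x) \<le> w x * pmf \<mu> x" by (simp add: mult.assoc)
    show "0 \<le> w x * (pmf \<mu> x * h x)" using h(1) w0 by simp
  qed
qed

text \<open>The limit of the number of outgoing half-edges of ruined agents, divided by \<open>n\<close>. By \<open>fW_eq\<close> the function
  \<open>fW\<close> is what remains of it after \<open>cum t\<close> reveals per agent.\<close>

definition ruinous_limit :: "real \<Rightarrow> real" where
  "ruinous_limit t = (\<Sum>\<^sub>\<infinity>x. real (outdeg P x) * (pmf \<mu> x * (1 - survivor_fraction x t)))"

lemma ruinous_limit_has_sum:
  assumes t: "0 \<le> t" "cum t < lam"
  shows "((\<lambda>x. real (outdeg P x) * (pmf \<mu> x * (1 - survivor_fraction x t))) has_sum ruinous_limit t) UNIV"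
  unfolding ruinous_limit_def
  by (rule weight_summable[OF limit_weight_out]) (use survivor_fraction_bounds[OF t] in auto)

lemma fW_eq:
  assumes t: "0 \<le> t" "cum t < lam"
  shows "fW P \<mu> R lam t = ruinous_limit t - cum t"
proof -
  have "((\<lambda>x. - (real (outdeg P x) * (pmf \<mu> x * (1 - survivor_fraction x t)))) has_sum (- ruinous_limit t)) UNIV"
    using ruinous_limit_has_sum[OF t] by (simp only: has_sum_uminus minus_minus)
  from has_sum_add[OF lam_out this]
  have "((\<lambda>x. pmf \<mu> x * real (outdeg P x) * survivor_fraction x t) has_sum (lam - ruinous_limit t)) UNIV"
    by (simp add: algebra_simps)
  then have "(\<Sum>\<^sub>\<infinity>x. pmf \<mu> x * real (outdeg P x) * survivor_fraction x t) = lam - ruinous_limit t" by (rule infsumI)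
  moreover have "lam * (1 - phi R lam t) = lam - cum t"
    using phi_eq[OF t(1) less_imp_le[OF t(2)]] lam_pos by (simp add: right_diff_distrib)
  ultimately show ?thesis
    unfolding fW_def survivor_fraction_eq[OF t(1) less_imp_le[OF t(2)]] by simp
qed

lemma ruinous_limit_nonneg:
  assumes t: "0 \<le> t" "cum t < lam" shows "0 \<le> ruinous_limit t"
  by (rule has_sum_nonneg[OF ruinous_limit_has_sum[OF t]]) (use survivor_fraction_bounds[OF t] in simp)

text \<open>The sum is a uniform limit of finite sums of continuous functions.\<close>

lemma continuous_on_ruinous_limit: "continuous_on {t. 0 \<le> t \<and> cum t < lam} ruinous_limit"
  unfolding continuous_on_def
proof (intro ballI tendstoI)
  fix t e :: real assume t: "t \<in> {t. 0 \<le> t \<and> cum t < lam}" and e: "0 < e"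
  let ?A = "{t. 0 \<le> t \<and> cum t < lam}"
  from limit_weight_tail[OF limit_weight_out, of "e / 3"] e obtain F
    where F: "finite F" "lam - (\<Sum>x\<in>F. real (outdeg P x) * pmf \<mu> x) < e / 3" by auto
  define p where "p t = (\<Sum>x\<in>F. real (outdeg P x) * (pmf \<mu> x * (1 - survivor_fraction x t)))" for t
  have close: "p u \<le> ruinous_limit u \<and> ruinous_limit u - p u < e / 3" if "u \<in> ?A" for u
  proof -
    have u: "0 \<le> u" "cum u < lam" using that by auto
    have h: "0 \<le> 1 - survivor_fraction x u" "1 - survivor_fraction x u \<le> 1" for x
      using survivor_fraction_bounds[OF u] by auto
    show ?thesis
      using weight_remainder[OF limit_weight_out h ruinous_limit_has_sum[OF u] F(1)] F(2) unfolding p_def by linarith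
  qed
  have "isCont p t" unfolding p_def by (intro continuous_intros isCont_survivor_fraction)
  then have "(p \<longlongrightarrow> p t) (at t within ?A)" unfolding isCont_def by (rule tendsto_within_subset[OF _ subset_UNIV])
  then have "\<forall>\<^sub>F u in at t within ?A. dist (p u) (p t) < e / 3" by (rule tendstoD) (use e in simp)
  moreover have "\<forall>\<^sub>F u in at t within ?A. u \<in> ?A" by (simp only: eventually_at_filter) simp
  ultimately show "\<forall>\<^sub>F u in at t within ?A. dist (ruinous_limit u) (ruinous_limit t) < e"
  proof eventually_elim
    case (elim u)
    show ?case using close[OF elim(2)] close[OF t] elim(1) unfolding dist_real_def by linarith
  qed
qed

text \<open>Intermediate values: the difference is not negative at 0 and has no zero before \<open>t_star\<close>.\<close>

lemma positive_before_t_star: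
  assumes t: "0 \<le> t" "cum t < lam" and star: "ereal t < t_star P \<mu> R lam"
  shows "cum t < ruinous_limit t"
proof (rule ccontr)
  assume neg: "\<not> cum t < ruinous_limit t"
  have le: "cum u < lam" if "u \<le> t" for u using cum_mono[OF that] t(2) by linarith
  have "\<exists>u. 0 \<le> u \<and> u \<le> t \<and> ruinous_limit u - cum u = 0"
  proof (rule IVT2')
    show "ruinous_limit t - cum t \<le> 0" using neg by simp
    show "0 \<le> ruinous_limit 0 - cum 0" using ruinous_limit_nonneg[of 0] cum_eq_0[of 0] lam_pos by simp
    show "continuous_on {0..t} (\<lambda>u. ruinous_limit u - cum u)"
    proof (intro continuous_on_diff)
      show "continuous_on {0..t} ruinous_limit" by (rule continuous_on_subset[OF continuous_on_ruinous_limit]) (use le in auto)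
      show "continuous_on {0..t} cum" by (simp add: continuous_at_imp_continuous_on isCont_cum)
    qed
  qed (rule t(1))
  then obtain u where u: "0 \<le> u" "u \<le> t" "ruinous_limit u - cum u = 0" by blast
  then have "fW P \<mu> R lam u = 0" using fW_eq[OF u(1) le[OF u(2)]] by simp
  then have "t_star P \<mu> R lam \<le> ereal u" unfolding t_star_def using u(1) by (intro Inf_lower) auto
  also have "... \<le> ereal t" using u(2) by simp
  finally show False using star by simp
qed

lemma reveals_until_le: "real (reveals_until t n) \<le> real n * cum t"
  using cum_nonneg[of t] by simp

text \<open>The statement of \<open>insolvent_limit\<close>, summed over all types with the outgoing degrees as weights.\<close>

lemma ruined_out_limit:
  assumes t: "0 \<le> t" "cum t < lam" and \<epsilon>: "0 < \<epsilon>"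
  shows "negligible (\<lambda>n. {z \<in> occ n (reveals_until t n).
    \<epsilon> \<le> \<bar>real (reveal_process.ruined_out P n (Z n) (reveals_until t n) z) / real n - ruinous_limit t\<bar>})"
proof -
  have "negligible (\<lambda>n. {z \<in> occ n (reveals_until t n). \<epsilon> \<le>
      \<bar>(\<Sum>i\<in>{1..n}. if insolv n i (reveals_until t n) z then real (outdeg P (atype (Z n) i)) else 0) / real n - ruinous_limit t\<bar>})"
    by (rule weighted_limit[OF limit_weight_out _ _ \<epsilon> ruinous_limit_has_sum[OF t] insolvent_limit[OF t]])
       (use survivor_fraction_bounds[OF t] in auto)
  then show ?thesis
  proof (rule negligible_subset)
    show "\<forall>\<^sub>F n in sequentially. {z \<in> occ n (reveals_until t n).
      \<epsilon> \<le> \<bar>real (reveal_process.ruined_out P n (Z n) (reveals_until t n) z) / real n - ruinous_limit t\<bar>}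
      \<subseteq> {z \<in> occ n (reveals_until t n). \<epsilon> \<le>
      \<bar>(\<Sum>i\<in>{1..n}. if insolv n i (reveals_until t n) z then real (outdeg P (atype (Z n) i)) else 0) / real n - ruinous_limit t\<bar>}"
      using eventually_ge_at_top[of 1]
    proof eventually_elim
      case (elim n)
      interpret reveal_process P n "Z n" by (rule reveal_process[OF elim])
      have "real (ruined_out k z) = (\<Sum>i\<in>{1..n}. if insolvent i k z then real (outdeg P (atype (Z n) i)) else 0)" for k z
        unfolding ruined_out_def of_nat_sum by (rule sum.cong) auto
      then show ?case by simp
    qed
  qed
qed

text \<open>As long as the limit of the number of unrevealed ruinous half-edges stays positive, the process goes on.
  It suffices to look at finitely many times, since few reveals take place between two neighbours on a
  fine grid.\<close>

lemma reached:
  assumes t: "0 \<le> t" "cum t < lam" and pos: "\<And>s. 0 \<le> s \<Longrightarrow> s \<le> t \<Longrightarrow> cum s < ruinous_limit s"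
  shows "negligible (unreached t)"
proof -
  have below: "cum u < lam" if "u \<le> t" for u using cum_mono[OF that] t(2) by linarith
  have "continuous_on {0..t} (\<lambda>u. ruinous_limit u - cum u)"
  proof (intro continuous_on_diff)
    show "continuous_on {0..t} ruinous_limit" by (rule continuous_on_subset[OF continuous_on_ruinous_limit]) (use below in auto)
    show "continuous_on {0..t} cum" by (simp add: continuous_at_imp_continuous_on isCont_cum)
  qed
  from continuous_attains_inf[OF compact_Icc _ this] t(1)
  obtain u where u: "u \<in> {0..t}" "\<forall>v\<in>{0..t}. ruinous_limit u - cum u \<le> ruinous_limit v - cum v" by auto
  define c where "c = ruinous_limit u - cum u"
  have c: "0 < c" using pos[of u] u(1) by (simp add: c_def)
  obtain N :: nat where N: "4 * cum t / c < real N" using reals_Archimedean2 by blast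
  have N0: "0 < real N" using N c cum_nonneg[of t] by (meson divide_nonneg_pos le_less_trans mult_nonneg_nonneg zero_le_numeral)
  define r where "r j = cum_inv (real j * cum t / real N)" for j :: nat
  have lvl: "0 \<le> real j * cum t / real N" for j :: nat using cum_nonneg[of t] by simp
  have lvl_le: "real j * cum t / real N \<le> cum t" if "j \<le> N" for j
  proof -
    have "real j * cum t \<le> real N * cum t" using that cum_nonneg[of t] by (intro mult_right_mono) auto
    then show ?thesis using N0 by (simp add: divide_le_eq mult.commute)
  qed
  have r: "0 \<le> r j" "cum (r j) = real j * cum t / real N" "r j \<le> t" if "j \<le> N" for j
  proof -
    have less: "real j * cum t / real N < cum_total" using lvl_le[OF that] cum_less_total[OF t(1)] by linarith
    show 1: "0 \<le> r j" "cum (r j) = real j * cum t / real N" unfolding r_def by (rule cum_inv[OF lvl less])+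
    show "r j \<le> t" using cum_le_iff[OF 1(1) t(1)] 1(2) lvl_le[OF that] by simp
  qed
  have cum_r0: "cum (r 0) = 0" using r(2)[of 0] by simp
  have cum_rN: "cum (r N) = cum t" using r(2)[of N] N0 by simp
  have step: "cum (r (Suc j)) \<le> cum (r j) + c / 4" if "Suc j \<le> N" for j
  proof -
    have "cum t / real N \<le> c / 4" using N c N0 by (simp add: field_simps)
    then show ?thesis using that r(2)[of j] r(2)[of "Suc j"] by (simp add: add_divide_distrib distrib_right)
  qed
  define \<eta> where "\<eta> = (cum_total - cum t) / 4"
  have \<eta>: "0 < \<eta>" using cum_less_total[OF t(1)] by (simp add: \<eta>_def)
  define V where "V j n = {z \<in> occ n (reveals_until (r j) n).
    c / 4 \<le> \<bar>real (reveal_process.ruined_out P n (Z n) (reveals_until (r j) n) z) / real n - ruinous_limit (r j)\<bar>}" for j n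
  have "negligible (V j)" if "j \<in> {..N}" for j
  proof -
    have j: "j \<le> N" using that by simp
    show ?thesis unfolding V_def[abs_def]
      by (rule ruined_out_limit[OF r(1)[OF j] below[OF r(3)[OF j]]]) (use c in simp)
  qed
  then have "negligible (\<lambda>n. \<Union>j\<in>{..N}. V j n)" by (intro negligible_UN finite_atMost)
  then have "negligible (\<lambda>n. timing_bad \<eta> n \<union> (\<Union>j\<in>{..N}. V j n))" by (intro negligible_Un timing_bad_negligible \<eta>)
  then show ?thesis
  proof (rule negligible_subset)
    show "\<forall>\<^sub>F n in sequentially. unreached t n \<subseteq> timing_bad \<eta> n \<union> (\<Union>j\<in>{..N}. V j n)"
      using eventually_ge_at_top[of 1]
    proof eventually_elim
      case (elim n)
      interpret T: timed_process P n "Z n" R by (rule timed_process[OF elim])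
      have n0: "0 < real n" using elim by simp
      show ?case
      proof
        fix z assume "z \<in> unreached t n"
        then have sp: "z \<in> space (PM (Z n))" and no: "z \<notin> occ n (reveals_until t n)" by auto
        show "z \<in> timing_bad \<eta> n \<union> (\<Union>j\<in>{..N}. V j n)"
        proof (rule ccontr)
          assume "z \<notin> timing_bad \<eta> n \<union> (\<Union>j\<in>{..N}. V j n)"
          then have good: "z \<notin> timing_bad \<eta> n" and nV: "z \<notin> V j n" if "j \<le> N" for j using that by auto
          have goodt: "z \<notin> timing_bad \<eta> n" using good[of 0] by simp
          define k where "k = T.last_reveal z"
          have k: "z \<in> occ n k" "time (Z n) (Suc k) z = \<infinity>" unfolding k_def by (rule T.last_reveal[OF sp])+
          have k_less: "k < reveals_until t n" using no T.last_reveal(2)[OF sp] unfolding k_def by (simp only: not_le)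
          define m where "m = (LEAST m. k < reveals_until (r m) n)"
          have rN: "k < reveals_until (r N) n" using k_less by (simp only: cum_rN)
          have m: "k < reveals_until (r m) n" unfolding m_def by (rule LeastI[of "\<lambda>m. k < reveals_until (r m) n", OF rN])
          have mN: "m \<le> N" unfolding m_def by (rule Least_le[of "\<lambda>m. k < reveals_until (r m) n", OF rN])
          have "m \<noteq> 0" using m cum_r0 by (intro notI) simp
          then obtain j where mj: "m = Suc j" using not0_implies_Suc by blast
          have jN: "j \<le> N" "Suc j \<le> N" using mN mj by auto
          have jk: "reveals_until (r j) n \<le> k"
          proof -
            have "j < (LEAST m. k < reveals_until (r m) n)" using mj unfolding m_def by simp
            from not_less_Least[OF this] show ?thesis by (simp only: not_less)
          qed
          have occj: "z \<in> occ n (reveals_until (r j) n)" using k(1) T.occurred_antimono[OF jk] by blast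
          have "\<bar>real (T.ruined_out (reveals_until (r j) n) z) / real n - ruinous_limit (r j)\<bar> < c / 4"
            using nV[OF jN(1)] occj unfolding V_def by (simp add: not_le)
          moreover have "c \<le> ruinous_limit (r j) - cum (r j)"
          proof -
            have "r j \<in> {0..t}" using r[OF jN(1)] by simp
            then show ?thesis using u(2) unfolding c_def by blast
          qed
          ultimately have "cum (r j) + c / 4 < real (T.ruined_out (reveals_until (r j) n) z) / real n" using c by linarith
          then have "cum (r (Suc j)) < real (T.ruined_out (reveals_until (r j) n) z) / real n" using step[OF jN(2)] by linarith
          then have "real n * cum (r (Suc j)) < real (T.ruined_out (reveals_until (r j) n) z)"
            using n0 by (simp add: less_divide_eq mult.commute)
          moreover have "real k < real n * cum (r (Suc j))"
            using m reveals_until_le[where t="r m" and n=n] unfolding mj by linarith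
          moreover have "T.ruined_out (reveals_until (r j) n) z \<le> T.ruined_out k z"
            unfolding T.ruined_out_def using T.insolvent_mono[OF _ jk] by (intro sum_mono) auto
          ultimately have "k < T.ruined_out k z" by linarith
          then have act: "z \<in> active P n (Z n) k" using k(1) by (simp add: T.active_iff)
          have "cum_total - cum (T.rtime k z) \<le> \<eta>"
            by (rule timing_good(2)[OF elim goodt k(1) less_imp_le[OF \<eta>] act k(2)])
          moreover have "\<bar>real k / real n - cum (T.rtime k z)\<bar> \<le> 2 * \<eta>"
            by (rule timing_good(1)[OF elim goodt k(1) less_imp_le[OF \<eta>]])
          moreover have "real k / real n \<le> cum t"
          proof -
            have "real k \<le> real n * cum t" using k_less reveals_until_le[where t=t and n=n] by linarith
            then show ?thesis using n0 by (simp add: divide_le_eq mult.commute)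
          qed
          ultimately show False using cum_less_total[OF t(1)] unfolding \<eta>_def by (simp add: abs_le_iff)
        qed
      qed
    qed
  qed
qed

text \<open>Every reveal uses up a ruinous half-edge, so the process cannot get to a step at which there would be
  fewer of these than reveals.\<close>

lemma not_reached:
  assumes t: "0 \<le> t" "cum t < lam" and neg: "ruinous_limit t < cum t"
  shows "negligible (\<lambda>n. occ n (reveals_until t n))"
proof -
  define c where "c = (cum t - ruinous_limit t) / 2"
  have c: "0 < c" and c2: "cum t = ruinous_limit t + 2 * c" using neg by (simp_all add: c_def field_simps)
  show ?thesis
  proof (rule negligible_subset[OF ruined_out_limit[OF t c]])
    obtain N :: nat where N: "1 / c < real N" using reals_Archimedean2 by blast
    show "\<forall>\<^sub>F n in sequentially. occ n (reveals_until t n) \<subseteq> {z \<in> occ n (reveals_until t n).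
      c \<le> \<bar>real (reveal_process.ruined_out P n (Z n) (reveals_until t n) z) / real n - ruinous_limit t\<bar>}"
      using eventually_ge_at_top[of "max 1 N"]
    proof eventually_elim
      case (elim n)
      then have n1: "1 \<le> n" and nN: "N \<le> n" by auto
      interpret T: reveal_process P n "Z n" by (rule reveal_process[OF n1])
      have n0: "0 < real n" using n1 by simp
      have "1 / c < real n" using N nN by (meson of_nat_le_iff less_le_trans)
      then have one: "1 / real n < c" using c n0 by (simp add: field_simps)
      show ?case
      proof
        fix z assume z: "z \<in> occ n (reveals_until t n)"
        have "real n * cum t - 1 \<le> real (reveals_until t n)" using cum_nonneg[of t] by linarith
        also have "... \<le> real (T.ruined_out (reveals_until t n) z)" using T.occurred_le_ruined_out[OF z] by (simp only: of_nat_le_iff)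
        finally have "(real n * cum t - 1) / real n \<le> real (T.ruined_out (reveals_until t n) z) / real n"
          by (rule divide_right_mono) simp
        moreover have "(real n * cum t - 1) / real n = cum t - 1 / real n" using n0 by (simp add: diff_divide_distrib)
        ultimately have "cum t - 1 / real n \<le> real (T.ruined_out (reveals_until t n) z) / real n" by (simp only:)
        then have "c \<le> real (T.ruined_out (reveals_until t n) z) / real n - ruinous_limit t"
          using one c2 by linarith
        then show "z \<in> {z \<in> occ n (reveals_until t n).
            c \<le> \<bar>real (T.ruined_out (reveals_until t n) z) / real n - ruinous_limit t\<bar>}" using z by simp
      qed
    qed
  qed
qed

end

section \<open>The final state\<close>

context loss_reveal_sequence
begin

text \<open>\<open>settles s\<close>: the number of reveals stops close to its value at a time at which the fraction of
  survivors of type \<open>x\<close> is close to \<open>s x\<close>. Near the end each further reveal ruins at most one agent, so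
  this determines the final fractions.\<close>

definition settles :: "('x \<Rightarrow> real) \<Rightarrow> bool" where
  "settles s \<longleftrightarrow> (\<forall>x. 0 \<le> s x \<and> s x \<le> 1) \<and> (\<forall>x. \<forall>\<delta>>0. \<exists>t. 0 \<le> t \<and> cum t < lam \<and>
     \<bar>survivor_fraction x t - s x\<bar> < \<delta> \<and>
     negligible (unreached t) \<and>
     negligible (\<lambda>n. {z \<in> space (PM (Z n)). real n * (cum t + \<delta>) < real (final n z)}))"

lemma eventually_one_le: "0 < \<delta> \<Longrightarrow> \<forall>\<^sub>F n in sequentially. 1 \<le> \<delta> * real n"
proof -
  assume \<delta>: "0 < \<delta>"
  obtain N :: nat where N: "1 / \<delta> < real N" using reals_Archimedean2 by blast
  show ?thesis using eventually_ge_at_top[of N]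
  proof eventually_elim
    case (elim n)
    then have "1 / \<delta> < real n" using N by (meson of_nat_le_iff less_le_trans)
    then show ?case using \<delta> by (simp add: divide_less_eq mult.commute)
  qed
qed

lemma settled_types:
  assumes s: "settles s" and \<epsilon>: "0 < \<epsilon>"
  shows "negligible (\<lambda>n. {z \<in> space (PM (Z n)).
    \<epsilon> \<le> \<bar>real (card {i \<in> {1..n}. atype (Z n) i = x \<and> insolv n i (final n z) z}) / real n - pmf \<mu> x * (1 - s x)\<bar>})"
    (is "negligible ?S")
proof -
  define \<delta> where "\<delta> = \<epsilon> / 4"
  have \<delta>: "0 < \<delta>" using \<epsilon> by (simp add: \<delta>_def)
  from s \<delta> have "\<exists>t. 0 \<le> t \<and> cum t < lam \<and> \<bar>survivor_fraction x t - s x\<bar> < \<delta> \<and>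
     negligible (unreached t) \<and>
     negligible (\<lambda>n. {z \<in> space (PM (Z n)). real n * (cum t + \<delta>) < real (final n z)})"
    unfolding settles_def by blast
  then obtain t where t_all: "0 \<le> t \<and> cum t < lam \<and> \<bar>survivor_fraction x t - s x\<bar> < \<delta> \<and>
     negligible (unreached t) \<and>
     negligible (\<lambda>n. {z \<in> space (PM (Z n)). real n * (cum t + \<delta>) < real (final n z)})" ..
  define N where "N n = unreached t n" for n
  define L where "L n = {z \<in> space (PM (Z n)). real n * (cum t + \<delta>) < real (final n z)}" for n
  have t: "0 \<le> t" "cum t < lam" "\<bar>survivor_fraction x t - s x\<bar> < \<delta>" and N: "negligible N" and L: "negligible L"
    using t_all unfolding N_def[abs_def] L_def[abs_def] by simp_all
  define D where "D n = {z \<in> occ n (reveals_until t n).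
    \<delta> \<le> \<bar>real (card {i \<in> {1..n}. atype (Z n) i = x \<and> insolv n i (reveals_until t n) z}) / real n
      - pmf \<mu> x * (1 - survivor_fraction x t)\<bar>}" for n
  have D: "negligible D" unfolding D_def[abs_def] by (rule insolvent_limit[OF t(1,2) \<delta>])
  have "negligible (\<lambda>n. N n \<union> L n \<union> D n)" by (intro negligible_Un N L D)
  then show ?thesis
  proof (rule negligible_subset)
    show "\<forall>\<^sub>F n in sequentially. ?S n \<subseteq> N n \<union> L n \<union> D n"
      using eventually_one_le[OF \<delta>] eventually_ge_at_top[of 1]
    proof eventually_elim
      case (elim n)
      interpret T: reveal_process P n "Z n" by (rule reveal_process[OF elim(2)])
      have n0: "0 < real n" using elim(2) by simp
      show ?case
      proof
        fix z assume zS: "z \<in> ?S n"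
        then have sp: "z \<in> space (PM (Z n))" by simp
        let ?k = "reveals_until t n"
        let ?l = "T.last_reveal z"
        let ?I = "{i \<in> {1..n}. atype (Z n) i = x}"
        define a where "a k = real (card {i \<in> {1..n}. atype (Z n) i = x \<and> T.insolvent i k z})" for k
        have a_eq: "a k = real (card {i \<in> ?I. T.insolvent i k z})" for k
          unfolding a_def by (intro arg_cong[where f=real] arg_cong[where f=card]) blast
        show "z \<in> N n \<union> L n \<union> D n"
        proof (rule ccontr)
          assume "z \<notin> N n \<union> L n \<union> D n"
          then have occ: "z \<in> occ n ?k" and last: "real ?l \<le> real n * (cum t + \<delta>)" and "z \<notin> D n"
            using sp by (auto simp: N_def L_def not_less)
          then have dev: "\<bar>a ?k / real n - pmf \<mu> x * (1 - survivor_fraction x t)\<bar> < \<delta>"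
            unfolding D_def a_def by (simp add: not_le)
          have kl: "?k \<le> ?l" using T.last_reveal(2)[OF sp] occ by blast
          have "{i \<in> ?I. T.insolvent i ?k z} \<subseteq> {i \<in> ?I. T.insolvent i ?l z}" using T.insolvent_mono[OF _ kl] by blast
          then have low: "a ?k \<le> a ?l" unfolding a_eq by (simp only: of_nat_le_iff) (rule card_mono, simp)
          have "card {i \<in> ?I. T.insolvent i ?l z} \<le> card {i \<in> ?I. T.insolvent i ?k z} + (?l - ?k)"
            by (rule T.card_insolvent_le[OF T.last_reveal(1)[OF sp] kl Collect_restrict])
          then have up: "a ?l \<le> a ?k + (real ?l - real ?k)" unfolding a_eq using kl by linarith
          have "real n * cum t - 1 \<le> real ?k" using cum_nonneg[of t] by linarith
          then have "a ?l \<le> a ?k + (2 * \<delta>) * real n" using up last elim(1) by (simp add: algebra_simps)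
          then have "a ?l / real n \<le> (a ?k + (2 * \<delta>) * real n) / real n" by (rule divide_right_mono) simp
          also have "... = a ?k / real n + 2 * \<delta>" using n0 by (simp add: add_divide_distrib)
          finally have up': "a ?l / real n \<le> a ?k / real n + 2 * \<delta>" .
          have low': "a ?k / real n \<le> a ?l / real n" by (rule divide_right_mono[OF low]) simp
          have "\<bar>pmf \<mu> x * (1 - survivor_fraction x t) - pmf \<mu> x * (1 - s x)\<bar> = pmf \<mu> x * \<bar>survivor_fraction x t - s x\<bar>"
            by (simp add: right_diff_distrib[symmetric] abs_mult abs_minus_commute)
          also have "... \<le> 1 * \<bar>survivor_fraction x t - s x\<bar>" by (rule mult_right_mono[OF pmf_le_1]) simp
          finally have "\<bar>pmf \<mu> x * (1 - survivor_fraction x t) - pmf \<mu> x * (1 - s x)\<bar> < \<delta>" using t(3) by simp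
          moreover have "4 * \<delta> \<le> \<bar>a ?l / real n - pmf \<mu> x * (1 - s x)\<bar>" using zS unfolding a_def by (simp add: \<delta>_def)
          ultimately show False using dev up' low' by linarith
        qed
      qed
    qed
  qed
qed

lemma settled_total:
  assumes s: "settles s" and \<epsilon>: "0 < \<epsilon>"
  shows "negligible (\<lambda>n. {z \<in> space (PM (Z n)).
    \<epsilon> \<le> \<bar>real (card {i \<in> {1..n}. insolv n i (final n z) z}) / real n - (\<Sum>\<^sub>\<infinity>x. pmf \<mu> x * (1 - s x))\<bar>})"
proof -
  have h: "0 \<le> 1 - s x" "1 - s x \<le> 1" for x using s by (auto simp: settles_def)
  have "negligible (\<lambda>n. {z \<in> space (PM (Z n)). \<epsilon> \<le>
      \<bar>(\<Sum>i\<in>{1..n}. if insolv n i (final n z) z then 1 else 0) / real n - (\<Sum>\<^sub>\<infinity>x. 1 * (pmf \<mu> x * (1 - s x)))\<bar>})"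
    by (rule weighted_limit[OF limit_weight_1 h \<epsilon> weight_summable[OF limit_weight_1 h] settled_types[OF s]])
  moreover have "(\<Sum>i\<in>{1..n}. if insolv n i (final n z) z then 1 else 0) = real (card {i \<in> {1..n}. insolv n i (final n z) z})" for n z
    by (simp flip: sum.inter_filter)
  ultimately show ?thesis by (simp only: mult_1)
qed

lemma ruin_count_eq:
  assumes "1 \<le> n" "z \<in> space (PM (Z n))"
  shows "ruin_count P n (Z n) (stop_time P n (Z n) z) z = card {i \<in> {1..n}. insolv n i (final n z) z}"
    and "ruin_count_type P n (Z n) x (stop_time P n (Z n) z) z = card {i \<in> {1..n}. atype (Z n) i = x \<and> insolv n i (final n z) z}"
proof -
  interpret T: reveal_process P n "Z n" by (rule reveal_process[OF assms(1)])
  show "ruin_count P n (Z n) (stop_time P n (Z n) z) z = card {i \<in> {1..n}. insolv n i (final n z) z}"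
    "ruin_count_type P n (Z n) x (stop_time P n (Z n) z) z = card {i \<in> {1..n}. atype (Z n) i = x \<and> insolv n i (final n z) z}"
    unfolding ruin_count_def ruin_count_type_def T.ruined_stop_time[OF assms(2)] by (rule refl)+
qed

text \<open>Dividing by the number of agents of the type needs a positive limit of their fraction.\<close>

lemma settled_conv:
  assumes s: "settles s" and x: "0 < pmf \<mu> x"
  shows "conv_in_prob (\<lambda>n. PM (Z n)) (\<lambda>n z. real (ruin_count_type P n (Z n) x (stop_time P n (Z n) z) z)
           / (real n * type_frac n (Z n) x)) (1 - s x)"
  unfolding conv_in_prob_def
proof (intro allI impI)
  fix e :: real assume e: "0 < e"
  let ?p = "pmf \<mu> x"
  define \<epsilon> where "\<epsilon> = e * ?p / 4"
  have \<epsilon>: "0 < \<epsilon>" using e x by (simp add: \<epsilon>_def)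
  let ?S = "\<lambda>n. {z \<in> space (PM (Z n)). \<bar>real (ruin_count_type P n (Z n) x (stop_time P n (Z n) z) z)
           / (real n * type_frac n (Z n) x) - (1 - s x)\<bar> > e}"
  have "negligible ?S"
  proof (rule negligible_subset[OF settled_types[OF s \<epsilon>]])
    have "\<forall>\<^sub>F n in sequentially. dist (type_frac n (Z n) x) ?p < min \<epsilon> (?p / 2)"
      by (rule tendstoD[OF types]) (use \<epsilon> x in simp)
    then show "\<forall>\<^sub>F n in sequentially. ?S n \<subseteq> {z \<in> space (PM (Z n)).
      \<epsilon> \<le> \<bar>real (card {i \<in> {1..n}. atype (Z n) i = x \<and> insolv n i (final n z) z}) / real n - ?p * (1 - s x)\<bar>}"
      using eventually_ge_at_top[of 1]
    proof eventually_elim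
      case (elim n)
      let ?f = "type_frac n (Z n) x"
      have fd: "\<bar>?f - ?p\<bar> < \<epsilon>" "\<bar>?f - ?p\<bar> < ?p / 2" using elim(1) unfolding dist_real_def by simp_all
      have f: "?p / 2 < ?f" using fd(2) by linarith
      have f0: "0 < ?f" using f x by linarith
      show ?case
      proof
        fix z assume z: "z \<in> ?S n"
        then have sp: "z \<in> space (PM (Z n))" by simp
        define c where "c = real (card {i \<in> {1..n}. atype (Z n) i = x \<and> insolv n i (final n z) z}) / real n"
        have "e < \<bar>c / ?f - (1 - s x)\<bar>"
          using z unfolding c_def by (simp add: ruin_count_eq(2)[OF elim(2) sp] mult.commute)
        also have "\<bar>c / ?f - (1 - s x)\<bar> = \<bar>c - ?f * (1 - s x)\<bar> / ?f"
        proof -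
          have "c / ?f - (1 - s x) = (c - ?f * (1 - s x)) / ?f" using f0 by (simp add: diff_divide_distrib)
          then show ?thesis using f0 by (simp only: abs_divide abs_of_pos)
        qed
        finally have "e * ?f < \<bar>c - ?f * (1 - s x)\<bar>" using f0 by (simp add: less_divide_eq)
        moreover have "e * (?p / 2) \<le> e * ?f" using f e by (intro mult_left_mono) auto
        moreover have "\<bar>?f * (1 - s x) - ?p * (1 - s x)\<bar> \<le> \<epsilon>"
        proof -
          have s01: "0 \<le> 1 - s x" "1 - s x \<le> 1" using s by (auto simp: settles_def)
          have "\<bar>?f * (1 - s x) - ?p * (1 - s x)\<bar> = \<bar>?f - ?p\<bar> * (1 - s x)"
            using s01 by (simp add: left_diff_distrib[symmetric] abs_mult)
          also have "... \<le> \<epsilon> * 1" using fd s01 \<epsilon> by (intro mult_mono) auto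
          finally show ?thesis by simp
        qed
        moreover have "e * (?p / 2) = 2 * \<epsilon>" by (simp add: \<epsilon>_def)
        ultimately have "\<epsilon> \<le> \<bar>c - ?p * (1 - s x)\<bar>" by linarith
        then show "z \<in> {z \<in> space (PM (Z n)).
          \<epsilon> \<le> \<bar>real (card {i \<in> {1..n}. atype (Z n) i = x \<and> insolv n i (final n z) z}) / real n - ?p * (1 - s x)\<bar>}"
          using sp unfolding c_def by blast
      qed
    qed
  qed
  then show "(\<lambda>n. measure (PM (Z n)) (?S n)) \<longlonglongrightarrow> 0" by (rule negligible_measure)
qed

lemma settled_small_op:
  assumes s: "settles s"
  shows "small_op (\<lambda>n. PM (Z n)) (\<lambda>n z. ereal (real (ruin_count P n (Z n) (stop_time P n (Z n) z) z)
             - real n * (\<Sum>\<^sub>\<infinity>x. pmf \<mu> x * (1 - s x))))"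
  unfolding small_op_def
proof (intro allI impI)
  fix e :: real assume e: "0 < e"
  let ?H = "\<Sum>\<^sub>\<infinity>x. pmf \<mu> x * (1 - s x)"
  let ?S = "\<lambda>n. {z \<in> space (PM (Z n)). \<bar>ereal (real (ruin_count P n (Z n) (stop_time P n (Z n) z) z)
             - real n * ?H)\<bar> > ereal (e * real n)}"
  have "negligible ?S"
  proof (rule negligible_subset[OF settled_total[OF s e]])
    show "\<forall>\<^sub>F n in sequentially. ?S n \<subseteq> {z \<in> space (PM (Z n)).
      e \<le> \<bar>real (card {i \<in> {1..n}. insolv n i (final n z) z}) / real n - ?H\<bar>}"
      using eventually_ge_at_top[of 1]
    proof eventually_elim
      case (elim n)
      have n0: "0 < real n" using elim by simp
      show ?case
      proof
        fix z assume z: "z \<in> ?S n"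
        then have sp: "z \<in> space (PM (Z n))" by simp
        define c where "c = real (card {i \<in> {1..n}. insolv n i (final n z) z})"
        have "e * real n < \<bar>c - real n * ?H\<bar>"
          using z unfolding c_def by (simp add: ruin_count_eq(1)[OF elim sp])
        moreover have "c / real n - ?H = (c - real n * ?H) / real n" using n0 by (simp add: diff_divide_distrib)
        then have "\<bar>c / real n - ?H\<bar> = \<bar>c - real n * ?H\<bar> / real n" using n0 by (simp only: abs_divide abs_of_pos)
        ultimately have "e \<le> \<bar>c / real n - ?H\<bar>" using n0 by (simp add: le_divide_eq)
        then show "z \<in> {z \<in> space (PM (Z n)). e \<le> \<bar>real (card {i \<in> {1..n}. insolv n i (final n z) z}) / real n - ?H\<bar>}"
          using sp unfolding c_def by blast
      qed
    qed
  qed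
  then show "(\<lambda>n. measure (PM (Z n)) (?S n)) \<longlonglongrightarrow> 0" by (rule negligible_measure)
qed

text \<open>If almost all half-edges are revealed, then almost all outgoing half-edges belong to ruined agents,
  and agents that have outgoing half-edges cannot escape.\<close>

lemma exhausted_small_op:
  assumes far: "\<And>\<delta>. 0 < \<delta> \<Longrightarrow> \<exists>t. 0 \<le> t \<and> lam - \<delta> < cum t \<and>
      negligible (unreached t)"
    and out: "\<And>x. 0 < pmf \<mu> x \<Longrightarrow> 0 < outdeg P x"
  shows "small_op (\<lambda>n. PM (Z n)) (\<lambda>n z. ereal (real n - real (ruin_count P n (Z n) (stop_time P n (Z n) z) z)))"
  unfolding small_op_def
proof (intro allI impI)
  fix e :: real assume e: "0 < e"
  let ?S = "\<lambda>n. {z \<in> space (PM (Z n)). \<bar>ereal (real n - real (ruin_count P n (Z n) (stop_time P n (Z n) z) z))\<bar> > ereal (e * real n)}"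
  define \<delta> where "\<delta> = e / 8"
  have \<delta>: "0 < \<delta>" using e by (simp add: \<delta>_def)
  from far[OF \<delta>] obtain t where t: "0 \<le> t" "lam - \<delta> < cum t"
    and N: "negligible (unreached t)" by auto
  from limit_weight_tail[OF limit_weight_1, of "4 * \<delta>"] \<delta> obtain F
    where F: "finite F" "F \<subseteq> set_pmf \<mu>"
      "\<forall>\<^sub>F n in sequentially. (\<Sum>i\<in>{i \<in> {1..n}. atype (Z n) i \<notin> F}. 1) < (4 * \<delta>) * real n" by auto
  have "(\<lambda>n. (\<Sum>i\<in>{1..n}. real (outdeg P (atype (Z n) i))) / real n) \<longlonglongrightarrow> lam"
    using limit_weight_out by (simp only: limit_weight_def)
  from order_tendstoD(2)[OF this, of "lam + \<delta>"] \<delta>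
  have outs: "\<forall>\<^sub>F n in sequentially. (\<Sum>i\<in>{1..n}. real (outdeg P (atype (Z n) i))) / real n < lam + \<delta>" by simp
  have "negligible ?S"
  proof (rule negligible_subset[OF N])
    show "\<forall>\<^sub>F n in sequentially. ?S n \<subseteq> unreached t n"
      using F(3) outs eventually_one_le[OF \<delta>] eventually_ge_at_top[of 1]
    proof eventually_elim
      case (elim n)
      interpret T: reveal_process P n "Z n" by (rule reveal_process[OF elim(4)])
      have n0: "0 < real n" using elim(4) by simp
      show ?case
      proof
        fix z assume zS: "z \<in> ?S n"
        then have sp: "z \<in> space (PM (Z n))" by simp
        show "z \<in> unreached t n"
        proof (rule ccontr)
          assume "z \<notin> unreached t n"
          then have occ: "z \<in> occ n (reveals_until t n)" using sp by blast
          let ?l = "T.last_reveal z"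
          let ?J = "\<lambda>i. T.insolvent i ?l z"
          let ?out = "\<lambda>i. real (outdeg P (atype (Z n) i))"
          have "reveals_until t n \<le> ?l" using T.last_reveal(2)[OF sp] occ by blast
          also have "... \<le> T.ruined_out ?l z" by (rule T.occurred_le_ruined_out[OF T.last_reveal(1)[OF sp]])
          finally have "real (reveals_until t n) \<le> real (T.ruined_out ?l z)" by (simp only: of_nat_le_iff)
          moreover have "real n * cum t - 1 \<le> real (reveals_until t n)" using cum_nonneg[of t] by linarith
          moreover have "real n * (lam - \<delta>) \<le> real n * cum t" using t(2) n0 by (intro mult_left_mono) auto
          ultimately have ro: "real n * lam - 2 * (\<delta> * real n) \<le> real (T.ruined_out ?l z)"
            using elim(3) by (simp add: algebra_simps)
          have ro_eq: "real (T.ruined_out ?l z) = (\<Sum>i\<in>{1..n}. if ?J i then ?out i else 0)"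
            unfolding T.ruined_out_def of_nat_sum by (rule sum.cong) auto
          have total: "(\<Sum>i\<in>{1..n}. ?out i) = (\<Sum>i\<in>{1..n}. if ?J i then ?out i else 0) + (\<Sum>i\<in>{1..n}. if ?J i then 0 else ?out i)"
            unfolding sum.distrib[symmetric] by (rule sum.cong) auto
          have tot: "(\<Sum>i\<in>{1..n}. ?out i) < real n * lam + \<delta> * real n" using elim(2) n0 by (simp add: divide_less_eq algebra_simps)
          have "real (card {i \<in> {1..n}. \<not> ?J i \<and> atype (Z n) i \<in> F}) = (\<Sum>i\<in>{1..n}. if \<not> ?J i \<and> atype (Z n) i \<in> F then 1 else 0)"
            by (simp flip: sum.inter_filter)
          also have "... \<le> (\<Sum>i\<in>{1..n}. if ?J i then 0 else ?out i)"
          proof (rule sum_mono)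
            fix i assume "i \<in> {1..n}"
            have "1 \<le> ?out i" if "atype (Z n) i \<in> F"
              using out[of "atype (Z n) i"] F(2) that by (auto simp: pmf_positive_iff)
            then show "(if \<not> ?J i \<and> atype (Z n) i \<in> F then 1 else 0) \<le> (if ?J i then 0 else ?out i)" by simp
          qed
          finally have in_F: "real (card {i \<in> {1..n}. \<not> ?J i \<and> atype (Z n) i \<in> F}) \<le> 3 * (\<delta> * real n)"
            using ro ro_eq total tot by linarith
          have "real (card {i \<in> {1..n}. \<not> ?J i \<and> atype (Z n) i \<notin> F}) \<le> real (card {i \<in> {1..n}. atype (Z n) i \<notin> F})"
            by (simp only: of_nat_le_iff) (rule card_mono, auto)
          then have not_F: "real (card {i \<in> {1..n}. \<not> ?J i \<and> atype (Z n) i \<notin> F}) < 4 * (\<delta> * real n)" using elim(1) by simp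
          have "n = card {1..n}" by simp
          also have "... = card ({i \<in> {1..n}. ?J i} \<union> ({i \<in> {1..n}. \<not> ?J i \<and> atype (Z n) i \<in> F} \<union> {i \<in> {1..n}. \<not> ?J i \<and> atype (Z n) i \<notin> F}))"
            by (rule arg_cong[where f=card]) blast
          also have "... = card {i \<in> {1..n}. ?J i} + card ({i \<in> {1..n}. \<not> ?J i \<and> atype (Z n) i \<in> F} \<union> {i \<in> {1..n}. \<not> ?J i \<and> atype (Z n) i \<notin> F})"
            by (rule card_Un_disjoint) auto
          also have "card ({i \<in> {1..n}. \<not> ?J i \<and> atype (Z n) i \<in> F} \<union> {i \<in> {1..n}. \<not> ?J i \<and> atype (Z n) i \<notin> F})
             = card {i \<in> {1..n}. \<not> ?J i \<and> atype (Z n) i \<in> F} + card {i \<in> {1..n}. \<not> ?J i \<and> atype (Z n) i \<notin> F}"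
            by (rule card_Un_disjoint) auto
          finally have n_eq: "n = card {i \<in> {1..n}. ?J i} + (card {i \<in> {1..n}. \<not> ?J i \<and> atype (Z n) i \<in> F} + card {i \<in> {1..n}. \<not> ?J i \<and> atype (Z n) i \<notin> F})" .
          have "real n - real (card {i \<in> {1..n}. ?J i}) = real (card {i \<in> {1..n}. \<not> ?J i \<and> atype (Z n) i \<in> F}) + real (card {i \<in> {1..n}. \<not> ?J i \<and> atype (Z n) i \<notin> F})"
            by (subst (1) n_eq) simp
          then have "0 \<le> real n - real (card {i \<in> {1..n}. ?J i})" "real n - real (card {i \<in> {1..n}. ?J i}) < 7 * (\<delta> * real n)"
            using in_F not_F by simp_all
          moreover have "e * real n < \<bar>real n - real (card {i \<in> {1..n}. ?J i})\<bar>"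
            using zS by (simp add: ruin_count_eq(1)[OF elim(4) sp])
          moreover have "e * real n = 8 * (\<delta> * real n)" by (simp add: \<delta>_def)
          moreover have "0 < \<delta> * real n" using \<delta> n0 by simp
          ultimately show False by linarith
        qed
      qed
    qed
  qed
  then show "(\<lambda>n. measure (PM (Z n)) (?S n)) \<longlonglongrightarrow> 0" by (rule negligible_measure)
qed

lemma t_star_nonneg: "0 \<le> t_star P \<mu> R lam"
  unfolding t_star_def by (rule Inf_greatest) auto

lemma reached_before_t_star:
  assumes t: "0 \<le> t" "cum t < lam" and star: "t = 0 \<or> ereal t < t_star P \<mu> R lam"
  shows "negligible (unreached t)"
  using star
proof
  assume t0: "t = 0"
  show ?thesis
  proof (rule negligible_subset[OF negligible_empty])
    show "\<forall>\<^sub>F n in sequentially. unreached t n \<subseteq> {}"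
      using eventually_ge_at_top[of 1]
    proof eventually_elim
      case (elim n)
      show ?case using reveal_process.occurred_0[OF reveal_process[OF elim]] cum_eq_0[of 0] by (simp add: t0)
    qed
  qed
next
  assume star: "ereal t < t_star P \<mu> R lam"
  show ?thesis
  proof (rule reached[OF t])
    fix s assume s: "0 \<le> s" "s \<le> t"
    have "ereal s < t_star P \<mu> R lam" using s(2) star by (meson ereal_less_eq(3) le_less_trans)
    moreover have "cum s < lam" using cum_mono[OF s(2)] t(2) by linarith
    ultimately show "cum s < ruinous_limit s" using positive_before_t_star[OF s(1)] by blast
  qed
qed

text \<open>The process passes \<open>t\<close> slightly before \<open>ts\<close> and does not reach \<open>u\<close> slightly after it. If \<open>ts = 0\<close>, then \<open>t\<close> is
  0 as well, and passing it is trivial.\<close>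

lemma settles_at_stable_solution:
  assumes star: "t_star P \<mu> R lam = ereal ts" and stable: "stable_solution (fW P \<mu> R lam) ts" and less: "cum ts < lam"
  shows "settles (\<lambda>x. survivor_fraction x ts)"
  unfolding settles_def
proof (intro conjI allI impI)
  have ts: "0 \<le> ts" using t_star_nonneg by (simp add: star)
  show "0 \<le> survivor_fraction x ts" "survivor_fraction x ts \<le> 1" for x
    by (rule survivor_fraction_bounds[OF ts less])+
  fix x and \<delta> :: real assume \<delta>: "0 < \<delta>"
  from isCont_survivor_fraction[where x=x and t=ts] \<delta> obtain d1 where d1: "0 < d1"
      "\<And>t. dist t ts < d1 \<Longrightarrow> dist (survivor_fraction x t) (survivor_fraction x ts) < \<delta>"
    unfolding continuous_at_eps_delta by meson
  have "0 < min (\<delta> / 2) (lam - cum ts)" using \<delta> less by simp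
  with isCont_cum[of ts] obtain d2 where d2: "0 < d2"
      "\<And>t. dist t ts < d2 \<Longrightarrow> dist (cum t) (cum ts) < min (\<delta> / 2) (lam - cum ts)"
    unfolding continuous_at_eps_delta by meson
  define t where "t = max 0 (ts - min d1 d2 / 2)"
  have t: "0 \<le> t" "t = 0 \<or> t < ts" "t \<le> ts" "dist t ts < d1" "dist t ts < d2"
    using d1(1) d2(1) ts by (auto simp: t_def dist_real_def)
  have sf: "\<bar>survivor_fraction x t - survivor_fraction x ts\<bar> < \<delta>" using d1(2)[OF t(4)] by (simp only: dist_real_def)
  have cum_t: "cum ts - cum t < \<delta> / 2" "cum t < lam" using d2(2)[OF t(5)] cum_mono[OF t(3)] less by (auto simp: dist_real_def)
  from stable obtain e where e: "0 < e" "\<And>s. s \<in> {ts<..<ts + e} \<Longrightarrow> fW P \<mu> R lam s < 0"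
    unfolding stable_solution_def by blast
  define u where "u = ts + min d2 e / 2"
  have u: "0 \<le> u" "u \<in> {ts<..<ts + e}" "dist u ts < d2" using d2(1) e(1) ts by (auto simp: u_def dist_real_def)
  have cum_u: "cum u < cum ts + \<delta> / 2" "cum u < lam" using d2(2)[OF u(3)] unfolding dist_real_def min_less_iff_conj by linarith+
  have "ruinous_limit u < cum u" using e(2)[OF u(2)] fW_eq[OF u(1) cum_u(2)] by simp
  then have nu: "negligible (\<lambda>n. occ n (reveals_until u n))" by (rule not_reached[OF u(1) cum_u(2)])
  have "negligible (unreached t)"
    by (rule reached_before_t_star[OF t(1) cum_t(2)]) (use t(2) star in auto)
  moreover have "negligible (\<lambda>n. {z \<in> space (PM (Z n)). real n * (cum t + \<delta>) < real (final n z)})"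
  proof (rule negligible_subset[OF nu])
    show "\<forall>\<^sub>F n in sequentially. {z \<in> space (PM (Z n)). real n * (cum t + \<delta>) < real (final n z)} \<subseteq> occ n (reveals_until u n)"
      using eventually_ge_at_top[of 1]
    proof eventually_elim
      case (elim n)
      interpret T: reveal_process P n "Z n" by (rule reveal_process[OF elim])
      have "real n * cum u \<le> real n * (cum t + \<delta>)" using cum_u(1) cum_t(1) by (intro mult_left_mono) auto
      then have le: "real (reveals_until u n) \<le> real n * (cum t + \<delta>)" using reveals_until_le[where t=u and n=n] by linarith
      show ?case
      proof
        fix z assume z: "z \<in> {z \<in> space (PM (Z n)). real n * (cum t + \<delta>) < real (final n z)}"
        then have "real (reveals_until u n) < real (final n z)" using le by simp
        then have "reveals_until u n \<le> final n z" by linarith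
        moreover have "z \<in> space (PM (Z n))" using z by simp
        ultimately show "z \<in> occ n (reveals_until u n)" using T.last_reveal(2) by blast
      qed
    qed
  qed
  ultimately show "\<exists>t. 0 \<le> t \<and> cum t < lam \<and> \<bar>survivor_fraction x t - survivor_fraction x ts\<bar> < \<delta> \<and>
     negligible (unreached t) \<and>
     negligible (\<lambda>n. {z \<in> space (PM (Z n)). real n * (cum t + \<delta>) < real (final n z)})"
    using t(1) cum_t(2) sf by (intro exI[of _ t] conjI)
qed

text \<open>The process passes every time, and the total intensity limits the number of reveals.\<close>

lemma settles_at_infinity:
  assumes star: "t_star P \<mu> R lam = \<infinity>" and less: "cum_total < lam"
    and s: "\<And>x. (survivor_fraction x \<longlongrightarrow> s x) at_top"
  shows "settles s"
  unfolding settles_def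
proof (intro conjI allI impI)
  have cum_less: "cum t < lam" for t using cum_le_total[of t] less by linarith
  have ev: "\<forall>\<^sub>F t in at_top. 0 \<le> (t :: real)" by (rule eventually_ge_at_top)
  show "0 \<le> s x" for x
    by (rule tendsto_lowerbound[OF s _ trivial_limit_at_top_linorder])
       (use ev in eventually_elim, rule survivor_fraction_bounds(1)[OF _ cum_less])
  show "s x \<le> 1" for x
    by (rule tendsto_upperbound[OF s _ trivial_limit_at_top_linorder])
       (use ev in eventually_elim, rule survivor_fraction_bounds(2)[OF _ cum_less])
  fix x and \<delta> :: real assume \<delta>: "0 < \<delta>"
  have "\<forall>\<^sub>F t in at_top. dist (survivor_fraction x t) (s x) < \<delta>" by (rule tendstoD[OF s \<delta>])
  moreover have "\<forall>\<^sub>F t in at_top. cum_total - \<delta> / 2 < cum t" by (rule order_tendstoD(1)[OF cum_tendsto_total]) (use \<delta> in simp)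
  ultimately have "\<forall>\<^sub>F t in at_top. 0 \<le> t \<and> dist (survivor_fraction x t) (s x) < \<delta> \<and> cum_total - \<delta> / 2 < cum t"
    using ev by eventually_elim (intro conjI)
  then obtain t where t: "0 \<le> t" "dist (survivor_fraction x t) (s x) < \<delta>" "cum_total - \<delta> / 2 < cum t"
    using eventually_happens'[OF trivial_limit_at_top_linorder] by blast
  have sf: "\<bar>survivor_fraction x t - s x\<bar> < \<delta>" using t(2) by (simp only: dist_real_def)
  have "negligible (unreached t)"
    by (rule reached_before_t_star[OF t(1) cum_less]) (simp add: star)
  moreover have "negligible (\<lambda>n. {z \<in> space (PM (Z n)). real n * (cum t + \<delta>) < real (final n z)})"
  proof (rule negligible_subset[OF timing_bad_negligible])
    show \<delta>4: "0 < \<delta> / 4" using \<delta> by simp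
    show "\<forall>\<^sub>F n in sequentially. {z \<in> space (PM (Z n)). real n * (cum t + \<delta>) < real (final n z)} \<subseteq> timing_bad (\<delta> / 4) n"
      using eventually_ge_at_top[of 1]
    proof eventually_elim
      case (elim n)
      interpret T: reveal_process P n "Z n" by (rule reveal_process[OF elim])
      have n0: "0 < real n" using elim by simp
      show ?case
      proof
        fix z assume z: "z \<in> {z \<in> space (PM (Z n)). real n * (cum t + \<delta>) < real (final n z)}"
        then have sp: "z \<in> space (PM (Z n))" by simp
        have "cum t + \<delta> < real (final n z) / real n" using z n0 by (simp add: less_divide_eq mult.commute)
        show "z \<in> timing_bad (\<delta> / 4) n"
        proof (rule ccontr)
          assume good: "z \<notin> timing_bad (\<delta> / 4) n"
          have "\<bar>real (final n z) / real n - cum (T.rtime (final n z) z)\<bar> \<le> 2 * (\<delta> / 4)"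
            by (rule timing_good(1)[OF elim good T.last_reveal(1)[OF sp] less_imp_le[OF \<delta>4]])
          then show False using \<open>cum t + \<delta> < real (final n z) / real n\<close> cum_le_total[of "T.rtime (final n z) z"] t(3) by linarith
        qed
      qed
    qed
  qed
  ultimately show "\<exists>t. 0 \<le> t \<and> cum t < lam \<and> \<bar>survivor_fraction x t - s x\<bar> < \<delta> \<and>
     negligible (unreached t) \<and>
     negligible (\<lambda>n. {z \<in> space (PM (Z n)). real n * (cum t + \<delta>) < real (final n z)})"
    using t(1) cum_less sf by (intro exI[of _ t] conjI)
qed

text \<open>Every time before \<open>t_star\<close> is passed, and \<open>cum\<close> comes arbitrarily close to \<open>lam\<close> at such times.\<close>

lemma exhausted_before_t_star:
  assumes star: "cum_rate R (t_star P \<mu> R lam) = lam" and \<delta>: "0 < \<delta>"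
  shows "\<exists>t. 0 \<le> t \<and> lam - \<delta> < cum t \<and>
      negligible (unreached t)"
proof -
  have "\<exists>t. 0 \<le> t \<and> lam - \<delta> < cum t \<and> cum t < lam \<and> ereal t < t_star P \<mu> R lam"
  proof (cases "t_star P \<mu> R lam")
    case (real ts)
    have ts: "0 \<le> ts" using t_star_nonneg by (simp add: real)
    have cts: "cum ts = lam" using star by (simp add: real)
    have pos: "0 < ts"
    proof (rule ccontr)
      assume "\<not> 0 < ts"
      then show False using cts cum_eq_0[of ts] lam_pos by simp
    qed
    from isCont_cum[of ts] \<delta> obtain d where d: "0 < d" "\<And>t. dist t ts < d \<Longrightarrow> dist (cum t) (cum ts) < \<delta>"
      unfolding continuous_at_eps_delta by meson
    define t where "t = max 0 (ts - d / 2)"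
    have t: "0 \<le> t" "t < ts" "dist t ts < d" using d(1) pos by (auto simp: t_def dist_real_def)
    have "lam - \<delta> < cum t" using d(2)[OF t(3)] unfolding dist_real_def cts by linarith
    moreover have "cum t < lam" using cum_strict_mono[OF t(1,2)] by (simp only: cts)
    ultimately show ?thesis using t(1,2) real by auto
  next
    case PInf
    then have ct: "cum_total = lam" using star by simp
    have "\<forall>\<^sub>F t in at_top. cum_total - \<delta> < cum t" by (rule order_tendstoD(1)[OF cum_tendsto_total]) (use \<delta> in simp)
    then have "\<forall>\<^sub>F t in at_top. 0 \<le> t \<and> cum_total - \<delta> < cum t"
      using eventually_ge_at_top[of 0] by eventually_elim (intro conjI)
    then obtain t where t: "0 \<le> t" "cum_total - \<delta> < cum t"
      using eventually_happens'[OF trivial_limit_at_top_linorder] by blast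
    then show ?thesis using cum_less_total[OF t(1)] PInf ct by auto
  next
    case MInf
    then show ?thesis using t_star_nonneg by simp
  qed
  then obtain t where t: "0 \<le> t" "lam - \<delta> < cum t" "cum t < lam" "ereal t < t_star P \<mu> R lam" by blast
  then show ?thesis using reached_before_t_star[OF t(1,3)] by (intro exI[of _ t]) blast
qed

end

theorem theorem3p8:
  fixes P :: "'x::countable network"
    and Z :: "nat \<Rightarrow> ('x, 'w) reveal_run"
    and \<mu> :: "'x pmf"
    and lam :: real
    and R :: "real \<Rightarrow> real"
  assumes params: "network_params P"
    and process: "\<And>n. 1 \<le> n \<Longrightarrow> loss_reveal_process P n (Z n)"
    and types: "\<And>x. (\<lambda>n. type_frac n (Z n) x) \<longlonglongrightarrow> pmf \<mu> x"
    and balance: "\<And>n. 1 \<le> n \<Longrightarrow>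
        (\<Sum>\<^sub>\<infinity>x. real (indeg P x) * type_frac n (Z n) x) = (\<Sum>\<^sub>\<infinity>x. real (outdeg P x) * type_frac n (Z n) x)"
    and mean_degree: "(\<lambda>n. \<Sum>\<^sub>\<infinity>x. real (indeg P x) * type_frac n (Z n) x) \<longlonglongrightarrow> lam"
    and lam_in: "((\<lambda>x. real (indeg P x) * pmf \<mu> x) has_sum lam) UNIV"
    and lam_out: "((\<lambda>x. real (outdeg P x) * pmf \<mu> x) has_sum lam) UNIV"
    and lam_pos: "0 < lam"
    and R_cont: "continuous_on {0..} R"
    and R_pos: "\<And>t. 0 \<le> t \<Longrightarrow> 0 < R t"
    and R_int: "set_integrable lborel {0..} R"
    and R_limit: "small_op (\<lambda>n. PM (Z n)) (\<lambda>n \<omega>. enn2ereal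
        (\<integral>\<^sup>+t\<in>{t. 0 \<le> t \<and> ereal t \<le> stop_time P n (Z n) \<omega>}.
            ennreal \<bar>intensity P n (Z n) t \<omega> - real n * R t\<bar> \<partial>lborel))"
  shows
    "(cum_rate R (t_star P \<mu> R lam) = lam \<and> (\<forall>x. 0 < pmf \<mu> x \<longrightarrow> 0 < outdeg P x) \<longrightarrow>
        small_op (\<lambda>n. PM (Z n))
          (\<lambda>n \<omega>. ereal (real n - real (ruin_count P n (Z n) (stop_time P n (Z n) \<omega>) \<omega>))))
     \<and>
     (\<forall>ts. t_star P \<mu> R lam = ereal ts \<and> stable_solution (fW P \<mu> R lam) ts
           \<and> cum_rate R (ereal ts) < lam \<longrightarrow>
        (\<forall>x. 0 < pmf \<mu> x \<longrightarrow>
          conv_in_prob (\<lambda>n. PM (Z n))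
            (\<lambda>n \<omega>. real (ruin_count_type P n (Z n) x (stop_time P n (Z n) \<omega>) \<omega>)
                     / (real n * type_frac n (Z n) x))
            (1 - (\<Sum>\<theta>\<le>indeg P x. binom_prob (indeg P x) (phi R lam ts) \<theta> * surv P R x \<theta> ts))) \<and>
        small_op (\<lambda>n. PM (Z n))
          (\<lambda>n \<omega>. ereal (real (ruin_count P n (Z n) (stop_time P n (Z n) \<omega>) \<omega>)
             - real n * (\<Sum>\<^sub>\<infinity>x. pmf \<mu> x *
                 (1 - (\<Sum>\<theta>\<le>indeg P x. binom_prob (indeg P x) (phi R lam ts) \<theta> * surv P R x \<theta> ts))))))
     \<and>
     (t_star P \<mu> R lam = \<infinity> \<and> cum_rate R \<infinity> < lam \<longrightarrow>
        (\<forall>x. 0 < pmf \<mu> x \<longrightarrow>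
          conv_in_prob (\<lambda>n. PM (Z n))
            (\<lambda>n \<omega>. real (ruin_count_type P n (Z n) x (stop_time P n (Z n) \<omega>) \<omega>)
                     / (real n * type_frac n (Z n) x))
            (1 - (\<Sum>\<theta>\<le>indeg P x. binom_prob (indeg P x) (cum_rate R \<infinity> / lam) \<theta> * surv_lim P R x \<theta>))) \<and>
        small_op (\<lambda>n. PM (Z n))
          (\<lambda>n \<omega>. ereal (real (ruin_count P n (Z n) (stop_time P n (Z n) \<omega>) \<omega>)
             - real n * (\<Sum>\<^sub>\<infinity>x. pmf \<mu> x *
                 (1 - (\<Sum>\<theta>\<le>indeg P x. binom_prob (indeg P x) (cum_rate R \<infinity> / lam) \<theta> * surv_lim P R x \<theta>))))))"
proof -
  interpret loss_reveal_sequence P R lam Z \<mu>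
    by (intro loss_reveal_sequence.intro limit_model.intro limit_model_axioms.intro loss_reveal_sequence_axioms.intro
        network.intro reveal_intensity.intro assms)
  have stable: "settles (\<lambda>x. \<Sum>\<theta>\<le>indeg P x. binom_prob (indeg P x) (phi R lam ts) \<theta> * surv P R x \<theta> ts)"
    if "t_star P \<mu> R lam = ereal ts \<and> stable_solution (fW P \<mu> R lam) ts \<and> cum_rate R (ereal ts) < lam" for ts
  proof -
    have "0 \<le> ts" using t_star_nonneg that by simp
    then show ?thesis
      using settles_at_stable_solution that survivor_fraction_eq by (simp add: less_imp_le)
  qed
  have infinite: "settles (\<lambda>x. \<Sum>\<theta>\<le>indeg P x. binom_prob (indeg P x) (cum_rate R \<infinity> / lam) \<theta> * surv_lim P R x \<theta>)"
    if "t_star P \<mu> R lam = \<infinity> \<and> cum_rate R \<infinity> < lam"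
    by (rule settles_at_infinity[OF conjunct1[OF that] conjunct2[OF that]])
       (rule survivor_fraction_tendsto[OF less_imp_le[OF conjunct2[OF that]]])
  show ?thesis
  proof (intro conjI allI impI, goal_cases)
    case 1 then show ?case using exhausted_small_op[OF exhausted_before_t_star] by blast
  next
    case (2 ts x) then show ?case using settled_conv[OF stable] by blast
  next
    case (3 ts) then show ?case using settled_small_op[OF stable] by blast
  next
    case (4 x) then show ?case using settled_conv[OF infinite] by blast
  next
    case 5 then show ?case using settled_small_op[OF infinite] by blast
  qed
qed

end
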